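(* Let $Q$ be an $n\times n$ symmetric integer matrix (an integral quadratic form), let $k$ be a positive integer, and let $t$ be an element of $\mathbb{Z}/2^k\mathbb{Z}$. Then there exists a deterministic polynomial time algorithm that performs $O(n^{1+\omega}\log k+nk^3)$ ring operations over $\mathbb{Z}/2^k\mathbb{Z}$ and samples a uniform (respectively: uniform primitive; uniform non-primitive) $2^k$-representation of $t$ by $Q$, if such a representation exists.
   Context: A $q$-representation of $t$ by $Q$ is a vector $x\in(\mathbb{Z}/q\mathbb{Z})^n$ with $x^{T}Qx\equiv t \pmod q$. For a prime power $p^k$, a vector $v\in(\mathbb{Z}/p^k\mathbb{Z})^n$ is primitive if some coordinate $v_i$ satisfies $\gcd(v_i,p)=1$, and non-primitive otherwise. Complexity is measured in ring operations: additions, multiplications, inversions in $\mathbb{Z}/p^k\mathbb{Z}$, operations on integers, and sampling a uniformly random element of $\mathbb{Z}/p^k\mathbb{Z}$ each count as $O(1)$. $\omega$ is a constant such that multiplying two $n\times n$ matrices over $\mathbb{Z}/p^k\mathbb{Z}$ takes $O(n^\omega)$ ring operations.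
   Formalization: With only uniform elements of Z/2^kZ as randomness, exact uniform sampling in bounded time is impossible (2xy≡0 mod 4 has 12 solutions); the formal statement also allows drawing a uniform integer from {0,…,N−1}, for any computed N, as a single operation. *)

theory Defs
  imports
    "HOL-Probability.Probability_Mass_Function"
    "HOL-Number_Theory.Modular_Inverse"
    "HOL-Library.Log_Nat"
    "Jordan_Normal_Form.Matrix"
begin

section \<open>Representations by an integral quadratic form\<close>

text \<open>
  An element of $\mathbb{Z}/q\mathbb{Z}$ is given by its canonical residue in \<open>{0..<q}\<close>, so that
  the sets below are finite and in bijection with the sets of residue vectors they stand for.
\<close>

definition residue_vecs :: "int \<Rightarrow> nat \<Rightarrow> int vec set" where
  "residue_vecs q n = {x \<in> carrier_vec n. \<forall>i<n. x $ i \<in> {0..<q}}"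

definition primitive_vec :: "int \<Rightarrow> int vec \<Rightarrow> bool" where
  "primitive_vec p x \<longleftrightarrow> (\<exists>i<dim_vec x. coprime (x $ i) p)"

definition representations :: "int \<Rightarrow> nat \<Rightarrow> int mat \<Rightarrow> int \<Rightarrow> int vec set" where
  "representations p k Q t =
     {x \<in> residue_vecs (p ^ k) (dim_row Q). [x \<bullet> (Q *\<^sub>v x) = t] (mod p ^ k)}"

definition primitive_representations :: "int \<Rightarrow> nat \<Rightarrow> int mat \<Rightarrow> int \<Rightarrow> int vec set" where
  "primitive_representations p k Q t = {x \<in> representations p k Q t. primitive_vec p x}"

definition nonprimitive_representations :: "int \<Rightarrow> nat \<Rightarrow> int mat \<Rightarrow> int \<Rightarrow> int vec set" where
  "nonprimitive_representations p k Q t = {x \<in> representations p k Q t. \<not> primitive_vec p x}"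


section \<open>Randomized programs with ring and integer operations\<close>

text \<open>
  Algorithms are programs of a small imperative language over integer variables and integer
  arrays. The modulus \<open>q\<close> is a parameter of the semantics, not of the program: one program serves
  all moduli and all dimensions.
\<close>

datatype binop =
  Int_Add | Int_Sub | Int_Mul | Int_Div | Int_Mod | Int_Less | Int_Eq
| Ring_Add | Ring_Sub | Ring_Mul

datatype expr =
  Lit int
| Var nat
| Cell nat expr           \<comment> \<open>entry of the array with the given name, at a computed index\<close>
| Binop binop expr expr
| Ring_Inv expr

datatype com =
  Skip
| Assign nat expr
| Store nat expr expr     \<comment> \<open>array name, index, value\<close>
| Sample_Ring nat
| Sample_Int nat expr
| Seq com com
| If expr com com
| While expr com

record state =
  var :: "nat \<Rightarrow> int"
  arr :: "nat \<Rightarrow> int \<Rightarrow> int"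

fun apply_binop :: "int \<Rightarrow> binop \<Rightarrow> int \<Rightarrow> int \<Rightarrow> int" where
  "apply_binop q Int_Add a b = a + b"
| "apply_binop q Int_Sub a b = a - b"
| "apply_binop q Int_Mul a b = a * b"
| "apply_binop q Int_Div a b = a div b"
| "apply_binop q Int_Mod a b = a mod b"
| "apply_binop q Int_Less a b = of_bool (a < b)"
| "apply_binop q Int_Eq a b = of_bool (a = b)"
| "apply_binop q Ring_Add a b = (a + b) mod q"
| "apply_binop q Ring_Sub a b = (a - b) mod q"
| "apply_binop q Ring_Mul a b = (a * b) mod q"

text \<open>The library's modular inverse is 0 on non-units.\<close>

primrec eval :: "int \<Rightarrow> expr \<Rightarrow> state \<Rightarrow> int" where
  "eval q (Lit z) s = z"
| "eval q (Var x) s = var s x"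
| "eval q (Cell a e) s = arr s a (eval q e s)"
| "eval q (Binop f e1 e2) s = apply_binop q f (eval q e1 s) (eval q e2 s)"
| "eval q (Ring_Inv e) s = modular_inverse q (eval q e s)"

text \<open>Array accesses are charged as well, as one operation each.\<close>

primrec ops :: "expr \<Rightarrow> nat" where
  "ops (Lit z) = 0"
| "ops (Var x) = 0"
| "ops (Cell a e) = 1 + ops e"
| "ops (Binop f e1 e2) = 1 + ops e1 + ops e2"
| "ops (Ring_Inv e) = 1 + ops e"

definition set_var :: "nat \<Rightarrow> int \<Rightarrow> state \<Rightarrow> state" where
  "set_var x z s = s\<lparr>var := (var s)(x := z)\<rparr>"

definition set_cell :: "nat \<Rightarrow> int \<Rightarrow> int \<Rightarrow> state \<Rightarrow> state" where
  "set_cell a i z s = s\<lparr>arr := (arr s)(a := (arr s a)(i := z))\<rparr>"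

text \<open>
  One execution step; the last component of the result is the cost of the step. Every step costs
  at least 1, so the accumulated cost also bounds the number of steps. A guard is true if it is
  nonzero.

  \<open>Sample_Int x e\<close> draws an integer uniformly from \<open>{0..<N}\<close>, where \<open>N\<close> is the value of \<open>e\<close>
  (0 if \<open>N \<le> 0\<close>). Uniform elements of $\mathbb{Z}/2^k\mathbb{Z}$ alone do not suffice for a worst-case
  bound: a program that always halts within a fixed number of steps and draws only such elements has
  dyadic outcome probabilities, whereas $2xy \equiv 0 \pmod 4$ has 12 solutions.
\<close>

primrec step :: "int \<Rightarrow> com \<Rightarrow> state \<Rightarrow> (com \<times> state \<times> nat) pmf" where
  "step q Skip s = return_pmf (Skip, s, 0)"
| "step q (Assign x e) s = return_pmf (Skip, set_var x (eval q e s) s, 1 + ops e)"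
| "step q (Store a e1 e2) s =
     return_pmf (Skip, set_cell a (eval q e1 s) (eval q e2 s) s, 1 + ops e1 + ops e2)"
| "step q (Sample_Ring x) s =
     map_pmf (\<lambda>z. (Skip, set_var x z s, 1)) (pmf_of_set {0..<q})"
| "step q (Sample_Int x e) s =
     map_pmf (\<lambda>z. (Skip, set_var x z s, 1 + ops e)) (pmf_of_set {0..<max 1 (eval q e s)})"
| "step q (Seq c1 c2) s =
     (if c1 = Skip then return_pmf (c2, s, 1)
      else map_pmf (\<lambda>(c1', s', w). (Seq c1' c2, s', w)) (step q c1 s))"
| "step q (If e c1 c2) s = return_pmf (if eval q e s \<noteq> 0 then c1 else c2, s, 1 + ops e)"
| "step q (While e c) s =
     return_pmf (if eval q e s \<noteq> 0 then Seq c (While e c) else Skip, s, 1 + ops e)"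

text \<open>
  A configuration consists of the remaining program, the state and the cost so far; \<open>Skip\<close> is the
  halted program.
\<close>

type_synonym config = "com \<times> state \<times> nat"

primrec run :: "int \<Rightarrow> com \<Rightarrow> state \<Rightarrow> nat \<Rightarrow> config pmf" where
  "run q c s 0 = return_pmf (c, s, 0)"
| "run q c s (Suc N) =
     bind_pmf (run q c s N) (\<lambda>(c', s', w).
       map_pmf (\<lambda>(c'', s'', w'). (c'', s'', w + w')) (step q c' s'))"

definition halted_after :: "int \<Rightarrow> com \<Rightarrow> state \<Rightarrow> nat \<Rightarrow> bool" where
  "halted_after q c s N \<longleftrightarrow> (\<forall>(c', s', w) \<in> set_pmf (run q c s N). c' = Skip)"

text \<open>Worst case over all outcomes of the random draws.\<close>

definition halts_within :: "int \<Rightarrow> com \<Rightarrow> state \<Rightarrow> real \<Rightarrow> bool" where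
  "halts_within q c s B \<longleftrightarrow>
     (\<exists>N. halted_after q c s N \<and> (\<forall>(c', s', w) \<in> set_pmf (run q c s N). real w \<le> B))"

text \<open>Only meaningful for programs that halt within some fixed number of steps.\<close>

definition final_state :: "int \<Rightarrow> com \<Rightarrow> state \<Rightarrow> state pmf" where
  "final_state q c s =
     map_pmf (\<lambda>(c', s', w). s') (run q c s (LEAST N. halted_after q c s N))"

definition bit_length :: "int \<Rightarrow> nat" where
  "bit_length z = floorlog 2 (nat \<bar>z\<bar>)"

text \<open>
  Unit-cost arithmetic on integers of unbounded size is not a polynomial-time model, so that a
  polynomial-time claim also needs a bound on the integers that are stored. (An expression in a
  fixed program has a fixed number of operations, hence its intermediate results are longer than
  the stored integers by at most a constant factor, up to an additive constant.)
\<close>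

definition stores_within :: "int \<Rightarrow> com \<Rightarrow> state \<Rightarrow> real \<Rightarrow> bool" where
  "stores_within q c s B \<longleftrightarrow>
     (\<forall>N. \<forall>(c', s', w) \<in> set_pmf (run q c s N).
        (\<forall>x. real (bit_length (var s' x)) \<le> B) \<and>
        (\<forall>a i. real (bit_length (arr s' a i)) \<le> B))"


section \<open>Input and output conventions\<close>

text \<open>Matrices are stored in row-major order.\<close>

definition mat_cells :: "nat \<Rightarrow> int mat \<Rightarrow> int \<Rightarrow> int" where
  "mat_cells n A l =
     (if 0 \<le> l \<and> l < int (n * n) then A $$ (nat l div n, nat l mod n) else 0)"

definition quadratic_input :: "nat \<Rightarrow> nat \<Rightarrow> int mat \<Rightarrow> int \<Rightarrow> state" where
  "quadratic_input n k Q t =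
     \<lparr>var = (\<lambda>_. 0)(0 := int n, 1 := int k, 2 := t),
      arr = (\<lambda>_ _. 0)(0 := mat_cells n Q)\<rparr>"

definition vec_output :: "nat \<Rightarrow> state \<Rightarrow> int vec" where
  "vec_output n s = vec n (\<lambda>i. arr s 1 (int i))"

definition quadratic_input_size :: "nat \<Rightarrow> nat \<Rightarrow> int mat \<Rightarrow> nat" where
  "quadratic_input_size n k Q = n + k + (\<Sum>i<n. \<Sum>j<n. bit_length (Q $$ (i, j)))"

definition matmul_input :: "nat \<Rightarrow> nat \<Rightarrow> int mat \<Rightarrow> int mat \<Rightarrow> state" where
  "matmul_input n k A B =
     \<lparr>var = (\<lambda>_. 0)(0 := int n, 1 := int k),
      arr = (\<lambda>_ _. 0)(0 := mat_cells n A, 1 := mat_cells n B)\<rparr>"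

definition mat_output :: "nat \<Rightarrow> state \<Rightarrow> int mat" where
  "mat_output n s = mat n n (\<lambda>(i, j). arr s 2 (int (i * n + j)))"

definition residue_mats :: "int \<Rightarrow> nat \<Rightarrow> int mat set" where
  "residue_mats q n = {A \<in> carrier_mat n n. \<forall>i<n. \<forall>j<n. A $$ (i, j) \<in> {0..<q}}"

text \<open>
  \<open>\<omega>\<close> is an exponent of matrix multiplication over $\mathbb{Z}/p^k\mathbb{Z}$: one program multiplies
  $n\times n$ matrices with $O(n^\omega)$ operations, the constant being independent of \<open>n\<close> and \<open>k\<close>.
\<close>

definition matmul_exponent :: "int \<Rightarrow> real \<Rightarrow> bool" where
  "matmul_exponent p \<omega> \<longleftrightarrow>
     (\<exists>prog C. \<forall>n\<ge>1. \<forall>k\<ge>1. \<forall>A \<in> residue_mats (p ^ k) n. \<forall>B \<in> residue_mats (p ^ k) n.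
        halts_within (p ^ k) prog (matmul_input n k A B) (C * real n powr \<omega>) \<and>
        map_pmf (mat_output n) (final_state (p ^ k) prog (matmul_input n k A B)) =
          return_pmf (map_mat (\<lambda>z. z mod p ^ k) (A * B)))"

end

(*
  Symmetric elimination turns Q modulo 2^k, up to an invertible substitution, into an orthogonal
  sum of blocks of size one and two. For such a sum, let the level of a vector be the largest
  m <= k such that the coordinates of each block are divisible by the least power 2^c for which
  the contribution of the block is divisible by 2^m. Dividing the coordinates by these powers
  leaves the equation F(w) = t / 2^m modulo 2^(k - m), in which, if m < k, maximality of m provides
  a block with a unit coefficient and an odd coordinate. Moving a coordinate of the first such block
  by multiples of 4 or 8 lifts approximate solutions modulo 8 to solutions, as in Hensel's lemma,
  and every solution arises in the same number of ways. Approximate solutions are the words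
  accepted by an automaton with 32 states that reads the coordinates modulo 8, so that they can be
  counted and unranked. Hence one number, drawn uniformly below the total count over all levels,
  decodes to a uniform solution.

  An exponent of matrix multiplication is at least 2, because each entry of a product has to be
  written; therefore cubic elimination is fast enough.
*)
theory Submission
  imports Defs
begin

section \<open>Runs of probabilistic programs\<close>

text \<open>The cost bound is a worst case over all draws. This excludes rejection sampling, so all
  solutions must be hit by exactly equally many numbers, namely \<open>2 ^ k * 64 ^ n\<close>; given
  that, no separate probabilities of levels have to be handled.

  Powers of 2 are divided out block by block because lifting fails at even coordinates, where the
  derivative degenerates. After the division a block with a unit coefficient has a coordinate along
  which the value can be steered. A square still has the derivative \<open>2 * al * y\<close>, and
  this factor 2 is why approximations modulo 8 are taken.

  The cost model shapes the code. Time and size of stored integers are claimed for a concrete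
  program, so it is written in a loop language whose running time can be read off the syntax, and
  stored sums and products are reduced modulo a huge number that exceeds all true values. For
  \<open>k = 1\<close> the logarithm vanishes, and a bound linear in \<open>n\<close> does not allow
  elimination; that case has a separate, diagonal treatment.\<close>

lemma run_Suc_front:
  "run q c s (Suc N) =
     bind_pmf (step q c s) (\<lambda>(c1, s1, w1). map_pmf (\<lambda>(c', s', w). (c', s', w1 + w)) (run q c1 s1 N))"
proof (induction N)
  case 0
  show ?case by (simp add: bind_return_pmf map_pmf_def case_prod_unfold)
next
  case (Suc N)
  show ?case
    by (subst run.simps(2), subst Suc)
       (simp add: bind_assoc_pmf map_pmf_def case_prod_unfold bind_return_pmf add.assoc)
qed

lemma run_Skip [simp]: "run q Skip s N = return_pmf (Skip, s, 0)"
  by (induction N) (simp_all add: bind_return_pmf)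

text \<open>\<open>Skip\<close> steps to itself at cost 0, so a halted distribution is stationary
  and any later time is as good as the first halting time.\<close>

lemma run_halted_Suc:
  assumes "halted_after q c s N"
  shows "run q c s (Suc N) = run q c s N"
proof -
  have "run q c s (Suc N) = bind_pmf (run q c s N) return_pmf"
    unfolding run.simps(2)
    by (rule bind_pmf_cong) (use assms in \<open>auto simp: halted_after_def\<close>)
  then show ?thesis by (simp add: bind_return_pmf')
qed

lemma run_halted_le:
  assumes "halted_after q c s N" "N \<le> N'"
  shows "run q c s N' = run q c s N"
  using assms(2)
proof (induction N' rule: dec_induct)
  case (step m)
  then have "halted_after q c s m" using assms(1) by (simp add: halted_after_def)
  then show ?case using run_halted_Suc step.IH by metis
qed simp

text \<open>Frees \<open>final_state\<close> from its LEAST: every halting time yields the same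
  law.\<close>

lemma final_state_eq:
  assumes "halted_after q c s N"
  shows "final_state q c s = map_pmf (\<lambda>(c', s', w). s') (run q c s N)"
proof -
  have "halted_after q c s (LEAST N. halted_after q c s N)" using assms by (rule LeastI)
  from run_halted_le[OF this Least_le[of "halted_after q c s", OF assms]] show ?thesis by (simp add: final_state_def)
qed

text \<open>Everything the theorem asks of an execution. \<open>I\<close> is demanded of every
  reachable state at every time, since storage is bounded during the run and not only at its end;
  \<open>C\<close> bounds the cost in every branch, and \<open>D\<close> is the law of the final
  state. The number of steps stays existential.\<close>

definition runs :: "int \<Rightarrow> (state \<Rightarrow> bool) \<Rightarrow> nat \<Rightarrow> com \<Rightarrow> state \<Rightarrow> state pmf \<Rightarrow> bool" where
  "runs q I C c s D \<longleftrightarrow>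
     (\<forall>K c' s' w. (c', s', w) \<in> set_pmf (run q c s K) \<longrightarrow> I s') \<and>
     (\<exists>N. (\<forall>c' s' w. (c', s', w) \<in> set_pmf (run q c s N) \<longrightarrow> c' = Skip \<and> w \<le> C) \<and>
          map_pmf (\<lambda>(c', s', w). s') (run q c s N) = D)"

lemma runs_Skip: "I s \<Longrightarrow> runs q I C Skip s (return_pmf s)"
  by (simp add: runs_def)

lemma runs_mono: "runs q I C c s D \<Longrightarrow> C \<le> C' \<Longrightarrow> runs q I C' c s D"
  unfolding runs_def by (elim conjE exE, intro conjI exI) (assumption, fastforce+)

lemma runs_final:
  assumes "runs q I C c s D"
  shows "final_state q c s = D"
proof -
  obtain N where N: "\<forall>c' s' w. (c', s', w) \<in> set_pmf (run q c s N) \<longrightarrow> c' = Skip \<and> w \<le> C"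
    "map_pmf (\<lambda>(c', s', w). s') (run q c s N) = D"
    using assms by (auto simp: runs_def)
  have "halted_after q c s N" using N by (auto simp: halted_after_def)
  from final_state_eq[OF this] N show ?thesis by simp
qed

lemma runs_halts: "runs q I C c s D \<Longrightarrow> real C \<le> B \<Longrightarrow> halts_within q c s B"
  unfolding runs_def halts_within_def halted_after_def
  by (elim conjE exE, rule_tac x = N in exI) (auto intro: order_trans[OF of_nat_mono[of _ C]])

lemma runs_stores:
  assumes "runs q I C c s D"
    and "\<And>s. I s \<Longrightarrow> (\<forall>x. real (bit_length (var s x)) \<le> B) \<and> (\<forall>a i. real (bit_length (arr s a i)) \<le> B)"
  shows "stores_within q c s B"
proof -
  have "I s'" if "(c', s', w) \<in> set_pmf (run q c s K)" for c' s' w K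
    using assms(1) that unfolding runs_def by blast
  then show ?thesis using assms(2) unfolding stores_within_def by blast
qed

text \<open>Different outcomes of a draw may halt at different times. The support is finite and
  halted runs are stationary, so the largest of the halting times serves all branches.\<close>

lemma runs_step:
  assumes "I s" and fin: "finite (set_pmf P)"
    and step: "step q c s = map_pmf (\<lambda>z. (c1, g z, w1)) P"
    and runs: "\<And>z. z \<in> set_pmf P \<Longrightarrow> runs q I C c1 (g z) (D z)"
  shows "runs q I (w1 + C) c s (bind_pmf P D)"
proof -
  have run: "run q c s (Suc N) =
      bind_pmf P (\<lambda>z. map_pmf (\<lambda>(c', s', w). (c', s', w1 + w)) (run q c1 (g z) N))" for N
    by (simp only: run_Suc_front step bind_map_pmf prod.case)
  have inv: "I s'" if r: "(c', s', w) \<in> set_pmf (run q c s K)" for K c' s' w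
  proof (cases K)
    case 0
    then show ?thesis using assms(1) r by simp
  next
    case (Suc N)
    then obtain z w' where "z \<in> set_pmf P" "(c', s', w') \<in> set_pmf (run q c1 (g z) N)"
      using r unfolding Suc run by force
    then show ?thesis using runs[of z] unfolding runs_def by blast
  qed
  define halts where "halts z N \<longleftrightarrow>
      (\<forall>c' s' w. (c', s', w) \<in> set_pmf (run q c1 (g z) N) \<longrightarrow> c' = Skip \<and> w \<le> C) \<and>
      map_pmf (\<lambda>(c', s', w). s') (run q c1 (g z) N) = D z" for z N
  have "\<exists>N. halts z N" if "z \<in> set_pmf P" for z
    using runs[OF that] by (auto simp: runs_def halts_def)
  then obtain n where n: "\<And>z. z \<in> set_pmf P \<Longrightarrow> halts z (n z)" by metis
  define N where "N = Max (n ` set_pmf P)"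
  have N: "halts z N" if z: "z \<in> set_pmf P" for z
  proof -
    have "halted_after q c1 (g z) (n z)"
      using n[OF z] by (auto simp: halts_def halted_after_def)
    moreover have "n z \<le> N" using fin z by (simp add: N_def)
    ultimately show ?thesis using n[OF z] run_halted_le unfolding halts_def by metis
  qed
  have 1: "c' = Skip \<and> w \<le> w1 + C" if r: "(c', s', w) \<in> set_pmf (run q c s (Suc N))" for c' s' w
  proof -
    obtain z w' where "z \<in> set_pmf P" "(c', s', w') \<in> set_pmf (run q c1 (g z) N)" "w = w1 + w'"
      using r unfolding run by force
    then show ?thesis using N[of z] unfolding halts_def by auto
  qed
  have "map_pmf (\<lambda>(c', s', w). s') (run q c s (Suc N)) =
      bind_pmf P (\<lambda>z. map_pmf (\<lambda>(c', s', w). s') (run q c1 (g z) N))"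
    unfolding run by (simp add: map_bind_pmf map_pmf_comp case_prod_unfold)
  also have "\<dots> = bind_pmf P D"
    by (rule bind_pmf_cong) (use N in \<open>auto simp: halts_def\<close>)
  finally have "map_pmf (\<lambda>(c', s', w). s') (run q c s (Suc N)) = bind_pmf P D" .
  with 1 inv show ?thesis unfolding runs_def by blast
qed

lemma runs_det_step:
  assumes "I s" "step q c s = return_pmf (c1, s1, w1)" "runs q I C c1 s1 D"
  shows "runs q I (w1 + C) c s D"
proof -
  have "runs q I (w1 + C) c s (bind_pmf (return_pmf ()) (\<lambda>_. D))"
    by (rule runs_step[where g = "\<lambda>_. s1"]) (use assms in auto)
  then show ?thesis by (simp add: bind_return_pmf)
qed

text \<open>Runs without random draws, with exact cost and with \<open>I\<close> checked in each
  state on the way. Excluding \<open>Skip\<close> in the second rule lets a run be lifted below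
  \<open>Seq\<close>, where \<open>Skip\<close> on the left behaves differently.\<close>

inductive det :: "int \<Rightarrow> (state \<Rightarrow> bool) \<Rightarrow> com \<Rightarrow> state \<Rightarrow> com \<Rightarrow> state \<Rightarrow> nat \<Rightarrow> bool" for q I where
  det_refl: "I s \<Longrightarrow> det q I c s c s 0"
| det_step: "I s \<Longrightarrow> c \<noteq> Skip \<Longrightarrow> step q c s = return_pmf (c1, s1, w1) \<Longrightarrow> det q I c1 s1 c' s' w \<Longrightarrow>
    det q I c s c' s' (w1 + w)"

lemma det_trans:
  "det q I c s c' s' w \<Longrightarrow> det q I c' s' c'' s'' w' \<Longrightarrow> det q I c s c'' s'' (w + w')"
proof (induction rule: det.induct)
  case (det_step s c c1 s1 w1 c' s' w)
  then show ?case using det.det_step[of I s c q c1 s1 w1 c'' s'' "w + w'"] by (simp add: add.assoc)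
qed simp

lemma det_Seq: "det q I c s c' s' w \<Longrightarrow> det q I (Seq c d) s (Seq c' d) s' w"
proof (induction rule: det.induct)
  case (det_step s c c1 s1 w1 c' s' w)
  then show ?case by (intro det.det_step) auto
qed (rule det_refl)

lemma det_last: "det q I c s c' s' w \<Longrightarrow> I s'"
  by (induction rule: det.induct)

lemma det_runs: "det q I c s c' s' w \<Longrightarrow> runs q I C c' s' D \<Longrightarrow> runs q I (w + C) c s D"
proof (induction rule: det.induct)
  case (det_step s c c1 s1 w1 c' s' w)
  then show ?case using runs_det_step[of I s q c c1 s1 w1 "w + C" D] by (simp add: add.assoc)
qed simp

lemma det_Seq_Skip:
  assumes "det q I c s Skip s' w"
  shows "det q I (Seq c d) s d s' (w + 1)"
proof (rule det_trans[OF det_Seq[OF assms]])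
  have "det q I (Seq Skip d) s' d s' (1 + 0)"
    using det_last[OF assms] by (intro det_step[OF _ _ _ det_refl]) auto
  then show "det q I (Seq Skip d) s' d s' 1" by simp
qed

lemma det_Assign: "I s \<Longrightarrow> I (set_var x (eval q e s) s) \<Longrightarrow>
    det q I (Assign x e) s Skip (set_var x (eval q e s) s) (1 + ops e)"
  by (rule det_step[where w = 0, simplified]) (auto intro: det_refl)


section \<open>Deterministic loop programs\<close>

datatype lprog =
  LSkip
| LAssign nat expr
| LStore nat expr expr
| LSeq lprog lprog (infixr ";;" 60)
| LIf expr lprog lprog
| LFor nat expr lprog

primrec compile :: "lprog \<Rightarrow> com" where
  "compile LSkip = Skip"
| "compile (LAssign x e) = Assign x e"
| "compile (LStore a i e) = Store a i e"
| "compile (c ;; d) = Seq (compile c) (compile d)"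
| "compile (LIf e c d) = If e (compile c) (compile d)"
| "compile (LFor x b c) =
     Seq (Assign x (Lit 0))
       (While (Binop Int_Less (Var x) b)
         (Seq (compile c) (Assign x (Binop Int_Add (Var x) (Lit 1)))))"

text \<open>A loop is iterated a number of times fixed at its entry, whereas the compiled
  \<open>While\<close> evaluates its bound in every round. The two agree for bounds that the body
  cannot change, which \<open>confined\<close> guarantees: a literal or a variable that no confined
  program writes.\<close>

primrec den :: "int \<Rightarrow> lprog \<Rightarrow> state \<Rightarrow> state" where
  "den q LSkip s = s"
| "den q (LAssign x e) s = set_var x (eval q e s) s"
| "den q (LStore a i e) s = set_cell a (eval q i s) (eval q e s) s"
| "den q (c ;; d) s = den q d (den q c s)"
| "den q (LIf e c d) s = (if eval q e s \<noteq> 0 then den q c s else den q d s)"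
| "den q (LFor x b c) s =
     ((\<lambda>s. set_var x (var s x + 1) (den q c s)) ^^ nat (eval q b s)) (set_var x 0 s)"

primrec wvars :: "lprog \<Rightarrow> nat set" where
  "wvars LSkip = {}"
| "wvars (LAssign x e) = {x}"
| "wvars (LStore a i e) = {}"
| "wvars (c ;; d) = wvars c \<union> wvars d"
| "wvars (LIf e c d) = wvars c \<union> wvars d"
| "wvars (LFor x b c) = insert x (wvars c)"

primrec warrs :: "lprog \<Rightarrow> nat set" where
  "warrs LSkip = {}"
| "warrs (LAssign x e) = {}"
| "warrs (LStore a i e) = {a}"
| "warrs (c ;; d) = warrs c \<union> warrs d"
| "warrs (LIf e c d) = warrs c \<union> warrs d"
| "warrs (LFor x b c) = warrs c"

section \<open>Frame properties and the invariant rule for loops\<close>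

lemma var_set_var [simp]: "var (set_var x z s) y = (if y = x then z else var s y)"
  and arr_set_var [simp]: "arr (set_var x z s) = arr s"
  and var_set_cell [simp]: "var (set_cell a i z s) = var s"
  and arr_set_cell [simp]:
    "arr (set_cell a i z s) b j = (if b = a \<and> j = i then z else arr s b j)"
  by (auto simp: set_var_def set_cell_def)

lemma arr_set_cell_other [simp]: "b \<noteq> a \<Longrightarrow> arr (set_cell a i z s) b = arr s b"
  by (auto simp: set_cell_def)

lemma den_var: "x \<notin> wvars c \<Longrightarrow> var (den q c s) x = var s x"
proof (induction c arbitrary: s)
  case (LFor y b c)
  have "var (((\<lambda>s. set_var y (var s y + 1) (den q c s)) ^^ N) s') x = var s' x" for N s'
    using LFor by (induction N) auto
  then show ?case using LFor by simp
qed auto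

lemma den_arr: "a \<notin> warrs c \<Longrightarrow> arr (den q c s) a = arr s a"
proof (induction c arbitrary: s)
  case (LFor y b c)
  have "arr (((\<lambda>s. set_var y (var s y + 1) (den q c s)) ^^ N) s') a = arr s' a" for N s'
    using LFor by (induction N) auto
  then show ?case using LFor by simp
qed (auto simp: set_cell_def)

text \<open>Invariant rule with the frame built in: the step may assume that everything outside the
  syntactic write sets of the body has its value from before the loop, so invariants mention only
  what changes.\<close>

lemma den_For:
  assumes x: "x \<notin> wvars c"
    and N: "N = nat (eval q b s)"
    and "I 0 (set_var x 0 s)"
    and step: "\<And>i s'. i < N \<Longrightarrow> I i s' \<Longrightarrow> var s' x = int i \<Longrightarrow>
        (\<And>y. y \<noteq> x \<Longrightarrow> y \<notin> wvars c \<Longrightarrow> var s' y = var s y) \<Longrightarrow>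
        (\<And>a. a \<notin> warrs c \<Longrightarrow> arr s' a = arr s a) \<Longrightarrow>
        I (Suc i) (set_var x (int (Suc i)) (den q c s'))"
  shows "I N (den q (LFor x b c) s)"
proof -
  let ?f = "\<lambda>s. set_var x (var s x + 1) (den q c s)"
  let ?s = "\<lambda>i. (?f ^^ i) (set_var x 0 s)"
  have "I i (?s i) \<and> var (?s i) x = int i \<and>
      (\<forall>y. y \<noteq> x \<longrightarrow> y \<notin> wvars c \<longrightarrow> var (?s i) y = var s y) \<and>
      (\<forall>a. a \<notin> warrs c \<longrightarrow> arr (?s i) a = arr s a)" if "i \<le> N" for i
    using that
  proof (induction i)
    case 0
    then show ?case using assms by auto
  next
    case (Suc i)
    have eq: "?s (Suc i) = set_var x (int (Suc i)) (den q c (?s i))"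
      using Suc by (simp add: add.commute)
    have "I (Suc i) (?s (Suc i))" unfolding eq by (rule step) (use Suc in auto)
    then show ?case using Suc x unfolding eq by (auto simp: den_var den_arr)
  qed
  from this[of N] show ?thesis using N by simp
qed

text \<open>The outermost operation alone must bound the value: comparisons and ring operations do,
  a remainder does if its divisor is variable 3 or a small literal, and a quotient is no larger than
  its dividend. Unreduced sums and products may occur below a remainder. Literals reach up to 64,
  the number of letters over which loops run.\<close>

fun safe :: "expr \<Rightarrow> bool" where
  "safe (Lit z) \<longleftrightarrow> \<bar>z\<bar> \<le> 64"
| "safe (Var x) \<longleftrightarrow> True"
| "safe (Cell a e) \<longleftrightarrow> True"
| "safe (Ring_Inv e) \<longleftrightarrow> True"
| "safe (Binop Int_Mod e1 e2) \<longleftrightarrow> e2 = Var 3 \<or> e2 \<in> Lit ` {1..64}"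
| "safe (Binop Int_Div e1 e2) \<longleftrightarrow> safe e1"
| "safe (Binop f e1 e2) \<longleftrightarrow> f \<notin> {Int_Add, Int_Sub, Int_Mul}"

fun const_bound :: "expr \<Rightarrow> bool" where
  "const_bound (Lit z) \<longleftrightarrow> \<bar>z\<bar> \<le> 64"
| "const_bound (Var x) \<longleftrightarrow> x < 10"
| "const_bound _ \<longleftrightarrow> False"

text \<open>
  Variables below 10 are constants, variable 3 holding a bound on everything that is stored. A
  program that is \<open>confined\<close> has, for syntactic reasons, a running time that depends only on the
  values of these constants.
\<close>

primrec confined :: "lprog \<Rightarrow> bool" where
  "confined LSkip \<longleftrightarrow> True"
| "confined (LAssign x e) \<longleftrightarrow> 10 \<le> x \<and> safe e"
| "confined (LStore a i e) \<longleftrightarrow> safe e"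
| "confined (c ;; d) \<longleftrightarrow> confined c \<and> confined d"
| "confined (LIf e c d) \<longleftrightarrow> confined c \<and> confined d"
| "confined (LFor x b c) \<longleftrightarrow> 10 \<le> x \<and> x \<notin> wvars c \<and> const_bound b \<and> confined c"

text \<open>The constants are the administrative steps of a compiled loop: 4 for setting the
  counter, the sequencing step after it and the failing test; and per round 6 for the test, the
  increment and two sequencing steps.\<close>

primrec time :: "(nat \<Rightarrow> int) \<Rightarrow> lprog \<Rightarrow> nat" where
  "time \<gamma> LSkip = 0"
| "time \<gamma> (LAssign x e) = 1 + ops e"
| "time \<gamma> (LStore a i e) = 1 + ops i + ops e"
| "time \<gamma> (c ;; d) = time \<gamma> c + 1 + time \<gamma> d"
| "time \<gamma> (LIf e c d) = 1 + ops e + max (time \<gamma> c) (time \<gamma> d)"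
| "time \<gamma> (LFor x b c) =
     4 + nat (case b of Lit z \<Rightarrow> z | Var y \<Rightarrow> \<gamma> y | _ \<Rightarrow> 0) * (time \<gamma> c + 6)"

definition bounded :: "int \<Rightarrow> (nat \<Rightarrow> int) \<Rightarrow> state \<Rightarrow> bool" where
  "bounded B \<gamma> s \<longleftrightarrow> (\<forall>x<10. var s x = \<gamma> x) \<and> (\<forall>x. \<bar>var s x\<bar> < B) \<and> (\<forall>a i. \<bar>arr s a i\<bar> < B)"

text \<open>Flooring can move a negative quotient away from zero, yet never beyond \<open>a\<close>
  in absolute value; a zero divisor gives 0. Otherwise quotient times divisor would be too far from
  \<open>a\<close> to leave a remainder below the divisor.\<close>

lemma abs_div_le: "\<bar>a div b\<bar> \<le> \<bar>a :: int\<bar>"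
proof (rule ccontr)
  assume "\<not> \<bar>a div b\<bar> \<le> \<bar>a\<bar>"
  then have b: "b \<noteq> 0" and *: "\<bar>a\<bar> + 1 \<le> \<bar>a div b\<bar>" by auto
  have "\<bar>a\<bar> + \<bar>b\<bar> \<le> \<bar>b\<bar> * (\<bar>a\<bar> + 1)"
    using b mult_right_mono[of 1 "\<bar>b\<bar>" "\<bar>a\<bar>"] by (simp add: algebra_simps)
  also have "\<dots> \<le> \<bar>b\<bar> * \<bar>a div b\<bar>" using * by (rule mult_left_mono) simp
  also have "\<dots> = \<bar>a - a mod b\<bar>" by (simp add: abs_mult minus_mod_eq_mult_div)
  also have "\<dots> \<le> \<bar>a\<bar> + \<bar>a mod b\<bar>" by simp
  also have "\<dots> < \<bar>a\<bar> + \<bar>b\<bar>" using abs_mod_less[OF b] by simp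
  finally show False by simp
qed

context
  fixes q B :: int and \<gamma> :: "nat \<Rightarrow> int"
  assumes q: "0 < q" "q \<le> B" and M: "0 < \<gamma> 3" "\<gamma> 3 \<le> B" and B: "64 < B"
begin

lemma safe_eval:
  assumes "bounded B \<gamma> s"
  shows "safe e \<Longrightarrow> \<bar>eval q e s\<bar> < B"
proof (induction e rule: safe.induct)
  case (5 e1 e2)
  have *: "\<bar>a mod m\<bar> < B" if "0 < m" "m \<le> B" for a m :: int
    using that by (smt (verit) pos_mod_bound pos_mod_sign)
  have "eval q e2 s = \<gamma> 3 \<or> eval q e2 s \<in> {1..64}"
    using 5 assms by (auto simp: bounded_def)
  then show ?case using M B by (auto intro!: *)
next
  case (6 e1 e2)
  then show ?case using abs_div_le[of "eval q e1 s" "eval q e2 s"] by simp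
next
  case (4 e)
  then show ?case
    using q modular_inverse_int_nonneg[of q "eval q e s"] modular_inverse_int_less[of q "eval q e s"]
    by simp
qed (use assms q B in \<open>auto simp: bounded_def abs_of_nonneg
      intro: order.strict_trans2[OF pos_mod_bound]\<close>)

lemma bounded_set_var:
  "bounded B \<gamma> s \<Longrightarrow> 10 \<le> x \<Longrightarrow> \<bar>z\<bar> < B \<Longrightarrow> bounded B \<gamma> (set_var x z s)"
  unfolding bounded_def by simp

lemma bounded_set_cell:
  "bounded B \<gamma> s \<Longrightarrow> \<bar>z\<bar> < B \<Longrightarrow> bounded B \<gamma> (set_cell a i z s)"
  unfolding bounded_def by simp

text \<open>The cost depends on the branches taken, so only the bound \<open>time\<close> is
  claimed. Loop counters are the one place in a confined program where an unreduced sum is stored;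
  they stay at most the loop bound, which is below \<open>B\<close>.\<close>

lemma compile_det:
  "confined c \<Longrightarrow> bounded B \<gamma> s \<Longrightarrow>
     \<exists>w \<le> time \<gamma> c. det q (bounded B \<gamma>) (compile c) s Skip (den q c s) w"
proof (induction c arbitrary: s)
  case LSkip
  then show ?case by (intro exI[of _ 0]) (simp add: det_refl)
next
  case (LAssign x e)
  then have "bounded B \<gamma> (set_var x (eval q e s) s)"
    using safe_eval[of s e] by (intro bounded_set_var) simp_all
  from det_Assign[of "bounded B \<gamma>", OF LAssign(2) this]
  show ?case by (intro exI[of _ "1 + ops e"]) simp
next
  case (LStore a i e)
  then have "bounded B \<gamma> (set_cell a (eval q i s) (eval q e s) s)"
    using safe_eval[of s e] by (intro bounded_set_cell) simp_all
  then have "det q (bounded B \<gamma>) (Store a i e) s Skip (set_cell a (eval q i s) (eval q e s) s)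
      (1 + ops i + ops e + 0)"
    using LStore by (intro det_step[OF _ _ _ det_refl]) simp_all
  then show ?case by (intro exI[of _ "1 + ops i + ops e"]) simp
next
  case (LSeq c d)
  obtain w1 where w1: "w1 \<le> time \<gamma> c" "det q (bounded B \<gamma>) (compile c) s Skip (den q c s) w1"
    using LSeq.IH(1)[of s] LSeq.prems by auto
  obtain w2 where w2: "w2 \<le> time \<gamma> d"
    "det q (bounded B \<gamma>) (compile d) (den q c s) Skip (den q d (den q c s)) w2"
    using LSeq.IH(2)[OF _ det_last[OF w1(2)]] LSeq.prems by auto
  from det_trans[OF det_Seq_Skip[OF w1(2)] w2(2)] show ?case using w1(1) w2(1)
    by (intro exI[of _ "w1 + 1 + w2"]) simp
next
  case (LIf e c d)
  define c' where "c' = (if eval q e s \<noteq> 0 then c else d)"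
  obtain w where w: "w \<le> time \<gamma> c'" "det q (bounded B \<gamma>) (compile c') s Skip (den q c' s) w"
    using LIf.IH(1)[of s] LIf.IH(2)[of s] LIf.prems
    by (cases "eval q e s \<noteq> 0") (simp_all add: c'_def, blast+)
  have "det q (bounded B \<gamma>) (If e (compile c) (compile d)) s Skip (den q c' s) (1 + ops e + w)"
    by (rule det_step[OF _ _ _ w(2)]) (use LIf.prems in \<open>simp_all add: c'_def\<close>)
  then show ?case using w(1)
    by (intro exI[of _ "1 + ops e + w"]) (simp add: c'_def split: if_splits)
next
  case (LFor x b c)
  let ?I = "bounded B \<gamma>"
  let ?inc = "Assign x (Binop Int_Add (Var x) (Lit 1))"
  let ?body = "Seq (compile c) ?inc"
  let ?while = "While (Binop Int_Less (Var x) b) ?body"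
  let ?f = "\<lambda>s. set_var x (var s x + 1) (den q c s)"
  define N where "N = (case b of Lit z \<Rightarrow> z | Var y \<Rightarrow> \<gamma> y | _ \<Rightarrow> 0)"
  from LFor.prems have c: "confined c" "10 \<le> x" "x \<notin> wvars c" "const_bound b" by auto
  have N: "eval q b s' = N" if "?I s'" for s'
    using c(4) that by (cases b) (auto simp: N_def bounded_def)
  have "N < B" using c(4) LFor.prems(2) B by (cases b) (auto simp: N_def bounded_def abs_less_iff, metis)
  have ops: "ops b = 0" using c(4) by (cases b) auto
  have loop: "\<exists>w \<le> 2 + j * (time \<gamma> c + 6). det q ?I ?while s' Skip ((?f ^^ j) s') w"
    if "?I s'" "j = nat (N - var s' x)" "var s' x \<ge> 0" for j s'
    using that
  proof (induction j arbitrary: s')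
    case 0
    have "det q ?I ?while s' Skip s' (2 + 0)"
      by (rule det_step[OF _ _ _ det_refl]) (use 0 N[OF 0(1)] ops in \<open>simp_all\<close>)
    then show ?case by auto
  next
    case (Suc j)
    obtain w1 where w1: "w1 \<le> time \<gamma> c" "det q ?I (compile c) s' Skip (den q c s') w1"
      using LFor.IH[OF c(1) Suc.prems(1)] by auto
    have x: "var (den q c s') x = var s' x" using den_var[OF c(3)] .
    have lt: "var s' x < N" using Suc.prems(2) by simp
    have I1: "?I (den q c s')" using det_last[OF w1(2)] .
    have I2: "?I (?f s')"
      using I1 c(2) lt \<open>N < B\<close> Suc.prems(3) x by (intro bounded_set_var) simp_all
    have "det q ?I ?inc (den q c s') Skip (?f s') 2"
      using det_Assign[of ?I "den q c s'" x q "Binop Int_Add (Var x) (Lit 1)"] I1 I2 x by (simp add: numeral_2_eq_2)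
    from det_trans[OF det_Seq_Skip[OF w1(2)] this]
    have "det q ?I ?body s' Skip (?f s') (w1 + 1 + 2)" .
    from det_Seq_Skip[OF this] have 1: "det q ?I (Seq ?body ?while) s' ?while (?f s') (w1 + 1 + 2 + 1)" .
    have j: "j = nat (N - var (?f s') x)" using Suc.prems(2) x by simp
    obtain w2 where w2: "w2 \<le> 2 + j * (time \<gamma> c + 6)"
      "det q ?I ?while (?f s') Skip ((?f ^^ j) (?f s')) w2"
      using Suc.IH[OF I2 j] Suc.prems(3) x by auto
    have "det q ?I ?while s' Skip ((?f ^^ j) (?f s')) (2 + (w1 + 1 + 2 + 1 + w2))"
      by (rule det_step[OF _ _ _ det_trans[OF 1 w2(2)]]) (use Suc.prems(1) N[OF Suc.prems(1)] lt ops in simp_all)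
    then have "det q ?I ?while s' Skip ((?f ^^ Suc j) s') (2 + (w1 + 1 + 2 + 1 + w2))"
      by (simp only: funpow_Suc_right o_apply)
    moreover have "2 + (w1 + 1 + 2 + 1 + w2) \<le> 2 + Suc j * (time \<gamma> c + 6)" using w1(1) w2(1) by simp
    ultimately show ?case by blast
  qed
  have I0: "?I (set_var x 0 s)" using LFor.prems(2) c(2) B by (intro bounded_set_var) simp_all
  obtain w where w: "w \<le> 2 + nat N * (time \<gamma> c + 6)"
    "det q ?I ?while (set_var x 0 s) Skip ((?f ^^ nat N) (set_var x 0 s)) w"
    using loop[OF I0, of "nat N"] by (simp, blast)
  have "det q ?I (Assign x (Lit 0)) s Skip (set_var x 0 s) 1"
    using det_Assign[of ?I s x q "Lit 0"] LFor.prems I0 by simp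
  from det_trans[OF det_Seq_Skip[OF this] w(2)]
  have "det q ?I (compile (LFor x b c)) s Skip (den q (LFor x b c) s) (1 + 1 + w)"
    using N[OF LFor.prems(2)] by simp
  then show ?case using w by (intro exI[of _ "1 + 1 + w"]) (auto simp: N_def)
qed

end

section \<open>The exponent of matrix multiplication is at least 2\<close>

text \<open>One step writes at most one cell, and a step that writes has positive cost; the witness
  \<open>j\<close> is chosen before \<open>i\<close> to express the former.\<close>

lemma step_changed_cells:
  "(c', s', w) \<in> set_pmf (step q c s) \<Longrightarrow>
     \<exists>j. \<forall>i. arr s' a i \<noteq> arr s a i \<longrightarrow> w \<ge> 1 \<and> i = j"
proof (induction c arbitrary: c')
  case (Seq c1 c2)
  then show ?case by (cases "c1 = Skip") auto
qed auto

lemma run_changed_cells: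
  "(c', s', w) \<in> set_pmf (run q c s N) \<Longrightarrow>
     finite {i. arr s' a i \<noteq> arr s a i} \<and> card {i. arr s' a i \<noteq> arr s a i} \<le> w"
proof (induction N arbitrary: c' s' w)
  case (Suc N)
  obtain c1 s1 w1 w2 where 1: "(c1, s1, w1) \<in> set_pmf (run q c s N)"
    "(c', s', w2) \<in> set_pmf (step q c1 s1)" "w = w1 + w2"
    using Suc.prems unfolding run.simps set_bind_pmf by force
  let ?A = "{i. arr s1 a i \<noteq> arr s a i}" and ?A' = "{i. arr s' a i \<noteq> arr s a i}"
  from step_changed_cells[OF 1(2)] obtain j where
    j: "\<And>i. arr s' a i \<noteq> arr s1 a i \<Longrightarrow> w2 \<ge> 1 \<and> i = j" by blast
  have A: "finite ?A" "card ?A \<le> w1" using Suc.IH[OF 1(1)] by auto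
  have sub: "?A' \<subseteq> insert j ?A"
  proof
    fix i assume i: "i \<in> ?A'"
    show "i \<in> insert j ?A" using i j[of i] by (cases "arr s' a i = arr s1 a i") simp_all
  qed
  have fin: "finite ?A'" using sub A(1) by (rule finite_subset[OF _ finite.insertI])
  show ?case
  proof (cases "w2 = 0")
    case True
    have "arr s' a i = arr s1 a i" for i using j[of i] True by (cases "arr s' a i = arr s1 a i") simp_all
    then show ?thesis using A 1(3) True by simp
  next
    case False
    have "card ?A' \<le> card (insert j ?A)" using sub A(1) by (intro card_mono) auto
    also have "\<dots> \<le> Suc (card ?A)" using A(1) by (simp add: card_insert_if)
    finally show ?thesis using fin A(2) 1(3) False by simp
  qed
qed simp

lemma matmul_exponent_ge_2:
  assumes "matmul_exponent 2 \<omega>"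
  shows "\<omega> \<ge> 2"
proof (rule ccontr)
  assume less: "\<not> \<omega> \<ge> 2"
  obtain prog C where prog: "\<And>n k A B. n \<ge> 1 \<Longrightarrow> k \<ge> 1 \<Longrightarrow>
      A \<in> residue_mats (2 ^ k) n \<Longrightarrow> B \<in> residue_mats (2 ^ k) n \<Longrightarrow>
      halts_within (2 ^ k) prog (matmul_input n k A B) (C * real n powr \<omega>) \<and>
      map_pmf (mat_output n) (final_state (2 ^ k) prog (matmul_input n k A B)) =
        return_pmf (map_mat (\<lambda>z. z mod 2 ^ k) (A * B))"
    using assms unfolding matmul_exponent_def by blast
  have bound: "real (n * n) \<le> C * real n powr \<omega>" if n: "n \<ge> 1" for n
  proof -
    \<comment> \<open>The product of the identity and the all-ones matrix has no zero entry, while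
      the output array is zero initially; so \<open>n * n\<close> cells change, each at a cost of at
      least 1. The case \<open>k = 1\<close> suffices.\<close>
    define A :: "int mat" where "A = 1\<^sub>m n"
    define B :: "int mat" where "B = mat n n (\<lambda>_. 1)"
    define s where "s = matmul_input n 1 A B"
    have *: "halts_within 2 prog s (C * real n powr \<omega>)"
      "map_pmf (mat_output n) (final_state 2 prog s) = return_pmf (map_mat (\<lambda>z. z mod 2) (A * B))"
      using prog[OF n, of 1 A B] by (auto simp: A_def B_def residue_mats_def s_def)
    obtain N where N: "halted_after 2 prog s N"
      "\<forall>(c', s', w) \<in> set_pmf (run 2 prog s N). real w \<le> C * real n powr \<omega>"
      using *(1) by (auto simp: halts_within_def)
    obtain c' s' w where r: "(c', s', w) \<in> set_pmf (run 2 prog s N)"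
      using set_pmf_not_empty[of "run 2 prog s N"] by auto
    have "mat_output n s' \<in> set_pmf (map_pmf (mat_output n) (final_state 2 prog s))"
      using r unfolding final_state_eq[OF N(1)] by force
    then have out: "mat_output n s' = map_mat (\<lambda>z. z mod 2) (A * B)" unfolding * by simp
    have "arr s' 2 (int l) \<noteq> 0" if l: "l < n * n" for l
    proof -
      have ij: "l div n < n" "l mod n < n" using l n by (auto simp: less_mult_imp_div_less)
      have "arr s' 2 (int l) = mat_output n s' $$ (l div n, l mod n)"
        using ij by (simp add: mat_output_def flip: of_nat_mult of_nat_add)
      also have "\<dots> = 1" unfolding out using ij by (simp add: A_def B_def)
      finally show ?thesis by simp
    qed
    then have sub: "int ` {..<n * n} \<subseteq> {i. arr s' 2 i \<noteq> arr s 2 i}"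
      by (auto simp: s_def matmul_input_def)
    have "n * n = card (int ` {..<n * n})" by (simp add: card_image)
    also have "\<dots> \<le> w" using card_mono[OF _ sub] run_changed_cells[OF r, of 2] by auto
    finally have "n * n \<le> w" .
    then have "real (n * n) \<le> real w" by (rule of_nat_mono)
    also have "\<dots> \<le> C * real n powr \<omega>" using N(2) r by auto
    finally show ?thesis .
  qed
  define e where "e = 2 - \<omega>"
  have e: "e > 0" using less by (simp add: e_def)
  have C: "real n powr e \<le> C" if "n \<ge> 1" for n
  proof -
    have "real n powr \<omega> * real n powr e = real (n * n)"
      using that by (simp add: e_def powr_add[symmetric] power2_eq_square)
    also note bound[OF that]
    finally show ?thesis using that by (simp add: mult.commute)
  qed
  \<comment> \<open>Large enough for \<open>n powr e\<close> to exceed \<open>C\<close>; the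
    absolute value covers a negative \<open>C\<close>.\<close>
  define n where "n = Suc (nat \<lceil>(\<bar>C\<bar> + 1) powr (1 / e)\<rceil>)"
  have "(\<bar>C\<bar> + 1) powr (1 / e) \<le> real n" unfolding n_def by linarith
  then have "((\<bar>C\<bar> + 1) powr (1 / e)) powr e \<le> real n powr e"
    using e by (intro powr_mono2) auto
  then have "\<bar>C\<bar> + 1 \<le> real n powr e" using e by (simp add: powr_powr)
  with C[of n] show False by (simp add: n_def)
qed


section \<open>Maps with fibres of equal size\<close>

text \<open>For positive \<open>c\<close> such a map sends the uniform distribution on
  \<open>A\<close> to the uniform one on a nonempty \<open>B\<close>, and fibre sizes multiply under
  composition. So the argument can be carried out by counting, and probabilities enter only at the
  end.\<close>

definition equifibred :: "('a \<Rightarrow> 'b) \<Rightarrow> 'a set \<Rightarrow> 'b set \<Rightarrow> nat \<Rightarrow> bool" where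
  "equifibred f A B c \<longleftrightarrow> finite A \<and> f ` A \<subseteq> B \<and> (\<forall>b\<in>B. card {a \<in> A. f a = b} = c)"

lemma equifibred_comp:
  assumes f: "equifibred f A B c" and g: "equifibred g B C d"
  shows "equifibred (\<lambda>a. g (f a)) A C (c * d)"
proof -
  have "card {a \<in> A. g (f a) = z} = c * d" if z: "z \<in> C" for z
  proof -
    let ?B = "{b \<in> B. g b = z}"
    have "{a \<in> A. g (f a) = z} = (\<Union>b\<in>?B. {a \<in> A. f a = b})"
      using f by (auto simp: equifibred_def)
    also have "card \<dots> = (\<Sum>b\<in>?B. card {a \<in> A. f a = b})"
      using f g by (intro card_UN_disjoint) (auto simp: equifibred_def)
    also have "\<dots> = (\<Sum>b\<in>?B. c)"
      using f by (intro sum.cong) (auto simp: equifibred_def)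
    also have "\<dots> = c * d" using g z by (simp add: equifibred_def)
    finally show ?thesis .
  qed
  then show ?thesis using f g by (fastforce simp: equifibred_def)
qed

lemma equifibred_pmf:
  assumes f: "equifibred f A B c" and c: "c > 0" and B: "B \<noteq> {}"
  shows "A \<noteq> {}" and "map_pmf f (pmf_of_set A) = pmf_of_set B"
proof -
  have fin: "finite A" and fib: "\<And>b. b \<in> B \<Longrightarrow> card {a \<in> A. f a = b} = c" and sub: "f ` A \<subseteq> B"
    using f by (auto simp: equifibred_def)
  have "\<exists>a\<in>A. f a = b" if "b \<in> B" for b
  proof -
    have "{a \<in> A. f a = b} \<noteq> {}" using fib[OF that] c by (metis card.empty less_irrefl)
    then show ?thesis by blast
  qed
  then have img: "f ` A = B" using sub by blast
  then show A: "A \<noteq> {}" using B by blast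
  have finB: "finite B" using fin img by blast
  have "card A = (\<Sum>b\<in>B. card {a \<in> A. f a = b})"
  proof -
    have "A = (\<Union>b\<in>B. {a \<in> A. f a = b})" using sub by auto
    also have "card \<dots> = (\<Sum>b\<in>B. card {a \<in> A. f a = b})"
      using fin finB by (intro card_UN_disjoint) auto
    finally show ?thesis .
  qed
  also have "\<dots> = c * card B" using fib by simp
  finally have card: "card A = c * card B" .
  show "map_pmf f (pmf_of_set A) = pmf_of_set B"
  proof (rule pmf_eqI)
    fix b
    have "pmf (map_pmf f (pmf_of_set A)) b = real (card (A \<inter> f -` {b})) / real (card A)"
      using A fin by (simp add: pmf_map measure_pmf_of_set)
    also have "A \<inter> f -` {b} = {a \<in> A. f a = b}" by auto
    also have "real (card {a \<in> A. f a = b}) / real (card A) = indicator B b / real (card B)"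
    proof (cases "b \<in> B")
      case True
      then show ?thesis using fib[OF True] card c by simp
    next
      case False
      then have "{a \<in> A. f a = b} = {}" using sub by auto
      then show ?thesis using False by (simp only: card.empty) simp
    qed
    also have "\<dots> = pmf (pmf_of_set B) b" using finB B by (simp add: pmf_of_set)
    finally show "pmf (map_pmf f (pmf_of_set A)) b = pmf (pmf_of_set B) b" .
  qed
qed

lemma equifibred_bij:
  assumes "bij_betw f A B" "finite A"
  shows "equifibred f A B 1"
proof -
  have "card {a \<in> A. f a = b} = 1" if b: "b \<in> B" for b
  proof -
    obtain a where "a \<in> A" "f a = b" using bij_betw_imp_surj_on[OF assms(1)] b by blast
    then have "{a \<in> A. f a = b} = {a}" using assms by (auto simp: bij_betw_def inj_on_def)
    then show ?thesis by simp
  qed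
  then show ?thesis using assms by (auto simp: equifibred_def bij_betw_def)
qed


section \<open>Unranking\<close>

text \<open>Locates \<open>r\<close> among consecutive intervals of lengths \<open>f 0\<close>,
  \<open>f 1\<close>, and so on: inverse transform sampling for integer weights.\<close>

definition pick :: "(nat \<Rightarrow> nat) \<Rightarrow> nat \<Rightarrow> nat" where
  "pick f r = (LEAST a. r < sum f {..a})"

lemma sum_lessThan_le: "(a::nat) \<le> b \<Longrightarrow> sum f {..<a} \<le> (sum f {..<b} :: nat)"
  by (intro sum_mono2) auto

lemma pick_eq:
  assumes "sum f {..<a} \<le> r" "r < sum f {..<a} + f a"
  shows "pick f r = a"
  unfolding pick_def
proof (rule Least_equality)
  show "r < sum f {..a}" using assms(2) by (simp add: lessThan_Suc_atMost[symmetric])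
  fix b assume b: "r < sum f {..b}"
  show "a \<le> b"
  proof (rule ccontr)
    assume "\<not> a \<le> b"
    then have "sum f {..<Suc b} \<le> sum f {..<a}" by (intro sum_lessThan_le) simp
    then show False using b assms(1) by (simp add: lessThan_Suc_atMost)
  qed
qed

lemma pick:
  assumes "r < sum f {..<N}"
  shows "pick f r < N" "sum f {..<pick f r} \<le> r" "r < sum f {..<pick f r} + f (pick f r)"
proof -
  have N: "N > 0" using assms by (cases N) auto
  have ex: "r < sum f {..N - 1}" using assms N by (simp add: lessThan_Suc_atMost[symmetric])
  have 1: "r < sum f {..pick f r}" unfolding pick_def by (rule LeastI, rule ex)
  then show "r < sum f {..<pick f r} + f (pick f r)"
    by (simp add: lessThan_Suc_atMost[symmetric])
  have "pick f r \<le> N - 1" unfolding pick_def by (rule Least_le, rule ex)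
  then show "pick f r < N" using N by simp
  show "sum f {..<pick f r} \<le> r"
  proof (cases "pick f r")
    case (Suc p)
    have "\<not> r < sum f {..p}" using Suc unfolding pick_def by (metis lessI not_less_Least)
    then show ?thesis using Suc by (simp add: lessThan_Suc_atMost)
  qed simp
qed

text \<open>
  Words are lists of pairs of natural numbers, of which an automaton reads the residues mod 8. The
  \<open>j\<close>-th pair has the transition function \<open>tr i\<close>, with \<open>i\<close> the \<open>j\<close>-th element of the list of
  indices, and its entries range below \<open>8 * wy i\<close> and \<open>8 * wz i\<close>.
\<close>

type_synonym word = "(int \<times> int) list"

context
  fixes acc :: "nat \<Rightarrow> bool" and tr :: "nat \<Rightarrow> nat \<Rightarrow> nat \<Rightarrow> nat" and wy wz :: "nat \<Rightarrow> nat"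
begin

primrec cnt :: "nat list \<Rightarrow> nat \<Rightarrow> nat" where
  "cnt [] st = of_bool (acc st)"
| "cnt (i # is) st = (\<Sum>a<64. cnt is (tr i a st))"

text \<open>\<open>r\<close> chooses the letters, that is the residues modulo 8; \<open>u\<close> is
  read in mixed radix and supplies the higher digits, on which acceptance does not depend. What is
  left of \<open>u\<close> at the end is discarded, which produces the multiplicity \<open>J\<close>
  below.\<close>

primrec unrank :: "nat list \<Rightarrow> nat \<Rightarrow> nat \<Rightarrow> nat \<Rightarrow> word" where
  "unrank [] st r u = []"
| "unrank (i # is) st r u =
     (let a = pick (\<lambda>a. cnt is (tr i a st)) r in
      (int (a mod 8 + 8 * (u mod wy i)), int (a div 8 + 8 * (u div wy i mod wz i))) #
      unrank is (tr i a st) (r - (\<Sum>b<a. cnt is (tr i b st))) (u div wy i div wz i))"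

definition letter :: "int \<times> int \<Rightarrow> nat" where
  "letter p = nat (fst p mod 8 + 8 * (snd p mod 8))"

primrec accepted :: "nat list \<Rightarrow> nat \<Rightarrow> word set" where
  "accepted [] st = (if acc st then {[]} else {})"
| "accepted (i # is) st =
     {p # ws |p ws. fst p \<in> {0..<8 * int (wy i)} \<and> snd p \<in> {0..<8 * int (wz i)} \<and>
        ws \<in> accepted is (tr i (letter p) st)}"

lemma letter_less: "letter p < 64"
  using pos_mod_bound[of 8 "fst p"] pos_mod_bound[of 8 "snd p"] unfolding letter_def by linarith

lemma letter_encode:
  assumes "a < 64"
  shows "letter (int (a mod 8 + 8 * Y), int (a div 8 + 8 * Z)) = a"
proof -
  have "(a div 8 + 8 * Z) mod 8 = a div 8" "(a mod 8 + 8 * Y) mod 8 = a mod 8"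
    using assms by (simp_all add: less_mult_imp_div_less)
  then show ?thesis
    unfolding letter_def fst_conv snd_conv of_nat_numeral[symmetric, where 'a = int, of "num.Bit0 _"]
      zmod_int[symmetric] of_nat_mult[symmetric] of_nat_add[symmetric] nat_int by simp
qed

lemma letter_decode:
  assumes "0 \<le> y" "0 \<le> z"
  shows "y = int (letter (y, z) mod 8 + 8 * (nat y div 8))"
    and "z = int (letter (y, z) div 8 + 8 * (nat z div 8))"
proof -
  obtain y' z' where yz: "y = int y'" "z = int z'" using assms nonneg_int_cases by metis
  have "letter (y, z) = y' mod 8 + 8 * (z' mod 8)"
    unfolding letter_def yz fst_conv snd_conv of_nat_numeral[symmetric, where 'a = int, of "num.Bit0 _"]
      zmod_int[symmetric] of_nat_mult[symmetric] of_nat_add[symmetric] nat_int ..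
  then show "y = int (letter (y, z) mod 8 + 8 * (nat y div 8))"
    and "z = int (letter (y, z) div 8 + 8 * (nat z div 8))"
    unfolding yz by simp_all
qed

lemma acceptedI:
  assumes "fst p \<in> {0..<8 * int (wy i)}" "snd p \<in> {0..<8 * int (wz i)}"
    "ws \<in> accepted is (tr i (letter p) st)"
  shows "p # ws \<in> accepted (i # is) st"
  using assms unfolding accepted.simps by blast

text \<open>Locating an interval splits the first letter off \<open>r\<close>, and division with
  remainder splits two digits off \<open>u\<close>. Both splittings are bijective, so only the final
  remainder of \<open>u\<close>, with \<open>J\<close> possible values, is lost.\<close>

lemma equifibred_unrank:
  assumes "\<And>i. i \<in> set is \<Longrightarrow> wy i > 0 \<and> wz i > 0"
  shows "equifibred (\<lambda>(r, u). unrank is st r u)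
           ({..<cnt is st} \<times> {..<J * (\<Prod>i\<leftarrow>is. wy i * wz i)}) (accepted is st) J"
  using assms
proof (induction "is" arbitrary: st)
  case Nil
  have "{(r, u). r = 0 \<and> u < J} = {0} \<times> {..<J}" by auto
  then show ?case by (auto simp: equifibred_def)
next
  case (Cons i "is")
  define P where "P = J * (\<Prod>i\<leftarrow>is. wy i * wz i)"
  define A where "A st = {..<cnt is st} \<times> {..<P}" for st
  let ?A = "{..<cnt (i # is) st} \<times> {..<J * (\<Prod>i\<leftarrow>i # is. wy i * wz i)}"
  let ?f = "\<lambda>a. cnt is (tr i a st)"
  have w: "wy i > 0" "wz i > 0" using Cons.prems by auto
  have IH: "equifibred (\<lambda>(r, u). unrank is st r u) (A st) (accepted is st) J" for st
    using Cons unfolding A_def P_def by auto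
  have A': "?A = {..<sum ?f {..<64}} \<times> {..<P * wz i * wy i}" by (simp add: P_def mult_ac)
  have pick_a: "pick ?f r < 64" "r - sum ?f {..<pick ?f r} < ?f (pick ?f r)"
    "sum ?f {..<pick ?f r} \<le> r"
    if "r < sum ?f {..<64}" for r
    using pick[OF that] by auto
  have div: "u div wy i div wz i < P" if "u < P * wz i * wy i" for u
    using that w by (simp add: less_mult_imp_div_less)
  have into: "unrank (i # is) st r u \<in> accepted (i # is) st" if "(r, u) \<in> ?A" for r u
  proof -
    let ?a = "pick ?f r"
    have ru: "r < sum ?f {..<64}" "u < P * wz i * wy i" using that unfolding A' by auto
    have "(r - sum ?f {..<?a}, u div wy i div wz i) \<in> A (tr i ?a st)"
      using pick_a[OF ru(1)] div[OF ru(2)] by (simp add: A_def)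
    then have "unrank is (tr i ?a st) (r - sum ?f {..<?a}) (u div wy i div wz i) \<in>
        accepted is (tr i ?a st)"
      using IH unfolding equifibred_def by force
    moreover have "int (?a mod 8 + 8 * (u mod wy i)) \<in> {0..<8 * int (wy i)}"
    proof -
      have "?a mod 8 < 8" "u mod wy i < wy i" using w by simp_all
      then show ?thesis unfolding atLeastLessThan_iff by linarith
    qed
    moreover have "int (?a div 8 + 8 * (u div wy i mod wz i)) \<in> {0..<8 * int (wz i)}"
    proof -
      have "?a div 8 < 8" "u div wy i mod wz i < wz i"
        using w less_mult_imp_div_less[of ?a 8 8] pick_a(1)[OF ru(1)] by simp_all
      then show ?thesis unfolding atLeastLessThan_iff by linarith
    qed
    ultimately show ?thesis
      unfolding unrank.simps Let_def
      by (intro acceptedI) (simp_all only: fst_conv snd_conv letter_encode[OF pick_a(1)[OF ru(1)]])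
  qed
  have fibre: "card {(r, u) \<in> ?A. unrank (i # is) st r u = ws} = J"
    if ws: "ws \<in> accepted (i # is) st" for ws
  proof -
    obtain y z vs where vs: "ws = (y, z) # vs" "y \<in> {0..<8 * int (wy i)}" "z \<in> {0..<8 * int (wz i)}"
      "vs \<in> accepted is (tr i (letter (y, z)) st)"
      using ws by auto
    define a where "a = letter (y, z)"
    define Y where "Y = nat y div 8"
    define Z where "Z = nat z div 8"
    have a: "a < 64" unfolding a_def by (rule letter_less)
    have yz: "y = int (a mod 8 + 8 * Y)" "z = int (a div 8 + 8 * Z)"
      unfolding a_def Y_def Z_def using vs(2,3) by (intro letter_decode; simp)+
    have YZ: "Y < wy i" "Z < wz i" using vs(2,3) unfolding Y_def Z_def by auto
    let ?S = "{(r, u) \<in> ?A. unrank (i # is) st r u = ws}"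
    let ?T = "{(r, u) \<in> A (tr i a st). unrank is (tr i a st) r u = vs}"
    \<comment> \<open>Inverse of one decoding step: shift the rank by the counts of the smaller
      letters, and append the digits \<open>Z\<close> and \<open>Y\<close> to the rest of
      \<open>u\<close>.\<close>
    let ?g = "\<lambda>(r, u). (sum ?f {..<a} + r, (u * wz i + Z) * wy i + Y)"
    let ?h = "\<lambda>(r, u). (r - sum ?f {..<a}, u div wy i div wz i)"
    have S: "pick ?f r = a \<and> u mod wy i = Y \<and> u div wy i mod wz i = Z \<and>
        unrank is (tr i a st) (r - sum ?f {..<a}) (u div wy i div wz i) = vs"
      if "(r, u) \<in> ?S" for r u
    proof -
      let ?b = "pick ?f r"
      have ru: "(r, u) \<in> ?A" and eq: "unrank (i # is) st r u = (y, z) # vs" using that vs by auto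
      have b: "?b < 64" using ru pick_a(1) unfolding A' by auto
      have 1: "y = int (?b mod 8 + 8 * (u mod wy i))" "z = int (?b div 8 + 8 * (u div wy i mod wz i))"
        using eq by (simp_all add: Let_def)
      then have "?b = a" using letter_encode[OF b, of "u mod wy i" "u div wy i mod wz i"] by (simp add: a_def)
      then show ?thesis using 1 yz eq by (simp add: Let_def)
    qed
    have "bij_betw ?g ?T ?S"
    proof (rule bij_betw_byWitness[where f' = ?h])
      show "\<forall>p\<in>?T. ?h (?g p) = p" using YZ by auto
      show "\<forall>p\<in>?S. ?g (?h p) = p"
      proof
        fix p assume "p \<in> ?S"
        moreover obtain r u where p: "p = (r, u)" by (cases p)
        ultimately have ru: "(r, u) \<in> ?S" by simp
        from S[OF this] have s: "pick ?f r = a" "u mod wy i = Y" "u div wy i mod wz i = Z" by auto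
        have "sum ?f {..<a} \<le> r" using pick_a(3)[of r] ru s(1) unfolding A' by auto
        moreover have "u = (u div wy i div wz i * wz i + Z) * wy i + Y"
          using s(2,3) by (metis div_mult_mod_eq)
        ultimately show "?g (?h p) = p" unfolding p by simp
      qed
      show "?g ` ?T \<subseteq> ?S"
      proof (rule image_subsetI)
        fix p assume "p \<in> ?T"
        moreover obtain r u where p: "p = (r, u)" by (cases p)
        ultimately have ru: "(r, u) \<in> A (tr i a st)" and vs': "vs = unrank is (tr i a st) r u" by auto
        define u' where "u' = (u * wz i + Z) * wy i + Y"
        have r: "r < ?f a" and u: "u < P" using ru by (auto simp: A_def)
        have pick: "pick ?f (sum ?f {..<a} + r) = a" using r by (intro pick_eq) auto
        have "sum ?f {..<a} + r < sum ?f {..<Suc a}" using r by simp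
        also have "\<dots> \<le> sum ?f {..<64}" using a by (intro sum_lessThan_le) simp
        finally have 1: "sum ?f {..<a} + r < sum ?f {..<64}" .
        have "u * wz i + Z < (u + 1) * wz i" using YZ by simp
        also have "\<dots> \<le> P * wz i" using u by (intro mult_le_mono) auto
        finally have "u * wz i + Z + 1 \<le> P * wz i" by simp
        then have "(u * wz i + Z + 1) * wy i \<le> P * wz i * wy i" by (intro mult_le_mono) auto
        then have 2: "u' < P * wz i * wy i" using YZ unfolding u'_def by (simp add: algebra_simps)
        have 3: "u' mod wy i = Y" "u' div wy i = u * wz i + Z" using YZ by (auto simp: u'_def)
        have "unrank (i # is) st (sum ?f {..<a} + r) u' = ws"
          unfolding vs(1) yz vs' using YZ pick 3 by (simp add: Let_def)
        then show "?g p \<in> ?S" using 1 2 unfolding p A' by (simp add: u'_def)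
      qed
      show "?h ` ?S \<subseteq> ?T"
      proof (rule image_subsetI)
        fix p assume "p \<in> ?S"
        moreover obtain r u where p: "p = (r, u)" by (cases p)
        ultimately have ru: "(r, u) \<in> ?S" by simp
        have ru': "r < sum ?f {..<64}" "u < P * wz i * wy i" using ru unfolding A' by auto
        from S[OF ru] pick_a[OF ru'(1)] div[OF ru'(2)]
        show "?h p \<in> ?T" by (simp add: A_def p)
      qed
    qed
    then have "card ?S = card ?T" by (simp add: bij_betw_same_card)
    also have "?T = {p \<in> A (tr i a st). (case p of (r, u) \<Rightarrow> unrank is (tr i a st) r u) = vs}" by auto
    also have "card \<dots> = J" using IH[of "tr i a st"] vs(4) unfolding equifibred_def a_def by blast
    finally show ?thesis .
  qed
  show ?case unfolding equifibred_def
  proof (intro conjI ballI)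
    show "(\<lambda>(r, u). unrank (i # is) st r u) ` ?A \<subseteq> accepted (i # is) st"
      using into by (force simp only:)
    fix ws assume "ws \<in> accepted (i # is) st"
    from fibre[OF this]
    show "card {p \<in> ?A. (case p of (r, u) \<Rightarrow> unrank (i # is) st r u) = ws} = J"
      by (simp only: case_prod_unfold conj_commute prod.collapse)
  qed simp
qed

end

lemma card_lists_nth:
  "card {xs. length xs = n \<and> (\<forall>i<n. xs ! i \<in> D i)} = (\<Prod>i<n. card (D i))"
proof (induction n)
  case (Suc n)
  let ?L = "\<lambda>n. {xs. length xs = n \<and> (\<forall>i<n. xs ! i \<in> D i)}"
  have "bij_betw (\<lambda>(xs, x). xs @ [x]) (?L n \<times> D n) (?L (Suc n))"
  proof (rule bij_betw_byWitness[where f' = "\<lambda>xs. (butlast xs, last xs)"])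
    show "(\<lambda>(xs, x). xs @ [x]) ` (?L n \<times> D n) \<subseteq> ?L (Suc n)"
      by (auto simp: nth_append less_Suc_eq)
    show "(\<lambda>xs. (butlast xs, last xs)) ` ?L (Suc n) \<subseteq> ?L n \<times> D n"
      by (auto simp: nth_butlast last_conv_nth) (metis diff_Suc_1 last_conv_nth length_0_conv lessI nat.simps(3))
    show "\<forall>xs\<in>?L (Suc n). (case (butlast xs, last xs) of (xs, x) \<Rightarrow> xs @ [x]) = xs"
      by (auto, metis append_butlast_last_id length_0_conv nat.simps(3))
  qed auto
  then have "card (?L (Suc n)) = card (?L n \<times> D n)" by (simp add: bij_betw_same_card)
  then show ?case using Suc by (simp add: card_cartesian_product)
qed simp


section \<open>Lifting 2-adic solutions\<close>

text \<open>A finite-difference version of a 2-adic derivative that is 8 times a unit. The 8 arises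
  below because the arguments are step numbers of moves by 4 or 8.\<close>

definition steep :: "(int \<Rightarrow> int) \<Rightarrow> bool" where
  "steep g \<longleftrightarrow> (\<forall>e e'. \<exists>u. odd u \<and> g e - g e' = 8 * (e - e') * u)"

text \<open>Hensel lifting one binary digit at a time; digit \<open>s\<close> of the argument
  controls bit \<open>s + 3\<close> of the value because of the factor 8 in
  \<open>steep\<close>.\<close>

primrec lift :: "(int \<Rightarrow> int) \<Rightarrow> int \<Rightarrow> nat \<Rightarrow> int" where
  "lift g T 0 = 0"
| "lift g T (Suc s) =
     (if 2 ^ (s + 4) dvd g (lift g T s) - T then lift g T s else lift g T s + 2 ^ s)"

lemma lift_bounds: "0 \<le> lift g T s \<and> lift g T s < 2 ^ s"
  by (induction s) auto

lemma lift_solves: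
  assumes "steep g" "8 dvd g 0 - T"
  shows "2 ^ (s + 3) dvd g (lift g T s) - T"
proof (induction s)
  case 0
  then show ?case using assms(2) by simp
next
  case (Suc s)
  let ?e = "lift g T s"
  show ?case
  proof (cases "2 ^ (s + 4) dvd g ?e - T")
    case True
    then show ?thesis by (simp add: add.commute)
  next
    case False
    obtain w where w: "g ?e - T = 2 ^ (s + 3) * w" using Suc by (auto simp: dvd_def)
    obtain u where u: "odd u" "g (?e + 2 ^ s) - g ?e = 8 * (?e + 2 ^ s - ?e) * u"
      using assms(1) unfolding steep_def by blast
    \<comment> \<open>The error is an odd multiple of \<open>2 ^ (s + 3)\<close>, and so is the
      change caused by setting the digit; the sum of the two odd cofactors is even.\<close>
    have "odd w"
    proof
      assume "even w"
      then obtain v where "w = 2 * v" by (auto elim: evenE)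
      then have "g ?e - T = 2 ^ (s + 4) * v" using w by (simp add: power_add)
      then show False using False by (metis dvd_triv_left)
    qed
    then obtain v where v: "u + w = 2 * v" using u(1) by (metis evenE odd_add)
    have "g (?e + 2 ^ s) - T = 2 ^ (s + 3) * (u + w)"
      using u(2) w by (simp add: algebra_simps power_add)
    also have "\<dots> = 2 ^ (Suc s + 3) * v" by (simp add: v power_add)
    finally show ?thesis using False by simp
  qed
qed

lemma steep_inj:
  assumes "steep g" "2 ^ (s + 3) dvd g e - g e'" "\<bar>e - e'\<bar> < 2 ^ s"
  shows "e = e'"
proof -
  obtain u where u: "odd u" "g e - g e' = 8 * (e - e') * u"
    using assms(1) unfolding steep_def by blast
  have "8 * 2 ^ s dvd 8 * ((e - e') * u)"
    using assms(2) unfolding u(2) by (simp add: power_add mult_ac)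
  then have "2 ^ s dvd (e - e') * u" by simp
  moreover have "coprime (2 ^ s) u" using u(1) by simp
  ultimately have "2 ^ s dvd e - e'" by (simp add: coprime_dvd_mult_left_iff)
  then show ?thesis using assms(3) dvd_imp_le_int[of "e - e'" "2 ^ s"] by force
qed

lemma lift_unique:
  assumes "steep g" "8 dvd g 0 - T" "0 \<le> e" "e < 2 ^ s" "2 ^ (s + 3) dvd g e - T"
  shows "lift g T s = e"
proof (rule steep_inj[OF assms(1)])
  show "2 ^ (s + 3) dvd g (lift g T s) - g e"
    using dvd_diff[OF lift_solves[OF assms(1,2), of s] assms(5)] by simp
  show "\<bar>lift g T s - e\<bar> < 2 ^ s" using lift_bounds[of g T s] assms(3,4) by auto
qed


section \<open>Block diagonal forms\<close>

text \<open>
  Up to a unimodular substitution a form modulo \<open>2 ^ k\<close> is a sum of terms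
  \<open>2 ^ scale i * (al i * x\<^sub>i\<^sup>2 + be i * x\<^sub>i * x\<^sub>i\<^sub>+\<^sub>1 + ga i * x\<^sub>i\<^sub>+\<^sub>1\<^sup>2)\<close>. An index of kind 0 is a
  block of size one; indices of kind 1 and 2 are the first and the second index of a block of
  size two.
\<close>

locale block_form =
  fixes n k :: nat and kind scale :: "nat \<Rightarrow> nat" and al be ga :: "nat \<Rightarrow> int"
    and t :: int and okay :: "bool \<Rightarrow> bool"
  assumes k: "1 \<le> k"
    and kind: "i < n \<Longrightarrow> kind i \<le> 2"
    and kind0: "i < n \<Longrightarrow> kind i = 0 \<Longrightarrow> be i = 0 \<and> ga i = 0 \<and> (scale i < k \<longrightarrow> odd (al i))"
    and kind1: "i < n \<Longrightarrow> kind i = 1 \<Longrightarrow> odd (be i) \<and> Suc i < n \<and> kind (Suc i) = 2"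
    and kind2: "i < n \<Longrightarrow> kind i = 2 \<Longrightarrow>
      al i = 0 \<and> be i = 0 \<and> ga i = 0 \<and> 0 < i \<and> kind (i - 1) = 1"
begin

definition h :: "nat \<Rightarrow> int \<Rightarrow> int \<Rightarrow> int" where
  "h i y z = al i * y ^ 2 + be i * y * z + ga i * z ^ 2"

definition form :: "(nat \<Rightarrow> int) \<Rightarrow> int" where
  "form x = (\<Sum>i<n. 2 ^ scale i * h i (x i) (x (Suc i)))"

definition solutions :: "int vec set" where
  "solutions = {x \<in> residue_vecs (2 ^ k) n. [form (($) x) = t] (mod 2 ^ k) \<and> okay (primitive_vec 2 x)}"

text \<open>\<open>c m i\<close> is half of \<open>m - scale i\<close> rounded up, and 0 for
  \<open>m <= scale i\<close> by truncated subtraction, since scaling the coordinates of a block by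
  \<open>2 ^ c\<close> multiplies its value by \<open>4 ^ c\<close>. \<open>r m i\<close> is the
  exponent of 2 left over after division by \<open>2 ^ m\<close>; for \<open>m > scale i\<close> it
  is 0 or 1.\<close>

definition c :: "nat \<Rightarrow> nat \<Rightarrow> nat" where "c m i = (m - scale i + 1) div 2"
definition r :: "nat \<Rightarrow> nat \<Rightarrow> nat" where "r m i = scale i + 2 * c m i - m"

text \<open>A coordinate divided by \<open>2 ^ c\<close> matters modulo \<open>2 ^ (k - c)\<close>.
  \<open>box\<close> allows 8 times that range, so that the residue modulo 8 is an independent digit
  even when \<open>2 ^ (k - c) < 8\<close>. Positions without a coordinate get the range 8 as well;
  thus every index accounts for the same factor 64, whatever its kind.\<close>

definition wy :: "nat \<Rightarrow> nat \<Rightarrow> nat" where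
  "wy m i = (if kind i = 2 then 1 else 2 ^ (k - c m i))"
definition wz :: "nat \<Rightarrow> nat \<Rightarrow> nat" where
  "wz m i = (if kind i = 1 then 2 ^ (k - c m i) else 1)"

definition box :: "nat \<Rightarrow> word set" where
  "box m = {w. length w = n \<and>
     (\<forall>i<n. w ! i \<in> {0..<8 * int (wy m i)} \<times> {0..<8 * int (wz m i)})}"

definition val :: "nat \<Rightarrow> word \<Rightarrow> int" where
  "val m w = (\<Sum>i<n. 2 ^ r m i * h i (fst (w ! i)) (snd (w ! i)))"

definition od :: "nat \<Rightarrow> int \<times> int \<Rightarrow> bool" where
  "od i p \<longleftrightarrow> kind i \<noteq> 2 \<and> odd (fst p) \<or> kind i = 1 \<and> odd (snd p)"

definition good :: "nat \<Rightarrow> word \<Rightarrow> bool" where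
  "good m w \<longleftrightarrow> (\<exists>i<n. r m i = 0 \<and> od i (w ! i))"
definition prim :: "nat \<Rightarrow> word \<Rightarrow> bool" where
  "prim m w \<longleftrightarrow> (\<exists>i<n. c m i = 0 \<and> od i (w ! i))"

definition sat :: "nat \<Rightarrow> nat \<Rightarrow> word set" where
  "sat m j = {w \<in> box m. 2 ^ m dvd t \<and> (m < k \<longrightarrow> good m w) \<and> okay (prim m w) \<and>
     [val m w = t div 2 ^ m] (mod 2 ^ j)}"

text \<open>Words are organised by blocks: the second coordinate of a block of size two is the
  second component of the pair at the preceding index.\<close>

definition own :: "nat \<Rightarrow> nat" where "own j = (if kind j = 2 then j - 1 else j)"
definition co :: "word \<Rightarrow> nat \<Rightarrow> int" where
  "co w j = (if kind j = 2 then snd (w ! (j - 1)) else fst (w ! j))"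

definition out :: "nat \<Rightarrow> word \<Rightarrow> int vec" where
  "out m w = vec n (\<lambda>j. (2 ^ c m (own j) * co w j) mod 2 ^ k)"

lemma kind_cases:
  assumes "i < n"
  obtains "kind i = 0" | "kind i = 1" | "kind i = 2"
  using kind[OF assms] by linarith

lemma c_r: "scale i + 2 * c m i = m + r m i"
  unfolding c_def r_def by linarith

lemma c_le: "c m i \<le> m"
  unfolding c_def by linarith

text \<open>Passing to the next level costs a further factor 2 exactly in the blocks with
  \<open>r m i = 0\<close>. So a level below \<open>k\<close> is maximal for a vector iff one of
  these blocks has an odd coordinate, which is the meaning of \<open>good\<close>.\<close>

lemma c_Suc: "c (Suc m) i = c m i + (if r m i = 0 then 1 else 0)"
proof (cases "m < scale i")
  case True
  then show ?thesis by (simp add: c_def r_def)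
next
  case False
  define d where "d = m - scale i"
  have "m = scale i + d" using False by (simp add: d_def)
  then show ?thesis unfolding c_def r_def by (simp, presburger)
qed

lemma own:
  assumes "j < n"
  shows "own j < n \<and> kind (own j) \<noteq> 2"
  using kind2[OF assms] assms by (auto simp: own_def)

lemma h_cong:
  "[y = y'] (mod M) \<Longrightarrow> [z = z'] (mod M) \<Longrightarrow> [h i y z = h i y' z'] (mod M)"
  unfolding h_def by (intro cong_add cong_mult cong_pow cong_refl)

lemma h_scaled: "h i (a * y) (a * z) = a ^ 2 * h i y z"
  unfolding h_def by (simp add: algebra_simps power2_eq_square)

lemma form_out:
  "[form (($) (out m w)) = 2 ^ m * val m w] (mod 2 ^ k)"
proof -
  let ?x = "($) (out m w)"
  have "[2 ^ scale i * h i (?x i) (?x (Suc i)) =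
      2 ^ m * (2 ^ r m i * h i (fst (w ! i)) (snd (w ! i)))] (mod 2 ^ k)" if i: "i < n" for i
  proof -
    let ?y = "2 ^ c m i * fst (w ! i)" and ?z = "2 ^ c m i * snd (w ! i)"
    have "[h i (?x i) (?x (Suc i)) = h i ?y ?z] (mod 2 ^ k)"
    proof (rule kind_cases[OF i])
      assume "kind i = 0"
      then have "[?x i = ?y] (mod 2 ^ k)" and "h i y z = h i y z'" for y z z'
        using i kind0[OF i] by (auto simp: out_def own_def co_def cong_def h_def)
      then show ?thesis using h_cong[of "?x i" ?y _ 0 0 i] by (metis cong_refl)
    next
      assume "kind i = 1"
      then have "[?x i = ?y] (mod 2 ^ k)" "[?x (Suc i) = ?z] (mod 2 ^ k)"
        using i kind1[OF i] by (auto simp: out_def own_def co_def cong_def)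
      then show ?thesis by (rule h_cong)
    next
      assume "kind i = 2"
      then show ?thesis using kind2[OF i] by (simp add: h_def)
    qed
    then have "[2 ^ scale i * h i (?x i) (?x (Suc i)) =
        2 ^ scale i * h i ?y ?z] (mod 2 ^ k)" by (rule cong_scalar_left)
    also have "2 ^ scale i * h i ?y ?z = 2 ^ (scale i + 2 * c m i) * h i (fst (w ! i)) (snd (w ! i))"
      unfolding h_scaled by (simp add: power_add power_mult power2_eq_square power_mult_distrib[symmetric])
    finally show ?thesis unfolding c_r by (simp add: power_add mult_ac)
  qed
  then show ?thesis
    unfolding form_def val_def sum_distrib_left by (intro cong_sum) auto
qed

lemma ex_od: "(\<exists>i<n. P i \<and> od i (w ! i)) \<longleftrightarrow> (\<exists>j<n. P (own j) \<and> odd (co w j))"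
proof
  assume "\<exists>i<n. P i \<and> od i (w ! i)"
  then obtain i where i: "i < n" "P i" "od i (w ! i)" by auto
  show "\<exists>j<n. P (own j) \<and> odd (co w j)"
  proof (cases "kind i \<noteq> 2 \<and> odd (fst (w ! i))")
    case True
    then show ?thesis using i by (intro exI[of _ i]) (auto simp: own_def co_def)
  next
    case False
    then have "kind i = 1" "odd (snd (w ! i))" using i by (auto simp: od_def)
    then show ?thesis using i kind1[OF i(1)]
      by (intro exI[of _ "Suc i"]) (auto simp: own_def co_def)
  qed
next
  assume "\<exists>j<n. P (own j) \<and> odd (co w j)"
  then obtain j where j: "j < n" "P (own j)" "odd (co w j)" by auto
  then show "\<exists>i<n. P i \<and> od i (w ! i)"
    using own[OF j(1)] kind2[OF j(1)]
    by (intro exI[of _ "own j"]) (auto simp: own_def co_def od_def split: if_splits)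
qed

lemma good_co: "good m w \<longleftrightarrow> (\<exists>j<n. r m (own j) = 0 \<and> odd (co w j))"
  unfolding good_def by (rule ex_od)

lemma dim_out: "dim_vec (out m w) = n"
  by (simp add: out_def)

lemma primitive_out: "primitive_vec 2 (out m w) \<longleftrightarrow> prim m w"
proof -
  have "odd ((2 ^ a * b) mod 2 ^ k) \<longleftrightarrow> a = 0 \<and> odd b" for a and b :: int
    using k by (simp add: dvd_mod_iff)
  then have "coprime (out m w $ j) 2 \<longleftrightarrow> c m (own j) = 0 \<and> odd (co w j)" if "j < n" for j
    using that by (simp add: out_def coprime_right_2_iff_odd)
  then show ?thesis
    unfolding prim_def ex_od[of "\<lambda>i. c m i = 0"] primitive_vec_def
    by (auto simp: dim_out)
qed

text \<open>Dividing the congruence by \<open>2 ^ m\<close> is an equivalence once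
  \<open>2 ^ m\<close> divides \<open>t\<close>; if it does not, no word at this level gives a
  solution.\<close>

lemma sat_iff_out:
  assumes "m \<le> k" "w \<in> box m" "0 \<le> t" "t < 2 ^ k"
  shows "w \<in> sat m (k - m) \<longleftrightarrow> (m < k \<longrightarrow> good m w) \<and> out m w \<in> solutions"
proof -
  have "out m w \<in> residue_vecs (2 ^ k) n"
    by (auto simp: residue_vecs_def out_def)
  moreover have "[form (($) (out m w)) = t] (mod 2 ^ k) \<longleftrightarrow>
      2 ^ m dvd t \<and> [val m w = t div 2 ^ m] (mod 2 ^ (k - m))"
  proof -
    have k_eq: "(2::int) ^ k = 2 ^ m * 2 ^ (k - m)" using assms(1) by (simp add: power_add[symmetric])
    have 1: "[form (($) (out m w)) = t] (mod 2 ^ k) \<longleftrightarrow> [2 ^ m * val m w = t] (mod 2 ^ k)"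
      using form_out by (meson cong_sym cong_trans)
    show ?thesis
    proof (cases "2 ^ m dvd t")
      case True
      then obtain T where T: "t = 2 ^ m * T" by (auto simp: dvd_def)
      show ?thesis unfolding 1 unfolding T k_eq
        by (simp add: cong_iff_dvd_diff right_diff_distrib[symmetric])
    next
      case False
      have "\<not> [2 ^ m * val m w = t] (mod 2 ^ k)"
      proof
        assume "[2 ^ m * val m w = t] (mod 2 ^ k)"
        then have "2 ^ k dvd 2 ^ m * val m w - t" by (simp add: cong_iff_dvd_diff)
        then have "2 ^ m dvd 2 ^ m * val m w - t" unfolding k_eq by (rule dvd_mult_left)
        then show False using False by (simp add: dvd_diff_right_iff)
      qed
      then show ?thesis using False 1 by simp
    qed
  qed
  ultimately show ?thesis using assms(2) by (auto simp: sat_def solutions_def primitive_out)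
qed

section \<open>Levels of vectors\<close>

definition adm :: "nat \<Rightarrow> int vec \<Rightarrow> bool" where
  "adm m x \<longleftrightarrow> (\<forall>j<n. 2 ^ c m (own j) dvd x $ j)"

text \<open>At the top level \<open>m = k\<close> there is no maximality to ask for: every block
  already contributes 0 modulo \<open>2 ^ k\<close>.\<close>

definition level :: "nat \<Rightarrow> int vec \<Rightarrow> bool" where
  "level m x \<longleftrightarrow> m \<le> k \<and> adm m x \<and> (m < k \<longrightarrow> \<not> adm (Suc m) x)"

lemma adm_mono:
  assumes "adm m x" "m' \<le> m"
  shows "adm m' x"
proof -
  have "c m' i \<le> c m i" for i using assms(2) unfolding c_def by (intro div_le_mono) simp
  then show ?thesis using assms(1) unfolding adm_def by (meson le_imp_power_dvd dvd_trans)
qed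

lemma level_unique: "level m x \<Longrightarrow> level m' x \<Longrightarrow> m = m'"
proof (induction m m' rule: linorder_wlog)
  case (le m m')
  then show ?case using adm_mono[of m' x "Suc m"] unfolding level_def by (cases "m = m'") auto
qed auto

lemma level_exists: "\<exists>m. level m x"
proof (rule ccontr)
  assume no: "\<not> ?thesis"
  have "m \<le> k \<Longrightarrow> adm m x" for m
  proof (induction m)
    case 0
    show ?case by (simp add: adm_def c_def)
  next
    case (Suc m)
    then show ?case using no unfolding level_def by (metis Suc_leD Suc_le_lessD)
  qed
  then show False using no unfolding level_def by blast
qed

lemma adm_out: "adm m (out m w)" if "m \<le> k"
proof -
  have "(2::int) ^ c m i dvd 2 ^ k" for i using c_le[of m i] that by (intro le_imp_power_dvd) simp
  then show ?thesis by (auto simp: adm_def out_def dvd_mod)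
qed

lemma level_out:
  assumes m: "m \<le> k"
  shows "level m (out m w) \<longleftrightarrow> (m < k \<longrightarrow> good m w)"
proof -
  have "adm (Suc m) (out m w) \<longleftrightarrow> \<not> good m w" if "m < k"
  proof -
    have "2 ^ c (Suc m) (own j) dvd out m w $ j \<longleftrightarrow> \<not> (r m (own j) = 0 \<and> odd (co w j))"
      if j: "j < n" for j
    proof -
      let ?c = "c m (own j)"
      have "c (Suc m) (own j) \<le> Suc m" by (rule c_le)
      then have "(2::int) ^ c (Suc m) (own j) dvd 2 ^ k"
        using \<open>m < k\<close> by (intro le_imp_power_dvd) simp
      then have "2 ^ c (Suc m) (own j) dvd out m w $ j \<longleftrightarrow> 2 ^ c (Suc m) (own j) dvd 2 ^ ?c * co w j"
        using j by (simp add: out_def dvd_mod_iff)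
      also have "\<dots> \<longleftrightarrow> \<not> (r m (own j) = 0 \<and> odd (co w j))"
        unfolding c_Suc by simp
      finally show ?thesis .
    qed
    then show ?thesis unfolding adm_def good_co by auto
  qed
  then show ?thesis using adm_out[OF m, of w] m by (auto simp: level_def)
qed

section \<open>Fibres of the map from words to vectors\<close>

lemma zdiv_less: "0 < b \<Longrightarrow> a < c' * b \<Longrightarrow> a div b < (c' :: int)"
  by (rule ccontr) (use pos_mod_sign[of b a] mult_right_mono[of c' "a div b" b] div_mult_mod_eq[of a b] in linarith)

lemma card_0_8: "card {y :: int. 0 \<le> y \<and> y < 8} = 8"
proof -
  have "{y :: int. 0 \<le> y \<and> y < 8} = {0..<8}" by auto
  then show ?thesis by simp
qed

lemma card_residue_class:
  assumes "0 \<le> v" "v < W"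
  shows "card {y \<in> {0..<8 * W}. y mod W = (v :: int)} = 8"
proof -
  have "{y \<in> {0..<8 * W}. y mod W = v} = (\<lambda>j. v + W * j) ` {0..<8}"
  proof (rule equalityI; rule subsetI)
    fix y assume "y \<in> {y \<in> {0..<8 * W}. y mod W = v}"
    then have y: "0 \<le> y" "y < 8 * W" "y mod W = v" by auto
    have "y = v + W * (y div W)" using y(3) mult_div_mod_eq[of W y] by linarith
    moreover have "0 \<le> y div W" using y assms by (simp add: pos_imp_zdiv_nonneg_iff)
    moreover have "y div W < 8" using y assms by (intro zdiv_less) auto
    ultimately show "y \<in> (\<lambda>j. v + W * j) ` {0..<8}" by (intro image_eqI[of _ _ "y div W"]) auto
  next
    fix y assume "y \<in> (\<lambda>j. v + W * j) ` {0..<8}"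
    then obtain j where j: "0 \<le> j" "j < 8" "y = v + W * j" by auto
    have "W * j \<le> W * 7" using j assms by (intro mult_left_mono) auto
    moreover have "0 \<le> W * j" using j assms by simp
    moreover have "y mod W = v" using assms unfolding j(3) by simp
    ultimately show "y \<in> {y \<in> {0..<8 * W}. y mod W = v}"
      using j(3) assms unfolding mem_Collect_eq atLeastLessThan_iff by linarith
  qed
  moreover have "inj_on (\<lambda>j. v + W * j) {0..<8}" using assms by (intro inj_onI) simp
  ultimately show ?thesis by (simp only: card_image) simp
qed

text \<open>A coordinate of an admissible vector determines its word entry modulo
  \<open>2 ^ (k - c m i)\<close> and leaves 8 choices in the box; every position without a
  coordinate leaves 8 as well.\<close>

lemma card_out_fibre:
  assumes m: "m \<le> k" and x: "x \<in> residue_vecs (2 ^ k) n" and adm: "adm m x"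
  shows "card {w \<in> box m. out m w = x} = 64 ^ n"
proof -
  let ?C = "\<lambda>i. 2 ^ c m i :: int" and ?W = "\<lambda>i. 2 ^ (k - c m i) :: int"
  have CW: "?C i * ?W i = 2 ^ k" for i
    using c_le[of m i] m by (simp add: power_add[symmetric])
  define Y where "Y i = {y \<in> {0..<8 * int (wy m i)}. kind i \<noteq> 2 \<longrightarrow> y mod ?W i = x $ i div ?C i}" for i
  define Z where "Z i = {z \<in> {0..<8 * int (wz m i)}. kind i = 1 \<longrightarrow> z mod ?W i = x $ Suc i div ?C i}" for i
  have quot: "0 \<le> x $ j div ?C (own j) \<and> x $ j div ?C (own j) < ?W (own j)" if "j < n" for j
  proof -
    have "0 \<le> x $ j" "x $ j < ?W (own j) * ?C (own j)"
      using x that CW[of "own j"] by (auto simp: residue_vecs_def mult.commute)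
    then show ?thesis by (simp add: pos_imp_zdiv_nonneg_iff zdiv_less)
  qed
  have Y: "card (Y i) = 8" if i: "i < n" for i
  proof (cases "kind i = 2")
    case False
    then show ?thesis using quot[OF i] card_residue_class[of "x $ i div ?C i" "?W i"]
      by (simp add: Y_def wy_def own_def)
  qed (simp add: Y_def wy_def card_0_8)
  have Z: "card (Z i) = 8" if i: "i < n" for i
  proof (cases "kind i = 1")
    case True
    then have "Suc i < n" "own (Suc i) = i" using kind1[OF i] by (auto simp: own_def)
    then show ?thesis using True quot[of "Suc i"] card_residue_class[of "x $ Suc i div ?C i" "?W i"]
      by (simp add: Z_def wz_def)
  qed (simp add: Z_def wz_def card_0_8)
  have coord: "(?C i * y) mod 2 ^ k = x $ j \<longleftrightarrow> y mod ?W i = x $ j div ?C i"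
    if ij: "j < n" "own j = i" for i j y
  proof -
    obtain v where v: "x $ j = ?C i * v" using adm ij unfolding adm_def by (metis dvdE)
    show ?thesis unfolding CW[of i, symmetric] v by (simp add: mult_mod_right[symmetric])
  qed
  have "out m w = x \<longleftrightarrow> (\<forall>j<n. (?C (own j) * co w j) mod 2 ^ k = x $ j)" for w
    using x by (auto simp: out_def residue_vecs_def vec_eq_iff)
  then have "out m w = x \<longleftrightarrow> (\<forall>i<n. (kind i \<noteq> 2 \<longrightarrow> fst (w ! i) mod ?W i = x $ i div ?C i) \<and>
      (kind i = 1 \<longrightarrow> snd (w ! i) mod ?W i = x $ Suc i div ?C i))" (is "_ \<longleftrightarrow> ?R") for w
  proof (intro iffI)
    assume L: "out m w = x"
    then have L: "\<And>j. j < n \<Longrightarrow> (?C (own j) * co w j) mod 2 ^ k = x $ j"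
      using \<open>\<And>w. (out m w = x) = _ w\<close> by blast
    show ?R
    proof (intro allI impI conjI)
      fix i assume i: "i < n"
      show "fst (w ! i) mod ?W i = x $ i div ?C i" if "kind i \<noteq> 2"
        using L[OF i] coord[OF i, of i] that by (simp add: own_def co_def)
      show "snd (w ! i) mod ?W i = x $ Suc i div ?C i" if "kind i = 1"
        using L[of "Suc i"] coord[of "Suc i" i] that kind1[OF i] by (simp add: own_def co_def)
    qed
  next
    assume R: ?R
    have "(?C (own j) * co w j) mod 2 ^ k = x $ j" if j: "j < n" for j
    proof (cases "kind j = 2")
      case True
      then have j': "j - 1 < n" "kind (j - 1) = 1" "Suc (j - 1) = j" using kind2[OF j] j by auto
      then show ?thesis using R[rule_format, of "j - 1"] coord[OF j, of "j - 1"] True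
        by (simp add: own_def co_def)
    next
      case False
      then show ?thesis using R[rule_format, of j] coord[OF j, of j] j by (simp add: own_def co_def)
    qed
    then show "out m w = x" using \<open>\<And>w. (out m w = x) = _ w\<close> by blast
  qed
  then have "{w \<in> box m. out m w = x} = {w. length w = n \<and> (\<forall>i<n. w ! i \<in> Y i \<times> Z i)}"
    by (auto simp: box_def Y_def Z_def mem_Times_iff)
  also have "card \<dots> = (\<Prod>i<n. card (Y i \<times> Z i))" by (rule card_lists_nth)
  also have "\<dots> = (\<Prod>i<n. 64)" using Y Z by (intro prod.cong) (auto simp: card_cartesian_product)
  finally show ?thesis by simp
qed

lemma finite_box: "finite (box m)"
proof -
  let ?U = "\<Union>i<n. {0..<8 * int (wy m i)} \<times> {0..<8 * int (wz m i)}"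
  have "box m \<subseteq> {w. set w \<subseteq> ?U \<and> length w = n}"
  proof
    fix w assume w: "w \<in> box m"
    have "set w \<subseteq> ?U"
    proof
      fix p assume "p \<in> set w"
      then obtain i where "i < length w" "w ! i = p" by (auto simp: in_set_conv_nth)
      then show "p \<in> ?U" using w unfolding box_def by blast
    qed
    then show "w \<in> {w. set w \<subseteq> ?U \<and> length w = n}" using w by (simp add: box_def)
  qed
  then show ?thesis using finite_lists_length_eq[of ?U n] finite_subset by blast
qed

end


context block_form
begin

subsection \<open>Correcting an approximate solution\<close>

text \<open>Changing an odd \<open>y\<close> by \<open>4 * e\<close> changes \<open>y ^ 2\<close> by
  a multiple of 8. In a block of size two the cross term has an odd coefficient, so the partner of
  an odd coordinate is changed, by \<open>8 * e\<close>. All parities survive, hence the same pivot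
  is found afterwards.\<close>

definition move :: "nat \<Rightarrow> int \<Rightarrow> int \<times> int \<Rightarrow> int \<times> int" where
  "move i e p = (if kind i = 0 then (fst p + 4 * e, snd p)
     else if odd (fst p) then (fst p, snd p + 8 * e) else (fst p + 8 * e, snd p))"

definition adj :: "nat \<Rightarrow> nat \<Rightarrow> int \<Rightarrow> word \<Rightarrow> word" where
  "adj m i e w = w[i := (fst (move i e (w ! i)) mod (8 * int (wy m i)),
     snd (move i e (w ! i)) mod (8 * int (wz m i)))]"

definition moved :: "nat \<Rightarrow> nat \<Rightarrow> word \<Rightarrow> int \<Rightarrow> int" where
  "moved m i w e = val m w - h i (fst (w ! i)) (snd (w ! i)) +
     h i (fst (move i e (w ! i))) (snd (move i e (w ! i)))"

definition pivot :: "nat \<Rightarrow> word \<Rightarrow> nat" where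
  "pivot m w = (LEAST i. i < n \<and> r m i = 0 \<and> od i (w ! i))"

definition corr :: "nat \<Rightarrow> word \<Rightarrow> word" where
  "corr m w = (if k - m \<le> 3 then w
     else adj m (pivot m w) (lift (moved m (pivot m w) w) (t div 2 ^ m) (k - m - 3)) w)"

lemma moved_0: "moved m i w 0 = val m w"
  by (simp add: moved_def move_def)

text \<open>The derivative is \<open>2 * al i * y\<close> times 4 for a square, and
  \<open>be i * y\<close> or \<open>be i * z\<close> plus an even number, times 8, for a block of
  size two. Either way it is 8 times an odd number.\<close>

lemma steep_moved:
  assumes m: "m < k" and i: "i < n" "r m i = 0" "od i (w ! i)"
  shows "steep (moved m i w)"
  unfolding steep_def
proof (intro allI)
  fix e e'
  obtain y z where yz: "w ! i = (y, z)" by (cases "w ! i")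
  show "\<exists>u. odd u \<and> moved m i w e - moved m i w e' = 8 * (e - e') * u"
  proof (rule kind_cases[OF i(1)])
    assume 0: "kind i = 0"
    \<comment> \<open>From \<open>r m i = 0\<close> follows \<open>scale i <= m < k\<close>, and an
      odd coefficient is guaranteed only below scale \<open>k\<close>.\<close>
    have "scale i < k" using c_r[of i m] i(2) m by linarith
    then have a: "odd (al i)" "be i = 0" "ga i = 0" using kind0[OF i(1) 0] by auto
    have "odd y" using i(3) 0 yz by (simp add: od_def)
    then have "odd (al i * (y + 2 * (e + e')))" using a by simp
    moreover have "moved m i w e - moved m i w e' = 8 * (e - e') * (al i * (y + 2 * (e + e')))"
      using a 0 by (simp add: moved_def move_def yz h_def power2_eq_square algebra_simps)
    ultimately show ?thesis by blast
  next
    assume 1: "kind i = 1"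
    have b: "odd (be i)" using kind1[OF i(1) 1] by simp
    show ?thesis
    proof (cases "odd y")
      case True
      then have "odd (be i * y + 2 * ga i * (z + 4 * (e + e')))" using b by simp
      moreover have "moved m i w e - moved m i w e' =
          8 * (e - e') * (be i * y + 2 * ga i * (z + 4 * (e + e')))"
        using True 1 by (simp add: moved_def move_def yz h_def power2_eq_square algebra_simps)
      ultimately show ?thesis by blast
    next
      case False
      then have "odd z" using i(3) 1 yz by (simp add: od_def)
      then have "odd (be i * z + 2 * al i * (y + 4 * (e + e')))" using b by simp
      moreover have "moved m i w e - moved m i w e' =
          8 * (e - e') * (be i * z + 2 * al i * (y + 4 * (e + e')))"
        using False 1 by (simp add: moved_def move_def yz h_def power2_eq_square algebra_simps)
      ultimately show ?thesis by blast
    qed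
  next
    assume "kind i = 2"
    then show ?thesis using i(3) by (simp add: od_def)
  qed
qed

lemma w_pos: "0 < wy m i" "0 < wz m i"
  by (auto simp: wy_def wz_def)

lemma val_update:
  assumes "i < n" "length w = n"
  shows "val m (w[i := p]) = val m w - 2 ^ r m i * h i (fst (w ! i)) (snd (w ! i)) +
     2 ^ r m i * h i (fst p) (snd p)"
proof -
  have "val m v = 2 ^ r m i * h i (fst (v ! i)) (snd (v ! i)) +
      (\<Sum>j\<in>{..<n} - {i}. 2 ^ r m j * h j (fst (v ! j)) (snd (v ! j)))" for v
    unfolding val_def using assms(1) by (subst sum.remove[of _ i]) auto
  from this[of w] this[of "w[i := p]"] show ?thesis using assms by simp
qed

text \<open>Reducing the moved pair back into the box is harmless: the ranges of the coordinates are
  multiples of \<open>2 ^ (k - m)\<close> because \<open>c m i <= m\<close>.\<close>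

lemma val_adj:
  assumes m: "m \<le> k" and i: "i < n" "r m i = 0" "kind i \<noteq> 2" and w: "w \<in> box m"
  shows "[val m (adj m i e w) = moved m i w e] (mod 2 ^ (k - m))"
proof -
  have len: "length w = n" using w by (simp add: box_def)
  let ?p = "move i e (w ! i)"
  have W: "(2::int) ^ (k - m) dvd 8 * 2 ^ (k - c m i)"
  proof -
    have "(2::int) ^ (k - m) dvd 2 ^ (k - c m i)"
      using c_le[of m i] by (intro le_imp_power_dvd) simp
    then show ?thesis by (rule dvd_mult)
  qed
  have modW: "[a mod (8 * 2 ^ (k - c m i)) = a] (mod 2 ^ (k - m))" for a :: int
    using W by (simp add: cong_def mod_mod_cancel)
  have "[h i (fst ?p mod (8 * int (wy m i))) (snd ?p mod (8 * int (wz m i))) =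
      h i (fst ?p) (snd ?p)] (mod 2 ^ (k - m))"
  proof (cases "kind i = 0")
    case True
    have "h i y z = h i y 0" for y z using kind0[OF i(1) True] by (simp add: h_def)
    moreover have "[h i (fst ?p mod (8 * int (wy m i))) 0 = h i (fst ?p) 0] (mod 2 ^ (k - m))"
      using True by (intro h_cong) (auto simp: wy_def modW)
    ultimately show ?thesis by metis
  next
    case False
    then have "kind i = 1" using i kind[OF i(1)] by simp
    then show ?thesis by (intro h_cong) (auto simp: wy_def wz_def modW)
  qed
  then show ?thesis
    unfolding adj_def val_update[OF i(1) len] moved_def i(2)
    by (simp add: cong_add cong_refl)
qed

lemma adj_box:
  assumes "w \<in> box m" "i < n"
  shows "adj m i e w \<in> box m"
  using assms w_pos[of m] by (auto simp: box_def adj_def nth_list_update)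

lemma od_adj:
  assumes "i < n" "w \<in> box m"
  shows "od j (adj m i e w ! j) \<longleftrightarrow> od j (w ! j)"
    and "odd (fst (adj m i e w ! j)) \<longleftrightarrow> odd (fst (w ! j))"
proof -
  have len: "length w = n" using assms by (simp add: box_def)
  have "odd (a mod (8 * b)) \<longleftrightarrow> odd a" for a b :: int
    by (simp add: dvd_mod_iff)
  then show "od j (adj m i e w ! j) \<longleftrightarrow> od j (w ! j)"
    and "odd (fst (adj m i e w ! j)) \<longleftrightarrow> odd (fst (w ! j))"
    using assms(1) len by (cases "j = i"; auto simp: od_def adj_def move_def)+
qed

lemma good_adj: "i < n \<Longrightarrow> w \<in> box m \<Longrightarrow> good m' (adj m i e w) \<longleftrightarrow> good m' w"
  and prim_adj: "i < n \<Longrightarrow> w \<in> box m \<Longrightarrow> prim m' (adj m i e w) \<longleftrightarrow> prim m' w"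
  and pivot_adj: "i < n \<Longrightarrow> w \<in> box m \<Longrightarrow> pivot m' (adj m i e w) = pivot m' w"
  by (simp_all add: good_def prim_def pivot_def od_adj)

lemma adj_0:
  assumes "i < n" "w \<in> box m"
  shows "adj m i 0 w = w"
proof -
  have "w ! i \<in> {0..<8 * int (wy m i)} \<times> {0..<8 * int (wz m i)}" "length w = n"
    using assms by (auto simp: box_def)
  then have "(fst (w ! i) mod (8 * int (wy m i)), snd (w ! i) mod (8 * int (wz m i))) = w ! i"
    by (cases "w ! i") auto
  then show ?thesis unfolding adj_def by (simp add: move_def)
qed

text \<open>Moves are an action of the additive group of integers, since the coordinate that
  \<open>move\<close> selects depends on a parity that moves preserve.\<close>

lemma adj_adj:
  assumes "i < n" "w \<in> box m"
  shows "adj m i e (adj m i e' w) = adj m i (e + e') w"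
proof -
  have len: "length w = n" using assms by (simp add: box_def)
  have par: "odd (a mod (8 * b)) \<longleftrightarrow> odd a" for a b :: int
    by (simp add: dvd_mod_iff)
  have "(a mod W + d * e) mod W = (a + d * e) mod W" for a d W :: int
    by (simp add: mod_simps)
  then show ?thesis
    using assms(1) len by (auto simp: adj_def move_def par mod_simps algebra_simps)
qed

lemma pivot:
  assumes "good m w"
  shows "pivot m w < n" "r m (pivot m w) = 0" "od (pivot m w) (w ! pivot m w)"
    "kind (pivot m w) \<noteq> 2"
proof -
  have "\<exists>i. i < n \<and> r m i = 0 \<and> od i (w ! i)" using assms by (simp add: good_def)
  from LeastI_ex[OF this]
  show "pivot m w < n" "r m (pivot m w) = 0" "od (pivot m w) (w ! pivot m w)"
    unfolding pivot_def by blast+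
  then show "kind (pivot m w) \<noteq> 2" by (auto simp: od_def)
qed

lemma dvd_diff_trans: "d dvd a - b \<Longrightarrow> d dvd b - c' \<Longrightarrow> d dvd a - (c' :: int)"
  using dvd_add[of d "a - b" "b - c'"] by simp

text \<open>If \<open>k - m > 3\<close>, the fibre over an exact solution \<open>s\<close> consists
  of the words \<open>adj m i (- e) s\<close> with \<open>0 <= e < 2 ^ (k - m - 3)\<close>. A move
  changes the value by a multiple of 8, so all of them solve the equation modulo 8, and by
  uniqueness of the lift the correction finds \<open>e\<close> again. They are distinct because
  their values differ modulo \<open>2 ^ (k - m)\<close>.\<close>

lemma equifibred_corr:
  assumes m: "m \<le> k"
  shows "equifibred (corr m) (sat m (min 3 (k - m))) (sat m (k - m)) (2 ^ (k - m - 3))"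
proof (cases "k - m \<le> 3")
  case True
  then have "min 3 (k - m) = k - m" "k - m - 3 = 0" by auto
  moreover have "equifibred (corr m) (sat m (k - m)) (sat m (k - m)) 1"
    using True finite_box[of m] by (intro equifibred_bij) (auto simp: bij_betw_def inj_on_def corr_def sat_def)
  ultimately show ?thesis by simp
next
  case False
  define d where "d = k - m - 3"
  define T where "T = t div 2 ^ m"
  have d: "k - m = d + 3" "min 3 (k - m) = 3" and mk: "m < k" using False by (auto simp: d_def)
  let ?A = "sat m 3" and ?B = "sat m (d + 3)"
  have sat: "w \<in> sat m j \<longleftrightarrow> w \<in> box m \<and> 2 ^ m dvd t \<and> good m w \<and> okay (prim m w) \<and>
      2 ^ j dvd val m w - T" for w j
    using mk by (auto simp: sat_def cong_iff_dvd_diff T_def)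
  have corr: "corr m w = adj m (pivot m w) (lift (moved m (pivot m w) w) T d) w" for w
    using False by (simp add: corr_def d_def T_def)
  have dvd_iff: "2 ^ (d + 3) dvd val m (adj m i e w) - T \<longleftrightarrow> 2 ^ (d + 3) dvd moved m i w e - T"
    if "w \<in> box m" "i < n" "r m i = 0" "kind i \<noteq> 2" for w i e
    using val_adj[OF m that(2-4,1), of e] unfolding d(1) cong_iff_dvd_diff[symmetric]
    by (meson cong_sym cong_trans)
  have dvd8: "8 dvd val m (adj m i e w) - val m w"
    if w: "w \<in> box m" "good m w" "i = pivot m w" for w i e
  proof -
    note p = pivot[OF w(2), folded w(3)]
    have "[val m (adj m i e w) = moved m i w e] (mod 8)"
      using val_adj[OF m p(1,2,4) w(1), of e] unfolding d(1)
      by (rule cong_dvd_modulus) (simp add: power_add)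
    moreover have "8 dvd moved m i w e - moved m i w 0"
      using steep_moved[OF mk p(1-3)] unfolding steep_def by (metis dvd_mult_left dvd_triv_left)
    ultimately show ?thesis
      unfolding moved_0 cong_iff_dvd_diff by (rule dvd_diff_trans)
  qed
  have into: "corr m w \<in> ?B" if w: "w \<in> ?A" for w
  proof -
    let ?i = "pivot m w"
    have w': "w \<in> box m" "good m w" "8 dvd val m w - T" using w by (auto simp: sat)
    note p = pivot[OF w'(2)]
    have "2 ^ (d + 3) dvd moved m ?i w (lift (moved m ?i w) T d) - T"
      using w'(3) by (intro lift_solves steep_moved[OF mk p(1-3)]) (simp add: moved_0)
    then show ?thesis
      using w w' p unfolding corr sat by (simp add: adj_box good_adj prim_adj dvd_iff)
  qed
  have "card {w \<in> ?A. corr m w = s} = 2 ^ d" if s: "s \<in> ?B" for s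
  proof -
    define i where "i = pivot m s"
    have s': "s \<in> box m" "good m s" "2 ^ (d + 3) dvd val m s - T" using s by (auto simp: sat)
    note p = pivot[OF s'(2), folded i_def]
    have sub: "w = adj m i (- lift (moved m i w) T d) s" if w: "w \<in> ?A" "corr m w = s" for w
    proof -
      have w': "w \<in> box m" "good m w" using w(1) by (auto simp: sat)
      have i: "pivot m w = i"
        using pivot_adj[OF pivot(1)[OF w'(2)] w'(1)] w(2) unfolding corr i_def by metis
      have s: "s = adj m i (lift (moved m i w) T d) w" using w(2) unfolding corr i by (rule sym)
      show ?thesis unfolding s adj_adj[OF p(1) w'(1)] by (simp add: adj_0[OF p(1) w'(1)])
    qed
    have sup: "adj m i (- e) s \<in> ?A \<and> corr m (adj m i (- e) s) = s" if e: "e \<in> {0..<2 ^ d}" for e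
    proof
      let ?w = "adj m i (- e) s"
      have w: "?w \<in> box m" "good m ?w" "pivot m ?w = i"
        using s'(1,2) p(1) by (simp_all add: adj_box good_adj pivot_adj i_def)
      have undo: "adj m i e ?w = s" using p(1) s'(1) by (simp add: adj_adj adj_0)
      have "8 dvd val m s - T" using s'(3) by (rule dvd_trans[rotated]) (simp add: power_add)
      moreover have "8 dvd val m ?w - val m s" by (rule dvd8[OF s'(1,2) i_def])
      ultimately have 8: "8 dvd val m ?w - T" using dvd_diff_trans by blast
      then show "?w \<in> ?A" using s w unfolding sat by (simp add: prim_adj p(1))
      have od: "od i (?w ! i)" using p(1,3) s'(1) by (simp add: od_adj)
      have "lift (moved m i ?w) T d = e"
      proof (rule lift_unique)
        show "steep (moved m i ?w)" using steep_moved[OF mk p(1,2) od] .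
        show "8 dvd moved m i ?w 0 - T" using 8 by (simp add: moved_0)
        show "2 ^ (d + 3) dvd moved m i ?w e - T"
          using s'(3) dvd_iff[OF w(1) p(1,2,4), of e] undo by simp
      qed (use e in auto)
      then show "corr m ?w = s" unfolding corr w(3) using undo by simp
    qed
    have "{w \<in> ?A. corr m w = s} = (\<lambda>e. adj m i (- e) s) ` {0..<2 ^ d}"
    proof (rule equalityI; rule subsetI)
      fix w assume "w \<in> {w \<in> ?A. corr m w = s}"
      then have "w = adj m i (- lift (moved m i w) T d) s" using sub by blast
      then show "w \<in> (\<lambda>e. adj m i (- e) s) ` {0..<2 ^ d}"
        by (rule image_eqI) (use lift_bounds in auto)
    next
      fix w assume "w \<in> (\<lambda>e. adj m i (- e) s) ` {0..<2 ^ d}"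
      then show "w \<in> {w \<in> ?A. corr m w = s}" using sup by blast
    qed
    moreover have "inj_on (\<lambda>e. adj m i (- e) s) {0..<2 ^ d}"
    proof (rule inj_onI)
      fix e e' :: int assume e: "e \<in> {0..<2 ^ d}" "e' \<in> {0..<2 ^ d}"
        and eq: "adj m i (- e) s = adj m i (- e') s"
      have "[moved m i s (- e) = moved m i s (- e')] (mod 2 ^ (d + 3))"
        using val_adj[OF m p(1,2,4) s'(1), of "- e"] val_adj[OF m p(1,2,4) s'(1), of "- e'"]
        unfolding eq d(1) by (meson cong_sym cong_trans)
      then have "- e = - e'" using e
        by (intro steep_inj[OF steep_moved[OF mk p(1-3)]]) (auto simp: cong_iff_dvd_diff)
      then show "e = e'" by simp
    qed
    ultimately show ?thesis by (simp add: card_image)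
  qed
  moreover have "finite ?A" using finite_box[of m] by (auto simp: sat_def)
  ultimately show ?thesis using into d unfolding equifibred_def by auto
qed

lemma equifibred_out:
  assumes m: "m \<le> k" and t: "0 \<le> t" "t < 2 ^ k"
  shows "equifibred (out m) (sat m (k - m)) {x \<in> solutions. level m x} (64 ^ n)"
proof -
  have *: "w \<in> sat m (k - m) \<longleftrightarrow> w \<in> box m \<and> out m w \<in> {x \<in> solutions. level m x}" for w
    using sat_iff_out[OF m _ t, of w] level_out[OF m, of w] by (auto simp: sat_def)
  have "card {w \<in> sat m (k - m). out m w = x} = 64 ^ n" if x: "x \<in> {x \<in> solutions. level m x}" for x
  proof -
    have "{w \<in> sat m (k - m). out m w = x} = {w \<in> box m. out m w = x}" using * x by auto
    then show ?thesis using card_out_fibre[OF m, of x] x by (simp add: solutions_def level_def)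
  qed
  moreover have "finite (sat m (k - m))" using finite_box[of m] by (auto simp: sat_def)
  ultimately show ?thesis using * unfolding equifibred_def by blast
qed


subsection \<open>The automaton for approximate solutions\<close>

text \<open>A state is the value modulo 8 with two flags, for a good and for a primitive pair seen
  so far: 8 * 2 * 2 = 32 states.\<close>

definition enc :: "nat \<Rightarrow> bool \<Rightarrow> bool \<Rightarrow> nat" where
  "enc v g p = v + 8 * of_bool g + 16 * of_bool p"

definition tr :: "nat \<Rightarrow> nat \<Rightarrow> nat \<Rightarrow> nat \<Rightarrow> nat" where
  "tr m i a st =
     enc (nat ((int (st mod 8) + 2 ^ r m i * h i (int (a mod 8)) (int (a div 8))) mod 8))
       (odd (st div 8) \<or> r m i = 0 \<and> od i (int (a mod 8), int (a div 8)))
       (odd (st div 16) \<or> c m i = 0 \<and> od i (int (a mod 8), int (a div 8)))"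

definition acc :: "nat \<Rightarrow> nat \<Rightarrow> bool" where
  "acc m st \<longleftrightarrow> 2 ^ m dvd t \<and> (m < k \<longrightarrow> odd (st div 8)) \<and> okay (odd (st div 16)) \<and>
     [int (st mod 8) = t div 2 ^ m] (mod 2 ^ min 3 (k - m))"

lemma enc:
  assumes "v < 8"
  shows "enc v g p mod 8 = v" "odd (enc v g p div 8) \<longleftrightarrow> g" "odd (enc v g p div 16) \<longleftrightarrow> p"
    "enc v g p < 32"
  using assms unfolding enc_def by (cases g; cases p; simp; presburger)+

lemma letter_parts:
  "int (letter q mod 8) = fst q mod 8" "int (letter q div 8) = snd q mod 8"
proof -
  have "0 \<le> fst q mod 8" "0 \<le> snd q mod 8" "fst q mod 8 < 8" by simp_all
  then obtain a b where "fst q mod 8 = int a" "snd q mod 8 = int b" "a < 8"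
    using nonneg_int_cases by (metis of_nat_less_iff of_nat_numeral)
  moreover from this have "letter q = a + 8 * b" by (simp add: letter_def nat_int_add)
  ultimately show "int (letter q mod 8) = fst q mod 8" "int (letter q div 8) = snd q mod 8"
    by simp_all
qed

lemma tr_letter:
  assumes "v < 8"
  shows "tr m i (letter q) (enc v g p) =
     enc (nat ((int v + 2 ^ r m i * h i (fst q) (snd q)) mod 8))
       (g \<or> r m i = 0 \<and> od i q) (p \<or> c m i = 0 \<and> od i q)"
proof -
  have "[h i (fst q mod 8) (snd q mod 8) = h i (fst q) (snd q)] (mod 8)"
    by (intro h_cong) (auto simp: cong_def)
  then have "[int v + 2 ^ r m i * h i (fst q mod 8) (snd q mod 8) =
      int v + 2 ^ r m i * h i (fst q) (snd q)] (mod 8)"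
    by (intro cong_add cong_refl cong_mult)
  moreover have "od i (fst q mod 8, snd q mod 8) \<longleftrightarrow> od i q"
    by (simp add: od_def dvd_mod_iff)
  ultimately show ?thesis
    unfolding tr_def letter_parts enc[OF assms] by (simp add: cong_def)
qed

text \<open>Generalised from the start state to every state, because the induction on the word moves
  the state; \<open>v\<close>, \<open>g\<close> and \<open>p\<close> are its accumulators.\<close>

lemma accepted_iff:
  assumes "v < 8"
  shows "w \<in> accepted (acc m) (tr m) (wy m) (wz m) is (enc v g p) \<longleftrightarrow>
     length w = length is \<and>
     (\<forall>(i, q) \<in> set (zip is w). q \<in> {0..<8 * int (wy m i)} \<times> {0..<8 * int (wz m i)}) \<and>
     acc m (enc (nat ((int v + (\<Sum>(i, q)\<leftarrow>zip is w. 2 ^ r m i * h i (fst q) (snd q))) mod 8))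
       (g \<or> (\<exists>(i, q) \<in> set (zip is w). r m i = 0 \<and> od i q))
       (p \<or> (\<exists>(i, q) \<in> set (zip is w). c m i = 0 \<and> od i q)))"
  using assms
proof (induction "is" arbitrary: w v g p)
  case Nil
  then show ?case by auto
next
  case (Cons i "is")
  show ?case
  proof (cases w)
    case (Cons q ws)
    define v' where "v' = nat ((int v + 2 ^ r m i * h i (fst q) (snd q)) mod 8)"
    have v': "int v' = (int v + 2 ^ r m i * h i (fst q) (snd q)) mod 8" "v' < 8"
      by (auto simp: v'_def nat_less_iff)
    have "w \<in> accepted (acc m) (tr m) (wy m) (wz m) (i # is) (enc v g p) \<longleftrightarrow>
        q \<in> {0..<8 * int (wy m i)} \<times> {0..<8 * int (wz m i)} \<and>
        ws \<in> accepted (acc m) (tr m) (wy m) (wz m) is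
          (enc v' (g \<or> r m i = 0 \<and> od i q) (p \<or> c m i = 0 \<and> od i q))"
      using tr_letter[OF Cons.prems] unfolding Cons v'_def by (cases q) auto
    moreover have "nat ((int v' + X) mod 8) =
        nat ((int v + (2 ^ r m i * h i (fst q) (snd q) + X)) mod 8)" for X
      unfolding v'(1) by (simp add: mod_add_left_eq add.assoc)
    ultimately show ?thesis
      unfolding Cons.IH[OF v'(2)] Cons zip_Cons_Cons list.set(2) list.map(2) sum_list.Cons
        ball_simps(7) bex_simps(5) prod.case length_Cons nat.inject disj_assoc
      by (simp only:) (simp only: conj_ac)
  qed simp
qed

lemma accepted_eq: "accepted (acc m) (tr m) (wy m) (wz m) [0..<n] 0 = sat m (min 3 (k - m))"
proof -
  have "w \<in> accepted (acc m) (tr m) (wy m) (wz m) [0..<n] 0 \<longleftrightarrow> w \<in> sat m (min 3 (k - m))" for w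
  proof (cases "length w = n")
    case True
    have "set (zip [0..<n] w) = (\<lambda>i. (i, w ! i)) ` {..<n}"
    proof (rule equalityI; rule subsetI)
      fix x assume "x \<in> set (zip [0..<n] w)"
      then obtain i where "i < n" "x = ([0..<n] ! i, w ! i)" using True by (auto simp: set_zip)
      then show "x \<in> (\<lambda>i. (i, w ! i)) ` {..<n}" by simp
    next
      fix x assume "x \<in> (\<lambda>i. (i, w ! i)) ` {..<n}"
      then obtain i where i: "i < n" "x = (i, w ! i)" by auto
      then show "x \<in> set (zip [0..<n] w)"
        using True unfolding set_zip by (intro CollectI exI[of _ i]) simp
    qed
    then have set: "(\<exists>(i, q) \<in> set (zip [0..<n] w). P i q) \<longleftrightarrow> (\<exists>i<n. P i (w ! i))"
      "(\<forall>(i, q) \<in> set (zip [0..<n] w). P i q) \<longleftrightarrow> (\<forall>i<n. P i (w ! i))" for P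
      by auto
    have sum: "(\<Sum>(i, q)\<leftarrow>zip [0..<n] w. 2 ^ r m i * h i (fst q) (snd q)) = val m w"
      using True by (simp add: val_def sum_list_sum_nth atLeast0LessThan)
    have enc0: "enc 0 False False = 0" by (simp add: enc_def)
    have v: "nat (val m w mod 8) < 8" by (simp add: nat_less_iff)
    have "[val m w mod 8 = T] (mod 2 ^ min 3 j) \<longleftrightarrow> [val m w = T] (mod 2 ^ min 3 j)" for T :: int and j
    proof -
      \<comment> \<open>The approximation is modulo a divisor of 8, hence visible in the value
        modulo 8.\<close>
      have "(2::int) ^ min 3 j dvd 2 ^ 3" by (intro le_imp_power_dvd) simp
      then show ?thesis by (simp add: cong_def mod_mod_cancel)
    qed
    then show ?thesis
      using accepted_iff[of 0 w m "[0..<n]" False False] True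
      unfolding enc0 set sum by (simp add: acc_def enc[OF v] sat_def box_def good_def prim_def)
  next
    case False
    then show ?thesis
      using accepted_iff[of 0 w m "[0..<n]" False False]
      by (auto simp: enc_def sat_def box_def)
  qed
  then show ?thesis by blast
qed


subsection \<open>Decoding a number to a solution\<close>

abbreviation words_from :: "nat \<Rightarrow> nat \<Rightarrow> nat \<Rightarrow> nat" where
  "words_from m i st \<equiv> cnt (acc m) (tr m) [i..<n] st"

text \<open>The extra power equalises the levels: the correction identifies
  \<open>2 ^ (k - m - 3)\<close> words, which is 1 near the top by truncated subtraction, and
  together with \<open>2 ^ min k (m + 3)\<close> this gives \<open>2 ^ k\<close> at every
  level.\<close>

definition refinements :: "nat \<Rightarrow> nat" where
  "refinements m = 2 ^ min k (m + 3) * (\<Prod>i<n. wy m i * wz m i)"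

definition weight :: "nat \<Rightarrow> nat" where
  "weight m = words_from m 0 0 * refinements m"

definition decode_level :: "nat \<Rightarrow> nat \<Rightarrow> int vec" where
  "decode_level m s = out m (corr m (unrank (acc m) (tr m) (wy m) (wz m) [0..<n] 0
     (s mod words_from m 0 0) (s div words_from m 0 0)))"

definition decode :: "nat \<Rightarrow> int vec" where
  "decode s = (let m = pick weight s in decode_level m (s - sum weight {..<m}))"

lemma equifibred_divmod: "equifibred (\<lambda>s. (s mod a, s div a)) {..<a * b :: nat} ({..<a} \<times> {..<b}) 1"
proof (cases "a = 0")
  case True
  then show ?thesis by (simp add: equifibred_def)
next
  case False
  have "bij_betw (\<lambda>s. (s mod a, s div a)) {..<a * b} ({..<a} \<times> {..<b})"
  proof (rule bij_betw_byWitness[where f' = "\<lambda>(x, y). x + a * y"])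
    show "(\<lambda>s. (s mod a, s div a)) ` {..<a * b} \<subseteq> {..<a} \<times> {..<b}"
      using False by (auto simp: less_mult_imp_div_less mult.commute)
    show "(\<lambda>(x, y). x + a * y) ` ({..<a} \<times> {..<b}) \<subseteq> {..<a * b}"
    proof (rule image_subsetI)
      fix p assume "p \<in> {..<a} \<times> {..<b}"
      then obtain x y where p: "p = (x, y)" "x < a" "Suc y \<le> b" by auto
      have "x + a * y < a * Suc y" using p(2) by simp
      also have "\<dots> \<le> a * b" using p(3) by (intro mult_le_mono) auto
      finally show "(case p of (x, y) \<Rightarrow> x + a * y) \<in> {..<a * b}" using p(1) by simp
    qed
  qed auto
  then show ?thesis by (rule equifibred_bij) simp
qed

lemma equifibred_decode_level:
  assumes m: "m \<le> k" and t: "0 \<le> t" "t < 2 ^ k"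
  shows "equifibred (decode_level m) {..<weight m} {x \<in> solutions. level m x} (2 ^ k * 64 ^ n)"
proof -
  let ?N = "words_from m 0 0" and ?J = "2 ^ min k (m + 3) :: nat"
  have "refinements m = ?J * (\<Prod>i\<leftarrow>[0..<n]. wy m i * wz m i)"
    unfolding refinements_def by (simp add: prod.list_conv_set_nth atLeast0LessThan)
  then have 1: "equifibred (\<lambda>(r, u). unrank (acc m) (tr m) (wy m) (wz m) [0..<n] 0 r u)
      ({..<?N} \<times> {..<refinements m}) (sat m (min 3 (k - m))) ?J"
    using equifibred_unrank[of "[0..<n]" "wy m" "wz m" "acc m" "tr m" 0 ?J] w_pos accepted_eq by simp
  have "min k (m + 3) + (k - m - 3) = k" using m by simp
  then have "?J * 2 ^ (k - m - 3) * 64 ^ n = 2 ^ k * 64 ^ n" by (simp add: power_add[symmetric])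
  with equifibred_comp[OF equifibred_comp[OF equifibred_comp[OF equifibred_divmod 1]
      equifibred_corr[OF m]] equifibred_out[OF m t]]
  show ?thesis unfolding weight_def by (simp add: decode_level_def[abs_def])
qed

text \<open>The levels partition the solutions and have fibres of one size, so laying their
  intervals of numbers end to end keeps all fibres equal.\<close>

theorem equifibred_decode:
  assumes t: "0 \<le> t" "t < 2 ^ k"
  shows "equifibred decode {..<sum weight {..k}} solutions (2 ^ k * 64 ^ n)"
proof -
  let ?W = "\<lambda>m. sum weight {..<m}"
  have tot: "sum weight {..k} = ?W (Suc k)" by (simp add: lessThan_Suc_atMost)
  have lev: "equifibred (decode_level m) {..<weight m} {x \<in> solutions. level m x} (2 ^ k * 64 ^ n)"
    if "m \<le> k" for m using that t by (rule equifibred_decode_level)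
  have dec: "decode s = decode_level (pick weight s) (s - ?W (pick weight s))" for s
    by (simp add: decode_def Let_def)
  have pick_s: "pick weight s \<le> k" "?W (pick weight s) \<le> s" "s - ?W (pick weight s) < weight (pick weight s)"
    if "s < ?W (Suc k)" for s
    using pick[OF that] by auto
  have into: "decode s \<in> {x \<in> solutions. level (pick weight s) x}" if "s < ?W (Suc k)" for s
    unfolding dec using lev[OF pick_s(1)[OF that]] pick_s(3)[OF that] unfolding equifibred_def by blast
  have "card {s \<in> {..<?W (Suc k)}. decode s = x} = 2 ^ k * 64 ^ n" if x: "x \<in> solutions" for x
  proof -
    obtain m where m: "level m x" using level_exists by blast
    then have mk: "m \<le> k" by (simp add: level_def)
    have "{s \<in> {..<?W (Suc k)}. decode s = x} =
        (\<lambda>s. ?W m + s) ` {s \<in> {..<weight m}. decode_level m s = x}"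
    proof (rule equalityI; rule subsetI)
      fix s assume "s \<in> {s \<in> {..<?W (Suc k)}. decode s = x}"
      then have s: "s < ?W (Suc k)" "decode s = x" by auto
      have "pick weight s = m" using into[OF s(1)] level_unique[OF _ m] s(2) by blast
      then show "s \<in> (\<lambda>s. ?W m + s) ` {s \<in> {..<weight m}. decode_level m s = x}"
        using pick_s[OF s(1)] s(2) dec[of s] by (intro image_eqI[of _ _ "s - ?W m"]) auto
    next
      fix s assume "s \<in> (\<lambda>s. ?W m + s) ` {s \<in> {..<weight m}. decode_level m s = x}"
      then obtain s' where s': "s = ?W m + s'" "s' < weight m" "decode_level m s' = x" by auto
      have "pick weight s = m" using s' by (intro pick_eq) auto
      moreover have "s < ?W (Suc m)" using s' by simp
      moreover have "?W (Suc m) \<le> ?W (Suc k)" using mk by (intro sum_lessThan_le) simp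
      ultimately show "s \<in> {s \<in> {..<?W (Suc k)}. decode s = x}" using s' dec[of s] by simp
    qed
    then have "card {s \<in> {..<?W (Suc k)}. decode s = x} = card {s \<in> {..<weight m}. decode_level m s = x}"
      by (simp add: card_image)
    also have "\<dots> = 2 ^ k * 64 ^ n" using lev[OF mk] x m unfolding equifibred_def by blast
    finally show ?thesis .
  qed
  then show ?thesis using into unfolding equifibred_def tot by blast
qed

end


section \<open>Symmetric elimination\<close>

definition lin :: "nat \<Rightarrow> (nat \<Rightarrow> nat \<Rightarrow> int) \<Rightarrow> (nat \<Rightarrow> int) \<Rightarrow> nat \<Rightarrow> int" where
  "lin n X y i = (\<Sum>j<n. X i j * y j)"

definition bil :: "nat \<Rightarrow> (nat \<Rightarrow> nat \<Rightarrow> int) \<Rightarrow> (nat \<Rightarrow> int) \<Rightarrow> (nat \<Rightarrow> int) \<Rightarrow> int" where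
  "bil n X u v = (\<Sum>i<n. u i * lin n X v i)"

definition col_op :: "int \<Rightarrow> nat \<Rightarrow> nat \<Rightarrow> int \<Rightarrow> (nat \<Rightarrow> nat \<Rightarrow> int) \<Rightarrow> nat \<Rightarrow> nat \<Rightarrow> int" where
  "col_op q a b c X i j = (if j = a then (X i a + c * X i b) mod q else X i j)"

definition row_op :: "int \<Rightarrow> nat \<Rightarrow> nat \<Rightarrow> int \<Rightarrow> (nat \<Rightarrow> nat \<Rightarrow> int) \<Rightarrow> nat \<Rightarrow> nat \<Rightarrow> int" where
  "row_op q a b c X i j = (if i = a then (X a j + c * X b j) mod q else X i j)"

text \<open>The coordinate change dual to \<open>col_op\<close>: adding \<open>c\<close> times
  column \<open>b\<close> to column \<open>a\<close> amounts to adding \<open>c\<close> times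
  coordinate \<open>a\<close> to coordinate \<open>b\<close>.\<close>

definition shear :: "nat \<Rightarrow> nat \<Rightarrow> int \<Rightarrow> (nat \<Rightarrow> int) \<Rightarrow> nat \<Rightarrow> int" where
  "shear a b c y = y(b := y b + c * y a)"

lemma lin_shear:
  assumes "b < n"
  shows "lin n X (shear a b c y) i = lin n X y i + X i b * (c * y a)"
proof -
  have "lin n X (shear a b c y) i = (\<Sum>j<n. X i j * y j + (if j = b then X i b * (c * y a) else 0))"
    unfolding lin_def shear_def by (intro sum.cong) (auto simp: algebra_simps)
  then show ?thesis using assms by (simp add: sum.distrib lin_def)
qed

lemma lin_col_op:
  assumes "a < n" "b < n"
  shows "[lin n (col_op q a b c X) y i = lin n X (shear a b c y) i] (mod q)"
proof -
  have "[(\<Sum>j<n. col_op q a b c X i j * y j) =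
      (\<Sum>j<n. X i j * y j + (if j = a then X i b * (c * y a) else 0))] (mod q)"
  proof (rule cong_sum)
    fix j assume "j \<in> {..<n}"
    have "[col_op q a b c X i j = X i j + (if j = a then c * X i b else 0)] (mod q)"
      by (simp add: col_op_def cong_def)
    then have "[col_op q a b c X i j * y j = (X i j + (if j = a then c * X i b else 0)) * y j] (mod q)"
      by (rule cong_scalar_right)
    then show "[col_op q a b c X i j * y j = X i j * y j + (if j = a then X i b * (c * y a) else 0)] (mod q)"
      by (cases "j = a") (simp_all add: algebra_simps)
  qed
  then show ?thesis
    unfolding lin_shear[OF assms(2)] using assms(1) by (simp add: sum.distrib lin_def)
qed

lemma lin_cong:
  "(\<And>j. j < n \<Longrightarrow> [y j = y' j] (mod q)) \<Longrightarrow> [lin n X y i = lin n X y' i] (mod q)"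
  unfolding lin_def by (intro cong_sum cong_scalar_left) auto

lemma bil_cong:
  "(\<And>j. j < n \<Longrightarrow> [u j = u' j] (mod q)) \<Longrightarrow> (\<And>j. j < n \<Longrightarrow> [v j = v' j] (mod q)) \<Longrightarrow>
     [bil n X u v = bil n X u' v'] (mod q)"
  unfolding bil_def by (intro cong_sum cong_mult lin_cong) auto

lemma bil_transpose: "bil n X u v = bil n (\<lambda>i j. X j i) v u"
proof -
  have "bil n X u v = (\<Sum>i<n. \<Sum>j<n. u i * (X i j * v j))"
    by (simp add: bil_def lin_def sum_distrib_left)
  also have "\<dots> = (\<Sum>j<n. \<Sum>i<n. u i * (X i j * v j))" by (rule sum.swap)
  finally show ?thesis by (simp add: bil_def lin_def sum_distrib_left mult_ac)
qed

lemma bil_col_op: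
  assumes "a < n" "b < n"
  shows "[bil n (col_op q a b c X) u v = bil n X u (shear a b c v)] (mod q)"
  unfolding bil_def by (intro cong_sum cong_scalar_left lin_col_op assms)

lemma bil_row_op:
  assumes "a < n" "b < n"
  shows "[bil n (row_op q a b c X) u v = bil n X (shear a b c u) v] (mod q)"
proof -
  have "(\<lambda>i j. row_op q a b c X j i) = col_op q a b c (\<lambda>i j. X j i)"
    by (auto simp: row_op_def col_op_def fun_eq_iff)
  then show ?thesis
    using bil_col_op[OF assms, of q c "\<lambda>i j. X j i" v u] by (subst (1 2) bil_transpose) simp
qed

text \<open>
  The form \<open>A\<close> arises from \<open>Q\<close> by a substitution that is invertible modulo \<open>q\<close>, with matrix \<open>U\<close>.
\<close>

definition equivalent ::
  "nat \<Rightarrow> int \<Rightarrow> (nat \<Rightarrow> nat \<Rightarrow> int) \<Rightarrow> (nat \<Rightarrow> nat \<Rightarrow> int) \<Rightarrow> (nat \<Rightarrow> nat \<Rightarrow> int) \<Rightarrow> bool" where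
  "equivalent n q Q A U \<longleftrightarrow>
     (\<forall>y. [bil n A y y = bil n Q (lin n U y) (lin n U y)] (mod q)) \<and>
     (\<forall>y y'. (\<forall>i<n. [lin n U y i = lin n U y' i] (mod q)) \<longrightarrow> (\<forall>i<n. [y i = y' i] (mod q)))"

text \<open>A column operation followed by the same row operation is a congruence transformation.
  The shear is undone by subtracting \<open>c * y a\<close>, as coordinate \<open>a\<close> is
  untouched.\<close>

lemma equivalent_elementary:
  assumes eq: "equivalent n q Q A U" and ab: "a < n" "b < n" "a \<noteq> b"
  shows "equivalent n q Q (row_op q a b c (col_op q a b c A)) (col_op q a b c U)"
  unfolding equivalent_def
proof (intro conjI allI impI)
  fix y
  let ?y = "shear a b c y"
  have "[bil n (row_op q a b c (col_op q a b c A)) y y = bil n A ?y ?y] (mod q)"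
    using bil_row_op[OF ab(1,2)] bil_col_op[OF ab(1,2)] by (rule cong_trans)
  also have "[bil n A ?y ?y = bil n Q (lin n U ?y) (lin n U ?y)] (mod q)"
    using eq by (simp add: equivalent_def)
  also have "[bil n Q (lin n U ?y) (lin n U ?y) =
      bil n Q (lin n (col_op q a b c U) y) (lin n (col_op q a b c U) y)] (mod q)"
    using lin_col_op[OF ab(1,2)] by (intro bil_cong) (auto intro: cong_sym)
  finally show "[bil n (row_op q a b c (col_op q a b c A)) y y =
      bil n Q (lin n (col_op q a b c U) y) (lin n (col_op q a b c U) y)] (mod q)" .
next
  fix y y' i
  assume "\<forall>i<n. [lin n (col_op q a b c U) y i = lin n (col_op q a b c U) y' i] (mod q)" and i: "i < n"
  then have "\<forall>i<n. [lin n U (shear a b c y) i = lin n U (shear a b c y') i] (mod q)"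
    using lin_col_op[OF ab(1,2)] by (meson cong_sym cong_trans)
  then have *: "[shear a b c y i = shear a b c y' i] (mod q)" if "i < n" for i
    using eq that unfolding equivalent_def by blast
  have a: "[y a = y' a] (mod q)" using *[OF ab(1)] ab(3) by (simp add: shear_def)
  show "[y i = y' i] (mod q)"
  proof (cases "i = b")
    case True
    have "[y b + c * y a = y' b + c * y' a] (mod q)" using *[OF ab(2)] by (simp add: shear_def)
    then have "[y b + c * y a - c * y a = y' b + c * y' a - c * y' a] (mod q)"
      by (rule cong_diff) (intro cong_scalar_left a)
    then show ?thesis using True by simp
  next
    case False
    then show ?thesis using *[OF i] by (simp add: shear_def)
  qed
qed

lemma equivalent_cong:
  assumes "equivalent n q Q A U" "\<And>i j. i < n \<Longrightarrow> j < n \<Longrightarrow> A i j = A' i j"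
    "\<And>i j. i < n \<Longrightarrow> j < n \<Longrightarrow> U i j = U' i j"
  shows "equivalent n q Q A' U'"
proof -
  have A: "lin n A y i = lin n A' y i" and U: "lin n U y i = lin n U' y i" if "i < n" for y i
    unfolding lin_def using assms that by (auto intro!: sum.cong)
  have "bil n A u v = bil n A' u v" for u v unfolding bil_def using A by (auto intro!: sum.cong)
  moreover have "bil n Q (lin n U y) (lin n U y) = bil n Q (lin n U' y) (lin n U' y)" for y
    unfolding bil_def using U by (auto intro!: sum.cong simp: lin_def)
  ultimately show ?thesis using assms(1) U unfolding equivalent_def by simp
qed

lemma lin_id: "i < n \<Longrightarrow> lin n (\<lambda>i j. of_bool (i = j)) y i = y i"
  by (simp add: lin_def of_bool_def if_distrib[of "\<lambda>c. c * _"] cong: if_cong)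

lemma equivalent_refl:
  assumes "\<And>i j. i < n \<Longrightarrow> j < n \<Longrightarrow> [A i j = Q i j] (mod q)"
  shows "equivalent n q Q A (\<lambda>i j. of_bool (i = j))"
proof -
  have "[bil n A y y = bil n Q y y] (mod q)" for y
    unfolding bil_def lin_def using assms by (intro cong_sum cong_scalar_left cong_scalar_right) auto
  moreover have "bil n Q (lin n (\<lambda>i j. of_bool (i = j)) y) (lin n (\<lambda>i j. of_bool (i = j)) y) = bil n Q y y" for y
    unfolding bil_def by (auto intro!: sum.cong simp: lin_id) (auto simp: lin_def[of _ Q] lin_id intro!: sum.cong)
  ultimately show ?thesis by (simp add: equivalent_def lin_id)
qed

text \<open>Modulo 2 the off-diagonal terms of a symmetric matrix cancel in pairs.\<close>

lemma equivalent_diagonal: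
  assumes "\<And>i j. i < n \<Longrightarrow> j < n \<Longrightarrow> Q i j = Q j i"
  shows "equivalent n 2 Q (\<lambda>i j. if i = j then Q i i mod 2 else 0) (\<lambda>i j. of_bool (i = j))"
proof -
  let ?D = "\<lambda>i j. if i = j then Q i i mod 2 else 0"
  let ?T = "\<lambda>y i j. y i * (Q i j * y j)"
  have "[bil n ?D y y = bil n Q y y] (mod 2)" for y
  proof -
    have lin: "lin n ?D y i = Q i i mod 2 * y i" if "i < n" for i
      using that by (simp add: lin_def if_distrib[of "\<lambda>c. c * _"] cong: if_cong)
    have "bil n ?D y y = (\<Sum>i<n. y i * (Q i i mod 2 * y i))"
      unfolding bil_def by (intro sum.cong) (auto simp: lin)
    also have "[\<dots> = (\<Sum>i<n. ?T y i i)] (mod 2)"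
      by (intro cong_sum cong_scalar_left cong_scalar_right) (simp add: cong_def)
    also have "[(\<Sum>i<n. ?T y i i) = (\<Sum>i<n. \<Sum>j<n. ?T y i j)] (mod 2)"
      using assms
    proof (induction n)
      case (Suc n)
      have "(\<Sum>i<n. ?T y i n) = (\<Sum>j<n. ?T y n j)"
        using Suc.prems by (intro sum.cong) auto
      then have 1: "(\<Sum>i<Suc n. \<Sum>j<Suc n. ?T y i j) =
          (\<Sum>i<n. \<Sum>j<n. ?T y i j) + ?T y n n + 2 * (\<Sum>j<n. ?T y n j)"
        by (simp add: sum.distrib)
      have "[(\<Sum>i<n. \<Sum>j<n. ?T y i j) + ?T y n n + 2 * (\<Sum>j<n. ?T y n j) =
          (\<Sum>i<n. ?T y i i) + ?T y n n + 0] (mod 2)"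
        using Suc by (intro cong_add cong_refl cong_sym[OF Suc.IH]) (auto simp: cong_def)
      from cong_sym[OF this] show ?case unfolding 1 by simp
    qed simp
    finally show ?thesis by (simp add: bil_def lin_def sum_distrib_left)
  qed
  moreover have "bil n Q (lin n (\<lambda>i j. of_bool (i = j)) y) (lin n (\<lambda>i j. of_bool (i = j)) y) = bil n Q y y" for y
    unfolding bil_def by (auto intro!: sum.cong simp: lin_id) (auto simp: lin_def[of _ Q] lin_id intro!: sum.cong)
  ultimately show ?thesis by (simp add: equivalent_def lin_id)
qed

text \<open>Off-diagonal entries enter the form twice, hence the condition on
  \<open>2 * A i (Suc i)\<close>: a pair whose off-diagonal entry has valuation \<open>v\<close> and
  whose diagonal entries have larger valuation becomes a block of scale \<open>v + 1\<close> with
  odd \<open>be\<close>. A block of size one and scale \<open>k\<close> or more may have any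
  coefficient, in particular 0.\<close>

definition block_matrix ::
  "nat \<Rightarrow> nat \<Rightarrow> (nat \<Rightarrow> nat \<Rightarrow> int) \<Rightarrow> (nat \<Rightarrow> nat) \<Rightarrow> (nat \<Rightarrow> nat) \<Rightarrow>
     (nat \<Rightarrow> int) \<Rightarrow> (nat \<Rightarrow> int) \<Rightarrow> (nat \<Rightarrow> int) \<Rightarrow> nat \<Rightarrow> bool" where
  "block_matrix n k A kind sc al be ga i \<longleftrightarrow>
     (kind i = 0 \<and> A i i = 2 ^ sc i * al i \<and> be i = 0 \<and> ga i = 0 \<and>
        (sc i < k \<longrightarrow> odd (al i)) \<and> (\<forall>j<n. j \<noteq> i \<longrightarrow> A i j = 0)) \<or>
     (kind i = 1 \<and> Suc i < n \<and> kind (Suc i) = 2 \<and> odd (be i) \<and> A (Suc i) i = A i (Suc i) \<and>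
        A i i = 2 ^ sc i * al i \<and> 2 * A i (Suc i) = 2 ^ sc i * be i \<and>
        A (Suc i) (Suc i) = 2 ^ sc i * ga i \<and>
        (\<forall>j<n. j \<noteq> i \<and> j \<noteq> Suc i \<longrightarrow> A i j = 0 \<and> A (Suc i) j = 0)) \<or>
     (kind i = 2 \<and> al i = 0 \<and> be i = 0 \<and> ga i = 0 \<and> 0 < i \<and> kind (i - 1) = 1)"

lemma block_matrix_block_form:
  assumes "1 \<le> k" "\<And>i. i < n \<Longrightarrow> block_matrix n k A kind sc al be ga i"
  shows "block_form n k kind sc al be ga"
proof
  show "1 \<le> k" by fact
  fix i assume "i < n"
  note b = assms(2)[OF this, unfolded block_matrix_def]
  show "kind i \<le> 2" using b by auto
  show "be i = 0 \<and> ga i = 0 \<and> (sc i < k \<longrightarrow> odd (al i))" if "kind i = 0" using b that by auto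
  show "odd (be i) \<and> Suc i < n \<and> kind (Suc i) = 2" if "kind i = 1" using b that by auto
  show "al i = 0 \<and> be i = 0 \<and> ga i = 0 \<and> 0 < i \<and> kind (i - 1) = 1" if "kind i = 2" using b that by auto
qed

text \<open>One side is summed by rows of the matrix, the other by blocks. Partial sums agree except
  when the cut goes through a block of size two, where the row sum still lacks the second
  row.\<close>

lemma bil_block_matrix:
  assumes k: "1 \<le> k" and blocks: "\<And>i. i < n \<Longrightarrow> block_matrix n k A kind sc al be ga i"
  shows "bil n A y y = block_form.form n sc al be ga y"
proof -
  interpret block_form n k kind sc al be ga using assms by (rule block_matrix_block_form)
  define f where "f i = y i * lin n A y i" for i
  define g where "g i = 2 ^ sc i * h i (y i) (y (Suc i))" for i
  have g0: "g i = f i" if i: "i < n" "kind i = 0" for i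
  proof -
    have A: "A i i = 2 ^ sc i * al i" "be i = 0" "ga i = 0" "\<And>j. j < n \<Longrightarrow> j \<noteq> i \<Longrightarrow> A i j = 0"
      using blocks[OF i(1)] i(2) unfolding block_matrix_def by auto
    have "lin n A y i = (\<Sum>j<n. if j = i then A i i * y i else 0)"
      unfolding lin_def using A by (intro sum.cong) auto
    then show ?thesis using i(1) A by (simp add: f_def g_def h_def power2_eq_square)
  qed
  have g1: "g i = f i + f (Suc i)" if i: "i < n" "kind i = 1" for i
  proof -
    have A: "A i i = 2 ^ sc i * al i" "2 * A i (Suc i) = 2 ^ sc i * be i"
      "A (Suc i) (Suc i) = 2 ^ sc i * ga i" "A (Suc i) i = A i (Suc i)" "Suc i < n"
      "\<And>j. j < n \<Longrightarrow> j \<noteq> i \<Longrightarrow> j \<noteq> Suc i \<Longrightarrow> A i j = 0 \<and> A (Suc i) j = 0"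
      using blocks[OF i(1)] i(2) unfolding block_matrix_def by auto
    have "lin n A y l = (\<Sum>j<n. (if j = i then A l i * y i else 0) +
        (if j = Suc i then A l (Suc i) * y (Suc i) else 0))" if "l \<in> {i, Suc i}" for l
      unfolding lin_def using A that by (intro sum.cong) auto
    then have lin: "lin n A y l = A l i * y i + A l (Suc i) * y (Suc i)" if "l \<in> {i, Suc i}" for l
      using that i(1) A(5) by (simp add: sum.distrib)
    have "f i + f (Suc i) = A i i * y i ^ 2 + 2 * A i (Suc i) * y i * y (Suc i) +
        A (Suc i) (Suc i) * y (Suc i) ^ 2"
      unfolding f_def by (simp add: lin A(4) power2_eq_square algebra_simps)
    also have "\<dots> = g i" unfolding A g_def h_def by (simp add: algebra_simps)
    finally show ?thesis by simp
  qed
  have g2: "g i = 0" if "i < n" "kind i = 2" for i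
    using kind2[OF that] by (simp add: g_def h_def)
  have "j \<le> n \<Longrightarrow> sum g {..<j} = sum f {..<j} + (if j > 0 \<and> kind (j - 1) = 1 then f j else 0)" for j
  proof (induction j)
    case (Suc j)
    then have j: "j < n" and IH: "sum g {..<j} = sum f {..<j} + (if j > 0 \<and> kind (j - 1) = 1 then f j else 0)"
      by auto
    have prev: "kind j = 2" if "j > 0" "kind (j - 1) = 1"
      using kind1[of "j - 1"] that j by simp
    show ?case
    proof (rule kind_cases[OF j])
      assume "kind j = 0"
      then show ?thesis using IH prev g0[OF j] by auto
    next
      assume "kind j = 1"
      then show ?thesis using IH prev g1[OF j] by auto
    next
      assume 2: "kind j = 2"
      then show ?thesis using IH g2[OF j] kind2[OF j 2] by auto
    qed
  qed simp
  from this[of n] have "sum g {..<n} = sum f {..<n}"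
    using kind1[of "n - 1"] by (cases "n > 0") auto
  then show ?thesis by (simp add: form_def g_def f_def bil_def)
qed

section \<open>Residue vectors under an invertible substitution\<close>

lemma finite_residue_vecs: "finite (residue_vecs q n)"
proof -
  have "residue_vecs q n \<subseteq> vec n ` (PiE {..<n} (\<lambda>_. {0..<q}))"
  proof
    fix x assume x: "x \<in> residue_vecs q n"
    then have "x = vec n (restrict (($) x) {..<n})" by (auto simp: residue_vecs_def)
    moreover have "restrict (($) x) {..<n} \<in> PiE {..<n} (\<lambda>_. {0..<q})"
      using x by (auto simp: residue_vecs_def)
    ultimately show "x \<in> vec n ` (PiE {..<n} (\<lambda>_. {0..<q}))" by (rule image_eqI)
  qed
  then show ?thesis by (rule finite_subset) (intro finite_imageI finite_PiE; simp)
qed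

definition subst_vec :: "nat \<Rightarrow> int \<Rightarrow> (nat \<Rightarrow> nat \<Rightarrow> int) \<Rightarrow> int vec \<Rightarrow> int vec" where
  "subst_vec n q U x = vec n (\<lambda>i. lin n U (($) x) i mod q)"

text \<open>An injective self-map of the finite set of residue vectors is bijective, so the
  injectivity demanded in \<open>equivalent\<close> is enough.\<close>

lemma bij_betw_subst_vec:
  assumes k: "1 \<le> k"
    and eq: "equivalent n (2 ^ k) Q A U"
    and A: "\<And>y. bil n A y y = F y"
  shows "bij_betw (subst_vec n (2 ^ k) U)
     {x \<in> residue_vecs (2 ^ k) n. [F (($) x) = t] (mod 2 ^ k) \<and> okay (primitive_vec 2 x)}
     {x \<in> residue_vecs (2 ^ k) n. [bil n Q (($) x) (($) x) = t] (mod 2 ^ k) \<and> okay (primitive_vec 2 x)}"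
proof -
  let ?q = "2 ^ k :: int" and ?f = "subst_vec n (2 ^ k) U"
  let ?V = "residue_vecs ?q n"
  have inj_mod: "\<forall>i<n. [y i = y' i] (mod ?q)" if "\<forall>i<n. [lin n U y i = lin n U y' i] (mod ?q)" for y y'
    using eq that unfolding equivalent_def by blast
  have f: "?f x \<in> ?V" and f_cong: "\<And>i. i < n \<Longrightarrow> [?f x $ i = lin n U (($) x) i] (mod ?q)" for x
    by (auto simp: subst_vec_def residue_vecs_def cong_def)
  have inj: "inj_on ?f ?V"
  proof (rule inj_onI)
    fix x y assume xy: "x \<in> ?V" "y \<in> ?V" "?f x = ?f y"
    have "\<forall>i<n. [lin n U (($) x) i = lin n U (($) y) i] (mod ?q)"
      using f_cong[of _ x] f_cong[of _ y] xy(3) by (metis cong_sym cong_trans)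
    from inj_mod[OF this] have "\<forall>i<n. x $ i = y $ i"
      using xy(1,2) by (auto simp: residue_vecs_def cong_def)
    then show "x = y" using xy(1,2) by (auto simp: residue_vecs_def)
  qed
  have surj: "?f ` ?V = ?V" using f inj finite_residue_vecs by (intro endo_inj_surj) auto
  have value_eq: "[F (($) x) = t] (mod ?q) \<longleftrightarrow> [bil n Q (($) (?f x)) (($) (?f x)) = t] (mod ?q)" for x
  proof -
    have "[F (($) x) = bil n Q (lin n U (($) x)) (lin n U (($) x))] (mod ?q)"
      using eq unfolding equivalent_def A by blast
    also have "[bil n Q (lin n U (($) x)) (lin n U (($) x)) = bil n Q (($) (?f x)) (($) (?f x))] (mod ?q)"
      using f_cong[of _ x] by (intro bil_cong) (auto intro: cong_sym)
    finally show ?thesis by (meson cong_sym cong_trans)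
  qed
  have parity: "even (?f x $ i) \<longleftrightarrow> even (lin n U (($) x) i)" if "i < n" for x i
    using that k by (simp add: subst_vec_def dvd_mod_iff)
  have prim: "primitive_vec 2 (?f x) \<longleftrightarrow> primitive_vec 2 x" if x: "x \<in> ?V" for x
  proof -
    have dims: "dim_vec x = n" "dim_vec (?f x) = n" using x by (auto simp: residue_vecs_def subst_vec_def)
    have "(\<forall>i<n. even (?f x $ i)) \<longleftrightarrow> (\<forall>i<n. even (x $ i))"
    proof
      assume "\<forall>i<n. even (x $ i)"
      then show "\<forall>i<n. even (?f x $ i)" using parity by (auto simp: lin_def intro!: dvd_sum)
    next
      assume "\<forall>i<n. even (?f x $ i)"
      then have ev: "\<forall>i<n. even (lin n U (($) x) i)" using parity by blast
      \<comment> \<open>If the image of \<open>x\<close> is even, then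
        \<open>2 ^ (k - 1) * x\<close> is mapped to 0 modulo \<open>2 ^ k\<close>; by injectivity it
        is 0 modulo \<open>2 ^ k\<close>, which means that \<open>x\<close> is even.\<close>
      obtain k' where k': "k = Suc k'" using k by (cases k) auto
      have "lin n U (\<lambda>i. 2 ^ k' * x $ i) i = 2 ^ k' * lin n U (($) x) i" for i
        by (simp add: lin_def sum_distrib_left mult_ac)
      then have "\<forall>i<n. [lin n U (\<lambda>i. 2 ^ k' * x $ i) i = lin n U (\<lambda>i. 0) i] (mod ?q)"
        using ev by (auto simp: cong_0_iff lin_def k' mult.commute[of 2])
      from inj_mod[OF this] show "\<forall>i<n. even (x $ i)" by (auto simp: cong_0_iff k' mult.commute[of 2])
    qed
    then show ?thesis unfolding primitive_vec_def dims coprime_right_2_iff_odd by blast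
  qed
  show ?thesis unfolding bij_betw_def
  proof
    show "inj_on ?f {x \<in> ?V. [F (($) x) = t] (mod ?q) \<and> okay (primitive_vec 2 x)}"
      using inj by (rule inj_on_subset) auto
    show "?f ` {x \<in> ?V. [F (($) x) = t] (mod ?q) \<and> okay (primitive_vec 2 x)} =
        {x \<in> ?V. [bil n Q (($) x) (($) x) = t] (mod ?q) \<and> okay (primitive_vec 2 x)}"
    proof (rule equalityI; rule subsetI)
      fix y assume "y \<in> ?f ` {x \<in> ?V. [F (($) x) = t] (mod ?q) \<and> okay (primitive_vec 2 x)}"
      then show "y \<in> {x \<in> ?V. [bil n Q (($) x) (($) x) = t] (mod ?q) \<and> okay (primitive_vec 2 x)}"
        using f value_eq prim by auto
    next
      fix y assume y: "y \<in> {x \<in> ?V. [bil n Q (($) x) (($) x) = t] (mod ?q) \<and> okay (primitive_vec 2 x)}"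
      then obtain x where "x \<in> ?V" "y = ?f x" using surj by auto
      then show "y \<in> ?f ` {x \<in> ?V. [F (($) x) = t] (mod ?q) \<and> okay (primitive_vec 2 x)}"
        using y value_eq prim by auto
    qed
  qed
qed


section \<open>The elimination program\<close>

text \<open>
  Array 0 holds the input matrix, 3 the current form and 4 the substitution; arrays 5 to 9 hold
  kind, scale and coefficients of the blocks, 10 the powers of 2, 11 the table of the automaton,
  12 the weights of the levels, 14 and 15 the word, and 16 the decoded vector.
\<close>

abbreviation expr_add (infixl "+." 65) where "a +. b \<equiv> Binop Int_Add a b"
abbreviation expr_sub (infixl "-." 65) where "a -. b \<equiv> Binop Int_Sub a b"
abbreviation expr_mul (infixl "*." 70) where "a *. b \<equiv> Binop Int_Mul a b"
abbreviation expr_div (infixl "div." 70) where "a div. b \<equiv> Binop Int_Div a b"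
abbreviation expr_mod (infixl "mod." 70) where "a mod. b \<equiv> Binop Int_Mod a b"
abbreviation expr_less (infix "<." 50) where "a <. b \<equiv> Binop Int_Less a b"
abbreviation expr_eq (infix "=." 50) where "a =. b \<equiv> Binop Int_Eq a b"
abbreviation expr_radd (infixl "+%" 65) where "a +% b \<equiv> Binop Ring_Add a b"
abbreviation expr_rsub (infixl "-%" 65) where "a -% b \<equiv> Binop Ring_Sub a b"
abbreviation expr_rmul (infixl "*%" 70) where "a *% b \<equiv> Binop Ring_Mul a b"

abbreviation (input) cell :: "nat \<Rightarrow> nat \<Rightarrow> nat \<Rightarrow> expr" where
  "cell X r c \<equiv> Cell X (Var r *. Var 0 +. Var c)"

section \<open>Matrix access and elementary operations\<close>

definition entry :: "nat \<Rightarrow> state \<Rightarrow> nat \<Rightarrow> nat \<Rightarrow> int" where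
  "entry X s r c = arr s X (int r * var s 0 + int c)"

lemma entry_set_var [simp]: "x \<noteq> 0 \<Longrightarrow> entry X (set_var x z s) = entry X s"
  by (auto simp: entry_def fun_eq_iff)

lemma entry_set_cell_other [simp]: "a \<noteq> X \<Longrightarrow> entry X (set_cell a j z s) = entry X s"
  by (auto simp: entry_def fun_eq_iff)

lemma row_major_inject:
  assumes "c < n" "c' < n"
  shows "int r * int n + int c = int r' * int n + int c' \<longleftrightarrow> r = r' \<and> c = c'"
proof
  assume "int r * int n + int c = int r' * int n + int c'"
  then have "int (r * n + c) = int (r' * n + c')" by simp
  then have eq: "r * n + c = r' * n + c'" by (simp only: of_nat_eq_iff)
  have "(r * n + c) div n = r" "(r' * n + c') div n = r'" using assms by simp_all
  then have "r = r'" unfolding eq by simp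
  then show "r = r' \<and> c = c'" using eq by simp
qed simp

lemma entry_set_cell:
  assumes "var s 0 = int n" "c < n" "c' < n"
  shows "entry X (set_cell X (int r * int n + int c) z s) r' c' =
    (if r' = r \<and> c' = c then z else entry X s r' c')"
  using row_major_inject[OF assms(3,2), of r' r] assms(1) by (auto simp: entry_def)

definition col_prog :: "nat \<Rightarrow> lprog" where
  "col_prog X = LFor 23 (Var 0)
     (LStore X (Var 23 *. Var 0 +. Var 20) (cell X 23 20 +% Var 22 *% cell X 23 21))"

definition row_prog :: "nat \<Rightarrow> lprog" where
  "row_prog X = LFor 23 (Var 0)
     (LStore X (Var 20 *. Var 0 +. Var 23) (cell X 20 23 +% Var 22 *% cell X 21 23))"

text \<open>Variables 20 and 21 hold target and source, 22 the factor. The form in array 3 is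
  transformed on both sides, while the substitution in array 4 accumulates the column operations
  only.\<close>

definition elem_prog :: lprog where
  "elem_prog = col_prog 3 ;; row_prog 3 ;; col_prog 4"

lemma writes_elem [simp]:
  "wvars (col_prog X) = {23}" "warrs (col_prog X) = {X}"
  "wvars (row_prog X) = {23}" "warrs (row_prog X) = {X}"
  "wvars elem_prog = {23}" "warrs elem_prog = {3, 4}"
  by (auto simp: col_prog_def row_prog_def elem_prog_def)

lemma den_col_prog:
  assumes n: "var s 0 = int n" and ab: "var s 20 = int a" "var s 21 = int b" "a < n" "b < n" "a \<noteq> b"
    and rc: "r < n" "c < n"
  shows "entry X (den q (col_prog X) s) r c = col_op q a b (var s 22) (entry X s) r c"
proof -
  define I where "I i s' \<longleftrightarrow> (\<forall>r<n. \<forall>c<n. entry X s' r c =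
      (if r < i then col_op q a b (var s 22) (entry X s) r c else entry X s r c))" for i s'
  have "I n (den q (col_prog X) s)"
    unfolding col_prog_def
  proof (rule den_For)
    show "I 0 (set_var 23 0 s)" by (simp add: I_def)
    fix i s'
    assume i: "i < n" and I: "I i s'" and i': "var s' 23 = int i"
      and v: "\<And>y. y \<noteq> 23 \<Longrightarrow> y \<notin> wvars (LStore X (Var 23 *. Var 0 +. Var 20)
        (cell X 23 20 +% Var 22 *% cell X 23 21)) \<Longrightarrow> var s' y = var s y"
    have vs: "var s' 0 = int n" "var s' 20 = int a" "var s' 21 = int b" "var s' 22 = var s 22"
      using v n ab by auto
    have ent: "arr s' X (int i * int n + int l) = entry X s i l" if "l < n" for l
      using I i that vs(1) by (simp add: I_def entry_def)
    have "den q (LStore X (Var 23 *. Var 0 +. Var 20) (cell X 23 20 +% Var 22 *% cell X 23 21)) s' =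
        set_cell X (int i * int n + int a) ((entry X s i a + var s 22 * entry X s i b) mod q) s'"
      by (simp add: vs i' ent ab mod_simps)
    then show "I (Suc i) (set_var 23 (int (Suc i)) (den q (LStore X (Var 23 *. Var 0 +. Var 20)
        (cell X 23 20 +% Var 22 *% cell X 23 21)) s'))"
      using I vs(1) ab(3) by (auto simp: I_def entry_set_cell col_op_def less_Suc_eq)
  qed (use n in auto)
  then show ?thesis using rc by (simp add: I_def)
qed

lemma den_row_prog:
  assumes n: "var s 0 = int n" and ab: "var s 20 = int a" "var s 21 = int b" "a < n" "b < n" "a \<noteq> b"
    and rc: "r < n" "c < n"
  shows "entry X (den q (row_prog X) s) r c = row_op q a b (var s 22) (entry X s) r c"
proof -
  define I where "I i s' \<longleftrightarrow> (\<forall>r<n. \<forall>c<n. entry X s' r c =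
      (if c < i then row_op q a b (var s 22) (entry X s) r c else entry X s r c))" for i s'
  have "I n (den q (row_prog X) s)"
    unfolding row_prog_def
  proof (rule den_For)
    show "I 0 (set_var 23 0 s)" by (simp add: I_def)
    fix i s'
    assume i: "i < n" and I: "I i s'" and i': "var s' 23 = int i"
      and v: "\<And>y. y \<noteq> 23 \<Longrightarrow> y \<notin> wvars (LStore X (Var 20 *. Var 0 +. Var 23)
        (cell X 20 23 +% Var 22 *% cell X 21 23)) \<Longrightarrow> var s' y = var s y"
    have vs: "var s' 0 = int n" "var s' 20 = int a" "var s' 21 = int b" "var s' 22 = var s 22"
      using v n ab by auto
    have ent: "arr s' X (int l * int n + int i) = entry X s l i" if "l < n" for l
      using I i that vs(1) by (simp add: I_def entry_def)
    have "den q (LStore X (Var 20 *. Var 0 +. Var 23) (cell X 20 23 +% Var 22 *% cell X 21 23)) s' =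
        set_cell X (int a * int n + int i) ((entry X s a i + var s 22 * entry X s b i) mod q) s'"
      by (simp add: vs i' ent ab mod_simps)
    then show "I (Suc i) (set_var 23 (int (Suc i)) (den q (LStore X (Var 20 *. Var 0 +. Var 23)
        (cell X 20 23 +% Var 22 *% cell X 21 23)) s'))"
      using I vs(1) i by (auto simp: I_def entry_set_cell row_op_def less_Suc_eq)
  qed (use n in auto)
  then show ?thesis using rc by (simp add: I_def)
qed

lemma den_elem_prog:
  assumes n: "var s 0 = int n" and ab: "var s 20 = int a" "var s 21 = int b" "a < n" "b < n" "a \<noteq> b"
    and rc: "r < n" "c < n"
  shows "entry 3 (den q elem_prog s) r c =
      row_op q a b (var s 22) (col_op q a b (var s 22) (entry 3 s)) r c"
    and "entry 4 (den q elem_prog s) r c = col_op q a b (var s 22) (entry 4 s) r c"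
proof -
  let ?s1 = "den q (col_prog 3) s"
  let ?s2 = "den q (row_prog 3) ?s1"
  have v: "var ?s1 y = var s y" "var ?s2 y = var s y" if "y \<noteq> 23" for y
    using that by (simp_all add: den_var)
  have arr: "arr (den q (col_prog 4) ?s2) 3 = arr ?s2 3" "arr ?s2 4 = arr s 4"
    by (simp_all add: den_arr)
  have v0: "var (den q (col_prog 4) ?s2) 0 = var ?s2 0" by (simp add: den_var)
  have "entry 3 (den q elem_prog s) r c = entry 3 ?s2 r c"
    by (simp add: elem_prog_def entry_def arr v0)
  also have "\<dots> = row_op q a b (var s 22) (entry 3 ?s1) r c"
    using den_row_prog[of ?s1 n a b r c 3 q] assms by (simp add: v)
  also have "\<dots> = row_op q a b (var s 22) (col_op q a b (var s 22) (entry 3 s)) r c"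
    unfolding row_op_def using den_col_prog[OF n ab, of _ c 3 q] rc ab by simp
  finally show "entry 3 (den q elem_prog s) r c =
      row_op q a b (var s 22) (col_op q a b (var s 22) (entry 3 s)) r c" .
  have "entry 4 ?s2 = entry 4 s" by (simp add: entry_def arr v fun_eq_iff)
  then show "entry 4 (den q elem_prog s) r c = col_op q a b (var s 22) (entry 4 s) r c"
    using den_col_prog[of ?s2 n a b r c 4 q] assms by (simp add: v elem_prog_def)
qed

text \<open>The remaining submatrix is kept divisible by the current power \<open>d\<close> of 2.
  This makes divisions by \<open>d\<close> exact, although \<open>d\<close> is in general not
  invertible modulo \<open>q\<close>.\<close>

definition eliminated ::
  "nat \<Rightarrow> int \<Rightarrow> (nat \<Rightarrow> nat \<Rightarrow> int) \<Rightarrow> nat \<Rightarrow> int \<Rightarrow> state \<Rightarrow> bool" where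
  "eliminated n q Q i d s \<longleftrightarrow>
     (\<forall>r<n. \<forall>c<n. entry 3 s r c \<in> {0..<q} \<and> entry 3 s r c = entry 3 s c r \<and>
       (r < i \<longrightarrow> i \<le> c \<longrightarrow> entry 3 s r c = 0) \<and> (i \<le> r \<longrightarrow> i \<le> c \<longrightarrow> d dvd entry 3 s r c)) \<and>
     equivalent n q Q (entry 3 s) (entry 4 s)"

lemma eliminatedD:
  assumes "eliminated n q Q i d s" "r < n" "c < n"
  shows "0 \<le> entry 3 s r c" "entry 3 s r c < q" "entry 3 s r c = entry 3 s c r"
    "r < i \<Longrightarrow> i \<le> c \<Longrightarrow> entry 3 s r c = 0" "i \<le> r \<Longrightarrow> i \<le> c \<Longrightarrow> d dvd entry 3 s r c"
  using assms unfolding eliminated_def atLeastLessThan_iff by blast+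

lemma elem_step:
  assumes q: "0 < q" "d dvd q" and s: "eliminated n q Q i d s" and n: "var s 0 = int n"
    and ab: "var s 20 = int a" "var s 21 = int b" "i \<le> a" "a < n" "i \<le> b" "b < n" "a \<noteq> b"
  defines "s' \<equiv> den q elem_prog s" and "A \<equiv> entry 3 s" and "e \<equiv> var s 22"
  shows "eliminated n q Q i d s'"
    and "\<And>r c. r < n \<Longrightarrow> c < n \<Longrightarrow> r \<noteq> a \<Longrightarrow> c \<noteq> a \<Longrightarrow> entry 3 s' r c = A r c"
    and "\<And>c. c < n \<Longrightarrow> c \<noteq> a \<Longrightarrow> entry 3 s' a c = (A a c + e * A b c) mod q"
    and "entry 3 s' a a = (A a a + 2 * e * A a b + e\<^sup>2 * A b b) mod q"
    and "\<And>r c. r < i \<Longrightarrow> c < n \<Longrightarrow> entry 3 s' r c = A r c"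
proof -
  note A = eliminatedD[OF s, folded A_def]
  have s'A: "entry 3 s' r c = row_op q a b e (col_op q a b e A) r c"
    and s'U: "entry 4 s' r c = col_op q a b e (entry 4 s) r c" if "r < n" "c < n" for r c
    using den_elem_prog[OF n ab(1,2,4,6,7) that] unfolding s'_def A_def e_def by auto
  show other: "entry 3 s' r c = A r c" if "r < n" "c < n" "r \<noteq> a" "c \<noteq> a" for r c
    using that by (simp add: s'A row_op_def col_op_def)
  show row: "entry 3 s' a c = (A a c + e * A b c) mod q" if "c < n" "c \<noteq> a" for c
    using that ab by (simp add: s'A row_op_def col_op_def)
  have col: "entry 3 s' c a = (A c a + e * A c b) mod q" if "c < n" "c \<noteq> a" for c
    using that ab by (simp add: s'A row_op_def col_op_def)
  show diag: "entry 3 s' a a = (A a a + 2 * e * A a b + e\<^sup>2 * A b b) mod q"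
  proof -
    have "[(A a a + e * A a b) mod q + e * ((A b a + e * A b b) mod q) =
        (A a a + e * A a b) + e * (A b a + e * A b b)] (mod q)"
      by (intro cong_add cong_scalar_left) (simp_all add: cong_def)
    then show ?thesis
      using ab A(3)[OF ab(6,4)]
      by (simp add: s'A row_op_def col_op_def cong_def power2_eq_square algebra_simps)
  qed
  show old: "entry 3 s' r c = A r c" if "r < i" "c < n" for r c
  proof (cases "c = a")
    case True
    then show ?thesis using that ab col[of r] A(4)[of r a] A(4)[of r b] by simp
  next
    case False
    then show ?thesis using that ab other[of r c] by simp
  qed
  show "eliminated n q Q i d s'"
    unfolding eliminated_def
  proof (intro conjI allI impI)
    show "equivalent n q Q (entry 3 s') (entry 4 s')"
      by (rule equivalent_cong[OF equivalent_elementary[of n q Q A "entry 4 s" a b e]])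
        (use s ab s'A s'U in \<open>auto simp: eliminated_def A_def\<close>)
    fix r c assume rc: "r < n" "c < n"
    show "entry 3 s' r c \<in> {0..<q}"
      using rc q A(1,2)[OF rc] diag row[of c] col[of r] other[OF rc] by (cases "r = a"; cases "c = a") auto
    show "entry 3 s' r c = entry 3 s' c r"
      using rc A(3)[OF rc] A(3)[of b c] A(3)[of b r] ab row[of c] col[of c] row[of r] col[of r] other[OF rc] other[of c r]
        A(3)[of a c] A(3)[of a r]
      by (cases "r = a"; cases "c = a") auto
    show "entry 3 s' r c = 0" if "r < i" "i \<le> c"
      using old[OF that(1) rc(2)] A(4)[OF rc that] by simp
    show "d dvd entry 3 s' r c" if "i \<le> r" "i \<le> c"
      using rc that ab q diag row[of c] col[of r] other[OF rc] A(5)[OF rc that] A(5)[of a b] A(5)[of b b]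
        A(5)[of b c] A(5)[of r b] A(5)[of a a]
      by (cases "r = a"; cases "c = a") (auto simp: dvd_mod_iff)
  qed
qed

text \<open>The lower bounds on \<open>M\<close>, the value of variable 3, make reductions modulo
  \<open>M\<close> invisible: indices and powers of 2 up to \<open>2 ^ (k + 8)\<close> stay below
  it.\<close>

definition constants :: "nat \<Rightarrow> nat \<Rightarrow> int \<Rightarrow> state \<Rightarrow> bool" where
  "constants n k M s \<longleftrightarrow> var s 0 = int n \<and> var s 1 = int k \<and> var s 3 = M \<and> var s 4 = int n + int k \<and>
     var s 5 = 2 ^ k \<and> var s 6 = int k + 1 \<and> 1 \<le> n \<and> 1 \<le> k \<and> int n + int k + 8 < M \<and> 2 ^ (k + 8) < M"

lemma constants_eq: "(\<And>y. y < 10 \<Longrightarrow> var s' y = var s y) \<Longrightarrow> constants n k M s' \<longleftrightarrow> constants n k M s"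
  unfolding constants_def by simp

section \<open>Clearing rows by pivot blocks of size one and two\<close>

definition clear1_prog :: lprog where
  "clear1_prog = LFor 14 (Var 0) (LIf (Var 11 <. Var 14)
     (LAssign 20 (Var 14) ;; LAssign 21 (Var 11) ;;
      LAssign 22 (Lit 0 -% (cell 3 11 14 div. Var 13) *% Var 24) ;; elem_prog) LSkip)"

text \<open>Cramer's rule. After division by \<open>2 ^ v\<close> the pivot block has diagonal
  \<open>a\<close>, \<open>c\<close> and off-diagonal entry \<open>b\<close> (variables 26, 28, 27),
  and \<open>x\<close>, \<open>y\<close> are the entries of its two rows in the column to be
  cleared. The factors \<open>D * (b * y - c * x)\<close> and \<open>D * (b * x - a * y)\<close>
  cancel them, where variable 24 holds the inverse \<open>D\<close> of
  \<open>a * c - b * b\<close>.\<close>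

definition clear2_prog :: lprog where
  "clear2_prog = LFor 14 (Var 0) (LIf (Var 25 <. Var 14)
     (LAssign 29 (cell 3 11 14 div. Var 13) ;; LAssign 30 (cell 3 25 14 div. Var 13) ;;
      LAssign 31 (Var 24 *% (Var 27 *% Var 30 -% Var 28 *% Var 29)) ;;
      LAssign 32 (Var 24 *% (Var 27 *% Var 29 -% Var 26 *% Var 30)) ;;
      LAssign 20 (Var 14) ;; LAssign 21 (Var 11) ;; LAssign 22 (Var 31) ;; elem_prog ;;
      LAssign 21 (Var 25) ;; LAssign 22 (Var 32) ;; elem_prog) LSkip)"

lemma writes_clear [simp]:
  "wvars clear1_prog = {14, 20, 21, 22, 23}" "warrs clear1_prog = {3, 4}"
  "wvars clear2_prog = {14, 20, 21, 22, 23, 29, 30, 31, 32}" "warrs clear2_prog = {3, 4}"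
  by (auto simp: clear1_prog_def clear2_prog_def)

lemma mult_mod_eq_0: "[x = 0] (mod q) \<Longrightarrow> (p * x) mod q = (0 :: int)"
  by (simp add: cong_0_iff dvd_imp_mod_0)

text \<open>The pivot may be a zero divisor; the factor is computed from the quotients by
  \<open>p\<close>, among which the pivot is a unit.\<close>

lemma den_clear1:
  assumes q: "0 < q" "p dvd q" "0 < p" and s: "eliminated n q Q i p s" and n: "var s 0 = int n"
    and i: "i < n" and v: "var s 11 = int i" "var s 13 = p"
    and inv: "[var s 24 * (entry 3 s i i div p) = 1] (mod q)"
  defines "s' \<equiv> den q clear1_prog s"
  shows "eliminated n q Q (Suc i) p s'" "entry 3 s' i i = entry 3 s i i"
    and "\<And>c. c < n \<Longrightarrow> i < c \<Longrightarrow> entry 3 s' i c = 0"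
    and "\<And>r c. r < i \<Longrightarrow> c < n \<Longrightarrow> entry 3 s' r c = entry 3 s r c"
proof -
  define body where "body = LIf (Var 11 <. Var 14)
     (LAssign 20 (Var 14) ;; LAssign 21 (Var 11) ;;
      LAssign 22 (Lit 0 -% (cell 3 11 14 div. Var 13) *% Var 24) ;; elem_prog) LSkip"
  define u where "u = entry 3 s i i div p"
  have u: "entry 3 s i i = p * u" using eliminatedD(5)[OF s i i] by (simp add: u_def)
  define I where "I l s' \<longleftrightarrow> eliminated n q Q i p s' \<and> entry 3 s' i i = entry 3 s i i \<and>
      (\<forall>c<n. i < c \<and> c < l \<longrightarrow> entry 3 s' i c = 0) \<and>
      (\<forall>r<i. \<forall>c<n. entry 3 s' r c = entry 3 s r c)" for l s'
  have "I n s'"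
    unfolding s'_def clear1_prog_def body_def[symmetric]
  proof (rule den_For)
    show "I 0 (set_var 14 0 s)" using s by (simp add: I_def eliminated_def)
    fix l s1
    assume l: "l < n" and I: "I l s1" and l': "var s1 14 = int l"
      and fr: "\<And>y. y \<noteq> 14 \<Longrightarrow> y \<notin> wvars body \<Longrightarrow> var s1 y = var s y"
    have vs: "var s1 0 = int n" "var s1 11 = int i" "var s1 13 = p" "var s1 24 = var s 24"
      using fr n v by (simp_all add: body_def)
    have e1: "eliminated n q Q i p s1" using I by (simp add: I_def)
    show "I (Suc l) (set_var 14 (int (Suc l)) (den q body s1))"
    proof (cases "i < l")
      case False
      then have "den q body s1 = s1" by (simp add: body_def l' vs)
      then show ?thesis using I False by (auto simp: I_def eliminated_def less_Suc_eq)
    next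
      case True
      obtain x where x: "entry 3 s1 i l = p * x" using eliminatedD(5)[OF e1 i l] True by auto
      define e where "e = (0 - (x * var s 24) mod q) mod q"
      define s2 where "s2 = set_var 22 e (set_var 21 (int i) (set_var 20 (int l) s1))"
      have "arr s1 3 (int i * int n + int l) = p * x" using x vs(1) by (simp add: entry_def)
      then have b: "den q body s1 = den q elem_prog s2"
        using True q by (simp add: body_def l' vs s2_def e_def)
      have s2: "eliminated n q Q i p s2" "entry 3 s2 = entry 3 s1" "var s2 22 = e" "var s2 0 = int n"
        "var s2 20 = int l" "var s2 21 = int i"
        using e1 vs by (simp_all add: s2_def eliminated_def)
      have li: "i \<le> l" "i \<le> i" "l \<noteq> i" using True by auto
      note st = elem_step[OF q(1,2) s2(1,4-6) li(1) l li(2) i li(3), unfolded s2(2,3)]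
      have "entry 3 (den q elem_prog s2) l i = (entry 3 s1 l i + e * entry 3 s1 i i) mod q"
        using st(3)[of i] i True by simp
      also have "entry 3 s1 l i + e * entry 3 s1 i i = p * (x + e * u)"
        using x u I eliminatedD(3)[OF e1 l i] by (simp add: I_def algebra_simps)
      also have "(p * (x + e * u)) mod q = 0"
      proof (rule mult_mod_eq_0)
        have "[e = 0 - x * var s 24] (mod q)" by (simp add: e_def cong_def mod_simps)
        then have "[x + e * u = x + (0 - x * var s 24) * u] (mod q)"
          by (intro cong_add cong_refl cong_scalar_right)
        also have "x + (0 - x * var s 24) * u = x - x * (var s 24 * u)" by (simp add: algebra_simps)
        also have "[x - x * (var s 24 * u) = x - x * 1] (mod q)"
          using inv unfolding u_def by (intro cong_diff cong_refl cong_scalar_left)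
        finally show "[x + e * u = 0] (mod q)" by simp
      qed
      finally have "entry 3 (den q elem_prog s2) i l = 0"
        using eliminatedD(3)[OF st(1) i l] by simp
      then show ?thesis
        using I st(1) st(2)[OF i] st(2)[OF i i] st(5) True li(3) unfolding I_def b
        by (auto simp: eliminated_def less_Suc_eq)
    qed
  qed (use n in \<open>auto simp: body_def\<close>)
  then have I: "eliminated n q Q i p s'" "entry 3 s' i i = entry 3 s i i"
      "\<And>c. c < n \<Longrightarrow> i < c \<Longrightarrow> entry 3 s' i c = 0"
      "\<And>r c. r < i \<Longrightarrow> c < n \<Longrightarrow> entry 3 s' r c = entry 3 s r c"
    by (auto simp: I_def)
  show "eliminated n q Q (Suc i) p s'"
    using I(1) I(3) unfolding eliminated_def by (auto simp: less_Suc_eq Suc_le_eq)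
  show "entry 3 s' i i = entry 3 s i i"
    and "\<And>c. c < n \<Longrightarrow> i < c \<Longrightarrow> entry 3 s' i c = 0"
    and "\<And>r c. r < i \<Longrightarrow> c < n \<Longrightarrow> entry 3 s' r c = entry 3 s r c" by fact+
qed

lemma den_clear2:
  assumes q: "0 < q" "p dvd q" "0 < p" and s: "eliminated n q Q i p s" and n: "var s 0 = int n"
    and i: "Suc i < n" and v: "var s 11 = int i" "var s 25 = int (Suc i)" "var s 13 = p"
    and abc: "entry 3 s i i = p * var s 26" "entry 3 s i (Suc i) = p * var s 27"
      "entry 3 s (Suc i) (Suc i) = p * var s 28"
    and inv: "[var s 24 * (var s 26 * var s 28 - var s 27 * var s 27) = 1] (mod q)"
  defines "s' \<equiv> den q clear2_prog s"
  shows "eliminated n q Q (Suc (Suc i)) p s'"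
    and "\<And>r c. r \<in> {i, Suc i} \<Longrightarrow> c \<in> {i, Suc i} \<Longrightarrow> entry 3 s' r c = entry 3 s r c"
    and "\<And>r c. r \<in> {i, Suc i} \<Longrightarrow> c < n \<Longrightarrow> Suc i < c \<Longrightarrow> entry 3 s' r c = 0"
    and "\<And>r c. r < i \<Longrightarrow> c < n \<Longrightarrow> entry 3 s' r c = entry 3 s r c"
proof -
  define body where "body = LIf (Var 25 <. Var 14)
     (LAssign 29 (cell 3 11 14 div. Var 13) ;; LAssign 30 (cell 3 25 14 div. Var 13) ;;
      LAssign 31 (Var 24 *% (Var 27 *% Var 30 -% Var 28 *% Var 29)) ;;
      LAssign 32 (Var 24 *% (Var 27 *% Var 29 -% Var 26 *% Var 30)) ;;
      LAssign 20 (Var 14) ;; LAssign 21 (Var 11) ;; LAssign 22 (Var 31) ;; elem_prog ;;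
      LAssign 21 (Var 25) ;; LAssign 22 (Var 32) ;; elem_prog) LSkip"
  let ?a = "var s 26" and ?b = "var s 27" and ?c = "var s 28" and ?D = "var s 24"
  have i': "i < n" using i by simp
  define I where "I l s' \<longleftrightarrow> eliminated n q Q i p s' \<and>
      (\<forall>r\<in>{i, Suc i}. \<forall>c\<in>{i, Suc i}. entry 3 s' r c = entry 3 s r c) \<and>
      (\<forall>r\<in>{i, Suc i}. \<forall>c<n. Suc i < c \<and> c < l \<longrightarrow> entry 3 s' r c = 0) \<and>
      (\<forall>r<i. \<forall>c<n. entry 3 s' r c = entry 3 s r c)" for l s'
  have "I n s'"
    unfolding s'_def clear2_prog_def body_def[symmetric]
  proof (rule den_For)
    show "I 0 (set_var 14 0 s)" using s by (simp add: I_def eliminated_def)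
    fix l s1
    assume l: "l < n" and I: "I l s1" and l': "var s1 14 = int l"
      and fr: "\<And>y. y \<noteq> 14 \<Longrightarrow> y \<notin> wvars body \<Longrightarrow> var s1 y = var s y"
    have vs: "var s1 0 = int n" "var s1 11 = int i" "var s1 25 = int (Suc i)" "var s1 13 = p" "var s1 24 = ?D"
      "var s1 26 = ?a" "var s1 27 = ?b" "var s1 28 = ?c"
      using fr n v by (simp_all add: body_def)
    have e1: "eliminated n q Q i p s1" using I by (simp add: I_def)
    show "I (Suc l) (set_var 14 (int (Suc l)) (den q body s1))"
    proof (cases "Suc i < l")
      case False
      then have "den q body s1 = s1" by (simp add: body_def l' vs)
      then show ?thesis using I False by (auto simp: I_def eliminated_def less_Suc_eq)
    next
      case True
      obtain x where x: "entry 3 s1 i l = p * x" using eliminatedD(5)[OF e1 i' l] True by auto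
      obtain y where y: "entry 3 s1 (Suc i) l = p * y" using eliminatedD(5)[OF e1 i l] True by auto
      define e where "e = (?D * (((?b * y) mod q - (?c * x) mod q) mod q)) mod q"
      define f where "f = (?D * (((?b * x) mod q - (?a * y) mod q) mod q)) mod q"
      define s2 where "s2 = set_var 22 e (set_var 21 (int i) (set_var 20 (int l)
        (set_var 32 f (set_var 31 e (set_var 30 y (set_var 29 x s1))))))"
      define s3 where "s3 = den q elem_prog s2"
      define s4 where "s4 = set_var 22 f (set_var 21 (int (Suc i)) s3)"
      have xy: "arr s1 3 (int i * int n + int l) = p * x" "arr s1 3 (int (Suc i) * int n + int l) = p * y"
        using x y vs(1) by (simp_all add: entry_def)
      have s3v: "var s3 z = var s2 z" if "z \<noteq> 23" for z using that by (simp add: s3_def den_var)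
      have b: "den q body s1 = den q elem_prog s4"
        using True q xy by (simp add: body_def l' vs s2_def e_def f_def s4_def s3_def den_var)
      have s2: "eliminated n q Q i p s2" "entry 3 s2 = entry 3 s1" "var s2 22 = e" "var s2 0 = int n"
        "var s2 20 = int l" "var s2 21 = int i"
        using e1 vs by (simp_all add: s2_def eliminated_def)
      have li: "i \<le> l" "i \<le> i" "l \<noteq> i" "i \<le> Suc i" "l \<noteq> Suc i" using True by auto
      note st = elem_step[OF q(1,2) s2(1,4-6) li(1) l li(2) i' li(3), unfolded s2(2,3), folded s3_def]
      have s4: "eliminated n q Q i p s4" "entry 3 s4 = entry 3 s3" "var s4 22 = f" "var s4 0 = int n"
        "var s4 20 = int l" "var s4 21 = int (Suc i)"
        using st(1) s2 s3v by (simp_all add: s4_def eliminated_def)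
      note st' = elem_step[OF q(1,2) s4(1,4-6) li(1) l li(4) i li(5), unfolded s4(2,3)]
      let ?s5 = "den q elem_prog s4"
      have ef: "[e = ?D * (?b * y - ?c * x)] (mod q)" "[f = ?D * (?b * x - ?a * y)] (mod q)"
        unfolding e_def f_def by (simp_all add: cong_def mod_simps)
      have dd: "[?D * (?a * ?c - ?b * ?b) * z = z] (mod q)" for z
        using cong_scalar_right[OF inv, of z] by simp
      have blk: "entry 3 s1 i i = p * ?a" "entry 3 s1 i (Suc i) = p * ?b"
        "entry 3 s1 (Suc i) i = p * ?b" "entry 3 s1 (Suc i) (Suc i) = p * ?c"
        using I abc eliminatedD(3)[OF s i' i] by (auto simp: I_def)
      have row: "entry 3 ?s5 l r' = 0"
        if r': "r' \<in> {i, Suc i}" and z: "entry 3 s1 r' l = p * z" "entry 3 s1 i r' = p * a"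
          "entry 3 s1 (Suc i) r' = p * c" and key: "[z + e * a + f * c = 0] (mod q)" for r' z a c
      proof -
        have r'n: "r' < n" "r' \<noteq> l" "Suc i \<noteq> l" using r' i True by auto
        have "entry 3 ?s5 l r' = (entry 3 s3 l r' + f * entry 3 s3 (Suc i) r') mod q"
          using st'(3)[of r'] r'n by simp
        also have "\<dots> = ((p * z + e * (p * a)) mod q + f * (p * c)) mod q"
          using st(3)[of r'] st(2)[OF i r'n(1,3,2)] r'n z eliminatedD(3)[OF e1 l r'n(1)] by simp
        also have "\<dots> = (p * (z + e * a + f * c)) mod q"
          by (simp add: mod_simps algebra_simps)
        also have "\<dots> = 0" using key by (rule mult_mod_eq_0)
        finally show ?thesis .
      qed
      have k1: "[x + e * ?a + f * ?b = 0] (mod q)"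
      proof -
        have "[x + e * ?a + f * ?b = x + ?D * (?b * y - ?c * x) * ?a + ?D * (?b * x - ?a * y) * ?b] (mod q)"
          by (intro cong_add cong_refl cong_scalar_right ef)
        also have "x + ?D * (?b * y - ?c * x) * ?a + ?D * (?b * x - ?a * y) * ?b =
            x - ?D * (?a * ?c - ?b * ?b) * x" by (simp add: algebra_simps)
        also have "[\<dots> = x - x] (mod q)" by (intro cong_diff cong_refl dd)
        finally show ?thesis by simp
      qed
      have k2: "[y + e * ?b + f * ?c = 0] (mod q)"
      proof -
        have "[y + e * ?b + f * ?c = y + ?D * (?b * y - ?c * x) * ?b + ?D * (?b * x - ?a * y) * ?c] (mod q)"
          by (intro cong_add cong_refl cong_scalar_right ef)
        also have "y + ?D * (?b * y - ?c * x) * ?b + ?D * (?b * x - ?a * y) * ?c =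
            y - ?D * (?a * ?c - ?b * ?b) * y" by (simp add: algebra_simps)
        also have "[\<dots> = y - y] (mod q)" by (intro cong_diff cong_refl dd)
        finally show ?thesis by simp
      qed
      have "entry 3 ?s5 l i = 0" using row[OF _ x blk(1,3) k1] by simp
      moreover have "entry 3 ?s5 l (Suc i) = 0" using row[OF _ y blk(2,4) k2] by simp
      ultimately have new: "entry 3 ?s5 r l = 0" if "r \<in> {i, Suc i}" for r
        using that eliminatedD(3)[OF st'(1) i' l] eliminatedD(3)[OF st'(1) i l] by auto
      have same: "entry 3 ?s5 r c = entry 3 s1 r c" if "r < n" "c < n" "r \<noteq> l" "c \<noteq> l" for r c
        using st(2)[OF that] st'(2)[OF that] by simp
      show ?thesis
        unfolding I_def b
      proof (intro conjI ballI allI impI)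
        show "eliminated n q Q i p (set_var 14 (int (Suc l)) ?s5)" using st'(1) by (simp add: eliminated_def)
        fix r assume r: "r \<in> {i, Suc i}"
        then have rn: "r < n" "r \<noteq> l" using i True by auto
        show "entry 3 (set_var 14 (int (Suc l)) ?s5) r c = entry 3 s r c" if "c \<in> {i, Suc i}" for c
        proof -
          have "c < n" "c \<noteq> l" using that i True by auto
          then show ?thesis using same[OF rn(1) _ rn(2), of c] I r that by (auto simp: I_def)
        qed
        show "entry 3 (set_var 14 (int (Suc l)) ?s5) r c = 0" if "c < n" "Suc i < c \<and> c < Suc l" for c
          using new[OF r] same[OF rn(1) that(1) rn(2)] I r that by (cases "c = l") (auto simp: I_def)
      next
        fix r c assume "r < i" "c < n"
        then show "entry 3 (set_var 14 (int (Suc l)) ?s5) r c = entry 3 s r c"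
          using st(5)[of r c] st'(5)[of r c] I by (simp add: I_def)
      qed
    qed
  qed (use n in \<open>auto simp: body_def\<close>)
  then have I: "eliminated n q Q i p s'"
      "\<And>r c. r \<in> {i, Suc i} \<Longrightarrow> c \<in> {i, Suc i} \<Longrightarrow> entry 3 s' r c = entry 3 s r c"
      "\<And>r c. r \<in> {i, Suc i} \<Longrightarrow> c < n \<Longrightarrow> Suc i < c \<Longrightarrow> entry 3 s' r c = 0"
      "\<And>r c. r < i \<Longrightarrow> c < n \<Longrightarrow> entry 3 s' r c = entry 3 s r c"
    by (auto simp: I_def)
  show "eliminated n q Q (Suc (Suc i)) p s'"
    using I(1) I(3) unfolding eliminated_def by (auto simp: less_Suc_eq Suc_le_eq)
  show "\<And>r c. r \<in> {i, Suc i} \<Longrightarrow> c \<in> {i, Suc i} \<Longrightarrow> entry 3 s' r c = entry 3 s r c"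
    and "\<And>r c. r \<in> {i, Suc i} \<Longrightarrow> c < n \<Longrightarrow> Suc i < c \<Longrightarrow> entry 3 s' r c = 0"
    and "\<And>r c. r < i \<Longrightarrow> c < n \<Longrightarrow> entry 3 s' r c = entry 3 s r c" by fact+
qed


text \<open>The loop cannot be left early, so the last hit survives; without a hit the variable
  keeps its initial value, which the scanning programs set to \<open>-1\<close>.\<close>

lemma den_scan:
  assumes n: "var s 0 = int n" and xy: "x \<noteq> y"
    and e: "\<And>l s1. l < n \<Longrightarrow> var s1 x = int l \<Longrightarrow> (\<And>z. z \<noteq> x \<Longrightarrow> z \<noteq> y \<Longrightarrow> var s1 z = var s z) \<Longrightarrow>
        arr s1 = arr s \<Longrightarrow> (eval q e s1 \<noteq> 0 \<longleftrightarrow> P l) \<and> eval q g s1 = f l"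
  defines "s' \<equiv> den q (LFor x (Var 0) (LIf e (LAssign y g) LSkip)) s"
  shows "(\<forall>l<n. \<not> P l) \<and> var s' y = var s y \<or> (\<exists>l<n. P l \<and> var s' y = f l)"
    and "\<And>z. z \<noteq> x \<Longrightarrow> z \<noteq> y \<Longrightarrow> var s' z = var s z" and "arr s' = arr s"
proof -
  let ?body = "LIf e (LAssign y g) LSkip"
  define I where "I i s' \<longleftrightarrow> (\<forall>l<i. \<not> P l) \<and> var s' y = var s y \<or> (\<exists>l<i. P l \<and> var s' y = f l)"
    for i and s' :: state
  have "I n s'"
    unfolding s'_def
  proof (rule den_For)
    show "I 0 (set_var x 0 s)" using xy by (simp add: I_def)
    fix i s1
    assume i: "i < n" and I: "I i s1" and x: "var s1 x = int i"
      and v: "\<And>z. z \<noteq> x \<Longrightarrow> z \<notin> wvars ?body \<Longrightarrow> var s1 z = var s z"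
      and a: "\<And>a. a \<notin> warrs ?body \<Longrightarrow> arr s1 a = arr s a"
    have "(eval q e s1 \<noteq> 0 \<longleftrightarrow> P i) \<and> eval q g s1 = f i"
      using e[OF i x] v a by (simp add: fun_eq_iff)
    then show "I (Suc i) (set_var x (int (Suc i)) (den q ?body s1))"
      using I xy unfolding I_def by (auto simp: less_Suc_eq)
  qed (use n xy in auto)
  then show "(\<forall>l<n. \<not> P l) \<and> var s' y = var s y \<or> (\<exists>l<n. P l \<and> var s' y = f l)"
    by (simp add: I_def)
  show "var s' z = var s z" if "z \<noteq> x" "z \<noteq> y" for z
    unfolding s'_def using that by (intro den_var) auto
  show "arr s' = arr s" unfolding s'_def by (rule ext, intro den_arr) auto
qed

text \<open>Variable 18 holds \<open>2 ^ Suc v\<close>. As all remaining entries are divisible by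
  \<open>2 ^ v\<close>, one with a nonzero remainder has minimal valuation and can serve as
  pivot.\<close>

definition scan_diag_prog :: lprog where
  "scan_diag_prog = LAssign 16 (Lit (- 1)) ;; LFor 14 (Var 0)
     (LIf ((Var 11 <. Var 14 +. Lit 1) *. (Lit 0 <. cell 3 14 14 mod. Var 18)) (LAssign 16 (Var 14)) LSkip)"

definition scan_row_prog :: lprog where
  "scan_row_prog = LAssign 19 (Lit (- 1)) ;; LFor 15 (Var 0)
     (LIf ((Var 11 <. Var 15 +. Lit 1) *. (Lit 0 <. cell 3 11 15 mod. Var 18)) (LAssign 19 (Var 15)) LSkip)"

definition scan_all_prog :: lprog where
  "scan_all_prog = LAssign 16 (Lit (- 1)) ;; LFor 14 (Var 0) (LFor 15 (Var 0)
     (LIf ((Var 11 <. Var 14 +. Lit 1) *. (Var 11 <. Var 15 +. Lit 1) *.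
       (Lit 0 <. cell 3 14 15 mod. Var 18)) (LAssign 16 (Var 14)) LSkip))"

lemma writes_scan [simp]:
  "wvars scan_diag_prog = {14, 16}" "warrs scan_diag_prog = {}"
  "wvars scan_row_prog = {15, 19}" "warrs scan_row_prog = {}"
  "wvars scan_all_prog = {14, 15, 16}" "warrs scan_all_prog = {}"
  by (auto simp: scan_diag_prog_def scan_row_prog_def scan_all_prog_def)

lemma mod_pos_iff: "0 < d \<Longrightarrow> 0 < a mod d \<longleftrightarrow> \<not> d dvd (a :: int)"
  by (metis dvd_eq_mod_eq_0 order_less_le pos_mod_sign)

context
  fixes n i :: nat and d :: int and s :: state and q :: int
  assumes n: "var s 0 = int n" and i: "var s 11 = int i" and d: "var s 18 = d" "0 < d"
begin

lemma den_scan_diag: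
  defines "s' \<equiv> den q scan_diag_prog s"
  shows "(\<forall>r<n. i \<le> r \<longrightarrow> d dvd entry 3 s r r) \<and> var s' 16 = - 1 \<or>
    (\<exists>r<n. i \<le> r \<and> \<not> d dvd entry 3 s r r \<and> var s' 16 = int r)"
proof -
  have "(\<forall>l<n. \<not> (i \<le> l \<and> \<not> d dvd entry 3 s l l)) \<and> var s' 16 = var (set_var 16 (- 1) s) 16 \<or>
    (\<exists>l<n. (i \<le> l \<and> \<not> d dvd entry 3 s l l) \<and> var s' 16 = int l)"
    unfolding s'_def scan_diag_prog_def den.simps(1-5) eval.simps(1)
    by (rule den_scan(1)) (use n i d in \<open>auto simp: mod_pos_iff entry_def\<close>)
  then show ?thesis by auto
qed

lemma den_scan_row:
  defines "s' \<equiv> den q scan_row_prog s"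
  shows "(\<forall>c<n. i \<le> c \<longrightarrow> d dvd entry 3 s i c) \<and> var s' 19 = - 1 \<or>
    (\<exists>c<n. i \<le> c \<and> \<not> d dvd entry 3 s i c \<and> var s' 19 = int c)"
proof -
  have "(\<forall>l<n. \<not> (i \<le> l \<and> \<not> d dvd entry 3 s i l)) \<and> var s' 19 = var (set_var 19 (- 1) s) 19 \<or>
    (\<exists>l<n. (i \<le> l \<and> \<not> d dvd entry 3 s i l) \<and> var s' 19 = int l)"
    unfolding s'_def scan_row_prog_def den.simps(1-5) eval.simps(1)
    by (rule den_scan(1)) (use n i d in \<open>auto simp: mod_pos_iff entry_def\<close>)
  then show ?thesis by auto
qed

lemma den_scan_all:
  defines "s' \<equiv> den q scan_all_prog s"
  shows "(\<forall>r<n. \<forall>c<n. i \<le> r \<longrightarrow> i \<le> c \<longrightarrow> d dvd entry 3 s r c) \<and> var s' 16 = - 1 \<or>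
    (\<exists>r<n. \<exists>c<n. i \<le> r \<and> i \<le> c \<and> \<not> d dvd entry 3 s r c \<and> var s' 16 = int r)"
proof -
  define inner where "inner = LFor 15 (Var 0)
     (LIf ((Var 11 <. Var 14 +. Lit 1) *. (Var 11 <. Var 15 +. Lit 1) *.
       (Lit 0 <. cell 3 14 15 mod. Var 18)) (LAssign 16 (Var 14)) LSkip)"
  define R where "R r \<longleftrightarrow> (\<exists>c<n. i \<le> r \<and> i \<le> c \<and> \<not> d dvd entry 3 s r c)" for r
  define I where "I l s' \<longleftrightarrow> arr s' = arr s \<and>
     ((\<forall>r<l. \<not> R r) \<and> var s' 16 = - 1 \<or> (\<exists>r<l. R r \<and> var s' 16 = int r))" for l and s' :: state
  have "I n s'"
    unfolding s'_def scan_all_prog_def den.simps(4) inner_def[symmetric]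
  proof (rule den_For)
    show "I 0 (set_var 14 0 (den q (LAssign 16 (Lit (- 1))) s))" by (simp add: I_def)
    fix l s1
    assume l: "l < n" and I: "I l s1" and l': "var s1 14 = int l"
      and v: "\<And>y. y \<noteq> 14 \<Longrightarrow> y \<notin> wvars inner \<Longrightarrow> var s1 y = var (den q (LAssign 16 (Lit (- 1))) s) y"
    have vs: "var s1 0 = int n" "var s1 11 = int i" "var s1 18 = d" using v n i d by (auto simp: inner_def)
    have a: "arr s1 = arr s" using I by (simp add: I_def)
    let ?s2 = "den q inner s1"
    have *: "(\<forall>c<n. \<not> (i \<le> l \<and> i \<le> c \<and> \<not> d dvd entry 3 s l c)) \<and> var ?s2 16 = var s1 16 \<or>
        (\<exists>c<n. (i \<le> l \<and> i \<le> c \<and> \<not> d dvd entry 3 s l c) \<and> var ?s2 16 = int l)"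
      unfolding inner_def
      by (rule den_scan(1)) (use vs d l' a n in \<open>auto simp: mod_pos_iff entry_def\<close>)
    have "arr ?s2 = arr s1" by (rule ext, intro den_arr) (simp add: inner_def)
    then show "I (Suc l) (set_var 14 (int (Suc l)) ?s2)"
    proof -
      have "\<not> R l \<and> var ?s2 16 = var s1 16 \<or> R l \<and> var ?s2 16 = int l" using * by (auto simp: R_def)
      then show ?thesis using I \<open>arr ?s2 = arr s1\<close> by (auto simp: I_def less_Suc_eq)
    qed
  qed (use n in \<open>auto simp: inner_def\<close>)
  then show ?thesis by (auto simp: I_def R_def)
qed

end

section \<open>Invariant and single steps of the elimination\<close>

lemma block_matrix_stable:
  assumes "block_matrix n k A kd sc al be ga r" "r < i" "i \<le> n" "kd r = 1 \<Longrightarrow> Suc r < i"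
    and "\<And>r c. r < i \<Longrightarrow> c < n \<Longrightarrow> A' r c = A r c"
    and "\<And>r. r < i \<Longrightarrow> kd' r = kd r \<and> sc' r = sc r \<and> al' r = al r \<and> be' r = be r \<and> ga' r = ga r"
  shows "block_matrix n k A' kd' sc' al' be' ga' r"
proof -
  have eqs: "kd' r = kd r" "sc' r = sc r" "al' r = al r" "be' r = be r" "ga' r = ga r"
    "kd' (r - 1) = kd (r - 1)" "\<And>c. c < n \<Longrightarrow> A' r c = A r c"
    using assms(2,5,6) by auto
  have eqs': "kd' (Suc r) = kd (Suc r)" "\<And>c. c < n \<Longrightarrow> A' (Suc r) c = A (Suc r) c" if "kd r = 1"
    using assms(4-6) that by auto
  have "r < n" "kd r = 1 \<Longrightarrow> Suc r < n" using assms(2-4) by auto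
  then show ?thesis using assms(1) eqs eqs' unfolding block_matrix_def by (elim disjE) simp_all
qed

definition block_at :: "nat \<Rightarrow> nat \<Rightarrow> state \<Rightarrow> nat \<Rightarrow> bool" where
  "block_at n k s = block_matrix n k (entry 3 s) (\<lambda>i. nat (arr s 5 (int i))) (\<lambda>i. nat (arr s 6 (int i)))
     (\<lambda>i. arr s 7 (int i)) (\<lambda>i. arr s 8 (int i)) (\<lambda>i. arr s 9 (int i))"

text \<open>Indices not yet treated are preset as blocks of size one with coefficient 0 and scale
  \<open>k\<close>. If the remaining submatrix turns out to vanish modulo \<open>2 ^ k\<close>, they
  are already described correctly.\<close>

definition progress ::
  "nat \<Rightarrow> nat \<Rightarrow> int \<Rightarrow> (nat \<Rightarrow> nat \<Rightarrow> int) \<Rightarrow> nat \<Rightarrow> nat \<Rightarrow> state \<Rightarrow> bool" where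
  "progress n k M Q i v s \<longleftrightarrow> constants n k M s \<and> i \<le> n \<and> v \<le> k \<and>
     var s 11 = int i \<and> var s 12 = int v \<and> var s 13 = 2 ^ v \<and> eliminated n (2 ^ k) Q i (2 ^ v) s \<and>
     (\<forall>r<i. block_at n k s r \<and> (arr s 5 (int r) = 1 \<longrightarrow> Suc r < i)) \<and>
     (\<forall>r<n. arr s 5 (int r) \<in> {0, 1, 2} \<and> arr s 6 (int r) \<in> {0..int k}) \<and>
     (\<forall>r<n. i \<le> r \<longrightarrow> arr s 5 (int r) = 0 \<and> arr s 6 (int r) = int k \<and> arr s 7 (int r) = 0 \<and>
       arr s 8 (int r) = 0 \<and> arr s 9 (int r) = 0)"

lemma block_at_stable:
  assumes "block_at n k s r" "r < i" "i \<le> n" "arr s 5 (int r) = 1 \<Longrightarrow> Suc r < i"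
    and "\<And>r c. r < i \<Longrightarrow> c < n \<Longrightarrow> entry 3 s' r c = entry 3 s r c"
    and "\<And>r a. r < i \<Longrightarrow> a \<in> {5..9} \<Longrightarrow> arr s' a (int r) = arr s a (int r)"
  shows "block_at n k s' r"
  using assms(1) unfolding block_at_def
  by (rule block_matrix_stable[where i = i]) (use assms(2-6) in auto)

definition add_prog :: "nat \<Rightarrow> nat \<Rightarrow> lprog" where
  "add_prog x y = LAssign 20 (Var x) ;; LAssign 21 (Var y) ;; LAssign 22 (Lit 1) ;; elem_prog"

lemma writes_add [simp]: "wvars (add_prog x y) = {20, 21, 22, 23}" "warrs (add_prog x y) = {3, 4}"
  by (auto simp: add_prog_def)

lemma den_add_prog:
  assumes q: "0 < q" "d dvd q" and s: "eliminated n q Q i d s" and n: "var s 0 = int n"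
    and xy: "y \<noteq> 20" "var s x = int a" "var s y = int b"
    and ab: "i \<le> a" "a < n" "i \<le> b" "b < n" "a \<noteq> b"
  defines "s' \<equiv> den q (add_prog x y) s"
  shows "eliminated n q Q i d s'"
    and "\<And>r c. r < n \<Longrightarrow> c < n \<Longrightarrow> r \<noteq> a \<Longrightarrow> c \<noteq> a \<Longrightarrow> entry 3 s' r c = entry 3 s r c"
    and "\<And>c. c < n \<Longrightarrow> c \<noteq> a \<Longrightarrow> entry 3 s' a c = (entry 3 s a c + entry 3 s b c) mod q"
    and "entry 3 s' a a = (entry 3 s a a + 2 * entry 3 s a b + entry 3 s b b) mod q"
    and "\<And>r c. r < i \<Longrightarrow> c < n \<Longrightarrow> entry 3 s' r c = entry 3 s r c"
proof -
  define s1 where "s1 = set_var 22 1 (set_var 21 (int b) (set_var 20 (int a) s))"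
  have s': "s' = den q elem_prog s1" using xy by (auto simp: s'_def add_prog_def s1_def)
  have s1: "eliminated n q Q i d s1" "entry 3 s1 = entry 3 s" "var s1 22 = 1" "var s1 0 = int n"
    "var s1 20 = int a" "var s1 21 = int b"
    using s n by (simp_all add: s1_def eliminated_def)
  note st = elem_step[OF q s1(1,4-6) ab, folded s', unfolded s1(2,3)]
  show "eliminated n q Q i d s'" by (rule st)
  show "\<And>r c. r < n \<Longrightarrow> c < n \<Longrightarrow> r \<noteq> a \<Longrightarrow> c \<noteq> a \<Longrightarrow> entry 3 s' r c = entry 3 s r c" by (rule st)
  show "\<And>c. c < n \<Longrightarrow> c \<noteq> a \<Longrightarrow> entry 3 s' a c = (entry 3 s a c + entry 3 s b c) mod q"
    using st(3) by simp
  show "entry 3 s' a a = (entry 3 s a a + 2 * entry 3 s a b + entry 3 s b b) mod q"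
    using st(4) by simp
  show "\<And>r c. r < i \<Longrightarrow> c < n \<Longrightarrow> entry 3 s' r c = entry 3 s r c" by (rule st)
qed

text \<open>Instead of swapping, row \<open>r\<close> is added if index \<open>i\<close> is not
  itself a pivot. The new diagonal entry \<open>A i i + 2 * A i r + A r r\<close> has valuation
  \<open>v\<close>, since only its last term is not divisible by \<open>2 ^ (v + 1)\<close>.\<close>

definition diag_prog :: lprog where
  "diag_prog = LIf (cell 3 11 11 mod. Var 18 =. Lit 0) (add_prog 11 16) LSkip ;;
     LAssign 24 (Ring_Inv (cell 3 11 11 div. Var 13)) ;; clear1_prog ;;
     LStore 6 (Var 11) (Var 12) ;; LStore 7 (Var 11) (cell 3 11 11 div. Var 13) ;;
     LAssign 11 ((Var 11 +. Lit 1) mod. Var 3)"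

lemma writes_diag [simp]:
  "wvars diag_prog = {11, 14, 20, 21, 22, 23, 24}" "warrs diag_prog = {3, 4, 6, 7}"
  by (auto simp: diag_prog_def)

lemma den_diag:
  assumes s: "progress n k M Q i v s" and iv: "i < n" "v < k" and v18: "var s 18 = 2 ^ Suc v"
    and r: "var s 16 = int r" "i \<le> r" "r < n" "\<not> 2 ^ Suc v dvd entry 3 s r r"
  shows "progress n k M Q (Suc i) v (den (2 ^ k) diag_prog s)"
proof -
  let ?q = "2 ^ k :: int" and ?p = "2 ^ v :: int" and ?i = "int i * int n + int i"
  define s1 where "s1 = den ?q (LIf (cell 3 11 11 mod. Var 18 =. Lit 0) (add_prog 11 16) LSkip) s"
  define s2 where "s2 = set_var 24 (modular_inverse ?q (entry 3 s1 i i div ?p)) s1"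
  define s3 where "s3 = den ?q clear1_prog s2"
  define s4 where "s4 = set_cell 7 (int i) (entry 3 s3 i i div ?p) (set_cell 6 (int i) (int v) s3)"
  have c: "constants n k M s" "var s 11 = int i" "var s 12 = int v" "var s 13 = ?p"
    and el: "eliminated n ?q Q i ?p s"
    using s by (auto simp: progress_def)
  have n: "var s 0 = int n" using c by (simp add: constants_def)
  have dvds: "?p dvd ?q" "2 ^ Suc v dvd ?q" using iv by (auto intro!: le_imp_power_dvd simp del: power_Suc)
  have ent: "arr s 3 ?i = entry 3 s i i" using n by (simp add: entry_def)
  have s1: "eliminated n ?q Q i ?p s1" "\<not> 2 ^ Suc v dvd entry 3 s1 i i"
    "\<And>r c. r < i \<Longrightarrow> c < n \<Longrightarrow> entry 3 s1 r c = entry 3 s r c"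
  proof -
    have "eliminated n ?q Q i ?p s1 \<and> \<not> 2 ^ Suc v dvd entry 3 s1 i i \<and>
        (\<forall>r<i. \<forall>c<n. entry 3 s1 r c = entry 3 s r c)"
    proof (cases "2 ^ Suc v dvd entry 3 s i i")
      case False
      then have "s1 = s" using c n v18 ent by (simp add: s1_def dvd_eq_mod_eq_0)
      then show ?thesis using el False by simp
    next
      case True
      then have s1: "s1 = den ?q (add_prog 11 16) s" using c n v18 ent by (simp add: s1_def dvd_eq_mod_eq_0)
      have "i \<noteq> r" using True r by auto
      note st = den_add_prog[of ?q ?p n Q i s 16 11 i r, OF _ dvds(1) el n _ c(2) r(1) _ iv(1) r(2,3) this,
          simplified, folded s1]
      have "2 ^ Suc v dvd 2 * entry 3 s i r" using eliminatedD(5)[OF el iv(1) r(3)] r(2) by simp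
      then have "2 ^ Suc v dvd (entry 3 s i i + 2 * entry 3 s i r + entry 3 s r r) mod ?q \<longleftrightarrow> 2 ^ Suc v dvd entry 3 s r r"
        using True dvds by (simp add: dvd_mod_iff dvd_add_right_iff del: power_Suc)
      then show ?thesis using st r(4) by simp
    qed
    then show "eliminated n ?q Q i ?p s1" "\<not> 2 ^ Suc v dvd entry 3 s1 i i"
      "\<And>r c. r < i \<Longrightarrow> c < n \<Longrightarrow> entry 3 s1 r c = entry 3 s r c" by auto
  qed
  have v1: "var s1 y = var s y" if "y \<notin> {20, 21, 22, 23}" for y
    unfolding s1_def by (rule den_var) (use that in auto)
  have a1: "arr s1 a = arr s a" if "a \<notin> {3, 4}" for a
    unfolding s1_def by (rule den_arr) (use that in auto)
  obtain u where u: "entry 3 s1 i i = ?p * u" using eliminatedD(5)[OF s1(1) iv(1) iv(1)] by auto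
  have odd: "odd u" using s1(2) u by (auto simp: mult.commute)
  have "[modular_inverse ?q u * u = 1] (mod ?q)" using odd by (intro cong_modular_inverse2) simp
  then have inv: "[var s2 24 * (entry 3 s2 i i div ?p) = 1] (mod ?q)" by (simp add: s2_def u)
  have s2: "eliminated n ?q Q i ?p s2" "var s2 0 = int n" "var s2 11 = int i" "var s2 13 = ?p"
    using s1(1) v1 c n by (simp_all add: s2_def eliminated_def)
  note cl = den_clear1[OF _ dvds(1) _ s2(1,2) iv(1) s2(3,4) inv, folded s3_def, simplified]
  have s3v: "var s3 y = var s y" if "y \<notin> {14, 20, 21, 22, 23, 24}" for y
    using that v1 by (simp add: s3_def den_var s2_def)
  have s3a: "arr s3 a = arr s a" if "a \<notin> {3, 4}" for a
    using that a1 by (simp add: s3_def den_arr s2_def)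
  have "arr s1 3 ?i = entry 3 s1 i i" "arr s3 3 ?i = entry 3 s3 i i"
    using v1 s3v n by (simp_all add: entry_def)
  moreover have "int i + 1 < M" using c iv by (simp add: constants_def)
  ultimately have fin: "den ?q diag_prog s = set_var 11 (int (Suc i)) s4"
    using c n v1 s3v unfolding diag_prog_def den.simps(4) s1_def[symmetric]
    by (simp add: s2_def[symmetric] s3_def[symmetric] s4_def constants_def add.commute)
  have e34: "entry 3 (set_var 11 z s4) = entry 3 s3" "entry 4 (set_var 11 z s4) = entry 4 s3" for z
    by (simp_all add: s4_def)
  have s3u: "entry 3 s3 i i = ?p * u" using cl(2) u by (simp add: s2_def)
  show ?thesis
    unfolding fin progress_def
  proof (intro conjI allI impI)
    show "constants n k M (set_var 11 (int (Suc i)) s4)"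
      using c(1) by (subst constants_eq[of _ s]) (auto simp: s4_def s3v)
    show "eliminated n ?q Q (Suc i) ?p (set_var 11 (int (Suc i)) s4)"
      using cl(1) unfolding eliminated_def e34 .
    show "var (set_var 11 (int (Suc i)) s4) 12 = int v" "var (set_var 11 (int (Suc i)) s4) 13 = 2 ^ v"
      using c by (simp_all add: s4_def s3v)
    fix r assume r: "r < Suc i"
    have kind_i: "arr s 5 (int i) = 0" "arr s 8 (int i) = 0" "arr s 9 (int i) = 0"
      using s iv by (auto simp: progress_def)
    show "block_at n k (set_var 11 (int (Suc i)) s4) r"
    proof (cases "r = i")
      case True
      have zero: "entry 3 s3 i j = 0" if j: "j < n" "j \<noteq> i" for j
      proof (cases "i < j")
        case False
        then have "j < i" using j by simp
        have "entry 3 s3 i j = entry 3 s3 j i" using eliminatedD(3)[OF cl(1) iv(1) j(1)] .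
        also have "\<dots> = entry 3 s2 j i" using cl(4)[OF \<open>j < i\<close> iv(1)] .
        also have "\<dots> = 0" using eliminatedD(4)[OF s2(1) j(1) iv(1) \<open>j < i\<close>] by simp
        finally show ?thesis .
      qed (use cl(3) j in auto)
      have "block_matrix n k (entry 3 s3) (\<lambda>i. nat (arr s4 5 (int i))) (\<lambda>i. nat (arr s4 6 (int i)))
         (\<lambda>i. arr s4 7 (int i)) (\<lambda>i. arr s4 8 (int i)) (\<lambda>i. arr s4 9 (int i)) i"
        unfolding block_matrix_def using zero kind_i s3u odd by (simp add: s4_def s3a)
      then show ?thesis unfolding block_at_def e34 True by simp
    next
      case False
      then have r: "r < i" using r by simp
      have "block_at n k s r" "arr s 5 (int r) = 1 \<Longrightarrow> Suc r < i" using s r by (auto simp: progress_def)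
      then show ?thesis
      proof (rule block_at_stable[OF _ r less_imp_le[OF iv(1)]])
        fix r c assume "r < i" "c < n"
        then show "entry 3 (set_var 11 (int (Suc i)) s4) r c = entry 3 s r c"
          unfolding e34 using cl(4)[of r c] s1(3)[of r c] by (simp add: s2_def)
      next
        fix r a assume "r < i" "a \<in> {5..9::nat}"
        then show "arr (set_var 11 (int (Suc i)) s4) a (int r) = arr s a (int r)"
          by (simp add: s4_def s3a)
      qed
    qed
    show "Suc r < Suc i" if "arr (set_var 11 (int (Suc i)) s4) 5 (int r) = 1"
    proof (cases "r = i")
      case True
      then show ?thesis using that kind_i by (simp add: s4_def s3a)
    next
      case False
      then have "r < i" "arr s 5 (int r) = 1" using r that by (simp_all add: s4_def s3a)
      then have "Suc r < i" using s unfolding progress_def by blast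
      then show ?thesis by simp
    qed
  next
    fix r assume r: "r < n"
    have "arr s 5 (int r) \<in> {0, 1, 2}" "arr s 6 (int r) \<in> {0..int k}" using s r unfolding progress_def by blast+
    then show "arr (set_var 11 (int (Suc i)) s4) 5 (int r) \<in> {0, 1, 2}"
      "arr (set_var 11 (int (Suc i)) s4) 6 (int r) \<in> {0..int k}"
      using iv(2) by (simp_all add: s4_def s3a)
    assume ir: "Suc i \<le> r"
    then have "arr s 5 (int r) = 0 \<and> arr s 6 (int r) = int k \<and> arr s 7 (int r) = 0 \<and>
        arr s 8 (int r) = 0 \<and> arr s 9 (int r) = 0" using s r Suc_leD[OF ir] unfolding progress_def by blast
    then show "arr (set_var 11 (int (Suc i)) s4) 5 (int r) = 0" "arr (set_var 11 (int (Suc i)) s4) 6 (int r) = int k"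
      "arr (set_var 11 (int (Suc i)) s4) 7 (int r) = 0" "arr (set_var 11 (int (Suc i)) s4) 8 (int r) = 0"
      "arr (set_var 11 (int (Suc i)) s4) 9 (int r) = 0"
      using ir by (simp_all add: s4_def s3a)
  qed (use iv in simp_all)
qed


text \<open>For the case that all remaining diagonal entries are divisible by
  \<open>2 ^ (v + 1)\<close> but some entry is not. Adding row \<open>r\<close> to row
  \<open>i\<close>, and then a row to row \<open>i + 1\<close>, each only if required, brings
  valuation \<open>v\<close> to position \<open>(i, i + 1)\<close>. The determinant of the block
  divided by \<open>2 ^ v\<close> is even minus odd, hence a unit; halving the diagonal coefficients
  accounts for the scale \<open>v + 1\<close>.\<close>

definition pair_prog :: lprog where
  "pair_prog = scan_row_prog ;;
     LIf (Var 19 <. Lit 0) (add_prog 11 16 ;; scan_row_prog) LSkip ;;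
     LAssign 25 ((Var 11 +. Lit 1) mod. Var 3) ;;
     LIf (cell 3 11 25 mod. Var 18 =. Lit 0) (add_prog 25 19) LSkip ;;
     LAssign 26 (cell 3 11 11 div. Var 13) ;; LAssign 27 (cell 3 11 25 div. Var 13) ;;
     LAssign 28 (cell 3 25 25 div. Var 13) ;;
     LAssign 24 (Ring_Inv (Var 26 *% Var 28 -% Var 27 *% Var 27)) ;; clear2_prog ;;
     LStore 5 (Var 11) (Lit 1) ;; LStore 5 (Var 25) (Lit 2) ;;
     LStore 6 (Var 11) ((Var 12 +. Lit 1) mod. Var 3) ;;
     LStore 7 (Var 11) (Var 26 div. Lit 2) ;; LStore 8 (Var 11) (Var 27) ;;
     LStore 9 (Var 11) (Var 28 div. Lit 2) ;;
     LAssign 11 ((Var 25 +. Lit 1) mod. Var 3)"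

lemma writes_pair [simp]:
  "wvars pair_prog = {11, 14, 15, 19, 20, 21, 22, 23, 24, 25, 26, 27, 28, 29, 30, 31, 32}"
  "warrs pair_prog = {3, 4, 5, 6, 7, 8, 9}"
  by (auto simp: pair_prog_def)

definition even_diagonal :: "nat \<Rightarrow> nat \<Rightarrow> int \<Rightarrow> state \<Rightarrow> bool" where
  "even_diagonal n i d s \<longleftrightarrow> (\<forall>r<n. i \<le> r \<longrightarrow> d dvd entry 3 s r r)"

text \<open>The cross term \<open>2 * A a b\<close> supplies the missing factor 2, so adding rows
  keeps the diagonal divisible by \<open>2 * p\<close>.\<close>

lemma add_even_diagonal:
  assumes q: "0 < q" "p dvd q" "2 * p dvd q" and s: "eliminated n q Q i p s" and n: "var s 0 = int n"
    and xy: "y \<noteq> 20" "var s x = int a" "var s y = int b"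
    and ab: "i \<le> a" "a < n" "i \<le> b" "b < n" "a \<noteq> b"
    and ev: "even_diagonal n i (2 * p) s"
  shows "even_diagonal n i (2 * p) (den q (add_prog x y) s)"
  unfolding even_diagonal_def
proof (intro allI impI)
  fix r assume r: "r < n" "i \<le> r"
  note st = den_add_prog[OF q(1,2) s n xy ab]
  show "2 * p dvd entry 3 (den q (add_prog x y) s) r r"
  proof (cases "r = a")
    case True
    have "2 * p dvd entry 3 s a a + 2 * entry 3 s a b + entry 3 s b b"
      using ev ab eliminatedD(5)[OF s ab(2,4,1,3)] unfolding even_diagonal_def
      by (intro dvd_add mult_dvd_mono) auto
    then show ?thesis unfolding True st(4) using q(3) by (simp only: dvd_mod_iff)
  next
    case False
    then show ?thesis using st(2)[OF r(1) r(1)] ev r unfolding even_diagonal_def by simp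
  qed
qed

lemma den_pair:
  assumes s: "progress n k M Q i v s" and iv: "i < n" "v < k" and v18: "var s 18 = 2 ^ Suc v"
    and ev: "even_diagonal n i (2 ^ Suc v) s"
    and r: "var s 16 = int r" "i \<le> r" "r < n" "i \<le> c0" "c0 < n" "\<not> 2 ^ Suc v dvd entry 3 s r c0"
  shows "progress n k M Q (Suc (Suc i)) v (den (2 ^ k) pair_prog s)"
proof -
  let ?q = "2 ^ k :: int" and ?p = "2 ^ v :: int" and ?d = "2 ^ Suc v :: int"
  have c: "constants n k M s" "var s 11 = int i" "var s 12 = int v" "var s 13 = ?p"
    and el: "eliminated n ?q Q i ?p s"
    using s by (auto simp: progress_def)
  have n: "var s 0 = int n" "var s 3 = M" using c by (simp_all add: constants_def)
  have dvds: "?p dvd ?q" "?d dvd ?q" using iv by (auto intro!: le_imp_power_dvd simp del: power_Suc)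
  have d2: "2 * ?p = ?d" by simp
  have arr_entry: "arr t 3 (int x * int n + int y) = entry 3 t x y" if "var t 0 = int n" for t x y
    using that by (simp add: entry_def)

  define s1 where "s1 = den ?q scan_row_prog s"
  define s2 where "s2 = den ?q (LIf (Var 19 <. Lit 0) (add_prog 11 16 ;; scan_row_prog) LSkip) s1"
  have v1: "var s1 y = var s y" if "y \<notin> {15, 19}" for y
    unfolding s1_def by (rule den_var) (use that in simp)
  have a1: "arr s1 = arr s" unfolding s1_def by (rule ext, rule den_arr) simp
  have e1: "entry X s1 = entry X s" for X using v1[of 0] a1 by (auto simp: entry_def fun_eq_iff)
  have row_i: "(\<forall>c<n. i \<le> c \<longrightarrow> ?d dvd entry 3 t i c) \<and> var (den ?q scan_row_prog t) 19 = - 1 \<or>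
      (\<exists>c<n. i \<le> c \<and> \<not> ?d dvd entry 3 t i c \<and> var (den ?q scan_row_prog t) 19 = int c)"
    if "var t 0 = int n" "var t 11 = int i" "var t 18 = ?d" for t
    using den_scan_row[OF that] by simp
  have v2: "var s2 y = var s y" if "y \<notin> {15, 19, 20, 21, 22, 23}" for y
    using that den_var[of y "LIf (Var 19 <. Lit 0) (add_prog 11 16 ;; scan_row_prog) LSkip" ?q s1] v1[of y]
    by (auto simp: s2_def)
  have a2: "arr s2 a = arr s a" if "a \<notin> {3, 4}" for a
    using that den_arr[of a "LIf (Var 19 <. Lit 0) (add_prog 11 16 ;; scan_row_prog) LSkip" ?q s1] a1
    by (simp add: s2_def)
  have "eliminated n ?q Q i ?p s2 \<and> even_diagonal n i ?d s2 \<and>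
      (\<forall>r<i. \<forall>c<n. entry 3 s2 r c = entry 3 s r c) \<and>
      (\<exists>c<n. i \<le> c \<and> \<not> ?d dvd entry 3 s2 i c \<and> var s2 19 = int c)"
  proof (cases "\<forall>c<n. i \<le> c \<longrightarrow> ?d dvd entry 3 s i c")
    case False
    then obtain c where c': "c < n" "i \<le> c" "\<not> ?d dvd entry 3 s i c" "var s1 19 = int c"
      using row_i[OF n(1) c(2) v18] unfolding s1_def by blast
    then have "s2 = s1" by (simp add: s2_def)
    then show ?thesis using c' el ev e1 by (auto simp: eliminated_def even_diagonal_def)
  next
    case True
    then have neg: "var s1 19 = - 1" using row_i[OF n(1) c(2) v18] unfolding s1_def by blast
    have ri: "i \<noteq> r" using True r by auto
    define t where "t = den ?q (add_prog 11 16) s1"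
    have s2: "s2 = den ?q scan_row_prog t" using neg by (simp add: s2_def t_def)
    have el1: "eliminated n ?q Q i ?p s1" "even_diagonal n i (2 * ?p) s1"
      using el ev by (simp_all add: eliminated_def even_diagonal_def e1)
    have vs: "var s1 0 = int n" "var s1 11 = int i" "var s1 16 = int r" using v1 n c r by auto
    have st: "eliminated n ?q Q i ?p t"
      "\<And>c. c < n \<Longrightarrow> c \<noteq> i \<Longrightarrow> entry 3 t i c = (entry 3 s i c + entry 3 s r c) mod ?q"
      "\<And>r c. r < i \<Longrightarrow> c < n \<Longrightarrow> entry 3 t r c = entry 3 s r c"
      using den_add_prog[of ?q ?p n Q i s1 16 11 i r, OF _ dvds(1) el1(1) vs(1) _ vs(2,3) _ iv(1) r(2,3) ri]
      unfolding t_def[symmetric] e1 by simp_all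
    have ev_t: "even_diagonal n i ?d t"
      using add_even_diagonal[of ?q ?p n Q i s1 16 11 i r, OF _ dvds(1) _ el1(1) vs(1) _ vs(2,3) _ iv(1) r(2,3) ri el1(2)]
        dvds(2) unfolding t_def d2 by simp
    have vt: "var t y = var s y" if "y \<notin> {15, 19, 20, 21, 22, 23}" for y
      using that v1[of y] unfolding t_def by (subst den_var) auto
    \<comment> \<open>By symmetry entry \<open>(r, i)\<close> equals entry \<open>(i, r)\<close>,
      which is divisible in this case.\<close>
    have "c0 \<noteq> i"
      using ev r eliminatedD(3)[OF el iv(1) r(3)] True[rule_format, OF r(3,2)] by auto
    then have "\<not> ?d dvd entry 3 t i c0"
      using st(2)[OF r(5)] True r dvds(2) by (simp add: dvd_mod_iff dvd_add_right_iff del: power_Suc)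
    then obtain c where "c < n" "i \<le> c" "\<not> ?d dvd entry 3 t i c" "var s2 19 = int c"
      using row_i[of t] vt n c v18 r unfolding s2 by auto
    moreover have "entry X s2 = entry X t" for X
      unfolding s2 by (auto simp: entry_def fun_eq_iff den_var den_arr)
    ultimately show ?thesis using st(1,3) ev_t by (auto simp: eliminated_def even_diagonal_def)
  qed
  then obtain c1 where el2: "eliminated n ?q Q i ?p s2" and ev2: "even_diagonal n i ?d s2"
    and old2: "\<And>r c. r < i \<Longrightarrow> c < n \<Longrightarrow> entry 3 s2 r c = entry 3 s r c"
    and c1: "c1 < n" "i \<le> c1" "\<not> ?d dvd entry 3 s2 i c1" "var s2 19 = int c1" by auto
  \<comment> \<open>The diagonal is divisible, so a hit in row \<open>i\<close> lies to the right of
    it; hence index \<open>i + 1\<close> exists.\<close>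
  have "c1 \<noteq> i" using c1 ev2 iv by (auto simp: even_diagonal_def)
  then have i1: "Suc i < n" using c1 by simp

  define s3 where "s3 = set_var 25 (int (Suc i)) s2"
  define s4 where "s4 = den ?q (LIf (cell 3 11 25 mod. Var 18 =. Lit 0) (add_prog 25 19) LSkip) s3"
  have v3: "var s3 y = var s y" if "y \<notin> {15, 19, 20, 21, 22, 23, 25}" for y
    using that v2 by (simp add: s3_def)
  have e3: "entry X s3 = entry X s2" for X by (simp add: s3_def)
  have v4: "var s4 y = var s3 y" if "y \<notin> {20, 21, 22, 23}" for y
    unfolding s4_def by (rule den_var) (use that in simp)
  have a4: "arr s4 a = arr s a" if "a \<notin> {3, 4}" for a
    using that den_arr[of a "LIf (cell 3 11 25 mod. Var 18 =. Lit 0) (add_prog 25 19) LSkip" ?q s3] a2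
    by (simp add: s4_def s3_def)
  have vs3: "var s3 0 = int n" "var s3 11 = int i" "var s3 18 = ?d" "var s3 25 = int (Suc i)" "var s3 19 = int c1"
    using v3 n c v18 c1 by (auto simp: s3_def)
  have cond: "eval ?q (cell 3 11 25 mod. Var 18 =. Lit 0) s3 \<noteq> 0 \<longleftrightarrow> ?d dvd entry 3 s2 i (Suc i)"
    using vs3 arr_entry[OF vs3(1), of i "Suc i"] e3 by (simp add: dvd_eq_mod_eq_0 del: of_nat_Suc power_Suc)
  have "eliminated n ?q Q i ?p s4 \<and> even_diagonal n i ?d s4 \<and>
      (\<forall>r<i. \<forall>c<n. entry 3 s4 r c = entry 3 s r c) \<and> \<not> ?d dvd entry 3 s4 i (Suc i)"
  proof (cases "?d dvd entry 3 s2 i (Suc i)")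
    case False
    then have "s4 = s3" using cond by (simp add: s4_def)
    then show ?thesis using el2 ev2 old2 False e3 by (auto simp: eliminated_def even_diagonal_def)
  next
    case True
    then have s4: "s4 = den ?q (add_prog 25 19) s3" using cond by (simp add: s4_def)
    have ne: "Suc i \<noteq> c1" using True c1 by auto
    have el3: "eliminated n ?q Q i ?p s3" "even_diagonal n i (2 * ?p) s3"
      using el2 ev2 by (simp_all add: eliminated_def even_diagonal_def e3)
    have st: "eliminated n ?q Q i ?p s4"
      "\<And>c. c < n \<Longrightarrow> c \<noteq> Suc i \<Longrightarrow> entry 3 s4 (Suc i) c = (entry 3 s2 (Suc i) c + entry 3 s2 c1 c) mod ?q"
      "\<And>r c. r < i \<Longrightarrow> c < n \<Longrightarrow> entry 3 s4 r c = entry 3 s2 r c"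
      using den_add_prog[of ?q ?p n Q i s3 19 25 "Suc i" c1, OF _ dvds(1) el3(1) vs3(1) _ vs3(4,5) _ i1 c1(2,1) ne]
      unfolding s4[symmetric] e3 by simp_all
    have "even_diagonal n i ?d s4"
      using add_even_diagonal[of ?q ?p n Q i s3 19 25 "Suc i" c1, OF _ dvds(1) _ el3(1) vs3(1) _ vs3(4,5) _ i1 c1(2,1) ne el3(2)]
        dvds(2) unfolding s4 d2 by simp
    moreover have "\<not> ?d dvd entry 3 s4 i (Suc i)"
    proof -
      have "entry 3 s4 i (Suc i) = (entry 3 s2 i (Suc i) + entry 3 s2 i c1) mod ?q"
        using st(2)[OF iv(1)] eliminatedD(3)[OF st(1) iv(1) i1] eliminatedD(3)[OF el2 iv(1) i1]
          eliminatedD(3)[OF el2 iv(1) c1(1)] by simp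
      then show ?thesis
        using True c1(3) dvds(2) by (simp add: dvd_mod_iff dvd_add_right_iff del: power_Suc)
    qed
    ultimately show ?thesis using st(1,3) old2 by auto
  qed
  then have el4: "eliminated n ?q Q i ?p s4" and ev4: "even_diagonal n i ?d s4"
    and old4: "\<And>r c. r < i \<Longrightarrow> c < n \<Longrightarrow> entry 3 s4 r c = entry 3 s r c"
    and odd4: "\<not> ?d dvd entry 3 s4 i (Suc i)" by auto
  obtain b where b: "entry 3 s4 i (Suc i) = ?p * b" using eliminatedD(5)[OF el4 iv(1) i1] by auto
  obtain a where a: "entry 3 s4 i i = ?d * a" using ev4 iv by (auto simp: even_diagonal_def)
  have "?d dvd entry 3 s4 (Suc i) (Suc i)" using ev4 i1 by (simp add: even_diagonal_def)
  then obtain e where e: "entry 3 s4 (Suc i) (Suc i) = ?d * e" by (rule dvdE)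
  have odd_b: "odd b" using odd4 b by (auto simp: mult.commute)
  define D where "D = (((2 * a) * (2 * e)) mod ?q - (b * b) mod ?q) mod ?q"
  define s5 where "s5 = set_var 24 (modular_inverse ?q D) (set_var 28 (2 * e) (set_var 27 b (set_var 26 (2 * a) s4)))"
  define s6 where "s6 = den ?q clear2_prog s5"
  have D: "[D = 2 * a * (2 * e) - b * b] (mod ?q)" by (simp add: D_def cong_def mod_simps)
  have "2 dvd ?q" using iv by simp
  then have par: "even (x mod ?q) \<longleftrightarrow> even x" for x :: int by (rule dvd_mod_iff)
  have "odd D" unfolding D_def par even_diff even_add even_mult_iff using odd_b by simp
  then have "[modular_inverse ?q D * D = 1] (mod ?q)" by (intro cong_modular_inverse2) simp
  moreover have "[modular_inverse ?q D * D = modular_inverse ?q D * (2 * a * (2 * e) - b * b)] (mod ?q)"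
    using D by (rule cong_scalar_left)
  ultimately have inv: "[modular_inverse ?q D * (2 * a * (2 * e) - b * b) = 1] (mod ?q)"
    by (meson cong_sym cong_trans)
  have v5: "var s5 y = var s y" if "y \<notin> {15, 19, 20, 21, 22, 23, 24, 25, 26, 27, 28}" for y
    using that v3 v4 by (simp add: s5_def)
  have e5: "entry X s5 = entry X s4" for X by (simp add: s5_def)
  have el5: "eliminated n ?q Q i ?p s5" using el4 by (simp add: eliminated_def e5)
  have vs5: "var s5 0 = int n" "var s5 11 = int i" "var s5 25 = int (Suc i)" "var s5 13 = ?p"
    "var s5 26 = 2 * a" "var s5 27 = b" "var s5 28 = 2 * e" "var s5 24 = modular_inverse ?q D"
    using v5 n c v4[of 25] vs3 by (simp_all add: s5_def)
  have abc5: "entry 3 s5 i i = ?p * var s5 26" "entry 3 s5 i (Suc i) = ?p * var s5 27"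
    "entry 3 s5 (Suc i) (Suc i) = ?p * var s5 28"
    using a b e by (simp_all add: e5 vs5)
  have inv5: "[var s5 24 * (var s5 26 * var s5 28 - var s5 27 * var s5 27) = 1] (mod ?q)"
    using inv by (simp only: vs5)
  have "(0::int) < ?q" "(0::int) < ?p" by simp_all
  note cl = den_clear2[OF \<open>0 < ?q\<close> dvds(1) \<open>0 < ?p\<close> el5 vs5(1) i1 vs5(2-4) abc5 inv5, folded s6_def]
  define s7 where "s7 = set_cell 9 (int i) e (set_cell 8 (int i) b (set_cell 7 (int i) a
    (set_cell 6 (int i) (int (Suc v)) (set_cell 5 (int (Suc i)) 2 (set_cell 5 (int i) 1 s6)))))"
  have v6: "var s6 y = var s5 y" if "y \<notin> {14, 20, 21, 22, 23, 29, 30, 31, 32}" for y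
    unfolding s6_def by (rule den_var) (use that in simp)
  have a6: "arr s6 x = arr s x" if "x \<notin> {3, 4}" for x
    using that a4 by (simp add: s6_def den_arr s5_def)
  have bounds: "int i + 1 < M" "int i + 2 < M" "int v + 1 < M" "0 < M"
    using c(1) iv unfolding constants_def by linarith+
  have vs4: "var s4 0 = int n" "var s4 11 = int i" "var s4 25 = int (Suc i)" "var s4 13 = ?p"
    using v4 v3 n c vs3 by auto
  have cells: "arr s4 3 (int i * int n + int i) = ?d * a" "arr s4 3 (int i * int n + int (Suc i)) = ?p * b"
    "arr s4 3 (int (Suc i) * int n + int (Suc i)) = ?d * e"
    using arr_entry[OF vs4(1)] a b e by (simp_all only:)
  have step3: "den ?q (LAssign 25 ((Var 11 +. Lit 1) mod. Var 3)) s2 = s3"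
    using v2 n c bounds by (simp add: s3_def add.commute)
  have step5: "den ?q (LAssign 26 (cell 3 11 11 div. Var 13) ;; LAssign 27 (cell 3 11 25 div. Var 13) ;;
     LAssign 28 (cell 3 25 25 div. Var 13) ;;
     LAssign 24 (Ring_Inv (Var 26 *% Var 28 -% Var 27 *% Var 27))) s4 = s5"
    using cells by (simp add: vs4 s5_def D_def del: of_nat_Suc)
  have step7: "den ?q (LStore 5 (Var 11) (Lit 1) ;; LStore 5 (Var 25) (Lit 2) ;;
     LStore 6 (Var 11) ((Var 12 +. Lit 1) mod. Var 3) ;;
     LStore 7 (Var 11) (Var 26 div. Lit 2) ;; LStore 8 (Var 11) (Var 27) ;;
     LStore 9 (Var 11) (Var 28 div. Lit 2) ;;
     LAssign 11 ((Var 25 +. Lit 1) mod. Var 3)) s6 = set_var 11 (int (Suc (Suc i))) s7"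
    using bounds n c v5 by (simp add: v6 vs5 s7_def add.commute)
  have fin: "den ?q pair_prog s = set_var 11 (int (Suc (Suc i))) s7"
    using step3 step5 step7
    by (simp only: pair_prog_def den.simps(4) s1_def[symmetric] s2_def[symmetric] s4_def[symmetric] s6_def[symmetric])
  define s' where "s' = set_var 11 (int (Suc (Suc i))) s7"
  have e': "entry 3 s' = entry 3 s6" "entry 4 s' = entry 4 s6" by (simp_all add: s'_def s7_def)
  have v': "var s' y = var s y" if "y < 10 \<or> y = 12 \<or> y = 13" for y
    using that by (auto simp: s'_def s7_def v6 v5)
  have a': "arr s' x (int r) = arr s x (int r)" if "x \<in> {5..9}" "r \<noteq> i" "r \<noteq> Suc i" for x r
    using that by (simp add: s'_def s7_def a6 del: of_nat_Suc)
  have a'i: "arr s' 5 (int i) = 1" "arr s' 5 (int (Suc i)) = 2" "arr s' 6 (int i) = int (Suc v)"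
    "arr s' 7 (int i) = a" "arr s' 8 (int i) = b" "arr s' 9 (int i) = e"
    by (simp_all add: s'_def s7_def)
  have "arr s 5 (int (Suc i)) = 0 \<and> arr s 6 (int (Suc i)) = int k \<and> arr s 7 (int (Suc i)) = 0 \<and>
      arr s 8 (int (Suc i)) = 0 \<and> arr s 9 (int (Suc i)) = 0"
    using s i1 unfolding progress_def by (meson le_Suc_eq order_refl)
  then have a'Si: "arr s' 6 (int (Suc i)) = int k" "arr s' 7 (int (Suc i)) = 0" "arr s' 8 (int (Suc i)) = 0"
    "arr s' 9 (int (Suc i)) = 0"
    by (simp_all add: s'_def s7_def a6)
  have blk: "entry 3 s6 i i = ?d * a" "entry 3 s6 i (Suc i) = ?p * b" "entry 3 s6 (Suc i) i = ?p * b"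
    "entry 3 s6 (Suc i) (Suc i) = ?d * e"
    using cl(2) a b e e5 eliminatedD(3)[OF el4 iv(1) i1] by simp_all
  have zero: "entry 3 s6 l j = 0" if l: "l \<in> {i, Suc i}" and j: "j < n" "j \<noteq> i" "j \<noteq> Suc i" for l j
  proof (cases "Suc i < j")
    case False
    then have ji: "j < i" using j by simp
    have ln: "l < n" "i \<le> l" using l iv i1 by auto
    have "entry 3 s6 l j = entry 3 s6 j l" using eliminatedD(3)[OF cl(1) ln(1) j(1)] .
    also have "\<dots> = entry 3 s5 j l" using cl(4)[OF ji ln(1)] .
    also have "\<dots> = 0" using eliminatedD(4)[OF el5 j(1) ln(1) ji ln(2)] .
    finally show ?thesis .
  qed (use cl(3)[OF l j(1)] in simp)
  show ?thesis
    unfolding fin s'_def[symmetric] progress_def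
  proof (intro conjI allI impI)
    show "constants n k M s'" using c(1) v' by (subst constants_eq[of _ s]) auto
    show "Suc (Suc i) \<le> n" "v \<le> k" using i1 iv by simp_all
    show "var s' 11 = int (Suc (Suc i))" by (simp add: s'_def)
    show "var s' 12 = int v" "var s' 13 = 2 ^ v" using v' c by simp_all
    show "eliminated n ?q Q (Suc (Suc i)) ?p s'" using cl(1) unfolding eliminated_def e' .
    fix r assume r: "r < Suc (Suc i)"
    show "block_at n k s' r"
    proof (cases "r < i")
      case True
      have "block_at n k s r" "arr s 5 (int r) = 1 \<Longrightarrow> Suc r < i" using s True by (auto simp: progress_def)
      then show ?thesis
      proof (rule block_at_stable[OF _ True less_imp_le[OF iv(1)]])
        fix r c assume "r < i" "c < n"
        then show "entry 3 s' r c = entry 3 s r c"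
          unfolding e' using cl(4)[of r c] old4[of r c] e5 by simp
      next
        fix r x assume "r < i" "x \<in> {5..9::nat}"
        then show "arr s' x (int r) = arr s x (int r)" by (intro a') auto
      qed
    next
      case False
      then consider "r = i" | "r = Suc i" using r by linarith
      then show ?thesis
      proof cases
        case 1
        show ?thesis unfolding 1 block_at_def block_matrix_def e'
          using i1 a'i(1-3) odd_b blk zero unfolding a'i(4-6)
          by (intro disjI2 disjI1) (simp add: nat_add_distrib)
      next
        case 2
        show ?thesis unfolding 2 block_at_def block_matrix_def using a'i(1,2) a'Si
          by (intro disjI2) simp
      qed
    qed
    show "Suc r < Suc (Suc i)" if "arr s' 5 (int r) = 1"
    proof (rule ccontr)
      assume "\<not> ?thesis"
      then have "r = Suc i" using r by simp
      then show False using that a'i(2) by simp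
    qed
  next
    fix r assume r: "r < n"
    have "arr s 5 (int r) \<in> {0, 1, 2} \<and> arr s 6 (int r) \<in> {0..int k}" using s r unfolding progress_def by blast
    then show "arr s' 5 (int r) \<in> {0, 1, 2}" "arr s' 6 (int r) \<in> {0..int k}"
      using a'[of _ r] a'i(1-3) a'Si(1) iv(2) by (cases "r = i"; cases "r = Suc i"; simp)+
    assume ir: "Suc (Suc i) \<le> r"
    then have ne: "r \<noteq> i" "r \<noteq> Suc i" "i \<le> r" by auto
    have "arr s 5 (int r) = 0 \<and> arr s 6 (int r) = int k \<and> arr s 7 (int r) = 0 \<and>
        arr s 8 (int r) = 0 \<and> arr s 9 (int r) = 0" using s r ne(3) unfolding progress_def by blast
    then show "arr s' 5 (int r) = 0" "arr s' 6 (int r) = int k" "arr s' 7 (int r) = 0"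
      "arr s' 8 (int r) = 0" "arr s' 9 (int r) = 0"
      using a'[OF _ ne(1,2)] by simp_all
  qed
qed


text \<open>Each round finishes one or two indices or raises \<open>v\<close>, so
  \<open>i + v\<close> grows until \<open>i = n\<close> or \<open>v = k\<close>. This happens within
  \<open>n + k\<close> rounds; further rounds change nothing, which matters because loops have
  constant bounds.\<close>

definition pivot_prog :: lprog where
  "pivot_prog = LIf ((Var 11 <. Var 0) *. (Var 12 <. Var 1))
     (LAssign 18 ((Var 13 +. Var 13) mod. Var 3) ;; scan_diag_prog ;;
      LIf (Lit (- 1) <. Var 16) diag_prog
        (scan_all_prog ;;
         LIf (Lit (- 1) <. Var 16) pair_prog
           (LAssign 13 (Var 18) ;; LAssign 12 ((Var 12 +. Lit 1) mod. Var 3)))) LSkip"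

lemma writes_pivot [simp]:
  "wvars pivot_prog = {11, 12, 13, 14, 15, 16, 18, 19, 20, 21, 22, 23, 24, 25, 26, 27, 28, 29, 30, 31, 32}"
  "warrs pivot_prog = {3, 4, 5, 6, 7, 8, 9}"
  by (auto simp: pivot_prog_def)

lemma progress_scan:
  assumes "progress n k M Q i v s" "\<And>y. y < 14 \<Longrightarrow> y \<noteq> 10 \<Longrightarrow> var s' y = var s y" "arr s' = arr s"
  shows "progress n k M Q i v s'"
proof -
  have e: "entry X s' = entry X s" for X using assms(2,3) by (auto simp: entry_def fun_eq_iff)
  have c: "constants n k M s' \<longleftrightarrow> constants n k M s" using assms(2) by (intro constants_eq) simp
  show ?thesis
    using assms(1) unfolding progress_def eliminated_def block_at_def e c assms(3)
    by (simp add: assms(2))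
qed

lemma den_pivot:
  assumes s: "progress n k M Q i v s"
  shows "\<exists>i' v'. progress n k M Q i' v' (den (2 ^ k) pivot_prog s) \<and>
    (if i = n \<or> v = k then i' = i \<and> v' = v else i + v < i' + v')"
proof (cases "i < n \<and> v < k")
  case False
  have "den (2 ^ k) pivot_prog s = s"
    using s False by (auto simp: pivot_prog_def progress_def constants_def)
  moreover have "i = n \<or> v = k" using s False by (auto simp: progress_def)
  ultimately show ?thesis using s by auto
next
  case True
  let ?q = "2 ^ k :: int" and ?d = "2 ^ Suc v :: int"
  define s1 where "s1 = set_var 18 ?d s"
  define s2 where "s2 = den ?q scan_diag_prog s1"
  define s3 where "s3 = den ?q scan_all_prog s2"
  have c: "constants n k M s" "var s 11 = int i" "var s 12 = int v" "var s 13 = 2 ^ v"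
    using s by (auto simp: progress_def)
  have n: "var s 0 = int n" "var s 1 = int k" "var s 3 = M" using c by (simp_all add: constants_def)
  have M: "?d < M" "int v + 1 < M"
  proof -
    have "?d \<le> 2 ^ (k + 8)" using True by (intro power_increasing) auto
    then show "?d < M" "int v + 1 < M" using c(1) True unfolding constants_def by linarith+
  qed
  have "den ?q (LAssign 18 ((Var 13 +. Var 13) mod. Var 3)) s = s1"
    using M(1) n c by (simp add: s1_def)
  then have den: "den ?q pivot_prog s = (if - 1 < var s2 16 then den ?q diag_prog s2
      else if - 1 < var s3 16 then den ?q pair_prog s3
      else den ?q (LAssign 13 (Var 18) ;; LAssign 12 ((Var 12 +. Lit 1) mod. Var 3)) s3)"
    using True n c by (simp add: pivot_prog_def s2_def s3_def)
  have v2: "var s2 y = var s1 y" if "y \<notin> {14, 16}" for y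
    unfolding s2_def by (rule den_var) (use that in simp)
  have v3: "var s3 y = var s1 y" if "y \<notin> {14, 15, 16}" for y
    unfolding s3_def using that v2[of y] by (simp add: den_var)
  have a: "arr s2 = arr s" "arr s3 = arr s"
    unfolding s3_def s2_def s1_def by (rule ext, simp add: den_arr)+
  have p2: "progress n k M Q i v s2" by (rule progress_scan[OF s _ a(1)]) (use v2 in \<open>simp add: s1_def\<close>)
  have p3: "progress n k M Q i v s3" by (rule progress_scan[OF s _ a(2)]) (use v3 in \<open>simp add: s1_def\<close>)
  have e: "entry X s1 = entry X s" "entry X s2 = entry X s" "entry X s3 = entry X s" for X
    using v2[of 0] v3[of 0] a by (auto simp: entry_def fun_eq_iff s1_def)
  have diag: "(\<forall>r<n. i \<le> r \<longrightarrow> ?d dvd entry 3 s r r) \<and> var s2 16 = - 1 \<or>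
    (\<exists>r<n. i \<le> r \<and> \<not> ?d dvd entry 3 s r r \<and> var s2 16 = int r)"
    unfolding s2_def e(1)[symmetric] by (rule den_scan_diag) (use n c in \<open>auto simp: s1_def\<close>)
  have all: "(\<forall>r<n. \<forall>c<n. i \<le> r \<longrightarrow> i \<le> c \<longrightarrow> ?d dvd entry 3 s r c) \<and> var s3 16 = - 1 \<or>
    (\<exists>r<n. \<exists>c<n. i \<le> r \<and> i \<le> c \<and> \<not> ?d dvd entry 3 s r c \<and> var s3 16 = int r)"
    unfolding s3_def e(2)[symmetric] by (rule den_scan_all) (use n c v2 in \<open>auto simp: s1_def\<close>)
  consider (single) r where "r < n" "i \<le> r" "\<not> ?d dvd entry 3 s r r" "var s2 16 = int r"
    | (pair) r c where "\<forall>r<n. i \<le> r \<longrightarrow> ?d dvd entry 3 s r r" "var s2 16 = - 1" "r < n" "c < n" "i \<le> r" "i \<le> c"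
      "\<not> ?d dvd entry 3 s r c" "var s3 16 = int r"
    | (none) "\<forall>r<n. \<forall>c<n. i \<le> r \<longrightarrow> i \<le> c \<longrightarrow> ?d dvd entry 3 s r c" "var s2 16 = - 1" "var s3 16 = - 1"
  proof (cases "\<exists>r<n. i \<le> r \<and> \<not> ?d dvd entry 3 s r r \<and> var s2 16 = int r")
    case True
    then show ?thesis using that(1) by (elim exE conjE)
  next
    case False
    then have "(\<forall>r<n. i \<le> r \<longrightarrow> ?d dvd entry 3 s r r) \<and> var s2 16 = - 1"
      by - (rule disjE[OF diag], assumption, erule notE, assumption)
    note A = conjunct1[OF this] conjunct2[OF this]
    from all show ?thesis
    proof
      assume "(\<forall>r<n. \<forall>c<n. i \<le> r \<longrightarrow> i \<le> c \<longrightarrow> ?d dvd entry 3 s r c) \<and> var s3 16 = - 1"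
      then show ?thesis using that(3) A(2) by (elim conjE)
    next
      assume "\<exists>r<n. \<exists>c<n. i \<le> r \<and> i \<le> c \<and> \<not> ?d dvd entry 3 s r c \<and> var s3 16 = int r"
      then show ?thesis using that(2)[OF A] by (elim exE conjE)
    qed
  qed
  then show ?thesis
  proof cases
    case single
    have "progress n k M Q (Suc i) v (den ?q diag_prog s2)"
      by (rule den_diag[OF p2 _ _ _ single(4,2,1)]) (use True v2 e single in \<open>simp_all add: s1_def\<close>)
    then show ?thesis using den single(4) by - (rule exI[of _ "Suc i"], rule exI[of _ v], use True in simp)
  next
    case pair
    have "progress n k M Q (Suc (Suc i)) v (den ?q pair_prog s3)"
      by (rule den_pair[OF p3 _ _ _ _ pair(8,5,3,6,4)])
        (use True v3 e pair in \<open>simp_all add: s1_def even_diagonal_def\<close>)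
    then show ?thesis using den pair(2,8) by - (rule exI[of _ "Suc (Suc i)"], rule exI[of _ v], use True in simp)
  next
    case none
    define s4 where "s4 = set_var 12 (int (Suc v)) (set_var 13 ?d s3)"
    have s4: "den ?q pivot_prog s = s4"
      using den none(2,3) v3 n c M by (simp add: s4_def s1_def add.commute)
    have e4: "entry X s4 = entry X s" for X using e(3) by (simp add: s4_def)
    have "constants n k M s4" using c(1) v3 by (subst constants_eq[of _ s]) (auto simp: s4_def s1_def)
    moreover have "eliminated n ?q Q i ?d s4"
    proof -
      have el: "eliminated n ?q Q i (2 ^ v) s" using s by (simp add: progress_def)
      show ?thesis unfolding eliminated_def e4
      proof (intro conjI allI impI)
        show "equivalent n ?q Q (entry 3 s) (entry 4 s)" using el by (simp add: eliminated_def)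
        fix r c assume rc: "r < n" "c < n"
        show "entry 3 s r c \<in> {0..<?q}" "entry 3 s r c = entry 3 s c r"
          using eliminatedD(1-3)[OF el rc] by simp_all
        show "entry 3 s r c = 0" if "r < i" "i \<le> c" using eliminatedD(4)[OF el rc that] .
        show "?d dvd entry 3 s r c" if "i \<le> r" "i \<le> c" using none(1) rc that by simp
      qed
    qed
    moreover have "arr s4 = arr s" using a by (simp add: s4_def)
    moreover have "var s4 11 = int i" using v3 c by (simp add: s4_def s1_def)
    ultimately have "progress n k M Q i (Suc v) s4"
      using s True unfolding progress_def block_at_def e4 by (simp add: s4_def)
    then show ?thesis unfolding s4 by - (rule exI[of _ i], rule exI[of _ "Suc v"], use True in simp)
  qed
qed

section \<open>The complete elimination\<close>

definition init_prog :: lprog where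
  "init_prog = LFor 14 (Var 0) (LFor 15 (Var 0)
       (LStore 3 (Var 14 *. Var 0 +. Var 15) (cell 0 14 15 +% Lit 0) ;;
        LStore 4 (Var 14 *. Var 0 +. Var 15) (Var 14 =. Var 15))) ;;
     LFor 14 (Var 0) (LStore 6 (Var 14) (Var 1)) ;;
     LAssign 11 (Lit 0) ;; LAssign 12 (Lit 0) ;; LAssign 13 (Lit 1)"

definition elim_prog :: lprog where
  "elim_prog = init_prog ;; LFor 10 (Var 4) pivot_prog"

lemma writes_init [simp]:
  "wvars init_prog = {11, 12, 13, 14, 15}" "warrs init_prog = {3, 4, 6}"
  by (auto simp: init_prog_def)

lemma writes_elim [simp]:
  "wvars elim_prog = {10, 11, 12, 13, 14, 15, 16, 18, 19, 20, 21, 22, 23, 24, 25, 26, 27, 28, 29, 30, 31, 32}"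
  "warrs elim_prog = {3, 4, 5, 6, 7, 8, 9}"
  by (auto simp: elim_prog_def)

lemma den_scale_init:
  assumes n: "var s 0 = int n" and k: "var s 1 = k"
  shows "\<forall>r<n. arr (den q (LFor 14 (Var 0) (LStore 6 (Var 14) (Var 1))) s) 6 (int r) = k"
  by (rule den_For[where I = "\<lambda>i s. \<forall>r<i. arr s 6 (int r) = k"])
    (use n k in \<open>auto simp: less_Suc_eq\<close>)

lemma den_init:
  assumes c: "constants n k M s" and zero: "\<And>a. a \<noteq> 0 \<Longrightarrow> arr s a = (\<lambda>_. 0)"
    and sym: "\<And>r c. r < n \<Longrightarrow> c < n \<Longrightarrow> entry 0 s r c = entry 0 s c r"
  shows "progress n k M (entry 0 s) 0 0 (den (2 ^ k) init_prog s)"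
proof -
  let ?q = "2 ^ k :: int"
  have n: "var s 0 = int n" "var s 1 = int k" using c by (simp_all add: constants_def)
  define cellp where "cellp = LStore 3 (Var 14 *. Var 0 +. Var 15) (cell 0 14 15 +% Lit 0) ;;
        LStore 4 (Var 14 *. Var 0 +. Var 15) (Var 14 =. Var 15)"
  define rowp where "rowp = LFor 15 (Var 0) cellp"
  define ok where "ok s' r c \<longleftrightarrow> entry 3 s' r c = entry 0 s r c mod ?q \<and> entry 4 s' r c = of_bool (r = c)"
    for s' :: state and r c
  define I where "I i s' \<longleftrightarrow> (\<forall>r<i. \<forall>c<n. ok s' r c)" for i s'
  define s1 where "s1 = den ?q (LFor 14 (Var 0) rowp) s"
  have "I n s1"
    unfolding s1_def
  proof (rule den_For)
    show "I 0 (set_var 14 0 s)" by (simp add: I_def)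
    fix i t
    assume i: "i < n" and I: "I i t" and i': "var t 14 = int i"
      and v: "\<And>y. y \<noteq> 14 \<Longrightarrow> y \<notin> wvars rowp \<Longrightarrow> var t y = var s y"
      and a: "\<And>a. a \<notin> warrs rowp \<Longrightarrow> arr t a = arr s a"
    have t: "var t 0 = int n" "arr t 0 = arr s 0" using v a n by (simp_all add: rowp_def cellp_def)
    define J where "J l t' \<longleftrightarrow> I i t' \<and> (\<forall>c<l. ok t' i c)" for l t'
    have "J n (den ?q rowp t)"
      unfolding rowp_def
    proof (rule den_For)
      show "J 0 (set_var 15 0 t)" using I by (simp add: J_def I_def ok_def)
      fix l u
      assume l: "l < n" and J: "J l u" and l': "var u 15 = int l"
        and v: "\<And>y. y \<noteq> 15 \<Longrightarrow> y \<notin> wvars cellp \<Longrightarrow> var u y = var t y"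
        and a: "\<And>a. a \<notin> warrs cellp \<Longrightarrow> arr u a = arr t a"
      have u: "var u 0 = int n" "var u 14 = int i" "arr u 0 = arr s 0"
        using v a t i' by (simp_all add: cellp_def)
      let ?j = "int i * int n + int l"
      have "arr u 0 ?j = entry 0 s i l" using u(3) n by (simp add: entry_def)
      then have den: "den ?q cellp u = set_cell 4 ?j (of_bool (i = l)) (set_cell 3 ?j (entry 0 s i l mod ?q) u)"
        by (simp add: cellp_def u l')
      have "ok (set_var 15 (int (Suc l)) (den ?q cellp u)) r c \<longleftrightarrow> (if r = i \<and> c = l then True else ok u r c)"
        if "c < n" for r c
        using that l u unfolding ok_def den by (simp add: entry_set_cell)
      then show "J (Suc l) (set_var 15 (int (Suc l)) (den ?q cellp u))"
        using J l by (auto simp: J_def I_def less_Suc_eq)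
    qed (use t in \<open>auto simp: cellp_def\<close>)
    then show "I (Suc i) (set_var 14 (int (Suc i)) (den ?q rowp t))"
      by (auto simp: I_def J_def ok_def less_Suc_eq)
  qed (use n in \<open>auto simp: rowp_def cellp_def\<close>)
  then have ok1: "ok s1 r c" if "r < n" "c < n" for r c using that by (simp add: I_def)
  define s2 where "s2 = den ?q (LFor 14 (Var 0) (LStore 6 (Var 14) (Var 1))) s1"
  have v1: "var s1 y = var s y" if "y < 14" for y
    unfolding s1_def by (rule den_var) (use that in \<open>auto simp: rowp_def cellp_def\<close>)
  have v2: "var s2 y = var s y" if "y < 14" for y
  proof -
    have "var s2 y = var s1 y" unfolding s2_def by (rule den_var) (use that in simp)
    then show ?thesis using v1[OF that] by simp
  qed
  have a2: "arr s2 a = arr s1 a" if "a \<noteq> 6" for a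
    unfolding s2_def by (rule den_arr) (use that in simp)
  have a1: "arr s1 a = arr s a" if "a \<notin> {3, 4}" for a
    unfolding s1_def by (rule den_arr) (use that in \<open>simp add: rowp_def cellp_def\<close>)
  have sc: "\<forall>r<n. arr s2 6 (int r) = int k"
    unfolding s2_def by (rule den_scale_init) (use v1 n in auto)
  define s3 where "s3 = set_var 13 1 (set_var 12 0 (set_var 11 0 s2))"
  have fin: "den ?q init_prog s = s3"
    unfolding init_prog_def cellp_def[symmetric] rowp_def[symmetric] by (simp add: s3_def s2_def s1_def)
  have e3: "entry X s3 = entry X s1" if "X \<noteq> 6" for X
    using v2[of 0] v1[of 0] a2[OF that] by (auto simp: s3_def entry_def fun_eq_iff)
  have zero3: "arr s3 a (int r) = 0" if "a \<in> {5, 7, 8, 9}" for a r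
    using that a1[of a] a2[of a] zero[of a] by (auto simp: s3_def)
  show ?thesis
    unfolding fin progress_def
  proof (intro conjI allI impI)
    show "constants n k M s3" using c v2 by (subst constants_eq[of _ s]) (auto simp: s3_def)
    show "eliminated n ?q (entry 0 s) 0 (2 ^ 0) s3"
      unfolding eliminated_def
    proof (intro conjI allI impI)
      show "equivalent n ?q (entry 0 s) (entry 3 s3) (entry 4 s3)"
        by (rule equivalent_cong[OF equivalent_refl[where A = "\<lambda>r c. entry 0 s r c mod ?q"]])
          (use ok1 in \<open>auto simp: e3 ok_def cong_def\<close>)
      fix r c assume "r < n" "c < n"
      then show "entry 3 s3 r c \<in> {0..<?q}" "entry 3 s3 r c = entry 3 s3 c r"
        using ok1[of r c] ok1[of c r] sym[of r c] by (simp_all add: e3 ok_def)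
    qed simp_all
    fix r assume "r < n"
    show "arr s3 5 (int r) \<in> {0, 1, 2}" "arr s3 6 (int r) \<in> {0..int k}"
      using zero3[of 5 r] sc \<open>r < n\<close> by (simp_all add: s3_def)
    show "arr s3 5 (int r) = 0" "arr s3 6 (int r) = int k" "arr s3 7 (int r) = 0"
      "arr s3 8 (int r) = 0" "arr s3 9 (int r) = 0"
      using zero3 sc \<open>r < n\<close> by (simp_all add: s3_def)
  qed (simp_all add: s3_def)
qed

definition diagonalized :: "nat \<Rightarrow> nat \<Rightarrow> state \<Rightarrow> bool" where
  "diagonalized n k s \<longleftrightarrow> (\<forall>r<n. block_at n k s r \<and> arr s 5 (int r) \<in> {0, 1, 2} \<and> arr s 6 (int r) \<in> {0..int k})"

text \<open>If \<open>v = k\<close>, the remaining entries are residues divisible by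
  \<open>2 ^ k\<close>, hence 0, and the preset blocks are the right ones.\<close>

lemma progress_end:
  assumes s: "progress n k M Q i v s" and "i = n \<or> v = k"
  shows "diagonalized n k s" "equivalent n (2 ^ k) Q (entry 3 s) (entry 4 s)"
proof -
  have el: "eliminated n (2 ^ k) Q i (2 ^ v) s" using s by (simp add: progress_def)
  then show "equivalent n (2 ^ k) Q (entry 3 s) (entry 4 s)" by (simp add: eliminated_def)
  have "block_at n k s r" if r: "r < n" for r
  proof (cases "r < i")
    case True
    then show ?thesis using s by (simp add: progress_def)
  next
    case False
    then have v: "v = k" using assms(2) r by auto
    have "entry 3 s r j = 0" if j: "j < n" for j
    proof (cases "j < i")
      case True
      then show ?thesis using eliminatedD(3)[OF el r j] eliminatedD(4)[OF el j r] False by simp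
    next
      case jF: False
      have "2 ^ k dvd entry 3 s r j" using eliminatedD(5)[OF el r j] False jF v by simp
      then show ?thesis using eliminatedD(1,2)[OF el r j] zdvd_not_zless[of "entry 3 s r j" "2 ^ k"] by linarith
    qed
    moreover have "arr s 5 (int r) = 0 \<and> arr s 6 (int r) = int k \<and> arr s 7 (int r) = 0 \<and>
        arr s 8 (int r) = 0 \<and> arr s 9 (int r) = 0" using s r False unfolding progress_def by (meson not_less)
    ultimately show ?thesis using r by (simp add: block_at_def block_matrix_def)
  qed
  then show "diagonalized n k s" using s by (simp add: diagonalized_def progress_def)
qed

lemma den_elim:
  assumes c: "constants n k M s" and zero: "\<And>a. a \<noteq> 0 \<Longrightarrow> arr s a = (\<lambda>_. 0)"
    and sym: "\<And>r c. r < n \<Longrightarrow> c < n \<Longrightarrow> entry 0 s r c = entry 0 s c r"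
  defines "s' \<equiv> den (2 ^ k) elim_prog s"
  shows "diagonalized n k s'" "equivalent n (2 ^ k) (entry 0 s) (entry 3 s') (entry 4 s')"
proof -
  let ?q = "2 ^ k :: int"
  define s1 where "s1 = den ?q init_prog s"
  have p: "progress n k M (entry 0 s) 0 0 s1" unfolding s1_def by (rule den_init[OF c zero sym])
  define I where "I it t \<longleftrightarrow> (\<exists>i v. progress n k M (entry 0 s) i v t \<and> (it \<le> i + v \<or> i = n \<or> v = k))"
    for it t
  have "I (n + k) (den ?q (LFor 10 (Var 4) pivot_prog) s1)"
  proof (rule den_For)
    show "n + k = nat (eval ?q (Var 4) s1)" using p by (simp add: progress_def constants_def nat_int_add)
    have "progress n k M (entry 0 s) 0 0 (set_var 10 0 s1)" by (rule progress_scan[OF p]) simp_all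
    then show "I 0 (set_var 10 0 s1)" unfolding I_def by auto
    fix it t assume "I it t"
    then obtain i v where iv: "progress n k M (entry 0 s) i v t" "it \<le> i + v \<or> i = n \<or> v = k"
      by (auto simp: I_def)
    obtain i' v' where iv': "progress n k M (entry 0 s) i' v' (den ?q pivot_prog t)"
      "if i = n \<or> v = k then i' = i \<and> v' = v else i + v < i' + v'" using den_pivot[OF iv(1)] by auto
    have "progress n k M (entry 0 s) i' v' (set_var 10 (int (Suc it)) (den ?q pivot_prog t))"
      by (rule progress_scan[OF iv'(1)]) simp_all
    moreover have "Suc it \<le> i' + v' \<or> i' = n \<or> v' = k"
      using iv(2) iv'(2) by (auto split: if_splits)
    ultimately show "I (Suc it) (set_var 10 (int (Suc it)) (den ?q pivot_prog t))" unfolding I_def by blast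
  qed simp
  then have "I (n + k) s'" by (simp add: s'_def elim_prog_def s1_def)
  then obtain i v where "progress n k M (entry 0 s) i v s'" "n + k \<le> i + v \<or> i = n \<or> v = k" by (auto simp: I_def)
  moreover from this have "i = n \<or> v = k" by (auto simp: progress_def)
  ultimately show "diagonalized n k s'" "equivalent n (2 ^ k) (entry 0 s) (entry 3 s') (entry 4 s')"
    using progress_end by blast+
qed


section \<open>The counting program\<close>

abbreviation capped :: "expr \<Rightarrow> expr" where "capped e \<equiv> e mod. Var 3"

text \<open>Data of the index in variable 40 at the level in variable 41: variables 42 to 47 receive
  \<open>c\<close>, \<open>r\<close>, \<open>2 ^ r\<close>, the kind, \<open>wy\<close> and
  \<open>wz\<close>. Factors that are comparisons replace truncated subtraction and case
  distinctions.\<close>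

definition coef_prog :: lprog where
  "coef_prog =
     LAssign 42 (capped (((Var 41 -. Cell 6 (Var 40)) *. (Cell 6 (Var 40) <. Var 41) +. Lit 1) div. Lit 2)) ;;
     LAssign 43 (capped (Cell 6 (Var 40) +. Lit 2 *. Var 42 -. Var 41)) ;;
     LAssign 44 (Cell 10 (Var 43)) ;;
     LAssign 45 (Cell 5 (Var 40)) ;;
     LAssign 46 (capped ((Var 45 =. Lit 2) +. (Lit 1 -. (Var 45 =. Lit 2)) *. Cell 10 (Var 1 -. Var 42))) ;;
     LAssign 47 (capped ((Lit 1 -. (Var 45 =. Lit 1)) +. (Var 45 =. Lit 1) *. Cell 10 (Var 1 -. Var 42)))"

abbreviation h_expr :: "expr \<Rightarrow> expr \<Rightarrow> expr" where
  "h_expr y z \<equiv> Cell 7 (Var 40) *. (y *. y) +. Cell 8 (Var 40) *. y *. z +. Cell 9 (Var 40) *. (z *. z)"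

text \<open>One transition of the automaton: letter in variable 48, state in 55, new state in 56.
  Variable 53 tells whether the letter qualifies its index as a pivot.\<close>

definition letter_prog :: lprog where
  "letter_prog =
     LAssign 49 (Var 48 mod. Lit 8) ;; LAssign 50 (Var 48 div. Lit 8) ;;
     LAssign 51 ((Var 44 *. h_expr (Var 49) (Var 50)) mod. Lit 8) ;;
     LAssign 52 (Lit 0 <. (Lit 1 -. (Var 45 =. Lit 2)) *. (Var 49 mod. Lit 2) +.
       (Var 45 =. Lit 1) *. (Var 50 mod. Lit 2)) ;;
     LAssign 53 (Lit 0 <. Var 52 *. (Var 43 =. Lit 0)) ;;
     LAssign 54 (Lit 0 <. Var 52 *. (Var 42 =. Lit 0)) ;;
     LAssign 56 (capped ((Var 55 +. Var 51) mod. Lit 8 +.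
       Lit 8 *. (Lit 0 <. (Var 55 div. Lit 8) mod. Lit 2 +. Var 53) +.
       Lit 16 *. (Lit 0 <. (Var 55 div. Lit 16) mod. Lit 2 +. Var 54)))"

text \<open>\<open>okay\<close> is compiled into two literals, one for each value of the primitivity
  flag, so the three sampling problems differ in constants of the program only. The index in the
  last factor computes \<open>min 3 (k - m)\<close>.\<close>

definition acc_expr :: "(bool \<Rightarrow> bool) \<Rightarrow> expr" where
  "acc_expr okay =
     ((Var 2 mod. Cell 10 (Var 41)) =. Lit 0) *.
     (Lit 0 <. (Var 41 =. Var 1) +. (Var 55 div. Lit 8) mod. Lit 2) *.
     (Lit (of_bool (okay False)) *. (Lit 1 -. (Var 55 div. Lit 16) mod. Lit 2) +.
       Lit (of_bool (okay True)) *. ((Var 55 div. Lit 16) mod. Lit 2)) *.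
     (((Var 55 mod. Lit 8 -. Var 2 div. Cell 10 (Var 41)) mod.
       Cell 10 (Var 1 -. Var 41 -. (Var 1 -. Var 41 -. Lit 3) *. (Lit 3 <. Var 1 -. Var 41))) =. Lit 0)"

definition row_sum_prog :: lprog where
  "row_sum_prog = LAssign 58 (Lit 0) ;;
     LFor 48 (Lit 64) (letter_prog ;;
       LAssign 58 (capped (Var 58 +. Cell 11 (Lit 32 *. (Var 40 +. Lit 1) +. Var 56)))) ;;
     LStore 11 (Lit 32 *. Var 40 +. Var 55) (Var 58)"

text \<open>Dynamic programming from the last index backwards: cell \<open>32 * i + st\<close> of
  array 11 counts the accepted continuations from index \<open>i\<close> in state
  \<open>st\<close>.\<close>

definition table_prog :: "(bool \<Rightarrow> bool) \<Rightarrow> lprog" where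
  "table_prog okay =
     LFor 55 (Lit 32) (LStore 11 (Lit 32 *. Var 0 +. Var 55) (capped (acc_expr okay))) ;;
     LFor 57 (Var 0) (LAssign 40 (capped (Var 0 -. Lit 1 -. Var 57)) ;; coef_prog ;;
       LFor 55 (Lit 32) row_sum_prog)"

lemma writes_count [simp]:
  "wvars coef_prog = {42, 43, 44, 45, 46, 47}" "warrs coef_prog = {}"
  "wvars letter_prog = {49, 50, 51, 52, 53, 54, 56}" "warrs letter_prog = {}"
  "wvars row_sum_prog = {48, 49, 50, 51, 52, 53, 54, 56, 58}" "warrs row_sum_prog = {11}"
  "wvars (table_prog okay) = {40, 42, 43, 44, 45, 46, 47, 48, 49, 50, 51, 52, 53, 54, 55, 56, 57, 58}"
  "warrs (table_prog okay) = {11}"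
  by (auto simp: coef_prog_def letter_prog_def row_sum_prog_def table_prog_def)

lemmas exec = den.simps(1-5) eval.simps apply_binop.simps var_set_var arr_set_var var_set_cell
  if_True if_False numeral_eq_iff num.distinct num.inject simp_thms
  numeral_eq_one_iff one_eq_numeral_iff zero_neq_numeral numeral_neq_zero zero_neq_one one_neq_zero

context block_form
begin

text \<open>Memory holds the parameters of the locale. The bound on \<open>M\<close> dominates the
  total weight of all levels, so counts are unaffected by reduction, too.\<close>

definition rep :: "int \<Rightarrow> state \<Rightarrow> bool" where
  "rep M s \<longleftrightarrow> constants n k M s \<and> var s 2 = t \<and> 64 ^ n * 2 ^ (2 * k + 2 * k * n) < M \<and>
     (\<forall>i<n. arr s 5 (int i) = int (kind i) \<and> arr s 6 (int i) = int (scale i) \<and> scale i \<le> k \<and>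
       arr s 7 (int i) = al i \<and> arr s 8 (int i) = be i \<and> arr s 9 (int i) = ga i) \<and>
     (\<forall>j\<le>k. arr s 10 (int j) = 2 ^ j)"

lemma rep_eq:
  assumes "\<And>y. y < 10 \<Longrightarrow> var s' y = var s y" "\<And>a. 5 \<le> a \<Longrightarrow> a \<le> 10 \<Longrightarrow> arr s' a = arr s a"
  shows "rep M s' \<longleftrightarrow> rep M s"
  unfolding rep_def using assms by (simp add: constants_eq[OF assms(1)])

lemma rep_set_var [simp]: "10 \<le> x \<Longrightarrow> rep M (set_var x z s) \<longleftrightarrow> rep M s"
  by (rule rep_eq) auto

lemma rep_set_cell [simp]: "11 \<le> a \<Longrightarrow> rep M (set_cell a j z s) \<longleftrightarrow> rep M s"
  by (rule rep_eq) auto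

lemma rep_den [simp]:
  assumes "\<And>y. y < 10 \<Longrightarrow> y \<notin> wvars p" "\<And>a. 5 \<le> a \<Longrightarrow> a \<le> 10 \<Longrightarrow> a \<notin> warrs p"
  shows "rep M (den q p s) \<longleftrightarrow> rep M s"
  by (rule rep_eq) (use assms in \<open>auto simp: den_var den_arr\<close>)

lemma rep_consts:
  assumes "rep M s"
  shows "var s 0 = int n" "var s (Suc 0) = int k" "var s 2 = t" "var s 3 = M" "var s 5 = 2 ^ k"
    "var s 6 = int k + 1" "1 \<le> n" "int n + int k + 8 < M" "2 ^ (k + 8) < M" "64 < M" "0 < M"
proof -
  show "var s 0 = int n" "var s (Suc 0) = int k" "var s 2 = t" "var s 3 = M" "var s 5 = 2 ^ k"
    "var s 6 = int k + 1" "1 \<le> n" "int n + int k + 8 < M" and M: "2 ^ (k + 8) < M"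
    using assms by (auto simp: rep_def constants_def)
  have "(2::int) ^ 8 \<le> 2 ^ (k + 8)" by (intro power_increasing) auto
  then show "64 < M" "0 < M" using M by simp_all
qed

lemma rep_arrs:
  assumes "rep M s" "i < n"
  shows "arr s 5 (int i) = int (kind i)" "arr s 6 (int i) = int (scale i)" "scale i \<le> k"
    "arr s 7 (int i) = al i" "arr s 8 (int i) = be i" "arr s 9 (int i) = ga i"
  using assms unfolding rep_def by auto

lemma rep_pw: "rep M s \<Longrightarrow> j \<le> k \<Longrightarrow> arr s 10 (int j) = 2 ^ j"
  unfolding rep_def by auto

lemma pw_less: "rep M s \<Longrightarrow> j \<le> k + 8 \<Longrightarrow> 2 ^ j < M"
  by (rule le_less_trans[OF power_increasing[of j "k + 8" "2::int"] rep_consts(9)]) simp_all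

lemma r_le:
  assumes "scale i \<le> k"
  shows "r m i \<le> k"
proof (cases "m \<le> scale i")
  case True
  then show ?thesis using assms unfolding r_def c_def by simp
next
  case False
  have "2 * ((m - scale i + 1) div 2) \<le> m - scale i + 1" by simp
  then show ?thesis using False k unfolding r_def c_def by linarith
qed

lemma den_coef:
  fixes q :: int
  assumes s: "rep M s" and i: "i < n" "var s 40 = int i" and m: "m \<le> k" "var s 41 = int m"
  defines "s' \<equiv> den q coef_prog s"
  shows "var s' 42 = int (c m i)" "var s' 43 = int (r m i)" "var s' 44 = 2 ^ r m i"
    "var s' 45 = int (kind i)" "var s' 46 = int (wy m i)" "var s' 47 = int (wz m i)"
proof -
  note vs = rep_consts[OF s] and as = rep_arrs[OF s i(1)]
  have c: "((int m - int (scale i)) * of_bool (int (scale i) < int m) + 1) div 2 = int (c m i)"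
    by (auto simp: c_def zdiv_int of_nat_diff)
  have cM: "int (c m i) < M" using c_le[of m i] m vs by linarith
  have r: "int (scale i) + 2 * int (c m i) - int m = int (r m i)" using c_r[of i m] by linarith
  have rM: "int (r m i) < M" using r_le[OF as(3), of m] vs by linarith
  have w: "int k - int (c m i) = int (k - c m i)" using c_le[of m i] m by simp
  have wM: "(2::int) ^ (k - c m i) < M" by (rule pw_less[OF s]) simp
  note pr = rep_pw[OF s r_le[OF as(3)], of m] and pw = rep_pw[OF s, of "k - c m i"]
  define s1 where "s1 = set_var 43 (int (r m i)) (set_var 42 (int (c m i)) s)"
  have s': "s' = set_var 47 (int (wz m i)) (set_var 46 (int (wy m i)) (set_var 45 (int (kind i)) (set_var 44 (2 ^ r m i) s1)))"
    unfolding s'_def coef_prog_def s1_def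
    using vs as i m c cM r rM wM pr pw
    by (simp add: w wy_def wz_def mod_pos_pos_trivial)
  show "var s' 42 = int (c m i)" "var s' 43 = int (r m i)" "var s' 44 = 2 ^ r m i"
    "var s' 45 = int (kind i)" "var s' 46 = int (wy m i)" "var s' 47 = int (wz m i)"
    unfolding s' by (simp_all add: s1_def)
qed

definition coefs :: "nat \<Rightarrow> nat \<Rightarrow> state \<Rightarrow> bool" where
  "coefs m i s \<longleftrightarrow> var s 40 = int i \<and> var s 42 = int (c m i) \<and> var s 43 = int (r m i) \<and>
     var s 44 = 2 ^ r m i \<and> var s 45 = int (kind i) \<and> var s 46 = int (wy m i) \<and> var s 47 = int (wz m i)"

lemma coefs_eq: "(\<And>y. 40 \<le> y \<Longrightarrow> y \<le> 47 \<Longrightarrow> var s' y = var s y) \<Longrightarrow> coefs m i s' \<longleftrightarrow> coefs m i s"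
  unfolding coefs_def by simp

lemma coefs_den:
  assumes "rep M s" "i < n" "var s 40 = int i" "m \<le> k" "var s 41 = int m"
  shows "coefs m i (den q coef_prog s)"
  using den_coef[OF assms] assms(3) by (simp add: coefs_def den_var)

lemma den_letter:
  fixes q :: int
  assumes s: "rep M s" "coefs m i s" and i: "i < n" and a: "var s 48 = int a" "a < 64"
    and st: "var s 55 = int st" "st < 32"
  defines "s' \<equiv> den q letter_prog s"
  shows "var s' 56 = int (tr m i a st)" "tr m i a st < 32"
    "var s' 53 = of_bool (r m i = 0 \<and> od i (int (a mod 8), int (a div 8)))"
proof -
  note vs = rep_consts[OF s(1)] and as = rep_arrs[OF s(1) i]
  let ?y = "int (a mod 8)" and ?z = "int (a div 8)"
  let ?v = "(2 ^ r m i * h i ?y ?z) mod 8"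
  let ?od = "od i (?y, ?z)"
  let ?V = "(int st + ?v) mod 8"
  let ?g = "odd (st div 8) \<or> r m i = 0 \<and> ?od" and ?p = "odd (st div 16) \<or> c m i = 0 \<and> ?od"
  have y: "int a mod 8 = ?y" and z: "int a div 8 = ?z" by (simp_all add: zmod_int zdiv_int)
  have h: "al i * (?y * ?y) + be i * ?y * ?z + ga i * (?z * ?z) = h i ?y ?z"
    by (simp add: h_def power2_eq_square mult.assoc)
  have od: "(0 < (1 - of_bool (int (kind i) = 2)) * (?y mod 2) + of_bool (int (kind i) = 1) * (?z mod 2)) = ?od"
    unfolding od_def fst_conv snd_conv mod_2_eq_odd
    by (cases "odd ?y"; cases "odd ?z"; rule kind_cases[OF i]) simp_all
  have bit: "(0 < (int st div int d) mod 2 + of_bool b) \<longleftrightarrow> odd (st div d) \<or> b" for d b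
    unfolding zdiv_int[symmetric] mod_2_eq_odd by (cases b) simp_all
  define s1 where "s1 = set_var 52 (of_bool ?od) (set_var 51 ?v (set_var 50 ?z (set_var 49 ?y s)))"
  define s2 where "s2 = set_var 54 (of_bool (c m i = 0 \<and> ?od)) (set_var 53 (of_bool (r m i = 0 \<and> ?od)) s1)"
  have trV: "(int (st mod 8) + 2 ^ r m i * h i ?y ?z) mod 8 = ?V" by (simp add: zmod_int mod_simps)
  have tr: "int (tr m i a st) = ?V + 8 * of_bool ?g + 16 * of_bool ?p"
    unfolding tr_def enc_def trV by (simp add: of_nat_add)
  have "0 \<le> ?V" "?V < 8" by simp_all
  then have bounds: "0 \<le> int (tr m i a st)" "int (tr m i a st) < 32" unfolding tr by (auto simp: of_bool_def)
  have "s' = set_var 56 (int (tr m i a st)) s2"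
  proof -
    note co = s(2)[unfolded coefs_def]
    have co: "var s 40 = int i" "var s 42 = int (c m i)" "var s 43 = int (r m i)" "var s 44 = 2 ^ r m i"
      "var s 45 = int (kind i)" using s(2) by (simp_all add: coefs_def)
    have eq0: "int x = 0 \<longleftrightarrow> x = 0" for x by simp
    have pos: "0 < of_bool b * (of_bool b' :: int) \<longleftrightarrow> b' \<and> b" for b b' by (cases b; cases b') simp_all
    have "den q (LAssign 49 (Var 48 mod. Lit 8) ;; LAssign 50 (Var 48 div. Lit 8) ;;
        LAssign 51 ((Var 44 *. h_expr (Var 49) (Var 50)) mod. Lit 8)) s =
        set_var 51 ?v (set_var 50 ?z (set_var 49 ?y s))"
      by (simp only: exec co a(1) as y z h)
    moreover have "den q (LAssign 52 (Lit 0 <. (Lit 1 -. (Var 45 =. Lit 2)) *. (Var 49 mod. Lit 2) +.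
       (Var 45 =. Lit 1) *. (Var 50 mod. Lit 2))) (set_var 51 ?v (set_var 50 ?z (set_var 49 ?y s))) = s1"
      by (simp only: exec co od s1_def)
    moreover have "den q (LAssign 53 (Lit 0 <. Var 52 *. (Var 43 =. Lit 0)) ;;
       LAssign 54 (Lit 0 <. Var 52 *. (Var 42 =. Lit 0))) s1 = s2"
      by (simp only: exec co s1_def s2_def pos eq0)
    moreover have "den q (LAssign 56 (capped ((Var 55 +. Var 51) mod. Lit 8 +.
       Lit 8 *. (Lit 0 <. (Var 55 div. Lit 8) mod. Lit 2 +. Var 53) +.
       Lit 16 *. (Lit 0 <. (Var 55 div. Lit 16) mod. Lit 2 +. Var 54)))) s2 = set_var 56 (int (tr m i a st)) s2"
    proof -
      have v: "var s2 55 = int st" "var s2 51 = ?v" "var s2 53 = of_bool (r m i = 0 \<and> ?od)"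
        "var s2 54 = of_bool (c m i = 0 \<and> ?od)" "var s2 3 = M"
        using st vs by (simp_all add: s2_def s1_def)
      show ?thesis
        using bit[of 8 "r m i = 0 \<and> ?od"] bit[of 16 "c m i = 0 \<and> ?od"] bounds vs(10)
        by (simp only: exec v of_nat_numeral tr[symmetric] mod_pos_pos_trivial)
    qed
    ultimately show ?thesis unfolding s'_def letter_prog_def by (simp only: den.simps(4))
  qed
  then show "var s' 56 = int (tr m i a st)" "tr m i a st < 32"
    "var s' 53 = of_bool (r m i = 0 \<and> od i (int (a mod 8), int (a div 8)))"
    using bounds by (simp_all add: s2_def)
qed

end


declare den.simps(6) [simp del]

context block_form
begin

lemma acc_expr:
  assumes s: "rep M s" and m: "m \<le> k" "var s 41 = int m" and st: "var s 55 = int st" "st < 32"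
  shows "eval q (acc_expr okay) s = of_bool (acc m st)"
proof -
  note vs = rep_consts[OF s]
  have bit: "int st div int d mod 2 = of_bool (odd (st div d))" for d
    unfolding zdiv_int[symmetric] mod_2_eq_odd by simp
  have j: "int k - int m - (int k - int m - 3) * of_bool (3 < int k - int m) = int (min 3 (k - m))"
    using m by (auto simp: min_def)
  have okay: "of_bool (okay False) * (1 - of_bool p) + of_bool (okay True) * of_bool p = (of_bool (okay p) :: int)" for p
    by (cases p) auto
  have cong: "of_bool ((int st mod 8 - t div 2 ^ m) mod 2 ^ min 3 (k - m) = 0) =
      (of_bool [int (st mod 8) = t div 2 ^ m] (mod 2 ^ min 3 (k - m)) :: int)"
    by (simp only: cong_iff_dvd_diff dvd_eq_mod_eq_0 zmod_int of_nat_numeral)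
  have good: "of_bool (0 < of_bool (int m = int k) + (of_bool (odd (st div 8)) :: int)) =
      (of_bool (m < k \<longrightarrow> odd (st div 8)) :: int)"
    using m(1) by (cases "m = k"; cases "odd (st div 8)") simp_all
  have vs1: "var s 1 = int k" using vs(2) by simp
  have 1: "eval q ((Var 2 mod. Cell 10 (Var 41)) =. Lit 0) s = of_bool (t mod 2 ^ m = 0)"
    by (simp only: exec vs m(2) rep_pw[OF s m(1)])
  have 2: "eval q (Lit 0 <. (Var 41 =. Var 1) +. (Var 55 div. Lit 8) mod. Lit 2) s =
      of_bool (m < k \<longrightarrow> odd (st div 8))"
    by (simp only: exec vs1 m(2) st(1) bit[of 8, simplified] good)
  have 3: "eval q (Lit (of_bool (okay False)) *. (Lit 1 -. (Var 55 div. Lit 16) mod. Lit 2) +.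
      Lit (of_bool (okay True)) *. ((Var 55 div. Lit 16) mod. Lit 2)) s = of_bool (okay (odd (st div 16)))"
    by (simp only: exec st(1) bit[of 16, simplified] okay)
  have pw_min: "arr s 10 (int (min 3 (k - m))) = 2 ^ min 3 (k - m)" by (rule rep_pw[OF s]) simp
  have 4: "eval q (((Var 55 mod. Lit 8 -. Var 2 div. Cell 10 (Var 41)) mod.
       Cell 10 (Var 1 -. Var 41 -. (Var 1 -. Var 41 -. Lit 3) *. (Lit 3 <. Var 1 -. Var 41))) =. Lit 0) s =
      of_bool [int (st mod 8) = t div 2 ^ m] (mod 2 ^ min 3 (k - m))"
    unfolding cong[symmetric] eval.simps apply_binop.simps vs1 vs(3) m(2) st(1) j pw_min rep_pw[OF s m(1)] ..
  have "eval q (acc_expr okay) s =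
      of_bool (t mod 2 ^ m = 0) * of_bool (m < k \<longrightarrow> odd (st div 8)) * of_bool (okay (odd (st div 16))) *
      of_bool [int (st mod 8) = t div 2 ^ m] (mod 2 ^ min 3 (k - m))"
    unfolding 1[symmetric] 2[symmetric] 3[symmetric] 4[symmetric] acc_expr_def by (simp only: eval.simps(4) apply_binop.simps(3))
  then show ?thesis by (simp only: acc_def dvd_eq_mod_eq_0 of_bool_conj mult.assoc)
qed

lemma words_from_le: "words_from m i st \<le> 64 ^ (n - i)"
proof -
  have "cnt (acc m) (tr m) is st \<le> 64 ^ length is" for "is"
  proof (induction "is" arbitrary: st)
    case (Cons i "is")
    have "(\<Sum>a<64. cnt (acc m) (tr m) is (tr m i a st)) \<le> (\<Sum>a<(64::nat). 64 ^ length is)"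
      using Cons by (intro sum_mono) auto
    then show ?case by simp
  qed simp
  from this[of "[i..<n]"] show ?thesis by simp
qed

lemma words_less:
  assumes "rep M s"
  shows "int (words_from m i st) < M"
proof -
  have "words_from m i st \<le> 64 ^ n"
    by (rule order.trans[OF words_from_le power_increasing]) simp_all
  then have "int (words_from m i st) \<le> 64 ^ n" by (metis of_nat_le_iff of_nat_numeral of_nat_power)
  also have "\<dots> \<le> 64 ^ n * 2 ^ (2 * k + 2 * k * n)" by simp
  also have "\<dots> < M" using assms by (simp add: rep_def)
  finally show ?thesis .
qed

lemma words_from_step: "i < n \<Longrightarrow> words_from m i st = (\<Sum>a<64. words_from m (Suc i) (tr m i a st))"
  by (simp add: upt_conv_Cons)

text \<open>The first claim is a fixed point equation: storing the count into its cell changes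
  nothing, that is, the cell contains it.\<close>

lemma den_row_sum:
  assumes s: "rep M s" "coefs m i s" and i: "i < n" and st: "var s 55 = int st" "st < 32"
    and tab: "\<And>st. st < 32 \<Longrightarrow> arr s 11 (32 * (int i + 1) + int st) = int (words_from m (Suc i) st)"
  shows "den q row_sum_prog s = set_cell 11 (32 * int i + int st) (int (words_from m i st)) (den q row_sum_prog s)"
    and "\<And>l. l \<noteq> 32 * int i + int st \<Longrightarrow> arr (den q row_sum_prog s) 11 l = arr s 11 l"
proof -
  define body where "body = letter_prog ;;
       LAssign 58 (capped (Var 58 +. Cell 11 (Lit 32 *. (Var 40 +. Lit 1) +. Var 56)))"
  define s1 where "s1 = den q (LFor 48 (Lit 64) body) (set_var 58 0 s)"
  define I where "I l u \<longleftrightarrow> var u 58 = int (\<Sum>a<l. words_from m (Suc i) (tr m i a st))" for l and u :: state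
  have "I 64 s1"
    unfolding s1_def
  proof (rule den_For)
    show "I 0 (set_var 48 0 (set_var 58 0 s))" by (simp add: I_def)
    fix a u
    assume a: "a < 64" and I: "I a u" and a': "var u 48 = int a"
      and v: "\<And>y. y \<noteq> 48 \<Longrightarrow> y \<notin> wvars body \<Longrightarrow> var u y = var (set_var 58 0 s) y"
      and ar: "\<And>x. x \<notin> warrs body \<Longrightarrow> arr u x = arr (set_var 58 0 s) x"
    have u: "rep M u" using s(1) v ar by (subst rep_eq[of _ s]) (auto simp: body_def)
    have co: "coefs m i u" using s(2) v by (subst coefs_eq[of _ s]) (auto simp: body_def)
    have u': "var u 40 = int i" "arr u 11 = arr s 11" "var u 55 = int st"
      using v ar st s(2) by (auto simp: body_def coefs_def)
    define u1 where "u1 = den q letter_prog u"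
    have u1: "var u1 56 = int (tr m i a st)" "tr m i a st < 32"
      using den_letter[OF u co i a' a u'(3) st(2)] by (auto simp: u1_def)
    have u1': "var u1 58 = var u 58" "var u1 40 = int i" "arr u1 11 = arr s 11" "var u1 3 = M"
      using u' rep_consts(4)[OF u] by (simp_all add: u1_def den_var den_arr)
    have le: "(\<Sum>a<Suc a. words_from m (Suc i) (tr m i a st)) \<le> words_from m i st"
      unfolding words_from_step[OF i, of m st] using a by (intro sum_lessThan_le) simp
    then have "int (\<Sum>a<Suc a. words_from m (Suc i) (tr m i a st)) < M"
      using words_less[OF s(1), of m i st] by linarith
    then have mod: "int (\<Sum>a<Suc a. words_from m (Suc i) (tr m i a st)) mod M =
        int (\<Sum>a<Suc a. words_from m (Suc i) (tr m i a st))"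
      by (rule mod_pos_pos_trivial[OF of_nat_0_le_iff])
    have "den q body u = set_var 58 (int (\<Sum>a<Suc a. words_from m (Suc i) (tr m i a st))) u1"
      using I tab[OF u1(2)] u1 u1' mod unfolding body_def den.simps(4) u1_def[symmetric]
      by (simp add: I_def algebra_simps)
    then show "I (Suc a) (set_var 48 (int (Suc a)) (den q body u))" by (simp add: I_def)
  qed (auto simp: body_def)
  then have s1: "var s1 58 = int (words_from m i st)" by (simp add: I_def words_from_step[OF i])
  have s1': "var s1 40 = int i" "var s1 55 = int st" "arr s1 11 = arr s 11"
    using s(2) st by (simp_all add: s1_def body_def den_var den_arr coefs_def)
  have "den q row_sum_prog s = set_cell 11 (32 * int i + int st) (int (words_from m i st)) s1"
    using s1 s1' by (simp add: row_sum_prog_def body_def[symmetric] s1_def[symmetric])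
  then show "den q row_sum_prog s = set_cell 11 (32 * int i + int st) (int (words_from m i st)) (den q row_sum_prog s)"
    and "\<And>l. l \<noteq> 32 * int i + int st \<Longrightarrow> arr (den q row_sum_prog s) 11 l = arr s 11 l"
    using s1' by (auto simp: set_cell_def fun_eq_iff)
qed

lemma den_table:
  assumes s: "rep M s" and m: "m \<le> k" "var s 41 = int m"
  shows "\<forall>i\<le>n. \<forall>st<32. arr (den q (table_prog okay) s) 11 (32 * int i + int st) = int (words_from m i st)"
proof -
  define last where "last = LStore 11 (Lit 32 *. Var 0 +. Var 55) (capped (acc_expr okay))"
  define body where "body = LAssign 40 (capped (Var 0 -. Lit 1 -. Var 57)) ;; coef_prog ;;
       LFor 55 (Lit 32) row_sum_prog"
  define s1 where "s1 = den q (LFor 55 (Lit 32) last) s"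
  define F where "F i u \<longleftrightarrow> (\<forall>st<32. arr u 11 (32 * int i + int st) = int (words_from m i st))"
    for i and u :: state
  define I where "I l u \<longleftrightarrow> (\<forall>st<l. arr u 11 (32 * int n + int st) = int (words_from m n st))" for l and u :: state
  have "I 32 s1"
    unfolding s1_def
  proof (rule den_For)
    fix st u
    assume st: "st < 32" and I: "I st u" and st': "var u 55 = int st"
      and v: "\<And>y. y \<noteq> 55 \<Longrightarrow> y \<notin> wvars last \<Longrightarrow> var u y = var s y"
      and ar: "\<And>x. x \<notin> warrs last \<Longrightarrow> arr u x = arr s x"
    have u: "rep M u" using s v ar by (subst rep_eq[of _ s]) (auto simp: last_def)
    have u': "var u 41 = int m" using v m by (simp add: last_def)
    have "of_bool (acc m st) mod M = int (words_from m n st)" using rep_consts(10)[OF s] by simp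
    then have "den q last u = set_cell 11 (32 * int n + int st) (int (words_from m n st)) u"
      using rep_consts(1,4)[OF u] by (simp add: last_def acc_expr[OF u m(1) u' st' st] st')
    then show "I (Suc st) (set_var 55 (int (Suc st)) (den q last u))"
      using I by (auto simp: I_def less_Suc_eq)
  qed (auto simp: I_def last_def)
  then have F1: "F n s1" by (simp add: I_def F_def)
  have r1: "rep M s1" using s by (simp add: s1_def last_def)
  have m1: "var s1 41 = int m" using m by (simp add: s1_def last_def den_var)
  define J where "J l u \<longleftrightarrow> (\<forall>i. n - l \<le> i \<and> i \<le> n \<longrightarrow> F i u)" for l u
  have "J n (den q (LFor 57 (Var 0) body) s1)"
  proof (rule den_For)
    show "J 0 (set_var 57 0 s1)" using F1 by (auto simp: J_def F_def)
    fix l u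
    assume l: "l < n" and J: "J l u" and l': "var u 57 = int l"
      and v: "\<And>y. y \<noteq> 57 \<Longrightarrow> y \<notin> wvars body \<Longrightarrow> var u y = var s1 y"
      and ar: "\<And>x. x \<notin> warrs body \<Longrightarrow> arr u x = arr s1 x"
    define i where "i = n - 1 - l"
    have i: "i < n" "Suc i = n - l" using l by (auto simp: i_def)
    have u: "rep M u" using r1 v ar by (subst rep_eq[of _ s1]) (auto simp: body_def)
    have u': "var u 41 = int m" using v m1 by (simp add: body_def)
    define u1 where "u1 = set_var 40 (int i) u"
    have "int n - 1 - int l = int i" "int i < M" using l rep_consts(8)[OF u] i by (auto simp: i_def)
    then have d1: "den q (LAssign 40 (capped (Var 0 -. Lit 1 -. Var 57))) u = u1"
      using rep_consts(1,4)[OF u] l' by (simp add: u1_def)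
    define u2 where "u2 = den q coef_prog u1"
    have u1r: "rep M u1" "var u1 40 = int i" "var u1 41 = int m" using u u' by (simp_all add: u1_def)
    have u2: "rep M u2" "coefs m i u2"
      using u1r coefs_den[OF u1r(1) i(1) u1r(2) m(1) u1r(3), of q] by (simp_all add: u2_def)
    have a2: "arr u2 11 = arr u 11" by (simp add: u2_def u1_def den_arr)
    have Fu: "F j u2" if "n - l \<le> j" "j \<le> n" for j using J that a2 by (auto simp: J_def F_def)
    define I2 where "I2 x w \<longleftrightarrow> (\<forall>j. Suc i \<le> j \<and> j \<le> n \<longrightarrow> F j w) \<and>
        (\<forall>st<x. arr w 11 (32 * int i + int st) = int (words_from m i st))" for x w
    have I2: "I2 32 (den q (LFor 55 (Lit 32) row_sum_prog) u2)"
    proof (rule den_For)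
      show "I2 0 (set_var 55 0 u2)" using Fu i by (auto simp: I2_def F_def)
      fix st w
      assume st: "st < 32" and I: "I2 st w" and st': "var w 55 = int st"
        and v: "\<And>y. y \<noteq> 55 \<Longrightarrow> y \<notin> wvars row_sum_prog \<Longrightarrow> var w y = var u2 y"
        and ar: "\<And>x. x \<notin> warrs row_sum_prog \<Longrightarrow> arr w x = arr u2 x"
      have w: "rep M w" using u2(1) v ar by (subst rep_eq[of _ u2]) auto
      have co: "coefs m i w" using u2(2) v by (subst coefs_eq[of _ u2]) auto
      have tab: "arr w 11 (32 * (int i + 1) + int st) = int (words_from m (Suc i) st)" if "st < 32" for st
        using I i(1) that by (auto simp: I2_def F_def add.commute)
      note d = den_row_sum[OF w co i(1) st' st tab, where q = q]
      have new: "arr (den q row_sum_prog w) 11 (32 * int i + int st) = int (words_from m i st)"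
        by (subst d(1)) simp_all
      have "F j (den q row_sum_prog w)" if j: "Suc i \<le> j" "j \<le> n" for j
        unfolding F_def
      proof (intro allI impI)
        fix st' :: nat assume "st' < 32"
        have "32 * int j + int st' \<noteq> 32 * int i + int st" using j st by linarith
        then show "arr (den q row_sum_prog w) 11 (32 * int j + int st') = int (words_from m j st')"
          using d(2) I j \<open>st' < 32\<close> by (auto simp: I2_def F_def)
      qed
      moreover have "arr (den q row_sum_prog w) 11 (32 * int i + int st') = int (words_from m i st')"
        if "st' < Suc st" for st'
        using d(2)[of "32 * int i + int st'"] new I that by (cases "st' = st") (auto simp: I2_def)
      ultimately show "I2 (Suc st) (set_var 55 (int (Suc st)) (den q row_sum_prog w))"
        by (auto simp: I2_def F_def)
    qed auto
    have "J (Suc l) (den q (LFor 55 (Lit 32) row_sum_prog) u2)"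
    proof -
      have "F j (den q (LFor 55 (Lit 32) row_sum_prog) u2)" if "n - Suc l \<le> j" "j \<le> n" for j
      proof (cases "j = i")
        case True
        then show ?thesis using I2 unfolding I2_def F_def by blast
      next
        case False
        then have "Suc i \<le> j" using that i by linarith
        then show ?thesis using I2 that unfolding I2_def by blast
      qed
      then show ?thesis unfolding J_def by blast
    qed
    then show "J (Suc l) (set_var 57 (int (Suc l)) (den q body u))"
      unfolding body_def den.simps(4) d1 u2_def[symmetric] by (auto simp: J_def F_def)
  qed (use rep_consts(1)[OF r1] in \<open>auto simp: body_def\<close>)
  then show ?thesis
    unfolding table_prog_def body_def[symmetric] last_def[symmetric] den.simps(4) s1_def[symmetric]
    by (auto simp: J_def F_def)
qed

end


section \<open>Weights of the levels and unranking of a word\<close>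

definition total_prog :: "(bool \<Rightarrow> bool) \<Rightarrow> lprog" where
  "total_prog okay = LAssign 60 (Lit 0) ;; LFor 41 (Var 6)
     (table_prog okay ;;
      LAssign 59 (Cell 10 (Var 1 -. (Var 1 -. Var 41 -. Lit 3) *. (Lit 3 <. Var 1 -. Var 41))) ;;
      LFor 40 (Var 0) (coef_prog ;; LAssign 59 (capped (Var 59 *. (Var 46 *. Var 47)))) ;;
      LStore 12 (Var 41) (capped (Cell 11 (Lit 0) *. Var 59)) ;;
      LAssign 60 (capped (Var 60 +. Cell 12 (Var 41))))"

text \<open>\<open>pick\<close> by repeated subtraction. Variable 62 freezes the result once it is
  found, as loops run to their end.\<close>

definition level_prog :: lprog where
  "level_prog = LAssign 62 (Lit 0) ;; LFor 63 (Var 6) (LIf (Var 62 =. Lit 0)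
     (LIf (Var 61 <. Cell 12 (Var 63)) (LAssign 41 (Var 63) ;; LAssign 62 (Lit 1))
       (LAssign 61 (capped (Var 61 -. Cell 12 (Var 63))))) LSkip)"

definition pick_letter_prog :: lprog where
  "pick_letter_prog = LAssign 62 (Lit 0) ;; LFor 48 (Lit 64) (LIf (Var 62 =. Lit 0)
     (letter_prog ;; LAssign 68 (Cell 11 (Lit 32 *. (Var 40 +. Lit 1) +. Var 56)) ;;
      LIf (Var 65 <. Var 68)
        (LAssign 69 (Var 48) ;; LAssign 70 (Var 56) ;; LAssign 71 (Var 53) ;; LAssign 62 (Lit 1))
        (LAssign 65 (capped (Var 65 -. Var 68)))) LSkip)"

text \<open>Variable 66 is the number read in mixed radix. Variable 67, initially \<open>-1\<close>,
  keeps the first index with a good pair, which is the pivot of the word.\<close>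

definition digit_prog :: lprog where
  "digit_prog = LAssign 55 (Var 70) ;;
     LStore 14 (Var 40) (capped (Var 69 mod. Lit 8 +. Lit 8 *. (Var 66 mod. Var 46))) ;;
     LAssign 66 (Var 66 div. Var 46) ;;
     LStore 15 (Var 40) (capped (Var 69 div. Lit 8 +. Lit 8 *. (Var 66 mod. Var 47))) ;;
     LAssign 66 (Var 66 div. Var 47) ;;
     LIf ((Var 67 <. Lit 0) *. Var 71) (LAssign 67 (Var 40)) LSkip"

definition word_prog :: lprog where
  "word_prog = LAssign 64 (Cell 11 (Lit 0)) ;; LAssign 65 (capped (Var 61 mod. Var 64)) ;;
     LAssign 66 (Var 61 div. Var 64) ;; LAssign 55 (Lit 0) ;; LAssign 67 (Lit (- 1)) ;;
     LFor 40 (Var 0) (coef_prog ;; pick_letter_prog ;; digit_prog)"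

lemma writes_decode1 [simp]:
  "warrs (total_prog okay) = {11, 12}" "wvars level_prog = {41, 61, 62, 63}" "warrs level_prog = {}"
  "wvars (total_prog okay) = {40, 41, 42, 43, 44, 45, 46, 47, 48, 49, 50, 51, 52, 53, 54, 55, 56, 57, 58, 59, 60}"
  "wvars pick_letter_prog = {48, 49, 50, 51, 52, 53, 54, 56, 62, 65, 68, 69, 70, 71}"
  "warrs pick_letter_prog = {}"
  "wvars digit_prog = {55, 66, 67}" "warrs digit_prog = {14, 15}"
  "wvars word_prog = {40, 42, 43, 44, 45, 46, 47, 48, 49, 50, 51, 52, 53, 54, 55, 56, 62, 64, 65, 66, 67, 68, 69, 70, 71}"
  "warrs word_prog = {14, 15}"
  by (auto simp: total_prog_def level_prog_def pick_letter_prog_def digit_prog_def word_prog_def)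

context block_form
begin

lemma w_le: "wy m i \<le> 2 ^ k" "wz m i \<le> 2 ^ k"
  by (simp_all add: wy_def wz_def)

lemma partial_refinements_le:
  "i \<le> n \<Longrightarrow> 2 ^ min k (m + 3) * (\<Prod>j<i. wy m j * wz m j) \<le> 2 ^ (k + 2 * k * n)"
proof -
  assume i: "i \<le> n"
  have "(\<Prod>j<i. wy m j * wz m j) \<le> (\<Prod>j<i. 2 ^ k * 2 ^ k)"
    using mult_le_mono[OF w_le] by (intro prod_mono) simp
  also have "\<dots> = 2 ^ (2 * k * i)" by (simp add: power_add[symmetric] power_mult[symmetric] mult_2)
  also have "\<dots> \<le> (2::nat) ^ (2 * k * n)" using i by (intro power_increasing) auto
  finally have "2 ^ min k (m + 3) * (\<Prod>j<i. wy m j * wz m j) \<le> 2 ^ k * 2 ^ (2 * k * n)"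
    by - (rule mult_le_mono[OF power_increasing], simp_all)
  then show ?thesis by (simp add: power_add)
qed

lemma weight_le: "weight m \<le> 64 ^ n * 2 ^ (k + 2 * k * n)"
  unfolding weight_def refinements_def
  using mult_le_mono[OF words_from_le[of m 0 0] partial_refinements_le[of n m]] by simp

text \<open>The second factor \<open>2 ^ k\<close> in the bound pays for the \<open>k + 1\<close>
  levels.\<close>

lemma sum_weight_less:
  assumes "rep M s" "j \<le> Suc k"
  shows "int (sum weight {..<j}) < M"
proof -
  have "sum weight {..<j} \<le> (\<Sum>m<j. 64 ^ n * 2 ^ (k + 2 * k * n))" by (intro sum_mono weight_le)
  also have "\<dots> = j * (64 ^ n * 2 ^ (k + 2 * k * n))" by simp
  also have "\<dots> \<le> 2 ^ k * (64 ^ n * 2 ^ (k + 2 * k * n))"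
  proof (rule mult_le_mono1)
    have "Suc k \<le> 2 ^ k" using less_exp[of k] by (simp add: Suc_le_eq)
    then show "j \<le> 2 ^ k" using assms(2) by simp
  qed
  also have "\<dots> = 64 ^ n * 2 ^ (2 * k + 2 * k * n)" by (simp add: power_add mult_2)
  finally have "int (sum weight {..<j}) \<le> int (64 ^ n * 2 ^ (2 * k + 2 * k * n))"
    by (rule of_nat_mono)
  then show ?thesis using assms(1) by (simp add: rep_def)
qed

lemma partial_refinements_less:
  assumes "rep M s" "i \<le> n"
  shows "int (2 ^ min k (m + 3) * (\<Prod>j<i. wy m j * wz m j)) < M"
proof -
  have "2 ^ min k (m + 3) * (\<Prod>j<i. wy m j * wz m j) \<le> 1 * 2 ^ (k + 2 * k * n)"
    using partial_refinements_le[OF assms(2)] by simp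
  also have "\<dots> \<le> 64 ^ n * 2 ^ (2 * k + 2 * k * n)"
    by (rule mult_le_mono[OF _ power_increasing]) simp_all
  finally have "int (2 ^ min k (m + 3) * (\<Prod>j<i. wy m j * wz m j)) \<le> int (64 ^ n * 2 ^ (2 * k + 2 * k * n))"
    by (rule of_nat_mono)
  also have "\<dots> < M" using assms(1) by (simp add: rep_def)
  finally show ?thesis .
qed

lemma den_total:
  assumes s: "rep M s"
  defines "s' \<equiv> den (2 ^ k) (total_prog okay) s"
  shows "\<forall>m\<le>k. arr s' 12 (int m) = int (weight m)" "var s' 60 = int (sum weight {..k})"
proof -
  let ?q = "2 ^ k :: int"
  define refine where "refine = coef_prog ;; LAssign 59 (capped (Var 59 *. (Var 46 *. Var 47)))"
  define body where "body = table_prog okay ;;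
      LAssign 59 (Cell 10 (Var 1 -. (Var 1 -. Var 41 -. Lit 3) *. (Lit 3 <. Var 1 -. Var 41))) ;;
      LFor 40 (Var 0) refine ;;
      LStore 12 (Var 41) (capped (Cell 11 (Lit 0) *. Var 59)) ;;
      LAssign 60 (capped (Var 60 +. Cell 12 (Var 41)))"
  define I where "I l u \<longleftrightarrow> (\<forall>m<l. arr u 12 (int m) = int (weight m)) \<and> var u 60 = int (sum weight {..<l})"
    for l and u :: state
  have "I (Suc k) (den ?q (LFor 41 (Var 6) body) (set_var 60 0 s))"
  proof (rule den_For)
    show "Suc k = nat (eval ?q (Var 6) (set_var 60 0 s))" using rep_consts(6)[OF s] by simp
    show "I 0 (set_var 41 0 (set_var 60 0 s))" by (simp add: I_def)
    fix m u
    assume m: "m < Suc k" and I: "I m u" and m': "var u 41 = int m"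
      and v: "\<And>y. y \<noteq> 41 \<Longrightarrow> y \<notin> wvars body \<Longrightarrow> var u y = var (set_var 60 0 s) y"
      and ar: "\<And>x. x \<notin> warrs body \<Longrightarrow> arr u x = arr (set_var 60 0 s) x"
    have u: "rep M u" using s v ar by (subst rep_eq[of _ s]) (auto simp: body_def refine_def)
    have mk: "m \<le> k" using m by simp
    define u1 where "u1 = den ?q (table_prog okay) u"
    define R where "R i = 2 ^ min k (m + 3) * (\<Prod>j<i. wy m j * wz m j)" for i
    define u2 where "u2 = set_var 59 (int (R 0)) u1"
    define u3 where "u3 = den ?q (LFor 40 (Var 0) refine) u2"
    have u1: "rep M u1" "var u1 41 = int m" "arr u1 12 = arr u 12" "var u1 60 = var u 60"
      "arr u1 11 0 = int (words_from m 0 0)"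
      using u m' den_table[OF u mk m', of ?q, THEN spec[of _ 0]]
      by (auto simp: u1_def den_var den_arr dest!: spec[of _ 0])
    have idx: "int k - (int k - int m - 3) * of_bool (3 < int k - int m) = int (min k (m + 3))"
    proof -
      have "3 < int k - int m \<longleftrightarrow> 3 < k - m" using mk by linarith
      then show ?thesis using mk by (cases "3 < k - m") simp_all
    qed
    have step2: "den ?q (LAssign 59 (Cell 10 (Var 1 -. (Var 1 -. Var 41 -. Lit 3) *. (Lit 3 <. Var 1 -. Var 41)))) u1 = u2"
      using rep_consts(2)[OF u1(1)] u1(2) idx rep_pw[OF u1(1), of "min k (m + 3)"]
      by (simp add: u2_def R_def)
    define J where "J i w \<longleftrightarrow> var w 59 = int (R i)" for i and w :: state
    have "J n u3"
      unfolding u3_def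
    proof (rule den_For)
      show "J 0 (set_var 40 0 u2)" by (simp add: J_def u2_def)
      fix i w
      assume i: "i < n" and J: "J i w" and i': "var w 40 = int i"
        and v: "\<And>y. y \<noteq> 40 \<Longrightarrow> y \<notin> wvars refine \<Longrightarrow> var w y = var u2 y"
        and ar: "\<And>x. x \<notin> warrs refine \<Longrightarrow> arr w x = arr u2 x"
      have w: "rep M w" using u1(1) v ar by (subst rep_eq[of _ u1]) (auto simp: refine_def u2_def)
      have w': "var w 41 = int m" using v u1(2) by (simp add: refine_def u2_def)
      define w1 where "w1 = den ?q coef_prog w"
      have co: "coefs m i w1" unfolding w1_def by (rule coefs_den[OF w i i' mk w'])
      have w1: "var w1 59 = int (R i)" "var w1 3 = M" "var w1 46 = int (wy m i)" "var w1 47 = int (wz m i)"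
        using J co rep_consts(4)[OF w] by (simp_all add: w1_def den_var J_def coefs_def)
      have "int (R (Suc i)) < M" unfolding R_def by (rule partial_refinements_less[OF w]) (use i in simp)
      then have md: "int (R (Suc i)) mod M = int (R (Suc i))" by (rule mod_pos_pos_trivial[OF of_nat_0_le_iff])
      have "int (R i) * (int (wy m i) * int (wz m i)) = int (R (Suc i))" by (simp add: R_def)
      then have "den ?q refine w = set_var 59 (int (R (Suc i))) w1"
        unfolding refine_def den.simps(4) w1_def[symmetric] by (simp only: exec w1 md)
      then show "J (Suc i) (set_var 40 (int (Suc i)) (den ?q refine w))" by (simp add: J_def)
    qed (use rep_consts(1)[OF u1(1)] in \<open>auto simp: refine_def u2_def\<close>)
    then have u3: "var u3 59 = int (refinements m)" by (simp add: J_def R_def refinements_def)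
    have u3': "var u3 41 = int m" "var u3 60 = var u 60" "arr u3 12 = arr u 12"
      "arr u3 11 0 = int (words_from m 0 0)" "var u3 3 = M"
      using u1 rep_consts(4)[OF u1(1)] by (simp_all add: u3_def u2_def refine_def den_var den_arr)
    have sumM: "int (sum weight {..<Suc m}) < M" by (rule sum_weight_less[OF s]) (use mk in simp)
    then have md: "int (sum weight {..<Suc m}) mod M = int (sum weight {..<Suc m})"
      by (rule mod_pos_pos_trivial[OF of_nat_0_le_iff])
    have "int (weight m) \<le> int (sum weight {..<Suc m})" unfolding of_nat_le_iff by simp
    then have "int (weight m) < M" using sumM by linarith
    then have md': "int (weight m) mod M = int (weight m)" by (rule mod_pos_pos_trivial[OF of_nat_0_le_iff])
    have wt: "int (words_from m 0 0) * int (refinements m) = int (weight m)" by (simp add: weight_def)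
    have sm: "int (sum weight {..<m}) + int (weight m) = int (sum weight {..<Suc m})" by simp
    have d: "den ?q body u = set_var 60 (int (sum weight {..<Suc m})) (set_cell 12 (int m) (int (weight m)) u3)"
      unfolding body_def den.simps(4) u1_def[symmetric] step2 u3_def[symmetric]
      using I by (simp only: exec u3 u3' wt md md' sm I_def arr_set_cell HOL.refl)
    show "I (Suc m) (set_var 41 (int (Suc m)) (den ?q body u))"
      unfolding d using I u3' by (auto simp: I_def less_Suc_eq)
  qed (simp add: body_def refine_def)
  then have "I (Suc k) s'"
    unfolding s'_def total_prog_def refine_def[symmetric] body_def[symmetric] by simp
  then show "\<forall>m\<le>k. arr s' 12 (int m) = int (weight m)" "var s' 60 = int (sum weight {..k})"
    by (auto simp: I_def lessThan_Suc_atMost)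
qed

lemma den_level:
  fixes q :: int
  assumes s: "rep M s" and W: "\<And>m. m \<le> k \<Longrightarrow> arr s 12 (int m) = int (weight m)"
    and x: "var s 61 = int x" "x < sum weight {..k}"
  defines "m \<equiv> pick weight x" and "s' \<equiv> den q level_prog s"
  shows "m \<le> k" "var s' 41 = int m" "var s' 61 = int (x - sum weight {..<m})"
    "x - sum weight {..<m} < weight m"
proof -
  have x': "x < sum weight {..<Suc k}" using x(2) by (simp add: lessThan_Suc_atMost)
  note p = pick[OF x', folded m_def]
  show "m \<le> k" "x - sum weight {..<m} < weight m" using p by auto
  define body where "body = LIf (Var 62 =. Lit 0)
     (LIf (Var 61 <. Cell 12 (Var 63)) (LAssign 41 (Var 63) ;; LAssign 62 (Lit 1))
       (LAssign 61 (capped (Var 61 -. Cell 12 (Var 63))))) LSkip"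
  have xM: "int x < M" using sum_weight_less[OF s, of "Suc k"] x' by linarith
  define I where "I l u \<longleftrightarrow> (var u 62 = 0 \<and> sum weight {..<l} \<le> x \<and> var u 61 = int (x - sum weight {..<l})) \<or>
      (var u 62 = 1 \<and> m < l \<and> var u 41 = int m \<and> var u 61 = int (x - sum weight {..<m}))"
    for l and u :: state
  have "I (Suc k) (den q (LFor 63 (Var 6) body) (set_var 62 0 s))"
  proof (rule den_For)
    show "Suc k = nat (eval q (Var 6) (set_var 62 0 s))" using rep_consts(6)[OF s] by simp
    show "I 0 (set_var 63 0 (set_var 62 0 s))" using x by (simp add: I_def)
    fix l u
    assume l: "l < Suc k" and I: "I l u" and l': "var u 63 = int l"
      and v: "\<And>y. y \<noteq> 63 \<Longrightarrow> y \<notin> wvars body \<Longrightarrow> var u y = var (set_var 62 0 s) y"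
      and ar: "\<And>x. x \<notin> warrs body \<Longrightarrow> arr u x = arr (set_var 62 0 s) x"
    have u: "arr u 12 (int l) = int (weight l)" "var u 3 = M"
      using v ar W l rep_consts(4)[OF s] by (auto simp: body_def)
    show "I (Suc l) (set_var 63 (int (Suc l)) (den q body u))"
    proof (cases "var u 62 = 0")
      case False
      then show ?thesis using I by (auto simp: I_def body_def)
    next
      case True
      then have r: "sum weight {..<l} \<le> x" "var u 61 = int (x - sum weight {..<l})" using I by (auto simp: I_def)
      define d where "d = x - sum weight {..<l}"
      have u61: "var u 61 = int d" using r(2) by (simp only: d_def)
      show ?thesis
      proof (cases "d < weight l")
        case True
        then have "m = l" unfolding m_def using r(1) by (intro pick_eq) (auto simp: d_def)
        moreover have "den q body u = set_var 62 1 (set_var 41 (int l) u)"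
          using True u61 u l' \<open>var u 62 = 0\<close> by (simp add: body_def)
        ultimately show ?thesis using r by (simp add: I_def)
      next
        case False
        have "int d - int (weight l) = int (d - weight l)" using False by simp
        moreover have "int (d - weight l) mod M = int (d - weight l)"
          using xM by (intro mod_pos_pos_trivial) (auto simp: d_def)
        ultimately have "den q body u = set_var 61 (int (d - weight l)) u"
          using False u61 u l' \<open>var u 62 = 0\<close> by (simp add: body_def del: of_nat_diff)
        moreover have "d - weight l = x - sum weight {..<Suc l}" "sum weight {..<Suc l} \<le> x"
          using False r(1) by (simp_all add: d_def)
        ultimately show ?thesis using True unfolding I_def by simp
      qed
    qed
  qed (simp add: body_def)
  then have "I (Suc k) s'" unfolding s'_def level_prog_def body_def[symmetric] by simp
  moreover have "\<not> sum weight {..<Suc k} \<le> x" using x' by simp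
  ultimately show "var s' 41 = int m" "var s' 61 = int (x - sum weight {..<m})" unfolding I_def by blast+
qed

lemma den_pick_letter:
  fixes q :: int
  assumes s: "rep M s" "coefs m i s" and i: "i < n" and st: "var s 55 = int st" "st < 32"
    and tab: "\<And>st. st < 32 \<Longrightarrow> arr s 11 (32 * (int i + 1) + int st) = int (words_from m (Suc i) st)"
    and x: "var s 65 = int x" "x < words_from m i st"
  defines "f \<equiv> \<lambda>a. words_from m (Suc i) (tr m i a st)"
  defines "a \<equiv> pick f x" and "s' \<equiv> den q pick_letter_prog s"
  shows "a < 64" "var s' 65 = int (x - sum f {..<a})" "var s' 69 = int a" "var s' 70 = int (tr m i a st)"
    "var s' 71 = of_bool (r m i = 0 \<and> od i (int (a mod 8), int (a div 8)))"
    "tr m i a st < 32" "x - sum f {..<a} < f a"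
proof -
  have x': "x < sum f {..<64}" using x(2) unfolding words_from_step[OF i, of m st] f_def .
  note p = pick[OF x', folded a_def]
  show "a < 64" "x - sum f {..<a} < f a" using p by auto
  define body where "body = LIf (Var 62 =. Lit 0)
     (letter_prog ;; LAssign 68 (Cell 11 (Lit 32 *. (Var 40 +. Lit 1) +. Var 56)) ;;
      LIf (Var 65 <. Var 68)
        (LAssign 69 (Var 48) ;; LAssign 70 (Var 56) ;; LAssign 71 (Var 53) ;; LAssign 62 (Lit 1))
        (LAssign 65 (capped (Var 65 -. Var 68)))) LSkip"
  have xM: "int x < M" using words_less[OF s(1), of m i st] x(2) by linarith
  define G where "G u \<longleftrightarrow> var u 69 = int a \<and> var u 70 = int (tr m i a st) \<and>
      var u 71 = of_bool (r m i = 0 \<and> od i (int (a mod 8), int (a div 8))) \<and> tr m i a st < 32 \<and>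
      var u 65 = int (x - sum f {..<a})" for u :: state
  define I where "I l u \<longleftrightarrow> (var u 62 = 0 \<and> sum f {..<l} \<le> x \<and> var u 65 = int (x - sum f {..<l})) \<or>
      (var u 62 = 1 \<and> G u)" for l and u :: state
  have "I 64 (den q (LFor 48 (Lit 64) body) (set_var 62 0 s))"
  proof (rule den_For)
    show "I 0 (set_var 48 0 (set_var 62 0 s))" using x by (simp add: I_def)
    fix l u
    assume l: "l < 64" and I: "I l u" and l': "var u 48 = int l"
      and v: "\<And>y. y \<noteq> 48 \<Longrightarrow> y \<notin> wvars body \<Longrightarrow> var u y = var (set_var 62 0 s) y"
      and ar: "\<And>x. x \<notin> warrs body \<Longrightarrow> arr u x = arr (set_var 62 0 s) x"
    show "I (Suc l) (set_var 48 (int (Suc l)) (den q body u))"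
    proof (cases "var u 62 = 0")
      case False
      then show ?thesis using I by (auto simp: I_def G_def body_def)
    next
      case True
      then have r: "sum f {..<l} \<le> x" "var u 65 = int (x - sum f {..<l})" using I by (auto simp: I_def)
      have u: "rep M u" using s(1) v ar by (subst rep_eq[of _ s]) (auto simp: body_def)
      have co: "coefs m i u" using s(2) v by (subst coefs_eq[of _ s]) (auto simp: body_def)
      have u': "var u 55 = int st" "arr u 11 = arr s 11" using v ar st by (auto simp: body_def)
      define u1 where "u1 = den q letter_prog u"
      note dl = den_letter(1)[OF u co i l' l u'(1) st(2), where q = q, folded u1_def]
        den_letter(2)[OF u co i l' l u'(1) st(2)]
        den_letter(3)[OF u co i l' l u'(1) st(2), where q = q, folded u1_def]
      have "var u1 40 = int i" using co by (simp add: u1_def den_var coefs_def)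
      moreover have "arr u1 11 = arr s 11" using u' by (simp add: u1_def den_arr)
      ultimately have fl: "arr u1 11 (32 * (var u1 40 + 1) + var u1 56) = int (f l)"
        using tab[OF dl(2)] dl(1) by (simp add: f_def)
      have u1: "var u1 65 = int (x - sum f {..<l})" "var u1 48 = int l" "var u1 3 = M" "var u1 62 = 0"
        using r l' rep_consts(4)[OF u] True by (simp_all add: u1_def den_var)
      define u2 where "u2 = set_var 68 (int (f l)) u1"
      define d where "d = x - sum f {..<l}"
      have u65: "var u1 65 = int d" using u1(1) by (simp only: d_def)
      have den: "den q body u = (if d < f l
          then set_var 62 1 (set_var 71 (var u1 53) (set_var 70 (var u1 56) (set_var 69 (int l) u2)))
          else set_var 65 ((int d - int (f l)) mod M) u2)"
        using True fl u1(2-4) u65 unfolding body_def u2_def by (simp add: u1_def[symmetric])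
      show ?thesis
      proof (cases "d < f l")
        case True
        then have al: "a = l" unfolding a_def using r(1) by (intro pick_eq) (auto simp: d_def)
        have "G (den q body u)" unfolding den G_def al if_P[OF True]
          using dl u65 by (simp add: u2_def d_def)
        moreover have "var (den q body u) 62 = 1" unfolding den if_P[OF True] by simp
        ultimately show ?thesis by (simp add: I_def G_def)
      next
        case False
        have "int d - int (f l) = int (d - f l)" using False by simp
        moreover have "int (d - f l) mod M = int (d - f l)"
          using xM by (intro mod_pos_pos_trivial) (auto simp: d_def)
        ultimately have "den q body u = set_var 65 (int (d - f l)) u2"
          unfolding den using False by (simp only: if_False)
        moreover have "d - f l = x - sum f {..<Suc l}" "sum f {..<Suc l} \<le> x"
          using False r(1) by (simp_all add: d_def)
        ultimately show ?thesis using u1(4) by (simp add: I_def u2_def)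
      qed
    qed
  qed (auto simp: body_def)
  then have "I 64 s'" unfolding s'_def pick_letter_prog_def body_def[symmetric] by simp
  moreover have "\<not> sum f {..<64} \<le> x" using x' by simp
  ultimately have "G s'" unfolding I_def by blast
  then show "var s' 65 = int (x - sum f {..<a})" "var s' 69 = int a" "var s' 70 = int (tr m i a st)"
    "var s' 71 = of_bool (r m i = 0 \<and> od i (int (a mod 8), int (a div 8)))" "tr m i a st < 32"
    unfolding G_def by blast+
qed

end


section \<open>Correcting the word and writing the vector\<close>

definition move_prog :: lprog where
  "move_prog = LIf (Var 45 =. Lit 0)
     (LAssign 79 (capped (Var 73 +. Lit 4 *. Var 77)) ;; LAssign 80 (Var 74))
     (LIf (Var 73 mod. Lit 2)
       (LAssign 79 (Var 73) ;; LAssign 80 (capped (Var 74 +. Lit 8 *. Var 77)))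
       (LAssign 79 (capped (Var 73 +. Lit 8 *. Var 77)) ;; LAssign 80 (Var 74)))"

definition sum_prog :: lprog where
  "sum_prog = coef_prog ;;
     LAssign 72 (Var 72 +% Var 44 *. h_expr (Cell 14 (Var 40)) (Cell 15 (Var 40)))"

text \<open>Only digits below \<open>k - m - 3\<close> are lifted; a guard expresses this, because
  the surrounding loop always makes \<open>k\<close> rounds.\<close>

definition lift_prog :: lprog where
  "lift_prog = LIf (Var 78 +. Lit 3 <. Var 1 -. Var 41)
     (move_prog ;;
      LIf ((Var 75 +. h_expr (Var 79) (Var 80) -. Var 76) mod. Cell 10 (Var 78 +. Lit 4))
        (LAssign 77 (capped (Var 77 +. Cell 10 (Var 78)))) LSkip) LSkip"

text \<open>The value of the whole word is computed once and the contribution of the pivot removed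
  (variable 75). Each lifting step then evaluates a single block, so the correction takes
  \<open>O(n + k)\<close> operations.\<close>

definition corr_prog :: lprog where
  "corr_prog = LIf (Lit 3 <. Var 1 -. Var 41)
     (LAssign 72 (Lit 0) ;; LFor 40 (Var 0) sum_prog ;;
      LAssign 40 (Var 67) ;; coef_prog ;;
      LAssign 73 (Cell 14 (Var 40)) ;; LAssign 74 (Cell 15 (Var 40)) ;;
      LAssign 75 (Var 72 -% h_expr (Var 73) (Var 74)) ;;
      LAssign 76 (Var 2 div. Cell 10 (Var 41)) ;; LAssign 77 (Lit 0) ;;
      LFor 78 (Var 1) lift_prog ;; move_prog ;;
      LStore 14 (Var 40) (capped (Var 79 mod. (Lit 8 *. Var 46))) ;;
      LStore 15 (Var 40) (capped (Var 80 mod. (Lit 8 *. Var 47)))) LSkip"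

definition out_prog :: lprog where
  "out_prog = LFor 40 (Var 0) (coef_prog ;;
     LIf (Var 45 =. Lit 2) LSkip (LStore 16 (Var 40) (Cell 10 (Var 42) *% Cell 14 (Var 40))) ;;
     LIf (Var 45 =. Lit 1) (LStore 16 (Var 40 +. Lit 1) (Cell 10 (Var 42) *% Cell 15 (Var 40))) LSkip)"

text \<open>Counting overwrites the table level by level and keeps only the weights, so the table of
  the chosen level is built again.\<close>

definition decode_prog :: "(bool \<Rightarrow> bool) \<Rightarrow> lprog" where
  "decode_prog okay = level_prog ;; table_prog okay ;; word_prog ;; corr_prog ;; out_prog"

lemma writes_decode2 [simp]:
  "wvars move_prog = {79, 80}" "warrs move_prog = {}"
  "wvars sum_prog = {42, 43, 44, 45, 46, 47, 72}" "warrs sum_prog = {}"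
  "wvars lift_prog = {77, 79, 80}" "warrs lift_prog = {}"
  "wvars corr_prog = {40, 42, 43, 44, 45, 46, 47, 72, 73, 74, 75, 76, 77, 78, 79, 80}"
  "warrs corr_prog = {14, 15}"
  "wvars out_prog = {40, 42, 43, 44, 45, 46, 47}" "warrs out_prog = {16}"
  "warrs (decode_prog okay) = {11, 14, 15, 16}"
  by (auto simp: move_prog_def sum_prog_def lift_prog_def corr_prog_def out_prog_def decode_prog_def)

definition pair_at :: "state \<Rightarrow> nat \<Rightarrow> int \<times> int" where
  "pair_at u j = (arr u 14 (int j), arr u 15 (int j))"

lemma pair_at_set_var [simp]: "pair_at (set_var x z u) = pair_at u"
  by (simp add: pair_at_def fun_eq_iff)

lemma pair_at_den [simp]: "14 \<notin> warrs p \<Longrightarrow> 15 \<notin> warrs p \<Longrightarrow> pair_at (den q p u) = pair_at u"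
  by (simp add: pair_at_def fun_eq_iff den_arr)

context block_form
begin

lemma den_digit:
  fixes q :: int
  assumes s: "rep M s" "coefs m i s" and a: "var s 69 = int a" "a < 64" and v: "var s 66 = int v"
  defines "u \<equiv> den q digit_prog s"
  shows "var u 55 = var s 70" "var u 66 = int (v div wy m i div wz m i)"
    "pair_at u = (pair_at s)(i := (int (a mod 8 + 8 * (v mod wy m i)), int (a div 8 + 8 * (v div wy m i mod wz m i))))"
    "var u 67 = (if var s 67 < 0 \<and> var s 71 \<noteq> 0 then int i else var s 67)"
    "\<And>x. x \<notin> {55, 66, 67} \<Longrightarrow> var u x = var s x"
proof -
  let ?y = "a mod 8 + 8 * (v mod wy m i)" and ?z = "a div 8 + 8 * (v div wy m i mod wz m i)"
  let ?v = "v div wy m i div wz m i"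
  have co: "var s 40 = int i" "var s 46 = int (wy m i)" "var s 47 = int (wz m i)" using s(2) by (auto simp: coefs_def)
  have M: "8 * 2 ^ k + 8 < M"
  proof -
    have "(2::int) ^ (k + 4) \<le> 2 ^ (k + 8)" "(8::int) \<le> 8 * 2 ^ k" by (auto intro: power_increasing)
    moreover have "(2::int) ^ (k + 4) = 8 * 2 ^ k + 8 * 2 ^ k" by (simp add: power_add)
    ultimately show ?thesis using rep_consts(9)[OF s(1)] by linarith
  qed
  have W: "int (wy m i) \<le> 2 ^ k" "int (wz m i) \<le> 2 ^ k"
    using of_nat_mono[OF w_le(1)[of m i], where 'a = int] of_nat_mono[OF w_le(2)[of m i], where 'a = int] by simp_all
  have "?y < 8 * wy m i + 8" "?z < 8 * wz m i + 8"
    using w_pos[of m i] a(2) mod_less_divisor[of "wy m i" v] mod_less_divisor[of "wz m i" "v div wy m i"]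
      mod_less_divisor[of 8 a] less_mult_imp_div_less[of a 8 8] by linarith+
  then have yM: "int ?y < M" "int ?z < M" using W M by linarith+
  have y: "(int a mod 8 + 8 * (int v mod int (wy m i))) mod M = int ?y"
  proof -
    have "int a mod 8 + 8 * (int v mod int (wy m i)) = int ?y" by (simp add: zmod_int)
    then show ?thesis using yM(1) by (simp only: mod_pos_pos_trivial[OF of_nat_0_le_iff])
  qed
  have z: "(int a div 8 + 8 * (int v div int (wy m i) mod int (wz m i))) mod M = int ?z"
  proof -
    have "int a div 8 + 8 * (int v div int (wy m i) mod int (wz m i)) = int ?z" by (simp add: zmod_int zdiv_int)
    then show ?thesis using yM(2) by (simp only: mod_pos_pos_trivial[OF of_nat_0_le_iff])
  qed
  have v': "int v div int (wy m i) div int (wz m i) = int ?v" by (simp add: zdiv_int)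
  define u0 where "u0 = set_var 66 (int ?v) (set_cell 15 (int i) (int ?z)
    (set_var 66 (int v div int (wy m i)) (set_cell 14 (int i) (int ?y) (set_var 55 (var s 70) s))))"
  have "u = (if (of_bool (var s 67 < 0) :: int) * var s 71 \<noteq> 0 then set_var 67 (int i) u0 else u0)"
    unfolding u_def digit_prog_def u0_def by (simp only: exec co a(1) v rep_consts(4)[OF s(1)] y z v')
  then have u: "u = (if var s 67 < 0 \<and> var s 71 \<noteq> 0 then set_var 67 (int i) u0 else u0)"
    by (cases "var s 67 < 0") simp_all
  show "var u 55 = var s 70" "var u 66 = int ?v" "var u 67 = (if var s 67 < 0 \<and> var s 71 \<noteq> 0 then int i else var s 67)"
    "\<And>x. x \<notin> {55, 66, 67} \<Longrightarrow> var u x = var s x"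
    unfolding u by (auto simp: u0_def)
  show "pair_at u = (pair_at s)(i := (int ?y, int ?z))"
    unfolding u by (auto simp: u0_def pair_at_def fun_eq_iff)
qed

definition first_good :: "nat \<Rightarrow> nat \<Rightarrow> state \<Rightarrow> bool" where
  "first_good m i u \<longleftrightarrow> (let P = \<lambda>j. r m j = 0 \<and> od j (pair_at u j) in
     var u 67 = - 1 \<and> (\<forall>j<i. \<not> P j) \<or> (\<exists>j<i. var u 67 = int j \<and> P j \<and> (\<forall>j'<j. \<not> P j')))"

lemma den_word:
  fixes q :: int
  assumes s: "rep M s" and m: "m \<le> k" "var s 41 = int m"
    and tab: "\<And>i st. i \<le> n \<Longrightarrow> st < 32 \<Longrightarrow> arr s 11 (32 * int i + int st) = int (words_from m i st)"
    and y: "var s 61 = int y" "y < weight m"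
  defines "N \<equiv> words_from m 0 0" and "s' \<equiv> den q word_prog s"
  defines "w \<equiv> unrank (acc m) (tr m) (wy m) (wz m) [0..<n] 0 (y mod N) (y div N)"
  shows "w \<in> sat m (min 3 (k - m))" "\<And>i. i < n \<Longrightarrow> pair_at s' i = w ! i"
    "good m w \<Longrightarrow> var s' 67 = int (pivot m w)"
proof -
  have yN: "y < N * refinements m" using y(2) unfolding weight_def N_def .
  then have N0: "0 < N" by (cases "N = 0") simp_all
  moreover have "y div N < refinements m" using yN by (intro less_mult_imp_div_less) (simp only: mult.commute)
  ultimately have N: "0 < N" "y div N < refinements m" .
  have ref: "refinements m = 2 ^ min k (m + 3) * (\<Prod>i\<leftarrow>[0..<n]. wy m i * wz m i)"
    unfolding refinements_def by (simp add: prod.list_conv_set_nth atLeast0LessThan)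
  have "(y mod N, y div N) \<in> {..<N} \<times> {..<2 ^ min k (m + 3) * (\<Prod>i\<leftarrow>[0..<n]. wy m i * wz m i)}"
    using N unfolding ref[symmetric] by simp
  then show w: "w \<in> sat m (min 3 (k - m))"
    using equifibred_unrank[of "[0..<n]" "wy m" "wz m" "acc m" "tr m" 0 "2 ^ min k (m + 3)"] w_pos
    unfolding equifibred_def accepted_eq w_def N_def by blast
  then have len: "length w = n" by (simp add: sat_def box_def)
  define body where "body = coef_prog ;; pick_letter_prog ;; digit_prog"
  define s0 where "s0 = set_var 67 (- 1) (set_var 55 0 (set_var 66 (int (y div N)) (set_var 65 (int (y mod N)) (set_var 64 (int N) s))))"
  have NM: "int N < M" unfolding N_def by (rule words_less[OF s])
  have "arr s 11 0 = int N" using tab[of 0 0] by (simp add: N_def)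
  moreover have "int y mod int N mod M = int (y mod N)"
    using NM N(1) mod_less_divisor[OF N(1), of y] by (simp add: zmod_int[symmetric])
  ultimately have s': "s' = den q (LFor 40 (Var 0) body) s0"
    unfolding s'_def word_prog_def body_def[symmetric] s0_def
    using y(1) rep_consts(4)[OF s] by (simp add: zdiv_int)
  \<comment> \<open>The word is fixed in advance: at any time it is the part already stored,
    followed by what unranking yields from the current state, rank and digits.\<close>
  define I where "I i u \<longleftrightarrow> (\<exists>st x v. st < 32 \<and> var u 55 = int st \<and> var u 65 = int x \<and> var u 66 = int v \<and>
      x < words_from m i st \<and>
      w = map (pair_at u) [0..<i] @ unrank (acc m) (tr m) (wy m) (wz m) [i..<n] st x v) \<and> first_good m i u"
    for i and u :: state
  have I: "I n s'"
    unfolding s'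
  proof (rule den_For)
    show "n = nat (eval q (Var 0) s0)" using rep_consts(1)[OF s] by (simp add: s0_def)
    show "I 0 (set_var 40 0 s0)"
      unfolding I_def
    proof (intro conjI exI)
      show "y mod N < words_from m 0 0" using N(1) by (simp add: N_def)
      show "w = map (pair_at (set_var 40 0 s0)) [0..<0] @
          unrank (acc m) (tr m) (wy m) (wz m) [0..<n] 0 (y mod N) (y div N)" by (simp add: w_def)
    qed (simp_all add: s0_def first_good_def)
    fix i u
    assume i: "i < n" and I: "I i u" and i': "var u 40 = int i"
      and fr: "\<And>y. y \<noteq> 40 \<Longrightarrow> y \<notin> wvars body \<Longrightarrow> var u y = var s0 y"
      and ar: "\<And>x. x \<notin> warrs body \<Longrightarrow> arr u x = arr s0 x"
    obtain st x v where st: "st < 32" "var u 55 = int st" and x: "var u 65 = int x" "x < words_from m i st"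
      and v: "var u 66 = int v"
      and wu: "w = map (pair_at u) [0..<i] @ unrank (acc m) (tr m) (wy m) (wz m) [i..<n] st x v"
      and fg: "first_good m i u"
      using I unfolding I_def by blast
    have u: "rep M u" using s fr ar by (subst rep_eq[of _ s]) (auto simp: body_def s0_def)
    have um: "var u 41 = int m" using fr m by (simp add: body_def s0_def)
    have a11: "arr u 11 = arr s 11" using ar by (simp add: body_def s0_def)
    define u1 where "u1 = den q coef_prog u"
    have u1: "rep M u1" "coefs m i u1" "var u1 55 = int st" "var u1 65 = int x" "var u1 66 = int v"
      "arr u1 11 = arr s 11" "var u1 67 = var u 67" "pair_at u1 = pair_at u"
      using u st x v a11 coefs_den[OF u i i' m(1) um, of q] by (simp_all add: u1_def den_var den_arr)
    have tab1: "arr u1 11 (32 * (int i + 1) + int st) = int (words_from m (Suc i) st)" if "st < 32" for st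
      using tab[of "Suc i" st] i that unfolding u1(6) by (simp add: algebra_simps)
    let ?f = "\<lambda>a. words_from m (Suc i) (tr m i a st)"
    define a where "a = pick ?f x"
    define u2 where "u2 = den q pick_letter_prog u1"
    have pk: "a < 64" "var u2 65 = int (x - sum ?f {..<a})" "var u2 69 = int a" "var u2 70 = int (tr m i a st)"
      "var u2 71 = of_bool (r m i = 0 \<and> od i (int (a mod 8), int (a div 8)))"
      "tr m i a st < 32" "x - sum ?f {..<a} < ?f a"
      unfolding u2_def a_def
      by (rule den_pick_letter[OF u1(1,2) i u1(3) st(1) tab1 u1(4) x(2)]; assumption)+
    have u2: "rep M u2" "coefs m i u2" "var u2 66 = int v" "var u2 67 = var u 67" "pair_at u2 = pair_at u"
      using u1 coefs_eq[of u2 u1 m i] by (simp_all add: u2_def den_var)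
    define u3 where "u3 = den q digit_prog u2"
    note dg = den_digit[OF u2(1,2) pk(3,1) u2(3), where q = q, folded u3_def]
    define p where "p = (int (a mod 8 + 8 * (v mod wy m i)), int (a div 8 + 8 * (v div wy m i mod wz m i)))"
    have p3: "pair_at u3 = (pair_at u)(i := p)" using dg(3) by (simp add: u2(5) p_def)
    have od_p: "od i (int (a mod 8), int (a div 8)) \<longleftrightarrow> od i p" by (simp add: od_def p_def)
    have den: "den q body u = u3" by (simp add: body_def u1_def u2_def u3_def)
    have fg3: "first_good m (Suc i) u3"
    proof -
      have 67: "var u3 67 = (if var u 67 < 0 \<and> r m i = 0 \<and> od i p then int i else var u 67)"
        unfolding dg(4) u2(4) pk(5) od_p by simp
      define P where "P j \<longleftrightarrow> r m j = 0 \<and> od j (pair_at u j)" for j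
      define P' where "P' j \<longleftrightarrow> r m j = 0 \<and> od j (pair_at u3 j)" for j
      have PP: "P' j \<longleftrightarrow> P j" if "j < i" for j using that by (simp add: P_def P'_def p3)
      have Pi: "P' i \<longleftrightarrow> r m i = 0 \<and> od i p" by (simp add: P'_def p3)
      from fg consider "var u 67 = - 1" "\<forall>j<i. \<not> P j" | j where "j < i" "var u 67 = int j" "P j" "\<forall>j'<j. \<not> P j'"
        unfolding first_good_def Let_def P_def by blast
      then have "var u3 67 = - 1 \<and> (\<forall>j<Suc i. \<not> P' j) \<or> (\<exists>j<Suc i. var u3 67 = int j \<and> P' j \<and> (\<forall>j'<j. \<not> P' j'))"
      proof cases
        case 1
        then show ?thesis
        proof (cases "P' i")
          case True
          then have "var u3 67 = int i" using 67 1(1) Pi by simp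
          then show ?thesis using True PP 1(2) by (intro disjI2 exI[of _ i]) auto
        next
          case False
          then have "var u3 67 = - 1" using 67 1(1) Pi by auto
          then show ?thesis using False PP 1(2) by (auto simp: less_Suc_eq)
        qed
      next
        case 2
        then have "var u3 67 = int j" using 67 by simp
        then show ?thesis using 2 PP by (intro disjI2 exI[of _ j]) auto
      qed
      then show ?thesis unfolding first_good_def Let_def P'_def .
    qed
    have map3: "map (pair_at u3) [0..<Suc i] = map (pair_at u) [0..<i] @ [p]"
      unfolding p3 by simp
    let ?v = "v div wy m i div wz m i" and ?x = "x - sum ?f {..<a}" and ?st = "tr m i a st"
    have unr: "unrank (acc m) (tr m) (wy m) (wz m) [i..<n] st x v =
        p # unrank (acc m) (tr m) (wy m) (wz m) [Suc i..<n] ?st ?x ?v"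
      unfolding upt_conv_Cons[OF i] unrank.simps Let_def a_def[symmetric] p_def ..
    have w3: "w = map (pair_at u3) [0..<Suc i] @ unrank (acc m) (tr m) (wy m) (wz m) [Suc i..<n] ?st ?x ?v"
      unfolding map3 using wu unfolding unr by simp
    have "var u3 55 = int ?st" using dg(1) pk(4) by simp
    moreover have "var u3 65 = int ?x" using dg(5)[of 65] pk(2) by simp
    ultimately have all3: "?st < 32 \<and> var u3 55 = int ?st \<and> var u3 65 = int ?x \<and> var u3 66 = int ?v \<and>
        ?x < words_from m (Suc i) ?st \<and>
        w = map (pair_at u3) [0..<Suc i] @ unrank (acc m) (tr m) (wy m) (wz m) [Suc i..<n] ?st ?x ?v"
      using dg(2) pk(6,7) w3 by (intro conjI)
    have "I (Suc i) u3"
      unfolding I_def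
      by (rule conjI[OF _ fg3], rule exI[of _ ?st], rule exI[of _ ?x], rule exI[of _ ?v], rule all3)
    then show "I (Suc i) (set_var 40 (int (Suc i)) (den q body u))"
      unfolding den by (simp add: I_def first_good_def)
  qed (simp add: body_def)
  then have wm: "w = map (pair_at s') [0..<n]" by (auto simp: I_def)
  then show wi: "\<And>i. i < n \<Longrightarrow> pair_at s' i = w ! i" by simp
  show "var s' 67 = int (pivot m w)" if g: "good m w"
  proof -
    have fg: "first_good m n s'" using I by (simp add: I_def)
    obtain i where i: "i < n" "r m i = 0" "od i (w ! i)" using g unfolding good_def by blast
    have "\<not> (\<forall>j<n. \<not> (r m j = 0 \<and> od j (pair_at s' j)))" using i wi[OF i(1)] by auto
    then obtain j where j': "j < n" "var s' 67 = int j" "r m j = 0 \<and> od j (pair_at s' j)"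
      "\<forall>j'<j. \<not> (r m j' = 0 \<and> od j' (pair_at s' j'))"
      using fg unfolding first_good_def Let_def by blast
    have j: "j < n" "var s' 67 = int j" "r m j = 0" "od j (w ! j)" using j' wi by simp_all
    have j5: "\<not> (r m j' = 0 \<and> od j' (w ! j'))" if "j' < j" for j'
    proof -
      have "pair_at s' j' = w ! j'" using wi[of j'] that j(1) by linarith
      then show ?thesis using spec[OF j'(4), of j'] that by metis
    qed
    have "pivot m w = j" unfolding pivot_def
    proof (rule Least_equality)
      show "j < n \<and> r m j = 0 \<and> od j (w ! j)" using j by blast
      fix y
      assume y: "y < n \<and> r m y = 0 \<and> od y (w ! y)"
      show "j \<le> y" by (rule ccontr) (use j5[of y] y in \<open>simp add: not_le\<close>)
    qed
    then show ?thesis using j by simp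
  qed
qed

lemma den_move:
  assumes s: "rep M s" and p: "var s 45 = int (kind i)" "var s 73 = fst p" "var s 74 = snd p" "var s 77 = e"
    and b: "0 \<le> fst p" "fst p < 8 * 2 ^ k" "0 \<le> snd p" "snd p < 8 * 2 ^ k" "0 \<le> e" "e < 2 ^ k"
  shows "den q move_prog s = set_var 80 (snd (move i e p)) (set_var 79 (fst (move i e p)) s)"
proof -
  have "(2::int) ^ (k + 4) \<le> 2 ^ (k + 8)" by (intro power_increasing) auto
  moreover have "(2::int) ^ (k + 4) = 8 * 2 ^ k + 8 * 2 ^ k" by (simp add: power_add)
  ultimately have M: "8 * 2 ^ k + 8 * 2 ^ k < M" using rep_consts(9)[OF s] by linarith
  have "(fst p + 4 * e) mod M = fst p + 4 * e" "(fst p + 8 * e) mod M = fst p + 8 * e"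
    "(snd p + 8 * e) mod M = snd p + 8 * e"
    using b M by (auto intro!: mod_pos_pos_trivial)
  moreover have "fst p mod 2 \<noteq> 0 \<longleftrightarrow> odd (fst p)" by (simp add: mod_2_eq_odd)
  ultimately show ?thesis
    using p rep_consts(4)[OF s] unfolding move_prog_def move_def by simp
qed

lemma den_sum:
  assumes s: "rep M s" and m: "m \<le> k" "var s 41 = int m" and w: "\<And>i. i < n \<Longrightarrow> pair_at s i = w ! i"
  shows "var (den (2 ^ k) (LFor 40 (Var 0) sum_prog) (set_var 72 0 s)) 72 = val m w mod 2 ^ k"
proof -
  let ?q = "2 ^ k :: int"
  let ?t = "\<lambda>i. 2 ^ r m i * h i (fst (w ! i)) (snd (w ! i))"
  define I where "I i u \<longleftrightarrow> var u 72 = sum ?t {..<i} mod ?q" for i and u :: state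
  have "I n (den ?q (LFor 40 (Var 0) sum_prog) (set_var 72 0 s))"
  proof (rule den_For)
    show "I 0 (set_var 40 0 (set_var 72 0 s))" by (simp add: I_def)
    fix i u
    assume i: "i < n" and I: "I i u" and i': "var u 40 = int i"
      and fr: "\<And>y. y \<noteq> 40 \<Longrightarrow> y \<notin> wvars sum_prog \<Longrightarrow> var u y = var (set_var 72 0 s) y"
      and ar: "\<And>x. x \<notin> warrs sum_prog \<Longrightarrow> arr u x = arr (set_var 72 0 s) x"
    have u: "rep M u" using s fr ar by (subst rep_eq[of _ s]) auto
    have um: "var u 41 = int m" using fr m by simp
    define u1 where "u1 = den ?q coef_prog u"
    have co: "coefs m i u1" unfolding u1_def by (rule coefs_den[OF u i i' m(1) um])
    have u1: "var u1 40 = int i" "var u1 44 = 2 ^ r m i" "var u1 72 = sum ?t {..<i} mod ?q"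
      "arr u1 14 (int i) = fst (w ! i)" "arr u1 15 (int i) = snd (w ! i)"
      "arr u1 7 (int i) = al i" "arr u1 8 (int i) = be i" "arr u1 9 (int i) = ga i"
      using co I w[OF i, symmetric] ar rep_arrs[OF u i]
      by (simp_all add: coefs_def u1_def den_var den_arr I_def pair_at_def)
    have h: "al i * (fst (w ! i) * fst (w ! i)) + be i * fst (w ! i) * snd (w ! i) + ga i * (snd (w ! i) * snd (w ! i)) =
        h i (fst (w ! i)) (snd (w ! i))" by (simp add: h_def power2_eq_square)
    have "den ?q sum_prog u = set_var 72 ((sum ?t {..<i} mod ?q + ?t i) mod ?q) u1"
      unfolding sum_prog_def den.simps(4) u1_def[symmetric] by (simp only: exec u1 h)
    then show "I (Suc i) (set_var 40 (int (Suc i)) (den ?q sum_prog u))"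
      by (simp add: I_def mod_add_left_eq)
  qed (use rep_consts(1)[OF s] in auto)
  then show ?thesis by (simp add: I_def val_def)
qed

lemma den_corr:
  assumes s: "rep M s" and m: "m \<le> k" "var s 41 = int m" and w: "\<And>i. i < n \<Longrightarrow> pair_at s i = w ! i"
    and sat: "w \<in> sat m (min 3 (k - m))" and piv: "good m w \<Longrightarrow> var s 67 = int (pivot m w)"
    and i: "i < n"
  shows "pair_at (den (2 ^ k) corr_prog s) i = corr m w ! i"
proof (cases "k - m \<le> 3")
  case True
  have "\<not> 3 < int k - int m" using True m by linarith
  then have "den (2 ^ k) corr_prog s = s"
    using rep_consts(2)[OF s] m(2) by (simp add: corr_prog_def)
  then show ?thesis using w[OF i] True by (simp add: corr_def)
next
  case False
  let ?q = "2 ^ k :: int"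
  define d where "d = k - m - 3"
  have mk: "m < k" and km: "3 < int k - int m" "k - m = d + 3" using False by (auto simp: d_def)
  have g: "good m w" and box: "w \<in> box m" using sat mk by (auto simp: sat_def)
  define j where "j = pivot m w"
  note pv = pivot[OF g, folded j_def]
  define p where "p = w ! j"
  define T where "T = t div 2 ^ m"
  define G where "G = moved m j w"
  have corr: "corr m w = adj m j (lift G T d) w" using False by (simp add: corr_def j_def d_def G_def T_def)
  have len: "length w = n" using box by (simp add: box_def)
  have W: "int (wy m j) \<le> 2 ^ k" "int (wz m j) \<le> 2 ^ k"
    using of_nat_mono[OF w_le(1)[of m j], where 'a = int] of_nat_mono[OF w_le(2)[of m j], where 'a = int] by simp_all
  have "p \<in> {0..<8 * int (wy m j)} \<times> {0..<8 * int (wz m j)}" using box pv(1) by (simp add: box_def p_def)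
  then have pb: "0 \<le> fst p" "fst p < 8 * 2 ^ k" "0 \<le> snd p" "snd p < 8 * 2 ^ k"
    using W unfolding mem_Times_iff atLeastLessThan_iff by linarith+
  have "(2::int) ^ d \<le> 2 ^ k" by (intro power_increasing) (auto simp: d_def)
  then have eb: "0 \<le> lift G T l" "l \<le> d \<Longrightarrow> lift G T l < 2 ^ k" for l
    using lift_bounds[of G T l] power_increasing[of l d "2::int"] by linarith+

  define s1 where "s1 = den ?q (LFor 40 (Var 0) sum_prog) (set_var 72 0 s)"
  define s2 where "s2 = den ?q coef_prog (set_var 40 (int j) s1)"
  define R where "R = (val m w mod ?q - h j (fst p) (snd p)) mod ?q"
  define s3 where "s3 = set_var 77 0 (set_var 76 T (set_var 75 R (set_var 74 (snd p) (set_var 73 (fst p) s2))))"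
  define s4 where "s4 = den ?q (LFor 78 (Var 1) lift_prog) s3"
  have s1: "rep M s1" "var s1 72 = val m w mod ?q" "var s1 67 = int j" "var s1 41 = int m" "pair_at s1 = pair_at s"
    using s den_sum[OF s m w] piv[OF g] m by (simp_all add: s1_def j_def den_var)
  have s1': "rep M (set_var 40 (int j) s1)" "var (set_var 40 (int j) s1) 40 = int j"
    "var (set_var 40 (int j) s1) 41 = int m" using s1 by simp_all
  have co2: "coefs m j s2" unfolding s2_def by (rule coefs_den[OF s1'(1) pv(1) s1'(2) m(1) s1'(3)])
  have s2: "rep M s2" "var s2 72 = val m w mod ?q" "var s2 41 = int m" "pair_at s2 = pair_at s"
    "var s2 40 = int j" "var s2 45 = int (kind j)"
    using s1 co2 by (simp_all add: s2_def den_var coefs_def)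
  have s2p: "arr s2 14 (int j) = fst p" "arr s2 15 (int j) = snd p"
    using fun_cong[OF s2(4), of j] w[OF pv(1)] unfolding pair_at_def p_def by (metis fst_conv, metis snd_conv)
  note ar2 = rep_arrs[OF s2(1) pv(1)]
  have hj: "al j * (y * y) + be j * y * z + ga j * (z * z) = h j y z" for y z
    by (simp add: h_def power2_eq_square)
  have step3: "den ?q (LAssign 73 (Cell 14 (Var 40)) ;; LAssign 74 (Cell 15 (Var 40)) ;;
      LAssign 75 (Var 72 -% h_expr (Var 73) (Var 74)) ;;
      LAssign 76 (Var 2 div. Cell 10 (Var 41)) ;; LAssign 77 (Lit 0)) s2 = s3"
    unfolding s3_def R_def T_def
    by (simp only: exec s2 s2p ar2 hj rep_consts(3)[OF s2(1)] rep_pw[OF s2(1) m(1)])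
  have lift_val: "var s4 77 = lift G T d \<and> (\<forall>y. y \<notin> {77, 78, 79, 80} \<longrightarrow> var s4 y = var s3 y)"
  proof -
    define I where "I l u \<longleftrightarrow> var u 77 = lift G T (min l d)" for l and u :: state
    have "I k s4"
      unfolding s4_def
    proof (rule den_For)
      show "k = nat (eval ?q (Var 1) s3)" using rep_consts(2)[OF s2(1)] by (simp add: s3_def)
      show "I 0 (set_var 78 0 s3)" by (simp add: I_def s3_def)
      fix l u
      assume l: "l < k" and I: "I l u" and l': "var u 78 = int l"
        and fr: "\<And>y. y \<noteq> 78 \<Longrightarrow> y \<notin> wvars lift_prog \<Longrightarrow> var u y = var s3 y"
        and ar: "\<And>x. x \<notin> warrs lift_prog \<Longrightarrow> arr u x = arr s3 x"
      have u: "rep M u" using s2(1) fr ar by (subst rep_eq[of _ s2]) (auto simp: s3_def)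
      have us: "var u 41 = int m" "var u 1 = int k" "var u 40 = int j" "var u 45 = int (kind j)" "var u 73 = fst p"
        "var u 74 = snd p" "var u 75 = R" "var u 76 = T" "var u 3 = M"
        using fr s2 rep_consts(2,4)[OF u] by (simp_all add: s3_def)
      show "I (Suc l) (set_var 78 (int (Suc l)) (den ?q lift_prog u))"
      proof (cases "l < d")
        case False
        then have "\<not> int l + 3 < int k - int m" using km(2) m by linarith
        then have "den ?q lift_prog u = u" using us l' by (simp add: lift_prog_def)
        then show ?thesis using I False by (simp add: I_def min_def)
      next
        case True
        then have lt: "int l + 3 < int k - int m" and l4: "l + 4 \<le> k" using km(2) by linarith+
        define e where "e = lift G T l"
        have e: "var u 77 = e" using I True by (simp add: I_def e_def min_def)
        have eb': "0 \<le> e" "e < 2 ^ k" using eb[of l] True by (auto simp: e_def)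
        define u1 where "u1 = set_var 80 (snd (move j e p)) (set_var 79 (fst (move j e p)) u)"
        have mv: "den ?q move_prog u = u1"
          unfolding u1_def by (rule den_move[OF u us(4-6) e pb eb'])
        let ?d = "2 ^ (l + 4) :: int"
        have dq: "?d dvd ?q" using l4 by (intro le_imp_power_dvd)
        have Ge: "G e = val m w - h j (fst p) (snd p) + h j (fst (move j e p)) (snd (move j e p))"
          by (simp add: G_def moved_def p_def)
        \<comment> \<open>Variable 75 was reduced modulo \<open>2 ^ k\<close>, whereas
          \<open>moved\<close> is an integer; the tests are modulo \<open>2 ^ (l + 4)\<close>, which
          divides \<open>2 ^ k\<close>.\<close>
        have "[R = val m w - h j (fst p) (snd p)] (mod ?q)" by (simp add: R_def cong_def mod_simps)
        then have "[R = val m w - h j (fst p) (snd p)] (mod ?d)" using dq by (rule cong_dvd_modulus)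
        then have "[R + h j (fst (move j e p)) (snd (move j e p)) - T = G e - T] (mod ?d)"
          unfolding Ge by (intro cong_diff cong_add cong_refl)
        then have test: "(R + h j (fst (move j e p)) (snd (move j e p)) - T) mod ?d = 0 \<longleftrightarrow> ?d dvd G e - T"
          by (metis cong_dvd_iff dvd_eq_mod_eq_0)
        have pws: "arr u 10 (int l + 4) = ?d" "arr u 10 (int l) = 2 ^ l"
          using rep_pw[OF u l4] rep_pw[OF u, of l] l by simp_all
        note aru = rep_arrs[OF u pv(1)]
        have d: "den ?q lift_prog u = (if (R + h j (fst (move j e p)) (snd (move j e p)) - T) mod ?d \<noteq> 0
            then set_var 77 ((e + 2 ^ l) mod M) u1 else u1)"
        proof -
          have "den ?q lift_prog u = den ?q (LIf ((Var 75 +. h_expr (Var 79) (Var 80) -. Var 76) mod. Cell 10 (Var 78 +. Lit 4))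
              (LAssign 77 (capped (Var 77 +. Cell 10 (Var 78)))) LSkip) u1"
            using lt us l' by (simp add: lift_prog_def mv)
          also have "\<dots> = (if (R + h j (fst (move j e p)) (snd (move j e p)) - T) mod ?d \<noteq> 0
            then set_var 77 ((e + 2 ^ l) mod M) u1 else u1)"
            unfolding u1_def by (simp only: exec us e l' aru pws hj)
          finally show ?thesis .
        qed
        have "(2::int) ^ l < 2 ^ k" using l by simp
        then have "e + 2 ^ l < 2 ^ k + 2 ^ k" using eb' by linarith
        also have "\<dots> \<le> 2 ^ (k + 8)" by (simp add: power_add)
        finally have "(e + 2 ^ l) mod M = e + 2 ^ l" using rep_consts(9)[OF u] eb' by simp
        then have "var (den ?q lift_prog u) 77 = lift G T (Suc l)"
          unfolding d if_distrib[of "\<lambda>u. var u 77"] using test e by (simp add: e_def[symmetric] u1_def)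
        then show ?thesis using True by (simp add: I_def min_def)
      qed
    qed simp
    moreover have "min k d = d" using km(2) by simp
    moreover have "var s4 y = var s3 y" if "y \<notin> {77, 78, 79, 80}" for y
      using that by (simp add: s4_def den_var)
    ultimately show ?thesis by (simp add: I_def)
  qed
  define e where "e = lift G T d"
  have s4: "rep M s4" "var s4 45 = int (kind j)" "var s4 73 = fst p" "var s4 74 = snd p" "var s4 77 = e"
    "var s4 40 = int j" "var s4 46 = int (wy m j)" "var s4 47 = int (wz m j)" "pair_at s4 = pair_at s"
    using lift_val s2 co2 by (simp_all add: s4_def[symmetric] e_def coefs_def s3_def) (simp_all add: s4_def s3_def s2)
  define s5 where "s5 = set_var 80 (snd (move j e p)) (set_var 79 (fst (move j e p)) s4)"
  have mv: "den ?q move_prog s4 = s5"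
    unfolding s5_def by (rule den_move[OF s4(1-5) pb eb(1,2)[of d, folded e_def]]) simp
  let ?y = "fst (move j e p) mod (8 * int (wy m j))" and ?z = "snd (move j e p) mod (8 * int (wz m j))"
  have M8: "8 * 2 ^ k < M"
  proof -
    have "(8::int) * 2 ^ k \<le> 2 ^ (k + 8)" by (simp add: power_add)
    then show ?thesis using rep_consts(9)[OF s] by linarith
  qed
  have "0 \<le> ?y" "?y < 8 * int (wy m j)" "0 \<le> ?z" "?z < 8 * int (wz m j)" using w_pos[of m j] by simp_all
  then have yz: "?y mod M = ?y" "?z mod M = ?z" using W M8 by - (rule mod_pos_pos_trivial; linarith)+
  have s5': "var s5 3 = M" using rep_consts(4)[OF s4(1)] by (simp add: s5_def)
  have "den ?q (LStore 14 (Var 40) (capped (Var 79 mod. (Lit 8 *. Var 46))) ;;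
      LStore 15 (Var 40) (capped (Var 80 mod. (Lit 8 *. Var 47)))) s5 =
      set_cell 15 (int j) ?z (set_cell 14 (int j) ?y s5)"
    using s5' s4 yz unfolding s5_def by (simp only: exec)
  moreover have "den ?q (LAssign 40 (Var 67)) s1 = set_var 40 (int j) s1" using s1 by simp
  moreover have "den ?q (LAssign 72 (Lit 0)) s = set_var 72 0 s" by simp
  moreover have "(of_bool (3 < int k - int m) :: int) \<noteq> 0" using km(1) by simp
  ultimately have fin: "den ?q corr_prog s = set_cell 15 (int j) ?z (set_cell 14 (int j) ?y s5)"
    using step3 mv rep_consts(2)[OF s, folded One_nat_def] m(2) unfolding corr_prog_def den.simps(4,5)
    by (simp add: s1_def[symmetric] s2_def[symmetric] s4_def[symmetric] del: den.simps(2,3) One_nat_def)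
  have "pair_at (den ?q corr_prog s) i = (if i = j then (?y, ?z) else pair_at s i)"
    using fun_cong[OF s4(9), of i] unfolding fin by (auto simp: pair_at_def s5_def)
  also have "\<dots> = corr m w ! i" using i len w[OF i] by (simp add: corr adj_def e_def p_def nth_list_update)
  finally show ?thesis .
qed

lemma den_out:
  assumes s: "rep M s" and m: "m \<le> k" "var s 41 = int m" and w: "\<And>i. i < n \<Longrightarrow> pair_at s i = w ! i"
  shows "\<forall>i<n. arr (den (2 ^ k) out_prog s) 16 (int i) = out m w $ i"
proof -
  let ?q = "2 ^ k :: int"
  define st where "st = LIf (Var 45 =. Lit 2) LSkip (LStore 16 (Var 40) (Cell 10 (Var 42) *% Cell 14 (Var 40))) ;;
     LIf (Var 45 =. Lit 1) (LStore 16 (Var 40 +. Lit 1) (Cell 10 (Var 42) *% Cell 15 (Var 40))) LSkip"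
  \<comment> \<open>At the first index of a block of size two the next entry is written ahead; the
    second clause carries it to the step at kind 2, which writes nothing.\<close>
  define I where "I i u \<longleftrightarrow> (\<forall>j<i. arr u 16 (int j) = out m w $ j) \<and>
      (0 < i \<longrightarrow> kind (i - 1) = 1 \<longrightarrow> arr u 16 (int i) = out m w $ i)" for i and u :: state
  have "I n (den ?q (LFor 40 (Var 0) (coef_prog ;; st)) s)"
  proof (rule den_For)
    show "I 0 (set_var 40 0 s)" by (simp add: I_def)
    fix i u
    assume i: "i < n" and I: "I i u" and i': "var u 40 = int i"
      and fr: "\<And>y. y \<noteq> 40 \<Longrightarrow> y \<notin> wvars (coef_prog ;; st) \<Longrightarrow> var u y = var s y"
      and ar: "\<And>x. x \<notin> warrs (coef_prog ;; st) \<Longrightarrow> arr u x = arr s x"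
    have u: "rep M u" using s fr ar by (subst rep_eq[of _ s]) (auto simp: st_def)
    have um: "var u 41 = int m" using fr m by (simp add: st_def)
    define u1 where "u1 = den ?q coef_prog u"
    have co: "coefs m i u1" unfolding u1_def by (rule coefs_den[OF u i i' m(1) um])
    have u1: "rep M u1" "var u1 40 = int i" "var u1 45 = int (kind i)" "var u1 42 = int (c m i)"
      "arr u1 14 (int i) = fst (w ! i)" "arr u1 15 (int i) = snd (w ! i)" "arr u1 16 = arr u 16"
      using u co w[OF i, symmetric] ar by (simp_all add: coefs_def u1_def den_arr pair_at_def st_def)
    have pw: "arr u1 10 (int (c m i)) = 2 ^ c m i" using rep_pw[OF u1(1), of "c m i"] c_le[of m i] m by simp
    let ?y = "(2 ^ c m i * fst (w ! i)) mod ?q" and ?z = "(2 ^ c m i * snd (w ! i)) mod ?q"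
    show "I (Suc i) (set_var 40 (int (Suc i)) (den ?q (coef_prog ;; st) u))"
    proof (rule kind_cases[OF i])
      assume 0: "kind i = 0"
      have "den ?q (coef_prog ;; st) u = set_cell 16 (int i) ?y u1"
        using u1 pw 0 by (simp add: st_def u1_def[symmetric])
      moreover have "out m w $ i = ?y" using i 0 by (simp add: out_def own_def co_def)
      ultimately show ?thesis using I u1(7) 0 by (auto simp: I_def less_Suc_eq)
    next
      assume 1: "kind i = 1"
      have "den ?q (coef_prog ;; st) u = set_cell 16 (int (Suc i)) ?z (set_cell 16 (int i) ?y u1)"
        using u1 pw 1 by (simp add: st_def u1_def[symmetric] add.commute)
      moreover have "out m w $ i = ?y" "out m w $ Suc i = ?z"
        using i 1 kind1[OF i 1] by (simp_all add: out_def own_def co_def)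
      ultimately show ?thesis using I u1(7) by (auto simp: I_def less_Suc_eq)
    next
      assume 2: "kind i = 2"
      have "den ?q (coef_prog ;; st) u = u1" using u1 2 by (simp add: st_def u1_def[symmetric])
      moreover have "0 < i" "kind (i - 1) = 1" using kind2[OF i 2] by auto
      ultimately show ?thesis using I u1(7) 2 by (auto simp: I_def less_Suc_eq)
    qed
  qed (use rep_consts(1)[OF s] in \<open>auto simp: st_def\<close>)
  then show ?thesis by (simp add: I_def out_prog_def st_def)
qed

lemma den_decode:
  assumes s: "rep M s" and W: "\<And>m. m \<le> k \<Longrightarrow> arr s 12 (int m) = int (weight m)"
    and x: "var s 61 = int x" "x < sum weight {..k}"
  shows "\<forall>i<n. arr (den (2 ^ k) (decode_prog okay) s) 16 (int i) = decode x $ i"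
proof -
  let ?q = "2 ^ k :: int"
  define m where "m = pick weight x"
  define y where "y = x - sum weight {..<m}"
  define s1 where "s1 = den ?q level_prog s"
  define s2 where "s2 = den ?q (table_prog okay) s1"
  define s3 where "s3 = den ?q word_prog s2"
  define s4 where "s4 = den ?q corr_prog s3"
  have lv: "m \<le> k" "var s1 41 = int m" "var s1 61 = int y" "y < weight m"
    unfolding m_def y_def s1_def by (rule den_level[OF s W x]; assumption)+
  have s1: "rep M s1" using s by (simp add: s1_def)
  have s2: "rep M s2" "var s2 41 = int m" "var s2 61 = int y" using s1 lv by (simp_all add: s2_def den_var)
  have tab: "arr s2 11 (32 * int i + int st) = int (words_from m i st)" if "i \<le> n" "st < 32" for i st
    using den_table[OF s1 lv(1,2), of ?q] that unfolding s2_def by blast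
  let ?N = "words_from m 0 0"
  define w where "w = unrank (acc m) (tr m) (wy m) (wz m) [0..<n] 0 (y mod ?N) (y div ?N)"
  have wd: "w \<in> sat m (min 3 (k - m))" "\<And>i. i < n \<Longrightarrow> pair_at s3 i = w ! i"
    "good m w \<Longrightarrow> var s3 67 = int (pivot m w)"
    unfolding w_def s3_def by (rule den_word[OF s2(1) lv(1) s2(2) tab s2(3) lv(4)]; assumption)+
  have s3: "rep M s3" "var s3 41 = int m" using s2 by (simp_all add: s3_def den_var)
  have s4: "rep M s4" "var s4 41 = int m" using s3 by (simp_all add: s4_def den_var)
  have "pair_at s4 i = corr m w ! i" if "i < n" for i
    unfolding s4_def by (rule den_corr[OF s3(1) lv(1) s3(2) wd(2,1,3) that])
  from den_out[OF s4(1) lv(1) s4(2) this] show ?thesis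
    by (simp add: decode_prog_def s1_def s2_def s3_def s4_def decode_def Let_def decode_level_def m_def y_def w_def)
qed

end


section \<open>The complete sampler\<close>

definition small :: "int \<Rightarrow> state \<Rightarrow> bool" where
  "small B s \<longleftrightarrow> (\<forall>x. \<bar>var s x\<bar> < B) \<and> (\<forall>a i. \<bar>arr s a i\<bar> < B)"

lemma small_bounded: "bounded B \<gamma> s \<Longrightarrow> small B s"
  by (simp add: small_def bounded_def)

lemma small_set_var: "small B s \<Longrightarrow> \<bar>z\<bar> < B \<Longrightarrow> small B (set_var x z s)"
  by (simp add: small_def)

lemma det_weaken: "det q I c s c' s' w \<Longrightarrow> (\<And>s. I s \<Longrightarrow> J s) \<Longrightarrow> det q J c s c' s' w"
proof (induction rule: det.induct)
  case (det_step s c c1 s1 w1 c' s' w)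
  then show ?case by (intro det.det_step) auto
qed (blast intro: det_refl)

lemma det_AssignI: "I s \<Longrightarrow> I (set_var x z s) \<Longrightarrow> eval q e s = z \<Longrightarrow> 1 + ops e = w \<Longrightarrow>
    det q I (Assign x e) s Skip (set_var x z s) w"
  using det_Assign[of I s x q e] by auto

text \<open>Computes the power in \<open>size_bound\<close> by repeated multiplication. It assigns
  variables 3 and 9, which confined programs may not touch, and is therefore a raw command with its
  own cost analysis.\<close>

definition bound_loop :: com where
  "bound_loop = While (Var 9 <. Var 0)
     (Seq (Assign 3 (Var 3 *. (Lit 64 *. Var 5 *. Var 5))) (Assign 9 (Var 9 +. Lit 1)))"

text \<open>
  The modulus is not stored anywhere in the input; it is read off from \<open>-1\<close>. Variable 3 receives
  a bound on all numbers that occur later, so that reducing modulo it changes nothing but makes the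
  size of the numbers evident from the syntax of the program.
\<close>

definition init_com :: com where
  "init_com = Seq (Assign 5 ((Lit 0 -% Lit 1) +. Lit 1)) (Seq (Assign 4 (Var 0 +. Var 1))
     (Seq (Assign 6 (Var 1 +. Lit 1)) (Seq (Assign 3 (Lit 512 *. Var 5 *. Var 5 *. Var 5)) bound_loop)))"

text \<open>Each index contributes a factor 64 for its letter and \<open>2 ^ k\<close> for the high
  digits of each of two coordinates. Two further factors \<open>2 ^ k\<close> cover the multiplicity
  and the number of levels, and the remaining \<open>512 * 2 ^ k\<close> exceeds
  \<open>2 ^ (k + 8)\<close>.\<close>

definition size_bound :: "nat \<Rightarrow> nat \<Rightarrow> int" where
  "size_bound n k = 512 * 2 ^ k * 2 ^ k * 2 ^ k * (64 * 2 ^ k * 2 ^ k) ^ n"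

lemma size_bound_eq: "size_bound n k = 2 ^ (9 + 3 * k + (6 + 2 * k) * n)"
proof -
  have e: "9 + 3 * k = 9 + k + k + k" "6 + 2 * k = 6 + k + k" by simp_all
  have "(2::int) ^ 9 = 512" "(2::int) ^ 6 = 64" by simp_all
  then show ?thesis unfolding size_bound_def e by (simp only: power_add power_mult)
qed

lemma det_bound_loop:
  assumes "var s 0 = int n" "var s 5 = 2 ^ k" "small B s"
    and "var s 9 = int j" "var s 3 = 512 * 2 ^ k * 2 ^ k * 2 ^ k * (64 * 2 ^ k * 2 ^ k) ^ j"
    and "size_bound n k < B" "int n < B" "j \<le> n"
  shows "\<exists>w \<le> 2 + 10 * (n - j). det q (small B) bound_loop s Skip
     (set_var 9 (int n) (set_var 3 (size_bound n k) s)) w"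
  using assms
proof (induction "n - j" arbitrary: j s)
  case 0
  then have "set_var 9 (int n) (set_var 3 (size_bound n k) s) = s"
    by (simp add: set_var_def size_bound_def fun_eq_iff)
  moreover have "det q (small B) bound_loop s Skip s (2 + 0)"
    by (rule det_step[OF _ _ _ det_refl]) (use 0 in \<open>auto simp: bound_loop_def\<close>)
  ultimately show ?case by (intro exI[of _ "2 + 0"]) auto
next
  case (Suc d)
  let ?b = "Seq (Assign 3 (Var 3 *. (Lit 64 *. Var 5 *. Var 5))) (Assign 9 (Var 9 +. Lit 1))"
  let ?P = "\<lambda>j. 512 * 2 ^ k * 2 ^ k * 2 ^ k * (64 * 2 ^ k * 2 ^ k) ^ j :: int"
  have j: "j < n" using Suc.hyps(2) by simp
  have P0: "0 \<le> ?P (Suc j)" by simp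
  have "(0::int) < 64 * 2 ^ k * 2 ^ k" by simp
  then have one: "(1::int) \<le> 64 * 2 ^ k * 2 ^ k" by linarith
  have "?P (Suc j) \<le> size_bound n k" unfolding size_bound_def
    using j one by (intro mult_left_mono power_increasing) simp_all
  then have P: "\<bar>?P (Suc j)\<bar> < B" using Suc.prems(6) P0 by linarith
  define s1 where "s1 = set_var 3 (?P (Suc j)) s"
  define s2 where "s2 = set_var 9 (int (Suc j)) s1"
  have small: "small B s" "small B s1" "small B s2"
    using Suc.prems(3,7) P j unfolding s1_def s2_def by (auto intro!: small_set_var)
  have e1: "eval q (Var 3 *. (Lit 64 *. Var 5 *. Var 5)) s = ?P (Suc j)"
    using Suc.prems by (simp add: algebra_simps)
  have e2: "eval q (Var 9 +. Lit 1) s1 = int (Suc j)" using Suc.prems by (simp add: s1_def)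
  have d1: "det q (small B) (Assign 3 (Var 3 *. (Lit 64 *. Var 5 *. Var 5))) s Skip s1 4"
    unfolding s1_def by (rule det_AssignI[OF small(1) small(2)[unfolded s1_def] e1]) simp
  have d2: "det q (small B) (Assign 9 (Var 9 +. Lit 1)) s1 Skip s2 2"
    unfolding s2_def by (rule det_AssignI[OF small(2) small(3)[unfolded s2_def] e2]) simp
  have d3: "det q (small B) (Seq ?b bound_loop) s bound_loop s2 (4 + 1 + 2 + 1)"
    by (rule det_Seq_Skip[OF det_trans[OF det_Seq_Skip[OF d1] d2]])
  have d4: "det q (small B) bound_loop s bound_loop s2 (2 + (4 + 1 + 2 + 1))"
    by (rule det_step[OF _ _ _ d3]) (use Suc.prems j in \<open>auto simp: bound_loop_def\<close>)
  have "\<exists>w \<le> 2 + 10 * (n - Suc j). det q (small B) bound_loop s2 Skip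
     (set_var 9 (int n) (set_var 3 (size_bound n k) s2)) w"
    by (rule Suc.hyps(1)) (use Suc.prems small j Suc.hyps(2) in \<open>simp_all add: s2_def s1_def\<close>)
  then obtain w where w: "w \<le> 2 + 10 * (n - Suc j)"
    "det q (small B) bound_loop s2 Skip (set_var 9 (int n) (set_var 3 (size_bound n k) s2)) w" by blast
  have "set_var 9 (int n) (set_var 3 (size_bound n k) s2) = set_var 9 (int n) (set_var 3 (size_bound n k) s)"
    by (simp add: s2_def s1_def set_var_def fun_eq_iff)
  with det_trans[OF d4 w(2)] show ?case using w(1) j by (intro exI[of _ "2 + (4 + 1 + 2 + 1) + w"]) auto
qed

definition init_state :: "nat \<Rightarrow> nat \<Rightarrow> int \<Rightarrow> state \<Rightarrow> state" where
  "init_state n k M s = set_var 9 (int n) (set_var 3 M (set_var 6 (int k + 1)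
     (set_var 4 (int n + int k) (set_var 5 (2 ^ k) s))))"

lemma det_init:
  assumes s: "var s 0 = int n" "var s 1 = int k" "var s 9 = 0" "small B s"
    and B: "size_bound n k < B" "1 \<le> n" "1 \<le> k"
  shows "\<exists>w \<le> 17 + 10 * n. det (2 ^ k) (small B) init_com s Skip (init_state n k (size_bound n k) s) w"
proof -
  let ?q = "2 ^ k :: int"
  have q: "1 < ?q" using B(3) by simp
  have e0: "(- 1) mod ?q = ?q - 1" using q by (simp add: zmod_minus1)
  have lt: "int n + int k + 8 < size_bound n k" "512 * 2 ^ k * 2 ^ k * 2 ^ k \<le> size_bound n k" "?q < size_bound n k"
  proof -
    have "n + k + 9 \<le> 9 + 3 * k + (6 + 2 * k) * n" using B(2) by (simp add: algebra_simps)
    also have "\<dots> < 2 ^ (9 + 3 * k + (6 + 2 * k) * n)" by (rule less_exp)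
    finally have "int (n + k + 9) < int (2 ^ (9 + 3 * k + (6 + 2 * k) * n))" by linarith
    then show "int n + int k + 8 < size_bound n k" unfolding size_bound_eq by simp
    have "(0::int) < (64 * 2 ^ k * 2 ^ k) ^ n" by simp
    then have "(1::int) \<le> (64 * 2 ^ k * 2 ^ k) ^ n" by linarith
    from mult_left_mono[OF this, of "512 * 2 ^ k * 2 ^ k * 2 ^ k"]
    show "512 * 2 ^ k * 2 ^ k * 2 ^ k \<le> size_bound n k" unfolding size_bound_def by simp
    show "?q < size_bound n k" unfolding size_bound_eq by (rule power_strict_increasing) auto
  qed
  define s1 where "s1 = set_var 5 ?q s"
  define s2 where "s2 = set_var 4 (int n + int k) s1"
  define s3 where "s3 = set_var 6 (int k + 1) s2"
  define s4 where "s4 = set_var 3 (512 * 2 ^ k * 2 ^ k * 2 ^ k) s3"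
  have sm: "small B s1" "small B s2" "small B s3" "small B s4"
    unfolding s4_def s3_def s2_def s1_def using s(4) lt B by (auto intro!: small_set_var)
  have e: "eval ?q ((Lit 0 -% Lit 1) +. Lit 1) s = ?q" "eval ?q (Var 0 +. Var 1) s1 = int n + int k"
    "eval ?q (Var 1 +. Lit 1) s2 = int k + 1" "eval ?q (Lit 512 *. Var 5 *. Var 5 *. Var 5) s3 = 512 * 2 ^ k * 2 ^ k * 2 ^ k"
    using s e0 by (simp_all add: s1_def s2_def s3_def)
  have d1: "det ?q (small B) (Assign 5 ((Lit 0 -% Lit 1) +. Lit 1)) s Skip s1 3"
    unfolding s1_def by (rule det_AssignI[OF s(4) sm(1)[unfolded s1_def] e(1)]) simp
  have d2: "det ?q (small B) (Assign 4 (Var 0 +. Var 1)) s1 Skip s2 2"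
    unfolding s2_def by (rule det_AssignI[OF sm(1) sm(2)[unfolded s2_def] e(2)]) simp
  have d3: "det ?q (small B) (Assign 6 (Var 1 +. Lit 1)) s2 Skip s3 2"
    unfolding s3_def by (rule det_AssignI[OF sm(2) sm(3)[unfolded s3_def] e(3)]) simp
  have d4: "det ?q (small B) (Assign 3 (Lit 512 *. Var 5 *. Var 5 *. Var 5)) s3 Skip s4 4"
    unfolding s4_def by (rule det_AssignI[OF sm(3) sm(4)[unfolded s4_def] e(4)]) simp
  have "\<exists>w \<le> 2 + 10 * (n - 0). det ?q (small B) bound_loop s4 Skip
     (set_var 9 (int n) (set_var 3 (size_bound n k) s4)) w"
    by (rule det_bound_loop[where k = k]) (use s sm lt B in \<open>simp_all add: s4_def s3_def s2_def s1_def\<close>)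
  then obtain w where w: "w \<le> 2 + 10 * n"
    "det ?q (small B) bound_loop s4 Skip (set_var 9 (int n) (set_var 3 (size_bound n k) s4)) w" by auto
  have "set_var 9 (int n) (set_var 3 (size_bound n k) s4) = init_state n k (size_bound n k) s"
    by (simp add: s4_def s3_def s2_def s1_def init_state_def set_var_def fun_eq_iff)
  with det_trans[OF det_Seq_Skip[OF d1] det_trans[OF det_Seq_Skip[OF d2] det_trans[OF det_Seq_Skip[OF d3]
      det_trans[OF det_Seq_Skip[OF d4] w(2)]]]]
  show ?thesis unfolding init_com_def using w(1) by (intro exI[of _ "3 + 1 + (2 + 1 + (2 + 1 + (4 + 1 + w)))"]) auto
qed

lemma constants_init:
  assumes "1 \<le> n" "1 \<le> k" "var s 0 = int n" "var s 1 = int k"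
  shows "constants n k (size_bound n k) (init_state n k (size_bound n k) s)"
    and "64 ^ n * 2 ^ (2 * k + 2 * k * n) < size_bound n k"
proof -
  have "n + k + 9 \<le> 9 + 3 * k + (6 + 2 * k) * n" using assms(1) by (simp add: algebra_simps)
  also have "\<dots> < 2 ^ (9 + 3 * k + (6 + 2 * k) * n)" by (rule less_exp)
  finally have "int (n + k + 9) < int (2 ^ (9 + 3 * k + (6 + 2 * k) * n))" by linarith
  then have 1: "int n + int k + 8 < size_bound n k" unfolding size_bound_eq by simp
  have 2: "2 ^ (k + 8) < size_bound n k" unfolding size_bound_eq by (rule power_strict_increasing) auto
  show "constants n k (size_bound n k) (init_state n k (size_bound n k) s)"
    using 1 2 assms by (simp add: constants_def init_state_def)
  have "(2::int) ^ 6 = 64" by simp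
  then have "(64::int) ^ n * 2 ^ (2 * k + 2 * k * n) = 2 ^ (6 * n + (2 * k + 2 * k * n))"
    by (simp only: power_mult[of _ 6] power_add)
  also have "\<dots> < size_bound n k"
    unfolding size_bound_eq by (rule power_strict_increasing) (auto simp: algebra_simps)
  finally show "64 ^ n * 2 ^ (2 * k + 2 * k * n) < size_bound n k" .
qed

text \<open>Two deterministic phases around the single draw; variable 60 holds the total weight,
  variable 61 the number drawn.\<close>

definition sample_com :: "lprog \<Rightarrow> lprog \<Rightarrow> com" where
  "sample_com c d = Seq init_com (Seq (compile c) (Seq (Sample_Int 61 (Var 60)) (compile d)))"

lemma runs_sample_com:
  assumes s: "var s 0 = int n" "var s 1 = int k" "var s 9 = 0" "small B s"
    and B: "size_bound n k < B" "1 \<le> n" "1 \<le> k" and cd: "confined c" "confined d"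
  defines "s1 \<equiv> init_state n k (size_bound n k) s"
  defines "s2 \<equiv> den (2 ^ k) c s1"
  shows "runs (2 ^ k) (small B) (22 + 10 * n + time (var s1) c + time (var s1) d) (sample_com c d) s
    (map_pmf (\<lambda>x. den (2 ^ k) d (set_var 61 x s2)) (pmf_of_set {0..<max 1 (var s2 60)}))"
proof -
  let ?q = "2 ^ k :: int" and ?g = "var s1"
  have cs: "2 ^ (k + 8) < size_bound n k" "?g 3 = size_bound n k"
    using constants_init(1)[OF B(2,3) s(1,2)] by (simp_all add: constants_def s1_def)
  have "(2::int) ^ k \<le> 2 ^ (k + 8)" "(64::int) < 2 ^ (k + 8)"
    using power_strict_increasing[of 6 "k + 8" "2::int"] by (simp_all add: power_increasing)
  then have hyp: "0 < ?q" "?q \<le> B" "0 < ?g 3" "?g 3 \<le> B" "64 < B" using cs B(1) by (linarith | simp)+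
  obtain w0 where w0: "w0 \<le> 17 + 10 * n" "det ?q (small B) init_com s Skip s1 w0"
    using det_init[OF s B] unfolding s1_def by blast
  have b1: "bounded B ?g s1" using det_last[OF w0(2)] by (simp add: bounded_def small_def)
  obtain w1 where w1: "w1 \<le> time ?g c" "det ?q (bounded B ?g) (compile c) s1 Skip s2 w1"
    using compile_det[OF hyp cd(1) b1] unfolding s2_def by blast
  have b2: "bounded B ?g s2" by (rule det_last[OF w1(2)])
  have run3: "runs ?q (small B) (2 + time ?g d) (Seq (Sample_Int 61 (Var 60)) (compile d)) s2
     (bind_pmf (pmf_of_set {0..<max 1 (var s2 60)}) (\<lambda>x. return_pmf (den ?q d (set_var 61 x s2))))"
  proof -
    have fin: "set_pmf (pmf_of_set {0..<max 1 (var s2 60)}) = {0..<max 1 (var s2 60)}"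
      by (rule set_pmf_of_set) auto
    have "runs ?q (small B) (1 + time ?g d) (Seq Skip (compile d)) (set_var 61 x s2)
        (return_pmf (den ?q d (set_var 61 x s2)))" if "x \<in> {0..<max 1 (var s2 60)}" for x
    proof -
      have "\<bar>var s2 60\<bar> < B" using b2 by (simp add: bounded_def)
      then have "\<bar>x\<bar> < B" using that hyp by auto
      then have b3: "bounded B ?g (set_var 61 x s2)" by (intro bounded_set_var hyp b2) auto
      obtain w where w: "w \<le> time ?g d"
        "det ?q (bounded B ?g) (compile d) (set_var 61 x s2) Skip (den ?q d (set_var 61 x s2)) w"
        using compile_det[OF hyp cd(2) b3] by blast
      have det: "det ?q (small B) (compile d) (set_var 61 x s2) Skip (den ?q d (set_var 61 x s2)) w"
        by (rule det_weaken[OF w(2) small_bounded])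
      have "det ?q (small B) (Seq Skip (compile d)) (set_var 61 x s2) Skip (den ?q d (set_var 61 x s2)) (1 + w)"
        by (rule det_step[OF _ _ _ det]) (use small_bounded[OF b3] in auto)
      from det_runs[OF this runs_Skip[where q = ?q and C = 0 and I = "small B", OF det_last[OF det]]] show ?thesis
        by (rule runs_mono) (use w(1) in simp)
    qed
    then have "runs ?q (small B) (1 + (1 + time ?g d)) (Seq (Sample_Int 61 (Var 60)) (compile d)) s2
     (bind_pmf (pmf_of_set {0..<max 1 (var s2 60)}) (\<lambda>x. return_pmf (den ?q d (set_var 61 x s2))))"
      using small_bounded[OF b2] fin
      by (intro runs_step[where ?c1.0 = "Seq Skip (compile d)" and g = "\<lambda>x. set_var 61 x s2"])
        (simp_all add: map_pmf_comp)
    then show ?thesis by simp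
  qed
  have "runs ?q (small B) (w0 + 1 + (w1 + 1 + (2 + time ?g d))) (sample_com c d) s
     (bind_pmf (pmf_of_set {0..<max 1 (var s2 60)}) (\<lambda>x. return_pmf (den ?q d (set_var 61 x s2))))"
    unfolding sample_com_def
    by (rule det_runs[OF det_Seq_Skip[OF w0(2)] det_runs[OF det_Seq_Skip[OF det_weaken[OF w1(2) small_bounded]] run3]])
  then show ?thesis unfolding map_pmf_def comp_def
    by (rule runs_mono) (use w0(1) w1(1) in linarith)
qed


section \<open>The two variants of the program and their running time\<close>

definition powers_prog :: lprog where
  "powers_prog = LAssign 33 (Lit 1) ;; LFor 34 (Var 6)
     (LStore 10 (Var 34) (Var 33) ;; LAssign 33 (capped (Var 33 +. Var 33)))"

text \<open>An odd diagonal entry gives the coefficient 1 at scale 0; an even one gives the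
  coefficient 0 at scale \<open>1 = k\<close>, where block forms allow it. The kinds and the other
  coefficients are 0 from the start.\<close>

definition parity_prog :: lprog where
  "parity_prog = LFor 14 (Var 0) (LStore 7 (Var 14) (cell 0 14 14 mod. Lit 2) ;;
     LStore 6 (Var 14) (Lit 1 -% (cell 0 14 14 mod. Lit 2)))"

definition copy_prog :: lprog where
  "copy_prog = LFor 14 (Var 0) (LStore 1 (Var 14) (Lit 0 +% Cell 16 (Var 14)))"

definition subst_prog :: lprog where
  "subst_prog = LFor 14 (Var 0) (LAssign 81 (Lit 0) ;;
     LFor 15 (Var 0) (LAssign 81 (Var 81 +% (cell 4 14 15 *% Cell 16 (Var 15)))) ;;
     LStore 1 (Var 14) (Var 81))"

lemma writes_powers [simp]: "wvars powers_prog = {33, 34}" "warrs powers_prog = {10}"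
  "wvars parity_prog = {14}" "warrs parity_prog = {6, 7}"
  by (auto simp: powers_prog_def parity_prog_def)

lemmas prog_defs = powers_prog_def parity_prog_def copy_prog_def subst_prog_def
  coef_prog_def letter_prog_def acc_expr_def row_sum_prog_def table_prog_def total_prog_def
  level_prog_def pick_letter_prog_def digit_prog_def word_prog_def move_prog_def sum_prog_def
  lift_prog_def corr_prog_def out_prog_def decode_prog_def col_prog_def row_prog_def elem_prog_def
  clear1_prog_def clear2_prog_def scan_diag_prog_def scan_row_prog_def scan_all_prog_def
  add_prog_def diag_prog_def pair_prog_def pivot_prog_def init_prog_def elim_prog_def

lemma confined_progs:
  "confined (elim_prog ;; powers_prog ;; total_prog okay)"
  "confined (parity_prog ;; powers_prog ;; total_prog okay)"
  "confined (decode_prog okay ;; subst_prog)" "confined (decode_prog okay ;; copy_prog)"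
  by (simp_all add: prog_defs)


text \<open>Counting builds \<open>k + 1\<close> tables and decoding one more, hence
  \<open>(k + 2) * n\<close> table rows of 32 * 64 transitions each; these dominate the coefficients
  of \<open>n\<close> and \<open>k * n\<close>. The cubic terms come from \<open>n + k\<close>
  elimination rounds, each clearing up to \<open>n\<close> columns with \<open>O(n)\<close>
  operations.\<close>

lemma time_progs:
  assumes "\<gamma> 0 = int n" "\<gamma> 1 = int k" "\<gamma> 4 = int n + int k" "\<gamma> 6 = int k + 1"
  shows "time \<gamma> (elim_prog ;; powers_prog ;; total_prog okay) + time \<gamma> (decode_prog okay ;; subst_prog) =
      3003 + 1631 * k + 301746 * n + 148310 * (k * n) + 262 * (n * n) + 121 * (k * n * n) + 121 * (n * n * n)"
    and "time \<gamma> (parity_prog ;; powers_prog ;; total_prog okay) + time \<gamma> (decode_prog okay ;; copy_prog) =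
      2987 + 1483 * k + 301594 * n + 148079 * (k * n)"
  using assms by (simp_all add: prog_defs algebra_simps nat_add_distrib)

section \<open>Distribution of the output\<close>

lemma den_powers:
  assumes c: "constants n k M s"
  shows "\<forall>j\<le>k. arr (den q powers_prog s) 10 (int j) = 2 ^ j"
proof -
  define I where "I i u \<longleftrightarrow> var u 33 = (2 ^ i) mod M \<and> (\<forall>j<i. arr u 10 (int j) = 2 ^ j)" for i and u :: state
  have M: "2 ^ (k + 8) < M" and cs: "var s 3 = M" "var s 6 = int k + 1" using c by (simp_all add: constants_def)
  have small: "(2::int) ^ j mod M = 2 ^ j" if "j \<le> k + 8" for j
    using le_less_trans[OF power_increasing[OF that, of "2::int"] M] by simp
  have "I (Suc k) (den q powers_prog s)"
    unfolding powers_prog_def den.simps(4)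
  proof (rule den_For)
    show "Suc k = nat (eval q (Var 6) (den q (LAssign 33 (Lit 1)) s))" using cs by simp
    show "I 0 (set_var 34 0 (den q (LAssign 33 (Lit 1)) s))" using small[of 0] by (simp add: I_def)
    fix i u
    assume i: "i < Suc k" and I: "I i u" and v: "var u 34 = int i"
      and "\<And>y. y \<noteq> 34 \<Longrightarrow> y \<notin> wvars (LStore 10 (Var 34) (Var 33) ;; LAssign 33 (capped (Var 33 +. Var 33))) \<Longrightarrow>
        var u y = var (den q (LAssign 33 (Lit 1)) s) y"
    then have u: "var u 3 = M" using cs by simp
    have "var u 33 = 2 ^ i" using I small[of i] i by (simp add: I_def)
    then show "I (Suc i) (set_var 34 (int (Suc i))
        (den q (LStore 10 (Var 34) (Var 33) ;; LAssign 33 (capped (Var 33 +. Var 33))) u))"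
      using I u v by (auto simp: I_def less_Suc_eq)
  qed simp
  then show ?thesis by (simp add: I_def less_Suc_eq_le)
qed

lemma den_parity:
  assumes c: "constants n k M s" and zero: "arr s 6 = (\<lambda>_. 0)" "arr s 7 = (\<lambda>_. 0)"
    and i: "i < n"
  shows "arr (den 2 parity_prog s) 7 (int i) = entry 0 s i i mod 2"
    and "arr (den 2 parity_prog s) 6 (int i) = 1 - entry 0 s i i mod 2"
proof -
  define I where "I i u \<longleftrightarrow> (\<forall>j<i. arr u 7 (int j) = entry 0 s j j mod 2 \<and> arr u 6 (int j) = 1 - entry 0 s j j mod 2)"
    for i and u :: state
  have cs: "var s 0 = int n" using c by (simp add: constants_def)
  have "I n (den 2 parity_prog s)"
    unfolding parity_prog_def
  proof (rule den_For)
    show "n = nat (eval 2 (Var 0) s)" using cs by simp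
    show "I 0 (set_var 14 0 s)" by (simp add: I_def)
    fix i u
    let ?c = "LStore 7 (Var 14) (cell 0 14 14 mod. Lit 2) ;; LStore 6 (Var 14) (Lit 1 -% (cell 0 14 14 mod. Lit 2))"
    assume I: "I i u" and v: "var u 14 = int i"
      and u: "\<And>y. y \<noteq> 14 \<Longrightarrow> y \<notin> wvars ?c \<Longrightarrow> var u y = var s y" "\<And>a. a \<notin> warrs ?c \<Longrightarrow> arr u a = arr s a"
    have u0: "var u 0 = var s 0" "arr u 0 = arr s 0" using u by simp_all
    have "(1 - x mod 2) mod 2 = 1 - x mod 2" for x :: int by presburger
    then show "I (Suc i) (set_var 14 (int (Suc i)) (den 2 ?c u))"
      using I v u0 by (auto simp: I_def less_Suc_eq entry_def)
  qed simp
  then show "arr (den 2 parity_prog s) 7 (int i) = entry 0 s i i mod 2"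
    and "arr (den 2 parity_prog s) 6 (int i) = 1 - entry 0 s i i mod 2" using i by (simp_all add: I_def)
qed

lemma den_copy:
  assumes "var s 0 = int n"
  shows "\<forall>i<n. arr (den q copy_prog s) 1 (int i) = arr s 16 (int i) mod q"
proof -
  define I where "I i u \<longleftrightarrow> (\<forall>j<i. arr u 1 (int j) = arr s 16 (int j) mod q)" for i and u :: state
  have "I n (den q copy_prog s)"
    unfolding copy_prog_def
  proof (rule den_For)
    show "n = nat (eval q (Var 0) s)" using assms by simp
    show "I 0 (set_var 14 0 s)" by (simp add: I_def)
    fix i u
    let ?c = "LStore 1 (Var 14) (Lit 0 +% Cell 16 (Var 14))"
    assume I: "I i u" and v: "var u 14 = int i" and u: "\<And>a. a \<notin> warrs ?c \<Longrightarrow> arr u a = arr s a"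
    have "arr u 16 = arr s 16" using u by simp
    then show "I (Suc i) (set_var 14 (int (Suc i)) (den q ?c u))"
      using I v by (auto simp: I_def less_Suc_eq)
  qed simp
  then show ?thesis by (simp add: I_def)
qed

lemma den_subst:
  assumes n: "var s 0 = int n"
  shows "\<forall>i<n. arr (den q subst_prog s) 1 (int i) = lin n (entry 4 s) (\<lambda>j. arr s 16 (int j)) i mod q"
proof -
  let ?x = "\<lambda>j. arr s 16 (int j)"
  define I where "I i u \<longleftrightarrow> (\<forall>j<i. arr u 1 (int j) = lin n (entry 4 s) ?x j mod q)" for i and u :: state
  define row where "row = LFor 15 (Var 0) (LAssign 81 (Var 81 +% (cell 4 14 15 *% Cell 16 (Var 15))))"
  define body where "body = LAssign 81 (Lit 0) ;; row ;; LStore 1 (Var 14) (Var 81)"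
  have "I n (den q subst_prog s)"
    unfolding subst_prog_def row_def[symmetric] body_def[symmetric]
  proof (rule den_For)
    show "14 \<notin> wvars body" by (simp add: body_def row_def)
    show "n = nat (eval q (Var 0) s)" using n by simp
    show "I 0 (set_var 14 0 s)" by (simp add: I_def)
    fix i u
    assume I: "I i u" and v: "var u 14 = int i" and uv: "\<And>y. y \<noteq> 14 \<Longrightarrow> y \<notin> wvars body \<Longrightarrow> var u y = var s y"
      and ua: "\<And>a. a \<notin> warrs body \<Longrightarrow> arr u a = arr s a"
    have u: "var u 0 = int n" "arr u 4 = arr s 4" "arr u 16 = arr s 16"
      using uv ua n by (simp_all add: body_def row_def)
    define J where "J j w \<longleftrightarrow> var w 81 = (\<Sum>c<j. entry 4 s i c * ?x c) mod q" for j and w :: state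
    define u1 where "u1 = set_var 81 0 u"
    have "J n (den q row u1)"
      unfolding row_def
    proof (rule den_For)
      show "n = nat (eval q (Var 0) u1)" using u by (simp add: u1_def)
      show "J 0 (set_var 15 0 u1)" by (simp add: J_def u1_def)
      fix j w
      let ?c = "LAssign 81 (Var 81 +% (cell 4 14 15 *% Cell 16 (Var 15)))"
      assume J: "J j w" and vw: "var w 15 = int j" and wv: "\<And>y. y \<noteq> 15 \<Longrightarrow> y \<notin> wvars ?c \<Longrightarrow> var w y = var u1 y"
        and wa: "\<And>a. a \<notin> warrs ?c \<Longrightarrow> arr w a = arr u1 a"
      have w: "var w 0 = int n" "var w 14 = int i" "arr w 4 = arr s 4" "arr w 16 = arr s 16"
        using wv wa u v by (simp_all add: u1_def)
      then show "J (Suc j) (set_var 15 (int (Suc j)) (den q ?c w))"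
        using J vw n by (simp add: J_def entry_def mod_add_eq mod_add_left_eq mod_add_right_eq)
    qed simp
    then have "var (den q row u1) 81 = lin n (entry 4 s) ?x i mod q" by (simp add: J_def lin_def)
    moreover have "var (den q row u1) 14 = int i" "arr (den q row u1) 1 = arr u 1"
      using v by (simp_all add: den_var den_arr row_def u1_def)
    moreover have "den q body u = den q (LStore 1 (Var 14) (Var 81)) (den q row u1)"
      by (simp add: body_def u1_def)
    ultimately show "I (Suc i) (set_var 14 (int (Suc i)) (den q body u))"
      using I by (auto simp: I_def less_Suc_eq)
  qed
  then show ?thesis by (simp add: I_def)
qed


text \<open>The common part of both branches: \<open>A\<close> is any preparation that leaves the
  coefficients of a block form in arrays 5 to 9, and \<open>F\<close> any final step that applies
  the substitution. \<open>D\<close> and \<open>U\<close> are abstract, since for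
  \<open>k = 1\<close> neither is stored anywhere.\<close>

lemma sample_distribution:
  fixes t :: int and okay :: "bool \<Rightarrow> bool"
  assumes s: "constants n k M s" "var s 2 = t" and t: "0 \<le> t" "t < 2 ^ k"
    and big: "64 ^ n * 2 ^ (2 * k + 2 * k * n) < M"
    and wA: "\<And>y. y < 10 \<Longrightarrow> y \<notin> wvars A"
    and fin: "\<And>u i. var u 0 = int n \<Longrightarrow> arr u 4 = arr (den (2 ^ k) A s) 4 \<Longrightarrow> i < n \<Longrightarrow>
      arr (den (2 ^ k) F u) 1 (int i) = lin n U (\<lambda>j. arr u 16 (int j)) i mod 2 ^ k"
  defines "sA \<equiv> den (2 ^ k) A s"
  assumes range: "\<And>i. i < n \<Longrightarrow> 0 \<le> arr sA 5 (int i) \<and> arr sA 6 (int i) \<in> {0..int k}"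
    and blocks: "\<And>i. i < n \<Longrightarrow> block_matrix n k D (\<lambda>i. nat (arr sA 5 (int i))) (\<lambda>i. nat (arr sA 6 (int i)))
      (\<lambda>i. arr sA 7 (int i)) (\<lambda>i. arr sA 8 (int i)) (\<lambda>i. arr sA 9 (int i)) i"
    and eq: "equivalent n (2 ^ k) Q D U"
  defines "R \<equiv> {x \<in> residue_vecs (2 ^ k) n. [bil n Q (($) x) (($) x) = t] (mod 2 ^ k) \<and> okay (primitive_vec 2 x)}"
  defines "s3 \<equiv> den (2 ^ k) (A ;; powers_prog ;; total_prog okay) s"
  assumes R: "R \<noteq> {}"
  shows "map_pmf (vec_output n) (map_pmf (\<lambda>x. den (2 ^ k) (decode_prog okay ;; F) (set_var 61 x s3))
      (pmf_of_set {0..<max 1 (var s3 60)})) = pmf_of_set R"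
proof -
  let ?q = "2 ^ k :: int"
  define kd where "kd i = nat (arr sA 5 (int i))" for i
  define sc where "sc i = nat (arr sA 6 (int i))" for i
  define a where "a i = arr sA 7 (int i)" for i
  define b where "b i = arr sA 8 (int i)" for i
  define g where "g i = arr sA 9 (int i)" for i
  have bm: "\<And>i. i < n \<Longrightarrow> block_matrix n k D kd sc a b g i"
    using blocks unfolding kd_def sc_def a_def b_def g_def .
  have k1: "1 \<le> k" using s(1) by (simp add: constants_def)
  interpret block_form n k kd sc a b g t okay
    by (rule block_matrix_block_form[OF k1 bm])
  define s2 where "s2 = den ?q powers_prog sA"
  have vA: "var sA y = var s y" if "y < 10" for y
    unfolding sA_def using wA[OF that] by (simp add: den_var)
  have cA: "constants n k M sA" using s(1) constants_eq[OF vA] by blast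
  have v2: "var s2 y = var sA y" if "y < 10" for y
    unfolding s2_def using that by (simp add: den_var)
  have a2: "arr s2 x = arr sA x" if "x \<noteq> 10" for x
    unfolding s2_def using that by (simp add: den_arr)
  have "sc i \<le> k" "int (kd i) = arr sA 5 (int i)" "int (sc i) = arr sA 6 (int i)" if "i < n" for i
    using range[OF that] by (simp_all add: kd_def sc_def nat_le_iff)
  then have rep2: "rep M s2"
    unfolding rep_def using cA constants_eq[OF v2] s(2) vA[of 2] v2[of 2] big den_powers[OF cA, of ?q]
    by (simp add: a2 a_def b_def g_def s2_def[symmetric])
  have s3: "s3 = den ?q (total_prog okay) s2" by (simp add: s3_def s2_def sA_def)
  have rep3: "rep M s3" unfolding s3 using rep2 by simp
  note tot = den_total[OF rep2, folded s3]
  define T where "T = sum weight {..k}"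
  have bij: "bij_betw (subst_vec n ?q U) solutions R"
    unfolding solutions_def R_def by (rule bij_betw_subst_vec[OF k1 eq bil_block_matrix[OF k1 bm]])
  then have sol: "solutions \<noteq> {}" using R by (auto simp: bij_betw_def)
  have "0 < (2::nat) ^ k * 64 ^ n" by simp
  note dec = equifibred_pmf[OF equifibred_decode[OF t] this sol, folded T_def]
  have T: "0 < T" using dec(1) by auto
  \<comment> \<open>Solutions exist, so the total is positive and the draw is exactly from the
    numbers below it.\<close>
  have "{0..<max 1 (var s3 60)} = int ` {..<T}"
    using T tot(2) by (simp add: T_def[symmetric] image_int_atLeastLessThan flip: atLeast0LessThan)
  then have pm: "pmf_of_set {0..<max 1 (var s3 60)} = map_pmf int (pmf_of_set {..<T})"
    using map_pmf_of_set_inj[of int "{..<T}"] dec(1) by simp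
  have out: "vec_output n (den ?q (decode_prog okay ;; F) (set_var 61 (int x) s3)) = subst_vec n ?q U (decode x)"
    if x: "x < T" for x
  proof -
    define u where "u = set_var 61 (int x) s3"
    define u' where "u' = den ?q (decode_prog okay) u"
    have ru: "rep M u" using rep3 by (simp add: u_def)
    have ru': "rep M u'" using ru by (simp add: u'_def decode_prog_def)
    have "arr u 12 (int m) = int (weight m)" if "m \<le> k" for m using tot(1) that by (simp add: u_def)
    from den_decode[OF ru this, of x] x have d: "\<forall>i<n. arr u' 16 (int i) = decode x $ i"
      by (simp add: u_def u'_def T_def)
    have "arr u' 4 = arr sA 4"
      by (simp add: u'_def u_def s3 den_arr a2)
    then have "arr (den ?q F u') 1 (int i) = lin n U (\<lambda>j. arr u' 16 (int j)) i mod ?q" if "i < n" for i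
      using fin[of u' i] rep_consts(1)[OF ru'] that unfolding sA_def by simp
    moreover have "lin n U (\<lambda>j. arr u' 16 (int j)) i = lin n U (($) (decode x)) i" for i
      unfolding lin_def using d by (intro sum.cong) auto
    ultimately show ?thesis unfolding vec_output_def subst_vec_def
      by (intro eq_vecI) (simp_all add: u'_def u_def)
  qed
  have "map_pmf (vec_output n) (map_pmf (\<lambda>x. den ?q (decode_prog okay ;; F) (set_var 61 x s3))
      (pmf_of_set {0..<max 1 (var s3 60)})) =
    map_pmf (\<lambda>x. vec_output n (den ?q (decode_prog okay ;; F) (set_var 61 (int x) s3))) (pmf_of_set {..<T})"
    unfolding pm by (simp only: map_pmf_comp)
  also have "\<dots> = map_pmf (\<lambda>x. subst_vec n ?q U (decode x)) (pmf_of_set {..<T})"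
    by (rule map_pmf_cong) (use out dec(1) in \<open>auto simp: set_pmf_of_set\<close>)
  also have "\<dots> = map_pmf (subst_vec n ?q U) (pmf_of_set solutions)"
    unfolding dec(2)[symmetric] map_pmf_comp ..
  also have "\<dots> = pmf_of_set R"
    by (rule map_pmf_of_set_bij_betw[OF bij sol])
      (simp add: solutions_def finite_residue_vecs)
  finally show ?thesis .
qed

lemma sample_elim:
  fixes t :: int and okay :: "bool \<Rightarrow> bool"
  assumes s: "constants n k M s" "var s 2 = t" and t: "0 \<le> t" "t < 2 ^ k"
    and big: "64 ^ n * 2 ^ (2 * k + 2 * k * n) < M"
    and zero: "\<And>a. a \<noteq> 0 \<Longrightarrow> arr s a = (\<lambda>_. 0)"
    and sym: "\<And>r c. r < n \<Longrightarrow> c < n \<Longrightarrow> entry 0 s r c = entry 0 s c r"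
  defines "R \<equiv> {x \<in> residue_vecs (2 ^ k) n. [bil n (entry 0 s) (($) x) (($) x) = t] (mod 2 ^ k) \<and> okay (primitive_vec 2 x)}"
    and "s3 \<equiv> den (2 ^ k) (elim_prog ;; powers_prog ;; total_prog okay) s"
  assumes R: "R \<noteq> {}"
  shows "map_pmf (vec_output n) (map_pmf (\<lambda>x. den (2 ^ k) (decode_prog okay ;; subst_prog) (set_var 61 x s3))
      (pmf_of_set {0..<max 1 (var s3 60)})) = pmf_of_set R"
  unfolding R_def s3_def
proof (rule sample_distribution[OF s t big])
  let ?q = "2 ^ k :: int"
  define sA where "sA = den ?q elim_prog s"
  note el = den_elim[OF s(1) zero sym, folded sA_def, unfolded diagonalized_def block_at_def]
  have n: "var sA 0 = int n" using s(1) by (simp add: sA_def den_var constants_def)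
  show "y \<notin> wvars elim_prog" if "y < 10" for y using that by auto
  show "equivalent n ?q (entry 0 s) (entry 3 sA) (entry 4 sA)" by (rule el(2))
  show "arr (den ?q subst_prog u) 1 (int i) = lin n (entry 4 sA) (\<lambda>j. arr u 16 (int j)) i mod ?q"
    if "var u 0 = int n" "arr u 4 = arr (den ?q elim_prog s) 4" "i < n" for u i
  proof -
    have "entry 4 u = entry 4 sA" using that n by (simp add: entry_def fun_eq_iff sA_def)
    then show ?thesis using den_subst[OF that(1), of ?q] that(3) by simp
  qed
  show "0 \<le> arr (den ?q elim_prog s) 5 (int i) \<and> arr (den ?q elim_prog s) 6 (int i) \<in> {0..int k}" if "i < n" for i
    using el(1) that unfolding sA_def by auto
  show "block_matrix n k (entry 3 sA) (\<lambda>i. nat (arr (den ?q elim_prog s) 5 (int i))) (\<lambda>i. nat (arr (den ?q elim_prog s) 6 (int i)))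
      (\<lambda>i. arr (den ?q elim_prog s) 7 (int i)) (\<lambda>i. arr (den ?q elim_prog s) 8 (int i))
      (\<lambda>i. arr (den ?q elim_prog s) 9 (int i)) i" if "i < n" for i
    using el(1) that unfolding sA_def by blast
  show "{x \<in> residue_vecs (2 ^ k) n. [bil n (entry 0 s) (($) x) (($) x) = t] (mod 2 ^ k) \<and> okay (primitive_vec 2 x)} \<noteq> {}"
    using R unfolding R_def .
qed

text \<open>
  For \<open>k = 1\<close> the time bound is linear in \<open>n\<close>, which does not even permit reading the matrix. But
  modulo 2 only the diagonal matters.
\<close>

lemma sample_parity:
  fixes t :: int and okay :: "bool \<Rightarrow> bool"
  assumes s: "constants n k M s" "var s 2 = t" and t: "0 \<le> t" "t < 2 ^ k" and k: "k = 1"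
    and big: "64 ^ n * 2 ^ (2 * k + 2 * k * n) < M"
    and zero: "\<And>a. a \<noteq> 0 \<Longrightarrow> arr s a = (\<lambda>_. 0)"
    and sym: "\<And>r c. r < n \<Longrightarrow> c < n \<Longrightarrow> entry 0 s r c = entry 0 s c r"
  defines "R \<equiv> {x \<in> residue_vecs (2 ^ k) n. [bil n (entry 0 s) (($) x) (($) x) = t] (mod 2 ^ k) \<and> okay (primitive_vec 2 x)}"
    and "s3 \<equiv> den (2 ^ k) (parity_prog ;; powers_prog ;; total_prog okay) s"
  assumes R: "R \<noteq> {}"
  shows "map_pmf (vec_output n) (map_pmf (\<lambda>x. den (2 ^ k) (decode_prog okay ;; copy_prog) (set_var 61 x s3))
      (pmf_of_set {0..<max 1 (var s3 60)})) = pmf_of_set R"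
  unfolding R_def s3_def
proof (rule sample_distribution[OF s t big])
  let ?q = "2 ^ k :: int"
  let ?D = "\<lambda>i j. if i = j then entry 0 s i i mod 2 else 0" and ?U = "\<lambda>i j. of_bool (i = j) :: int"
  have q: "?q = 2" using k by simp
  let ?s = "den ?q parity_prog s"
  have a: "arr ?s 5 (int i) = 0" "arr ?s 8 (int i) = 0" "arr ?s 9 (int i) = 0" for i
    using zero by (simp_all add: den_arr)
  have p: "arr ?s 7 (int i) = entry 0 s i i mod 2" "arr ?s 6 (int i) = 1 - entry 0 s i i mod 2" if "i < n" for i
    using den_parity[OF s(1) zero zero that] unfolding q by simp_all
  show "y \<notin> wvars parity_prog" if "y < 10" for y using that by simp
  show "equivalent n ?q (entry 0 s) ?D ?U" unfolding q by (rule equivalent_diagonal[OF sym])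
  show "arr (den ?q copy_prog u) 1 (int i) = lin n ?U (\<lambda>j. arr u 16 (int j)) i mod ?q"
    if "var u 0 = int n" "i < n" for u i
    using den_copy[OF that(1), of ?q] that(2) by (simp add: lin_id)
  show "0 \<le> arr ?s 5 (int i) \<and> arr ?s 6 (int i) \<in> {0..int k}" if "i < n" for i
    using p(2)[OF that] pos_mod_bound[of 2 "entry 0 s i i"] pos_mod_sign[of 2 "entry 0 s i i"] k
    unfolding a(1) by simp
  show "block_matrix n k ?D (\<lambda>i. nat (arr ?s 5 (int i))) (\<lambda>i. nat (arr ?s 6 (int i)))
      (\<lambda>i. arr ?s 7 (int i)) (\<lambda>i. arr ?s 8 (int i)) (\<lambda>i. arr ?s 9 (int i)) i" if "i < n" for i
  proof (cases "even (entry 0 s i i)")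
    case True
    then have "entry 0 s i i mod 2 = 0" by presburger
    then show ?thesis unfolding block_matrix_def a p[OF that] using k by simp
  next
    case False
    then have "entry 0 s i i mod 2 = 1" by presburger
    then show ?thesis unfolding block_matrix_def a p[OF that] using k by simp
  qed
  show "{x \<in> residue_vecs (2 ^ k) n. [bil n (entry 0 s) (($) x) (($) x) = t] (mod 2 ^ k) \<and> okay (primitive_vec 2 x)} \<noteq> {}"
    using R unfolding R_def .
qed

lemma bil_eq_scalar_prod:
  assumes "Q \<in> carrier_mat n n" "x \<in> carrier_vec n"
    and "\<And>i j. i < n \<Longrightarrow> j < n \<Longrightarrow> X i j = Q $$ (i, j)"
  shows "bil n X (($) x) (($) x) = x \<bullet> (Q *\<^sub>v x)"
  using assms by (auto simp: bil_def lin_def scalar_prod_def atLeast0LessThan intro!: sum.cong)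

text \<open>The three problems are one problem with a predicate on the primitivity flag: constantly
  true, the identity, and negation.\<close>

lemma representations_kinds:
  assumes "R \<in> {representations, primitive_representations, nonprimitive_representations}"
  shows "\<exists>okay. \<forall>n k Q t X. Q \<in> carrier_mat n n \<longrightarrow> (\<forall>i<n. \<forall>j<n. X i j = Q $$ (i, j)) \<longrightarrow>
    R 2 k Q t = {x \<in> residue_vecs (2 ^ k) n. [bil n X (($) x) (($) x) = t] (mod 2 ^ k) \<and> okay (primitive_vec 2 x)}"
proof -
  have r: "representations 2 k Q t = {x \<in> residue_vecs (2 ^ k) n. [bil n X (($) x) (($) x) = t] (mod 2 ^ k)}"
    if "Q \<in> carrier_mat n n" "\<forall>i<n. \<forall>j<n. X i j = Q $$ (i, j)" for n k Q t X
  proof -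
    have "bil n X (($) x) (($) x) = x \<bullet> (Q *\<^sub>v x)" if "x \<in> residue_vecs (2 ^ k) n" for x
      using that \<open>Q \<in> _\<close> \<open>\<forall>i<n. _\<close> by (intro bil_eq_scalar_prod) (auto simp: residue_vecs_def)
    then show ?thesis using that(1) by (auto simp: representations_def)
  qed
  from assms consider "R = representations" | "R = primitive_representations" | "R = nonprimitive_representations"
    by blast
  then show ?thesis
  proof cases
    case 1
    then show ?thesis using r by (intro exI[of _ "\<lambda>_. True"]) simp
  next
    case 2
    then show ?thesis using r
      by (intro exI[of _ "\<lambda>p. p"] allI impI) (simp add: primitive_representations_def conj_assoc)
  next
    case 3
    then show ?thesis using r
      by (intro exI[of _ Not] allI impI) (simp add: nonprimitive_representations_def conj_assoc)
  qed
qed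

section \<open>Numerical bounds\<close>

lemma bit_length_le: "\<bar>z\<bar> < 2 ^ L \<Longrightarrow> bit_length z \<le> L"
  unfolding bit_length_def by (rule floorlog_leI) (auto simp: nat_less_iff)

lemma abs_less_power_bit_length: "\<bar>z\<bar> < 2 ^ bit_length z"
proof -
  have "nat \<bar>z\<bar> < 2 ^ bit_length z" unfolding bit_length_def by (rule floorlog_leD) auto
  then have "int (nat \<bar>z\<bar>) < int (2 ^ bit_length z)" by linarith
  then show ?thesis by simp
qed

lemma entry_quadratic_input:
  assumes "i < n" "j < n"
  shows "mat_cells n Q (int i * int n + int j) = Q $$ (i, j)"
proof -
  have "(i + 1) * n \<le> n * n" using assms by (intro mult_right_mono) auto
  then have "i * n + j < n * n" using assms by (simp add: algebra_simps)
  moreover have "int i * int n + int j = int (i * n + j)" by simp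
  moreover have "(i * n + j) div n = i" "(i * n + j) mod n = j" using assms by simp_all
  ultimately show ?thesis unfolding mat_cells_def by (simp only: nat_int of_nat_less_iff of_nat_0_le_iff simp_thms if_True)
qed

text \<open>The exponent of \<open>size_bound\<close> is quadratic in the input size through its
  term \<open>2 * k * n\<close>, which is at most \<open>(n + k) ^ 2\<close>. The entries of
  \<open>Q\<close> are covered because their bit lengths are part of the size.\<close>

lemma small_input:
  fixes Q :: "int mat"
  assumes n: "1 \<le> n" and k: "1 \<le> k" and t: "0 \<le> t" "t < 2 ^ k"
  defines "S \<equiv> quadratic_input_size n k Q"
  shows "small (2 ^ (20 * S ^ 2)) (quadratic_input n k Q t)" "size_bound n k < 2 ^ (20 * S ^ 2)"
proof -
  let ?B = "2 ^ (20 * S ^ 2) :: int"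
  have S: "n + k \<le> S" "2 \<le> S" using n k by (simp_all add: S_def quadratic_input_size_def)
  have "2 * S \<le> S ^ 2" using S(2) by (simp add: power2_eq_square)
  moreover have "(n + k) ^ 2 \<le> S ^ 2" using S(1) by (rule power_mono) simp
  then have "2 * k * n \<le> S ^ 2" by (simp add: power2_eq_square algebra_simps)
  ultimately have e: "9 + 3 * k + (6 + 2 * k) * n < 20 * S ^ 2" "S < 20 * S ^ 2"
    using S by (simp_all add: algebra_simps)
  show "size_bound n k < ?B" unfolding size_bound_eq using e(1) by (intro power_strict_increasing) auto
  have pw: "(2::int) ^ j \<le> ?B" if "j \<le> S" for j using that e(2) by (intro power_increasing) auto
  have nk: "int j < ?B" if "j \<le> S" for j
    using pw[OF that] of_nat_less_two_power[of j, where 'a = int] by linarith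
  have "\<bar>mat_cells n Q l\<bar> < ?B" for l
  proof (cases "0 \<le> l \<and> l < int (n * n)")
    case True
    define i j where "i = nat l div n" and "j = nat l mod n"
    have "nat l < n * n" using True by linarith
    then have ij: "i < n" "j < n" using n by (simp_all add: i_def j_def less_mult_imp_div_less)
    have "bit_length (Q $$ (i, j)) \<le> (\<Sum>j<n. bit_length (Q $$ (i, j)))"
      using ij(2) by (intro member_le_sum) auto
    also have "\<dots> \<le> (\<Sum>i<n. \<Sum>j<n. bit_length (Q $$ (i, j)))"
      using ij(1) by (intro member_le_sum[of i _ "\<lambda>i. \<Sum>j<n. bit_length (Q $$ (i, j))"]) auto
    also have "\<dots> \<le> S" by (simp add: S_def quadratic_input_size_def)
    finally show ?thesis using True abs_less_power_bit_length[of "Q $$ (i, j)"] pw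
      by (simp add: mat_cells_def i_def[symmetric] j_def[symmetric] less_le_trans)
  next
    case False
    then have "mat_cells n Q l = 0" unfolding mat_cells_def by (rule if_not_P)
    then show ?thesis by simp
  qed
  moreover have "k \<le> S" using S(1) by simp
  then have "t < ?B" using t(2) pw[of k] by linarith
  ultimately show "small ?B (quadratic_input n k Q t)"
    using nk[of n] nk[of k] S(1) t(1) by (auto simp: small_def quadratic_input_def)
qed

text \<open>The critical term is \<open>k * n * n\<close>: it is at most \<open>n * k ^ 3\<close> if
  \<open>n <= k\<close>, and at most \<open>n ^ 3\<close> otherwise.\<close>

lemma time_bound:
  fixes n k :: nat
  assumes n: "1 \<le> n" and k: "1 \<le> k"
  shows "24 + 10 * n + (3003 + 1631 * k + 301746 * n + 148310 * (k * n) + 262 * (n * n) + 121 * (k * n * n) +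
      121 * (n * n * n)) \<le> 1000000 * (n ^ 3 + n * k ^ 3)"
    and "24 + 10 * n + (2987 + 1483 * k + 301594 * n + 148079 * (k * n)) \<le> 1000000 * (n * k ^ 3)"
proof -
  let ?X = "n ^ 3 + n * k ^ 3"
  have kn: "k * n \<le> n * k ^ 3" using self_le_power[of k 3] k n by (simp add: mult.commute)
  have k': "k \<le> k * n" "n \<le> k * n" "1 \<le> k * n" using n k by simp_all
  have nn: "n * n \<le> k * n * n" using k by simp
  have knn: "k * n * n \<le> ?X"
  proof (cases "n \<le> k")
    case True
    have "k * n * n \<le> k * n * k" using True by simp
    also have "\<dots> \<le> k * n * k * k" using mult_le_mono2[OF k, of "k * n * k"] by simp
    also have "\<dots> = n * k ^ 3" by (simp add: power3_eq_cube)
    finally show ?thesis by linarith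
  next
    case False
    then have "k * (n * n) \<le> n * (n * n)" by (intro mult_le_mono1) simp
    then have "k * n * n \<le> n ^ 3" by (simp add: power3_eq_cube mult.assoc)
    then show ?thesis by linarith
  qed
  have kX: "k * n \<le> ?X" using kn by linarith
  have "n * n * n \<le> ?X" by (simp add: power3_eq_cube)
  moreover have "24 + 10 * n + (3003 + 1631 * k + 301746 * n + 148310 * a + 262 * b + 121 * c + 121 * d) \<le> 1000000 * X"
    if "k \<le> a" "n \<le> a" "1 \<le> a" "b \<le> c" "c \<le> X" "d \<le> X" "a \<le> X" for a b c d X :: nat
    using that by linarith
  ultimately show "24 + 10 * n + (3003 + 1631 * k + 301746 * n + 148310 * (k * n) + 262 * (n * n) +
      121 * (k * n * n) + 121 * (n * n * n)) \<le> 1000000 * (n ^ 3 + n * k ^ 3)"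
    using k' nn knn kX by blast
  from kn k' show "24 + 10 * n + (2987 + 1483 * k + 301594 * n + 148079 * (k * n)) \<le> 1000000 * (n * k ^ 3)" by linarith
qed

theorem theorem2:
  fixes \<omega> :: real
    and R :: "int \<Rightarrow> nat \<Rightarrow> int mat \<Rightarrow> int \<Rightarrow> int vec set"
  assumes "matmul_exponent 2 \<omega>"
    and "R \<in> {representations, primitive_representations, nonprimitive_representations}"
  shows "\<exists>(prog :: com) (C :: real) (d :: nat).
           \<forall>(n :: nat) (k :: nat) (Q :: int mat) (t :: int).
             n \<ge> 1 \<and> k \<ge> 1 \<and> Q \<in> carrier_mat n n \<and> transpose_mat Q = Q \<and> t \<in> {0..<2 ^ k} \<longrightarrow>
               halts_within (2 ^ k) prog (quadratic_input n k Q t)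
                 (C * (real n powr (1 + \<omega>) * log 2 (real k) + real n * real k ^ 3)) \<and>
               stores_within (2 ^ k) prog (quadratic_input n k Q t)
                 (C * real (quadratic_input_size n k Q) ^ d) \<and>
               (R 2 k Q t \<noteq> {} \<longrightarrow>
                  map_pmf (vec_output n) (final_state (2 ^ k) prog (quadratic_input n k Q t)) =
                    pmf_of_set (R 2 k Q t))"
proof -
  obtain okay where kinds: "\<forall>n k Q t X. Q \<in> carrier_mat n n \<longrightarrow> (\<forall>i<n. \<forall>j<n. X i j = Q $$ (i, j)) \<longrightarrow>
    R 2 k Q t = {x \<in> residue_vecs (2 ^ k) n. [bil n X (($) x) (($) x) = t] (mod 2 ^ k) \<and> okay (primitive_vec 2 x)}"
    using representations_kinds[OF assms(2)] by (rule exE)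
  define c where "c p = (if p then parity_prog else elim_prog) ;; powers_prog ;; total_prog okay" for p
  define f where "f p = decode_prog okay ;; (if p then copy_prog else subst_prog)" for p
  \<comment> \<open>\<open>k = 1\<close> is the only case in which \<open>log 2 (real k)\<close>
    vanishes and the elimination cannot be paid for.\<close>
  define prog where "prog = If (Var 1 =. Lit 1) (sample_com (c True) (f True)) (sample_com (c False) (f False))"
  have main: "halts_within (2 ^ k) prog (quadratic_input n k Q t)
      (1000000 * (real n powr (1 + \<omega>) * log 2 (real k) + real n * real k ^ 3)) \<and>
    stores_within (2 ^ k) prog (quadratic_input n k Q t) (1000000 * real (quadratic_input_size n k Q) ^ 2) \<and>
    (R 2 k Q t \<noteq> {} \<longrightarrow>
      map_pmf (vec_output n) (final_state (2 ^ k) prog (quadratic_input n k Q t)) = pmf_of_set (R 2 k Q t))"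
    if n: "n \<ge> 1" and k: "k \<ge> 1" and Q: "Q \<in> carrier_mat n n" "transpose_mat Q = Q" and t: "t \<in> {0..<2 ^ k}"
    for n k :: nat and Q t
  proof -
    let ?q = "2 ^ k :: int"
    define p where "p \<longleftrightarrow> k = 1"
    define S where "S = quadratic_input_size n k Q"
    define s where "s = quadratic_input n k Q t"
    define s1 where "s1 = init_state n k (size_bound n k) s"
    define s3 where "s3 = den ?q (c p) s1"
    define D where "D = map_pmf (\<lambda>x. den ?q (f p) (set_var 61 x s3)) (pmf_of_set {0..<max 1 (var s3 60)})"
    define N where "N = 2 + (22 + 10 * n + time (var s1) (c p) + time (var s1) (f p))"
    have t': "0 \<le> t" "t < ?q" using t by auto
    have s: "var s 0 = int n" "var s 1 = int k" "var s 9 = 0" "var s 2 = t"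
      by (simp_all add: s_def quadratic_input_def)
    note sm = small_input[OF n k t', of Q, folded S_def s_def]
    have conf: "confined (c p)" "confined (f p)" by (simp_all only: c_def f_def confined_progs split: if_split) simp_all
    have run: "runs ?q (small (2 ^ (20 * S ^ 2))) N prog s D"
      unfolding N_def
    proof (rule runs_det_step)
      show "small (2 ^ (20 * S ^ 2)) s" by (rule sm(1))
      show "step ?q prog s = return_pmf (sample_com (c p) (f p), s, 2)"
        using s(2) by (simp add: prog_def p_def)
      show "runs ?q (small (2 ^ (20 * S ^ 2))) (22 + 10 * n + time (var s1) (c p) + time (var s1) (f p))
          (sample_com (c p) (f p)) s D"
        using runs_sample_com[OF s(1-3) sm n k conf] unfolding D_def s3_def s1_def .
    qed
    note con = constants_init[OF n k s(1,2), folded s1_def]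
    have v: "var s1 0 = int n" "var s1 1 = int k" "var s1 4 = int n + int k" "var s1 6 = int k + 1"
      using con(1) by (simp_all add: constants_def)
    have halts: "halts_within ?q prog s (1000000 * (real n powr (1 + \<omega>) * log 2 (real k) + real n * real k ^ 3))"
    proof (rule runs_halts[OF run])
      show "real N \<le> 1000000 * (real n powr (1 + \<omega>) * log 2 (real k) + real n * real k ^ 3)"
      proof (cases p)
        case True
        have "N \<le> 1000000 * (n * k ^ 3)"
          using time_bound(2)[OF n k] time_progs(2)[of "var s1", OF v, of okay] True
          by (simp add: N_def c_def f_def del: time.simps)
        then have "real N \<le> real (1000000 * (n * k ^ 3))" by (rule of_nat_mono)
        then show ?thesis using True by (simp add: p_def)
      next
        case False
        then have k2: "k \<ge> 2" using k by (simp add: p_def)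
        have "N \<le> 1000000 * (n ^ 3 + n * k ^ 3)"
          using time_bound(1)[OF n k] time_progs(1)[of "var s1", OF v, of okay] False
          by (simp add: N_def c_def f_def del: time.simps)
        then have "real N \<le> real (1000000 * (n ^ 3 + n * k ^ 3))" by (rule of_nat_mono)
        then have N: "real N \<le> 1000000 * (real n ^ 3 + real n * real k ^ 3)" by simp
        have "real n powr 3 \<le> real n powr (1 + \<omega>)"
          using n matmul_exponent_ge_2[OF assms(1)] by (intro powr_mono) auto
        moreover have "real n powr 3 = real n ^ 3" using n by simp
        moreover have "1 \<le> log 2 (real k)" using k2 by simp
        ultimately have "real n ^ 3 * 1 \<le> real n powr (1 + \<omega>) * log 2 (real k)"
          by (intro mult_mono) auto
        then show ?thesis using N by simp
      qed
    qed
    have stores: "stores_within ?q prog s (1000000 * real S ^ 2)"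
    proof (rule runs_stores[OF run])
      fix u assume u: "small (2 ^ (20 * S ^ 2)) u"
      have "real (20 * S ^ 2) \<le> 1000000 * real S ^ 2" by simp
      then have b: "real (bit_length z) \<le> 1000000 * real S ^ 2" if "\<bar>z\<bar> < 2 ^ (20 * S ^ 2)" for z
        using of_nat_mono[OF bit_length_le[OF that], where 'a = real] by linarith
      show "(\<forall>x. real (bit_length (var u x)) \<le> 1000000 * real S ^ 2) \<and>
          (\<forall>a i. real (bit_length (arr u a i)) \<le> 1000000 * real S ^ 2)"
        using u unfolding small_def by (intro conjI allI b) auto
    qed
    have dist: "map_pmf (vec_output n) (final_state ?q prog s) = pmf_of_set (R 2 k Q t)" if ne: "R 2 k Q t \<noteq> {}"
    proof -
      have s1: "var s1 2 = t" "arr s1 0 = mat_cells n Q" "\<And>a. a \<noteq> 0 \<Longrightarrow> arr s1 a = (\<lambda>_. 0)"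
        by (simp_all add: s1_def init_state_def s_def quadratic_input_def)
      have e: "entry 0 s1 i j = Q $$ (i, j)" if "i < n" "j < n" for i j
        using entry_quadratic_input[OF that] v(1) s1(2) by (simp add: entry_def)
      have sym: "entry 0 s1 i j = entry 0 s1 j i" if "i < n" "j < n" for i j
        using e that index_transpose_mat(1)[of i Q j] Q by simp
      have R: "R 2 k Q t = {x \<in> residue_vecs ?q n. [bil n (entry 0 s1) (($) x) (($) x) = t] (mod ?q) \<and>
          okay (primitive_vec 2 x)}" by (rule kinds[rule_format, OF Q(1) e])
      have ne': "{x \<in> residue_vecs ?q n. [bil n (entry 0 s1) (($) x) (($) x) = t] (mod ?q) \<and>
          okay (primitive_vec 2 x)} \<noteq> {}" using ne unfolding R .
      have "map_pmf (vec_output n) D = pmf_of_set (R 2 k Q t)"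
      proof (cases p)
        case True
        then have "k = 1" by (simp add: p_def)
        from sample_parity[OF con(1) s1(1) t' this con(2) s1(3) sym ne'] True show ?thesis
          unfolding R D_def s3_def c_def f_def by simp
      next
        case False
        from sample_elim[OF con(1) s1(1) t' con(2) s1(3) sym ne'] False show ?thesis
          unfolding R D_def s3_def c_def f_def by simp
      qed
      then show ?thesis using runs_final[OF run] by simp
    qed
    show ?thesis using halts stores dist unfolding s_def S_def by blast
  qed
  show ?thesis
    by (rule exI[of _ prog], rule exI[of _ 1000000], rule exI[of _ 2], intro allI impI, elim conjE)
      (rule main; assumption)
qed

end
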